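(* Let $N\ge2$, let $b^-<b^+$ be real constants, let $\Omega=\{x\in\mathbb{R}^N : b^-<x_N<b^+\}$ and $\Gamma^\pm=\{x\in\mathbb{R}^N : x_N=b^\pm\}$. Let $a>0$ and $1<p<\infty$. Suppose that $f_0^\pm\in W^{1,p}_{\mathrm{loc}}(\mathbb{R}^{N-1})$ and $f_1^\pm\in L^p_{\mathrm{loc}}(\mathbb{R}^{N-1})$ are such that $$\int_{\mathbb{R}^{N-1}}\left|f_0^+(x')-f_0^-(x')-(f_1^+(x')+f_1^-(x'))\frac{b^+-b^-}{2}\right|^pdx'<\infty,$$ $$\int_{\mathbb{R}^{N-1}}\big(|\nabla_{\parallel} f_0^+(x')-\nabla_{\parallel} f_0^-(x')|^p+|f_1^+(x')-f_1^-(x')|^p\big)\,dx'<\infty,$$ $$|\nabla_{\parallel} f_0^\pm|_{\tilde{W}^{1-1/p,p}_{(a)}(\mathbb{R}^{N-1})}<\infty,\qquad|f_1^\pm|_{\tilde{W}^{1-1/p,p}_{(a)}(\mathbb{R}^{N-1})}<\infty,$$ where $\nabla_{\parallel}:=(\partial_1,\dots,\partial_{N-1})$. Then there exists $u\in\dot{W}^{2,p}(\Omega)$ such that $\operatorname{Tr}(u)=f_0^\pm$ and $\operatorname{Tr}(\partial_Nu)=f_1^\pm$ on $\Gamma^\pm$, and $$\begin{aligned}\int_\Omega|\nabla^2u(x)|^p\,dx\le{}& c(b^+-b^-)^{-2p+1}\int_{\mathbb{R}^{N-1}}\left|f_0^+(x')-f_0^-(x')-(f_1^+(x')+f_1^-(x'))\frac{b^+-b^-}{2}\right|^pdx'\\&+c(b^+-b^-)^{-p+1}\int_{\mathbb{R}^{N-1}}\big(|\nabla_{\parallel}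 f_0^+(x')-\nabla_{\parallel} f_0^-(x')|^p+|f_1^+(x')-f_1^-(x')|^p\big)\,dx'\\&+c|\nabla_{\parallel} f_0^-|^p_{\tilde{W}^{1-1/p,p}_{(a)}(\mathbb{R}^{N-1})}+c|\nabla_{\parallel} f_0^+|^p_{\tilde{W}^{1-1/p,p}_{(a)}(\mathbb{R}^{N-1})}+c|f_1^-|^p_{\tilde{W}^{1-1/p,p}_{(a)}(\mathbb{R}^{N-1})}+c|f_1^+|^p_{\tilde{W}^{1-1/p,p}_{(a)}(\mathbb{R}^{N-1})}\end{aligned}$$ for some constant $c=c(a,N,p)>0$. Moreover, the map $(f_0^-,f_0^+,f_1^-,f_1^+)\mapsto u$ is linear.
   Context: Points are written $x=(x',x_N)\in\mathbb{R}^{N-1}\times\mathbb{R}$. $\dot{W}^{2,p}(\Omega)$ is the space of real-valued $u\in L^1_{\mathrm{loc}}(\Omega)$ all of whose weak derivatives of order $2$ belong to $L^p(\Omega)$; $\nabla^2u$ is the vector of all second-order partial derivatives. $\operatorname{Tr}$ denotes the usual Sobolev boundary trace with values in $L^p_{\mathrm{loc}}(\partial\Omega)$: if $u\in\dot W^{2,p}(\Omega)$ then $u$ and each $\partial_iu$ belong to $W^{1,p}$ of bounded Lipschitz subdomains of $\Omega$, so their traces are defined. Functions on $\Gamma^\pm$ are identified with functions of $x'\in\mathbb{R}^{N-1}$. For a constant $a>0$ and a (scalar- or vector-valued) $f\in L^1_{\mathrm{loc}}(\mathbb{R}^{N-1})$, with $B'(0,a)$ the open ball in $\mathbb{R}^{N-1}$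 with center $0$ and radius $a$, $$|f|_{\tilde{W}^{1-1/p,p}_{(a)}(\mathbb{R}^{N-1})}:=\left(\int_{\mathbb{R}^{N-1}}\int_{B'(0,a)}\frac{|f(x'+h')-f(x')|^p}{|h'|^{p+N-2}}\,dh'\,dx'\right)^{1/p}.$$
   Formalization: The constant c is allowed to depend, besides a, N and p, on an upper bound K for the width b^+ - b^- (uniformly over all strips of width at most K), since with c=c(a,N,p) alone the estimate fails for arbitrarily wide strips. *)

theory Defs
  imports "HOL-Analysis.Analysis"
begin

section \<open>Lebesgue spaces and weak derivatives\<close>

definition in_Lp :: "real \<Rightarrow> 'a::euclidean_space set \<Rightarrow> ('a \<Rightarrow> real) \<Rightarrow> bool" where
  "in_Lp p U f \<longleftrightarrow> f \<in> borel_measurable (lebesgue_on U) \<and>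
     (\<integral>\<^sup>+x\<in>U. ennreal (\<bar>f x\<bar> powr p) \<partial>lebesgue) < \<infinity>"

definition in_Lp_loc :: "real \<Rightarrow> 'a::euclidean_space set \<Rightarrow> ('a \<Rightarrow> real) \<Rightarrow> bool" where
  "in_Lp_loc p U f \<longleftrightarrow> f \<in> borel_measurable (lebesgue_on U) \<and>
     (\<forall>K. compact K \<and> K \<subseteq> U \<longrightarrow> (\<integral>\<^sup>+x\<in>K. ennreal (\<bar>f x\<bar> powr p) \<partial>lebesgue) < \<infinity>)"

primrec partials :: "'a::euclidean_space list \<Rightarrow> ('a \<Rightarrow> real) \<Rightarrow> 'a \<Rightarrow> real" where
  "partials [] \<phi> = \<phi>"
| "partials (b # bs) \<phi> = (\<lambda>x. frechet_derivative (partials bs \<phi>) (at x) b)"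

text \<open>A function is of class $C^\infty$ iff all its iterated partial derivatives exist and are
  differentiable everywhere (each of them is then continuous).\<close>

definition test_function :: "'a::euclidean_space set \<Rightarrow> ('a \<Rightarrow> real) \<Rightarrow> bool" where
  "test_function U \<phi> \<longleftrightarrow>
     (\<forall>bs. set bs \<subseteq> Basis \<longrightarrow> (\<forall>x. partials bs \<phi> differentiable (at x))) \<and>
     compact (closure {x. \<phi> x \<noteq> 0}) \<and> closure {x. \<phi> x \<noteq> 0} \<subseteq> U"

text \<open>\<open>U\<close> is meant to be open and \<open>bs\<close> a list of coordinate directions; its length is the
  order of the derivative.\<close>

definition has_weak_partial ::
    "'a::euclidean_space set \<Rightarrow> 'a list \<Rightarrow> ('a \<Rightarrow> real) \<Rightarrow> ('a \<Rightarrow> real) \<Rightarrow> bool" where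
  "has_weak_partial U bs u g \<longleftrightarrow> in_Lp_loc 1 U u \<and> in_Lp_loc 1 U g \<and>
     (\<forall>\<phi>. test_function U \<phi> \<longrightarrow>
        (LINT x:U|lebesgue. u x * partials bs \<phi> x)
          = (- 1) ^ length bs * (LINT x:U|lebesgue. g x * \<phi> x))"

text \<open>The weak derivative is unique up to null sets, so any representative may be chosen.  It is
  only used below for functions that do possess the derivative in question.\<close>

definition weak_partial ::
    "'a::euclidean_space set \<Rightarrow> 'a list \<Rightarrow> ('a \<Rightarrow> real) \<Rightarrow> 'a \<Rightarrow> real" where
  "weak_partial U bs u = (SOME g. has_weak_partial U bs u g)"

definition weak_grad ::
    "'a::euclidean_space set \<Rightarrow> ('a \<Rightarrow> real) \<Rightarrow> 'a \<Rightarrow> 'a" where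
  "weak_grad U u x = (\<Sum>i\<in>Basis. weak_partial U [i] u x *\<^sub>R i)"

text \<open>Euclidean norm of the vector of all second-order weak partial derivatives.\<close>

definition weak_hess_norm ::
    "'a::euclidean_space set \<Rightarrow> ('a \<Rightarrow> real) \<Rightarrow> 'a \<Rightarrow> real" where
  "weak_hess_norm U u x = sqrt (\<Sum>i\<in>Basis. \<Sum>j\<in>Basis. (weak_partial U [i, j] u x)\<^sup>2)"


section \<open>Sobolev spaces\<close>

definition in_W1p :: "real \<Rightarrow> 'a::euclidean_space set \<Rightarrow> ('a \<Rightarrow> real) \<Rightarrow> bool" where
  "in_W1p p U u \<longleftrightarrow> in_Lp p U u \<and> (\<forall>i\<in>Basis. \<exists>g. in_Lp p U g \<and> has_weak_partial U [i] u g)"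

definition in_W1p_loc :: "real \<Rightarrow> 'a::euclidean_space set \<Rightarrow> ('a \<Rightarrow> real) \<Rightarrow> bool" where
  "in_W1p_loc p U u \<longleftrightarrow>
     in_Lp_loc p U u \<and> (\<forall>i\<in>Basis. \<exists>g. in_Lp_loc p U g \<and> has_weak_partial U [i] u g)"

definition W1p_dist_pow ::
    "real \<Rightarrow> 'a::euclidean_space set \<Rightarrow> ('a \<Rightarrow> real) \<Rightarrow> ('a \<Rightarrow> real) \<Rightarrow> ennreal" where
  "W1p_dist_pow p U u v =
     (\<integral>\<^sup>+x\<in>U. ennreal (\<bar>u x - v x\<bar> powr p) \<partial>lebesgue) +
     (\<Sum>i\<in>Basis. \<integral>\<^sup>+x\<in>U. ennreal (\<bar>weak_partial U [i] u x - weak_partial U [i] v x\<bar> powr p)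
        \<partial>lebesgue)"

definition in_homog_W2p :: "real \<Rightarrow> 'a::euclidean_space set \<Rightarrow> ('a \<Rightarrow> real) \<Rightarrow> bool" where
  "in_homog_W2p p U u \<longleftrightarrow> in_Lp_loc 1 U u \<and>
     (\<forall>i\<in>Basis. \<forall>j\<in>Basis. \<exists>g. in_Lp p U g \<and> has_weak_partial U [i, j] u g)"

text \<open>The \<open>p\<close>-th power, with values in $[0,\infty]$, of the seminorm
  $|f|_{\tilde W^{1-1/p,p}_{(a)}}$.  The underlying space is $\mathbf{R}^{N-1}$, that is,
  \<open>N = DIM('a) + 1\<close> and the exponent $p + N - 2$ is \<open>p + DIM('a) - 1\<close>.\<close>

definition tilde_W_pow ::
    "real \<Rightarrow> real \<Rightarrow> ('a::euclidean_space \<Rightarrow> 'b::real_normed_vector) \<Rightarrow> ennreal" where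
  "tilde_W_pow a p f =
     (\<integral>\<^sup>+x. (\<integral>\<^sup>+h\<in>ball 0 a. ennreal (norm (f (x + h) - f x) powr p
         / norm h powr (p + real DIM('a) - 1)) \<partial>lebesgue) \<partial>lebesgue)"


section \<open>Strips and traces\<close>

definition strip :: "real \<Rightarrow> real \<Rightarrow> ('a::euclidean_space \<times> real) set" where
  "strip bm bp = UNIV \<times> {bm<..<bp}"

text \<open>The Sobolev trace on a bounded Lipschitz domain is the continuous extension to $W^{1,p}$ of
  the restriction map on the functions of $W^{1,p}$ that are continuous up to the boundary.
  Applied to the cylinders of radius \<open>R\<close>, this gives the trace of \<open>v\<close> on the boundary hyperplane
  of the strip at height \<open>t\<close>, which is to be \<open>bm\<close> or \<open>bp\<close>.\<close>

definition has_trace ::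
    "real \<Rightarrow> real \<Rightarrow> real \<Rightarrow> real \<Rightarrow> ('a::euclidean_space \<times> real \<Rightarrow> real) \<Rightarrow> ('a \<Rightarrow> real) \<Rightarrow> bool"
  where
  "has_trace p bm bp t v g \<longleftrightarrow> in_Lp_loc p UNIV g \<and>
     (\<forall>R>0. let Q = ball 0 R \<times> {bm<..<bp} in
        in_W1p p Q v \<and>
        (\<exists>w. (\<forall>k. in_W1p p Q (w k) \<and> continuous_on (cball 0 R \<times> {bm..bp}) (w k)) \<and>
             (\<lambda>k::nat. W1p_dist_pow p Q (w k) v) \<longlonglongrightarrow> 0 \<and>
             (\<lambda>k. \<integral>\<^sup>+x\<in>ball 0 R. ennreal (\<bar>w k (x, t) - g x\<bar> powr p) \<partial>lebesgue) \<longlonglongrightarrow> 0))"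

text \<open>The two difference integrals relating the data on the two boundary hyperplanes; the
  arguments are $f_0^-, f_0^+, f_1^-, f_1^+$.\<close>

definition diff_energy0 ::
    "real \<Rightarrow> real \<Rightarrow> real \<Rightarrow> ('a::euclidean_space \<Rightarrow> real) \<Rightarrow> ('a \<Rightarrow> real) \<Rightarrow> ('a \<Rightarrow> real) \<Rightarrow>
     ('a \<Rightarrow> real) \<Rightarrow> ennreal" where
  "diff_energy0 p bm bp f0m f0p f1m f1p =
     (\<integral>\<^sup>+x. ennreal (\<bar>f0p x - f0m x - (f1p x + f1m x) * ((bp - bm) / 2)\<bar> powr p) \<partial>lebesgue)"

definition diff_energy1 ::
    "real \<Rightarrow> ('a::euclidean_space \<Rightarrow> real) \<Rightarrow> ('a \<Rightarrow> real) \<Rightarrow> ('a \<Rightarrow> real) \<Rightarrow>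
     ('a \<Rightarrow> real) \<Rightarrow> ennreal" where
  "diff_energy1 p f0m f0p f1m f1p =
     (\<integral>\<^sup>+x. ennreal (norm (weak_grad UNIV f0p x - weak_grad UNIV f0m x) powr p
                  + \<bar>f1p x - f1m x\<bar> powr p) \<partial>lebesgue)"

definition admissible_data ::
    "real \<Rightarrow> real \<Rightarrow> real \<Rightarrow> real \<Rightarrow> ('a::euclidean_space \<Rightarrow> real) \<Rightarrow> ('a \<Rightarrow> real) \<Rightarrow>
     ('a \<Rightarrow> real) \<Rightarrow> ('a \<Rightarrow> real) \<Rightarrow> bool" where
  "admissible_data a p bm bp f0m f0p f1m f1p \<longleftrightarrow>
     in_W1p_loc p UNIV f0m \<and> in_W1p_loc p UNIV f0p \<and>
     in_Lp_loc p UNIV f1m \<and> in_Lp_loc p UNIV f1p \<and>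
     diff_energy0 p bm bp f0m f0p f1m f1p < \<infinity> \<and>
     diff_energy1 p f0m f0p f1m f1p < \<infinity> \<and>
     tilde_W_pow a p (weak_grad UNIV f0m) < \<infinity> \<and> tilde_W_pow a p (weak_grad UNIV f0p) < \<infinity> \<and>
     tilde_W_pow a p f1m < \<infinity> \<and> tilde_W_pow a p f1p < \<infinity>"

end

theory Submission
  imports Defs
begin

text \<open>The solution is an explicit Hermite interpolant of mollified data.  Let $L = b^+ - b^-$, let
  $A^\pm$, $B^\pm$ be the cubic Hermite basis functions on $[b^-,b^+]$, let $\varphi$ be an even mollifier
  supported in the unit ball, and let $\tau(t) = \kappa (t - b^-)(b^+ - t)/L$ with $\kappa$ so small that
  $\tau < a$.  Then
  $$u(x,t) = \sum_\pm A^\pm(t) \int f_0^\pm(x + \tau(t) y) \varphi(y)\,dy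
           + B^\pm(t) \int f_1^\pm(x + \tau(t) y) \varphi(y)\,dy$$
  is smooth in the open strip.  In its second derivatives the second derivatives of the Hermite polynomials
  reproduce the two difference energies; all remaining terms are $O(1/\tau)$ times an average of
  $\nabla f_0^\pm$ or $f_1^\pm$ against a kernel of mean zero, and by Tonelli their $L^p$ norms are bounded by
  the seminorm, since $\int_{\{\tau(t) > |h|\}} \tau(t)^{-p-N+1}\,dt \lesssim |h|^{-(p+N-2)}$.
  The traces are approximated by contracting $u$ in the normal direction towards the middle of the strip.\<close>

subsection \<open>Smooth functions\<close>

text \<open>The data lie in \<open>L^p\<close> only locally; what is globally integrable are
  differences, either between the two boundary hyperplanes or between a function and its translates.
  Every term of the Hessian has to be brought into one of these two forms. Mean zero of a kernel is
  what permits subtracting the value at the centre inside an average, so that translates appear. The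
  mollifier is even because differentiating the radius produces the first-moment kernels y_b
  \<phi>(y): being odd, they have mean zero, and they also drop out of the trace of the normal
  derivative. Each derivative of a mollification costs 1/\<tau>, and only one such factor is
  affordable. For f0 the other derivative falls on f0 itself. For f1 it is paid by the Hermite
  functions: both B are, up to the constant \<kappa>, the parabola \<tau> times an affine function,
  which is why \<tau> has this profile. The ratio \<kappa> is fixed as a / K, where K bounds the
  widths, and not adapted to each strip; so all constants are the same for all these strips. Since
  \<open>weak_partial\<close> returns an unspecified representative, uniqueness of weak derivatives
  must precede any statement about it.\<close>

abbreviation pd :: "'a::euclidean_space \<Rightarrow> ('a \<Rightarrow> real) \<Rightarrow> 'a \<Rightarrow> real" where
  "pd b f \<equiv> (\<lambda>x. frechet_derivative f (at x) b)"

text \<open>k-fold differentiability in a form suited to induction on the order. Continuity of the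
  last derivatives is not part of it; in \<open>smooth\<close> it follows from differentiability one
  order higher.\<close>

primrec Ck :: "nat \<Rightarrow> ('a::euclidean_space \<Rightarrow> real) \<Rightarrow> bool" where
  "Ck 0 f = True"
| "Ck (Suc k) f = ((\<forall>x. f differentiable (at x)) \<and> (\<forall>b\<in>Basis. Ck k (pd b f)))"

definition smooth :: "('a::euclidean_space \<Rightarrow> real) \<Rightarrow> bool" where
  "smooth f \<longleftrightarrow> (\<forall>k. Ck k f)"

text \<open>Uniqueness of the derivative identifies D with \<open>frechet_derivative\<close>, so
  that closure properties can exhibit the derivative by the usual rules instead of computing with a
  choice operator.\<close>

lemma Ck_SucI:
  assumes "\<And>x. (f has_derivative D x) (at x)" "\<And>b. b \<in> Basis \<Longrightarrow> Ck k (\<lambda>x. D x b)"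
  shows "Ck (Suc k) f"
proof -
  have "frechet_derivative f (at x) = D x" for x
    using assms(1)[of x] by (metis frechet_derivative_at)
  then show ?thesis using assms by (auto simp: differentiable_def)
qed

lemma Ck_SucD1: "Ck (Suc k) f \<Longrightarrow> (f has_derivative frechet_derivative f (at x)) (at x)"
  using frechet_derivative_works by auto

lemma Ck_SucD2: "Ck (Suc k) f \<Longrightarrow> b \<in> Basis \<Longrightarrow> Ck k (pd b f)"
  by auto

lemma Ck_Suc_imp: "Ck (Suc k) f \<Longrightarrow> Ck k f"
proof (induction k arbitrary: f)
  case (Suc k)
  then show ?case by (metis Ck.simps(2))
qed simp

lemma Ck_const: "Ck k (\<lambda>x. c)"
proof (induction k arbitrary: c)
  case (Suc k)
  show ?case by (rule Ck_SucI[where D="\<lambda>x h. 0"]) (use Suc in auto)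
qed simp

lemma Ck_add: "Ck k f \<Longrightarrow> Ck k g \<Longrightarrow> Ck k (\<lambda>x. f x + g x)"
proof (induction k arbitrary: f g)
  case (Suc k)
  show ?case
  proof (rule Ck_SucI)
    show "((\<lambda>x. f x + g x) has_derivative (\<lambda>h. frechet_derivative f (at x) h + frechet_derivative g (at x) h)) (at x)" for x
      by (intro has_derivative_add Suc.prems[THEN Ck_SucD1])
    show "Ck k (\<lambda>x. frechet_derivative f (at x) b + frechet_derivative g (at x) b)" if "b \<in> Basis" for b
      by (intro Suc.IH Suc.prems[THEN Ck_SucD2] that)
  qed
qed simp

lemma Ck_mult: "Ck k f \<Longrightarrow> Ck k g \<Longrightarrow> Ck k (\<lambda>x. f x * g x)"
proof (induction k arbitrary: f g)
  case (Suc k)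
  show ?case
  proof (rule Ck_SucI)
    show "((\<lambda>x. f x * g x) has_derivative (\<lambda>h. f x * frechet_derivative g (at x) h + frechet_derivative f (at x) h * g x)) (at x)" for x
      by (intro has_derivative_mult Suc.prems[THEN Ck_SucD1])
    show "Ck k (\<lambda>x. f x * frechet_derivative g (at x) b + frechet_derivative f (at x) b * g x)" if "b \<in> Basis" for b
      by (intro Ck_add Suc.IH Suc.prems[THEN Ck_SucD2] Suc.prems[THEN Ck_Suc_imp] that)
  qed
qed simp

lemma Ck_inner: "Ck k (\<lambda>x. x \<bullet> c)"
proof (cases k)
  case (Suc j)
  show ?thesis unfolding Suc
    by (rule Ck_SucI[where D="\<lambda>x h. h \<bullet> c"])
       (rule bounded_linear_imp_has_derivative bounded_linear_inner_left Ck_const)+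
qed simp

lemma Ck_sum: "(\<And>i. i \<in> S \<Longrightarrow> Ck k (f i)) \<Longrightarrow> Ck k (\<lambda>x. \<Sum>i\<in>S. f i x)"
  by (induction S rule: infinite_finite_induct) (auto simp: Ck_const Ck_add)

lemma Ck_affine: "Ck k f \<Longrightarrow> Ck k (\<lambda>x. f (c *\<^sub>R x + d))"
proof (induction k arbitrary: f)
  case (Suc k)
  show ?case
  proof (rule Ck_SucI)
    show "((\<lambda>x. f (c *\<^sub>R x + d)) has_derivative (\<lambda>h. frechet_derivative f (at (c *\<^sub>R x + d)) (c *\<^sub>R h))) (at x)" for x
      by (rule has_derivative_compose[where f="\<lambda>x. c *\<^sub>R x + d" and g=f])
         (auto intro!: derivative_eq_intros simp del: Ck.simps simp: Suc.prems[THEN Ck_SucD1])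
    fix b :: 'a assume b: "b \<in> Basis"
    have "frechet_derivative f (at (c *\<^sub>R x + d)) (c *\<^sub>R b) = c * frechet_derivative f (at (c *\<^sub>R x + d)) b" for x
    proof -
      have "linear (frechet_derivative f (at (c *\<^sub>R x + d)))"
        by (rule has_derivative_linear[OF Suc.prems[THEN Ck_SucD1]])
      then show ?thesis by (simp add: linear_cmul)
    qed
    moreover have "Ck k (\<lambda>x. c * frechet_derivative f (at (c *\<^sub>R x + d)) b)"
      by (intro Ck_mult Ck_const Suc.IH[of "pd b f"] Suc.prems[THEN Ck_SucD2] b)
    ultimately show "Ck k (\<lambda>x. frechet_derivative f (at (c *\<^sub>R x + d)) (c *\<^sub>R b))" by simp
  qed
qed simp

lemma Ck_compose:
  fixes g :: "real \<Rightarrow> real"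
  shows "Ck k g \<Longrightarrow> Ck k f \<Longrightarrow> Ck k (\<lambda>x. g (f x))"
proof (induction k arbitrary: f g)
  case (Suc k)
  show ?case
  proof (rule Ck_SucI)
    show "((\<lambda>x. g (f x)) has_derivative (\<lambda>h. frechet_derivative g (at (f x)) (frechet_derivative f (at x) h))) (at x)" for x
      by (rule has_derivative_compose; rule Suc.prems[THEN Ck_SucD1])
    fix b :: 'a assume b: "b \<in> Basis"
    have "frechet_derivative g (at (f x)) (frechet_derivative f (at x) b) =
      frechet_derivative f (at x) b * frechet_derivative g (at (f x)) 1" for x
    proof -
      have "linear (frechet_derivative g (at (f x)))"
        by (rule has_derivative_linear[OF Suc.prems(1)[THEN Ck_SucD1]])
      from linear_cmul[OF this, of "frechet_derivative f (at x) b" 1] show ?thesis by simp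
    qed
    moreover have "Ck k (\<lambda>x. frechet_derivative f (at x) b * frechet_derivative g (at (f x)) 1)"
      by (intro Ck_mult Suc.IH[of "pd 1 g" f] Suc.prems[THEN Ck_SucD2] b Suc.prems(2)[THEN Ck_Suc_imp]) simp
    ultimately show "Ck k (\<lambda>x. frechet_derivative g (at (f x)) (frechet_derivative f (at x) b))" by simp
  qed
qed simp

lemma smooth_const: "smooth (\<lambda>x. c)"
  by (simp add: smooth_def Ck_const)

lemma smooth_add: "smooth f \<Longrightarrow> smooth g \<Longrightarrow> smooth (\<lambda>x. f x + g x)"
  by (simp add: smooth_def Ck_add)

lemma smooth_mult: "smooth f \<Longrightarrow> smooth g \<Longrightarrow> smooth (\<lambda>x. f x * g x)"
  by (simp add: smooth_def Ck_mult)

lemma smooth_inner: "smooth (\<lambda>x. x \<bullet> d)"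
  by (simp add: smooth_def Ck_inner)

lemma smooth_affine: "smooth f \<Longrightarrow> smooth (\<lambda>x. f (r *\<^sub>R x + d))"
  using Ck_affine[of _ f r d] unfolding smooth_def by blast

lemma smooth_compose:
  fixes h :: "real \<Rightarrow> real"
  shows "smooth h \<Longrightarrow> smooth f \<Longrightarrow> smooth (\<lambda>x. h (f x))"
  using Ck_compose[of _ h f] unfolding smooth_def by blast

lemma smooth_sum: "(\<And>i. i \<in> S \<Longrightarrow> smooth (f i)) \<Longrightarrow> smooth (\<lambda>x. \<Sum>i\<in>S. f i x)"
  by (simp add: smooth_def Ck_sum)

lemma smooth_pd: "smooth f \<Longrightarrow> b \<in> Basis \<Longrightarrow> smooth (pd b f)"
  unfolding smooth_def by (metis Ck.simps(2))

lemma smooth_has_derivative: "smooth f \<Longrightarrow> (f has_derivative frechet_derivative f (at x)) (at x)"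
  unfolding smooth_def by (metis Ck_SucD1)

lemma smooth_continuous: "smooth f \<Longrightarrow> continuous_on S f"
  by (meson continuous_at_imp_continuous_on has_derivative_continuous smooth_has_derivative)

lemma pd_eq:
  assumes "(f has_derivative D) (at x)" shows "pd b f x = D b"
  using frechet_derivative_at[OF assms] by simp

lemma smooth_partials: "smooth f \<Longrightarrow> set bs \<subseteq> Basis \<Longrightarrow> smooth (partials bs f)"
  by (induction bs) (auto simp: smooth_pd)

lemma test_functionI:
  assumes "smooth f" "compact (closure {x. f x \<noteq> 0})" "closure {x. f x \<noteq> 0} \<subseteq> U"
  shows "test_function U f"
proof -
  have "partials bs f differentiable (at x)" if "set bs \<subseteq> Basis" for bs x
    using smooth_has_derivative[OF smooth_partials[OF assms(1) that]] differentiable_def by blast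
  then show ?thesis using assms unfolding test_function_def by blast
qed

text \<open>\<open>partials\<close> applies the head of the list last. Appending at the end
  therefore means differentiating f before everything else, which turns a property of all iterated
  derivatives of f into the same property for \<open>pd b f\<close>.\<close>

lemma partials_snoc: "partials bs (pd b f) = partials (bs @ [b]) f"
  by (induction bs) auto

lemma test_function_differentiable: "test_function U f \<Longrightarrow> f differentiable (at x)"
  unfolding test_function_def by (metis empty_set empty_subsetI partials.simps(1))

lemma pd_eq_0:
  assumes "open S" "x \<in> S" "\<And>y. y \<in> S \<Longrightarrow> f y = 0"
  shows "frechet_derivative f (at x) = (\<lambda>h. 0)"
proof -
  have "(f has_derivative (\<lambda>h. 0)) (at x)"
    by (rule has_derivative_transform_within_open[OF has_derivative_const[of 0] assms(1,2)]) (use assms(3) in auto)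
  then show ?thesis by (metis frechet_derivative_at)
qed

text \<open>Off the closed support f vanishes on an open set, hence so does its derivative. This
  keeps derivatives of test functions among the test functions.\<close>

lemma pd_support: "{x. pd b f x \<noteq> 0} \<subseteq> closure {x. f x \<noteq> 0}"
proof
  fix x assume x: "x \<in> {x. pd b f x \<noteq> 0}"
  show "x \<in> closure {x. f x \<noteq> 0}"
  proof (rule ccontr)
    assume "x \<notin> closure {x. f x \<noteq> 0}"
    then have "frechet_derivative f (at x) = (\<lambda>h. 0)"
      using closure_subset[of "{x. f x \<noteq> 0}"] by (intro pd_eq_0[of "- closure {x. f x \<noteq> 0}"]) auto
    with x show False by simp
  qed
qed

lemma test_function_pd:
  assumes "test_function U f" "b \<in> Basis"
  shows "test_function U (pd b f)"
proof -
  have *: "closure {x. pd b f x \<noteq> 0} \<subseteq> closure {x. f x \<noteq> 0}"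
    by (rule closure_minimal[OF pd_support]) simp
  have "compact (closure {x. pd b f x \<noteq> 0})"
    using assms(1) compact_Int_closed[of _ "closure {x. pd b f x \<noteq> 0}"] *
    unfolding test_function_def by (metis closed_closure inf.absorb_iff2)
  moreover have "closure {x. pd b f x \<noteq> 0} \<subseteq> U"
    using assms(1) * unfolding test_function_def by blast
  moreover have "\<forall>x. partials bs (pd b f) differentiable at x" if "set bs \<subseteq> Basis" for bs
    using assms that unfolding test_function_def partials_snoc by simp
  ultimately show ?thesis unfolding test_function_def by blast
qed

subsection \<open>A bump function\<close>

text \<open>The family is closed under differentiation, so that smoothness of $e^{-1/x}$ is an induction over the
  order.\<close>

definition flat :: "nat \<Rightarrow> real \<Rightarrow> real" where
  "flat k x = (if x > 0 then (1 / x) ^ k * exp (- (1 / x)) else 0)"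

text \<open>With y = 1/x the limit from the right is that of y^k / exp y at infinity; from the left
  the function is constant.\<close>

lemma flat_tendsto: "((\<lambda>x. flat k x) \<longlongrightarrow> 0) (at 0)"
proof -
  have "((\<lambda>x::real. (1 / x) ^ k * exp (- (1 / x))) \<longlongrightarrow> 0) (at_right 0)"
  proof -
    have "((\<lambda>x. inverse x ^ k / exp (inverse x)) \<longlongrightarrow> (0::real)) (at_right 0)"
      using filterlim_compose[OF tendsto_power_div_exp_0 filterlim_inverse_at_top_right] .
    then show ?thesis by (simp add: exp_minus divide_simps)
  qed
  then have "(flat k \<longlongrightarrow> 0) (at_right 0)"
    by (rule Lim_transform_eventually) (auto simp: flat_def eventually_at_filter)
  moreover have "(flat k \<longlongrightarrow> 0) (at_left 0)"
    by (rule Lim_transform_eventually[OF tendsto_const]) (auto simp: flat_def eventually_at_filter)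
  ultimately show ?thesis by (simp add: filterlim_split_at)
qed

lemma flat_deriv: "(flat k has_real_derivative (flat (k + 2) x - k * flat (k + 1) x)) (at x)"
proof -
  consider "x > 0" | "x < 0" | "x = 0" by linarith
  then show ?thesis
  proof cases
    case 1
    have d: "((\<lambda>x. 1 / x) has_real_derivative - ((1 / x) ^ 2)) (at x)"
      using 1 by (auto intro!: derivative_eq_intros simp: power2_eq_square field_simps)
    have "((\<lambda>x. (1 / x) ^ k * exp (- (1 / x))) has_real_derivative
      (of_nat k * (- ((1 / x)\<^sup>2) * (1 / x) ^ (k - Suc 0))) * exp (- (1 / x))
      + (exp (- (1 / x)) * - (- ((1 / x)\<^sup>2))) * (1 / x) ^ k) (at x)"
      by (intro DERIV_mult DERIV_power[OF d] DERIV_chain2[OF DERIV_exp] DERIV_minus d)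
    also have "(of_nat k * (- ((1 / x)\<^sup>2) * (1 / x) ^ (k - Suc 0))) * exp (- (1 / x))
      + (exp (- (1 / x)) * - (- ((1 / x)\<^sup>2))) * (1 / x) ^ k = flat (k + 2) x - k * flat (k + 1) x"
      using 1 by (cases k) (simp_all add: flat_def power2_eq_square algebra_simps)
    finally have "((\<lambda>x. (1 / x) ^ k * exp (- (1 / x))) has_real_derivative (flat (k + 2) x - k * flat (k + 1) x)) (at x)" .
    then show ?thesis
      by (rule has_field_derivative_transform_within_open[of _ _ _ "{0<..}"]) (use 1 in \<open>auto simp: flat_def\<close>)
  next
    case 2
    have "((\<lambda>x. 0) has_real_derivative (flat (k + 2) x - k * flat (k + 1) x)) (at x)"
      using 2 by (auto simp: flat_def)
    then show ?thesis
      by (rule has_field_derivative_transform_within_open[of _ _ _ "{..<0}"]) (use 2 in \<open>auto simp: flat_def\<close>)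
  next
    case 3
    \<comment> \<open>The difference quotient at 0 is \<open>flat (Suc k)\<close>, so the limit one
      exponent higher is the derivative.\<close>
    have "((\<lambda>y. (flat k y - flat k 0) / (y - 0)) \<longlongrightarrow> 0) (at 0)"
      by (rule Lim_transform_eventually[OF flat_tendsto[of "Suc k"]])
         (auto simp: flat_def eventually_at_filter)
    then show ?thesis using 3 by (simp add: has_field_derivative_iff flat_def)
  qed
qed

lemma smooth_flat: "smooth (flat k)"
proof -
  have "Ck j (flat k)" for j
  proof (induction j arbitrary: k)
    case (Suc j)
    show ?case
    proof (rule Ck_SucI)
      show "(flat k has_derivative (\<lambda>h. h * (flat (k + 2) x + (- real k) * flat (k + 1) x))) (at x)" for x
        using flat_deriv[of k x] by (simp add: has_field_derivative_def mult_commute_abs)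
      show "Ck j (\<lambda>x. b * (flat (k + 2) x + (- real k) * flat (k + 1) x))" for b
        by (intro Ck_mult Ck_add Ck_const Suc)
    qed
  qed simp
  then show ?thesis by (simp add: smooth_def)
qed

section \<open>Kernels supported in the closed unit ball\<close>

text \<open>A class closed under derivatives, linear combinations and multiplication by coordinates;
  all kernels below arise from one mollifier in this way. Sign and total mass are left free, since
  the decisive kernels have mean zero.\<close>

definition kern :: "('a::euclidean_space \<Rightarrow> real) \<Rightarrow> bool" where
  "kern f \<longleftrightarrow> smooth f \<and> (\<forall>y. norm y > 1 \<longrightarrow> f y = 0)"

lemma kern_cmult: "kern f \<Longrightarrow> kern (\<lambda>x. c * f x)"
  and kern_inner: "kern f \<Longrightarrow> kern (\<lambda>x. (x \<bullet> d) * f x)"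
  by (auto simp: kern_def smooth_const smooth_add smooth_mult smooth_inner)

lemma kern_sum: "(\<And>i. i \<in> S \<Longrightarrow> kern (f i)) \<Longrightarrow> kern (\<lambda>x. \<Sum>i\<in>S. f i x)"
  by (auto simp: kern_def smooth_sum)

lemma kern_pd:
  assumes "kern f" "b \<in> Basis" shows "kern (pd b f)"
proof -
  have "frechet_derivative f (at y) = (\<lambda>h. 0)" if "norm y > 1" for y
    by (rule pd_eq_0[of "{y. norm y > 1}"])
       (use that assms in \<open>auto simp: kern_def intro!: open_Collect_less continuous_intros\<close>)
  then show ?thesis using assms by (simp add: kern_def smooth_pd)
qed

lemma kern_continuous: "kern f \<Longrightarrow> continuous_on S f"
  by (simp add: kern_def smooth_continuous)

lemma kern_measurable: "kern f \<Longrightarrow> f \<in> borel_measurable borel"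
  by (simp add: borel_measurable_continuous_onI kern_continuous)

lemma kern_bounded:
  assumes "kern f" obtains B where "B > 0" "\<And>y. \<bar>f y\<bar> \<le> B * indicator (cball 0 1) y"
proof -
  have "bounded (f ` cball 0 1)"
    using assms by (intro compact_imp_bounded compact_continuous_image kern_continuous) auto
  then obtain B where "B > 0" "\<And>y. y \<in> cball 0 1 \<Longrightarrow> \<bar>f y\<bar> \<le> B"
    by (auto simp: bounded_pos)
  with assms show ?thesis
    by (intro that[of B]) (auto simp: kern_def indicator_def)
qed

lemma kern_integrable:
  assumes "kern f" shows "integrable lborel f"
proof -
  have "integrable lborel (\<lambda>x. indicator (cball 0 1) x *\<^sub>R f x)"
    by (rule borel_integrable_compact) (auto intro: kern_continuous assms)
  moreover have "(\<lambda>x. indicator (cball 0 1) x *\<^sub>R f x) = f"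
    using assms by (auto simp: kern_def fun_eq_iff indicator_def)
  ultimately show ?thesis by simp
qed

text \<open>Makes a mollification at centre x and radius r, up to normalization, a pairing with a
  test function, so that the definition of weak derivatives applies to it.\<close>

lemma kern_test_function:
  assumes "kern f" "r > 0" "cball x r \<subseteq> U"
  shows "test_function U (\<lambda>z. f ((1 / r) *\<^sub>R (z - x)))"
proof -
  have "{z. f ((1 / r) *\<^sub>R (z - x)) \<noteq> 0} \<subseteq> cball x r"
  proof
    fix z assume "z \<in> {z. f ((1 / r) *\<^sub>R (z - x)) \<noteq> 0}"
    then have "norm ((1 / r) *\<^sub>R (z - x)) \<le> 1" using assms(1) unfolding kern_def mem_Collect_eq by (meson not_le)
    then have "norm (z - x) \<le> r" using assms(2) unfolding norm_scaleR by (simp add: field_simps)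
    then show "z \<in> cball x r" by (simp add: dist_norm norm_minus_commute)
  qed
  then have c: "closure {z. f ((1 / r) *\<^sub>R (z - x)) \<noteq> 0} \<subseteq> cball x r"
    by (rule closure_minimal) simp
  have "smooth (\<lambda>z. f ((1 / r) *\<^sub>R z + (- ((1 / r) *\<^sub>R x))))"
    by (rule smooth_affine) (use assms(1) in \<open>simp add: kern_def\<close>)
  then show ?thesis
    using c assms(3)
    by (intro test_functionI)
       (auto simp: algebra_simps scaleR_diff_right compact_eq_bounded_closed intro: bounded_subset[OF bounded_cball])
qed

text \<open>The normalized radial function exp (-1 / (1 - |y|^2)); being radial it is even. It can
  be normalized because a nonnegative function with integral 0 vanishes almost everywhere, while
  this one is positive on the unit ball. The sum over coordinates in its definition serves the
  closure properties of \<open>smooth\<close>.\<close>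

lemma exists_bump:
  obtains \<phi> :: "'a::euclidean_space \<Rightarrow> real" where
    "kern \<phi>" "\<And>y. \<phi> (- y) = \<phi> y" "integral\<^sup>L lborel \<phi> = 1"
proof -
  define g :: "'a \<Rightarrow> real" where "g y = flat 0 (1 + (-1) * (\<Sum>i\<in>Basis. (y \<bullet> i) * (y \<bullet> i)))" for y
  have g': "g y = flat 0 (1 - y \<bullet> y)" for y
    by (simp add: g_def euclidean_inner[of y y])
  have k: "kern g"
    unfolding kern_def
  proof (intro conjI allI impI)
    show "smooth g" unfolding g_def
      by (rule smooth_compose[OF smooth_flat]) (intro smooth_add smooth_mult smooth_const smooth_sum smooth_inner)
    fix y :: 'a assume "norm y > 1"
    then have "y \<bullet> y > 1" by (metis dot_square_norm one_less_power pos2)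
    then show "g y = 0" by (simp add: g' flat_def)
  qed
  have nn: "g y \<ge> 0" for y by (auto simp: g' flat_def)
  have "integral\<^sup>L lborel g \<noteq> 0"
  proof
    assume "integral\<^sup>L lborel g = 0"
    then have "AE x in lborel. g x = 0"
      using integral_nonneg_eq_0_iff_AE[OF kern_integrable[OF k]] nn by simp
    then have "AE x in lborel. x \<notin> ball (0::'a) 1"
    proof (rule AE_mp, intro AE_I2 impI)
      fix x assume "g x = 0"
      then have "1 \<le> x \<bullet> x" by (auto simp: g' flat_def split: if_splits)
      then show "x \<notin> ball 0 1" by (metis dot_square_norm mem_ball_0 not_le power_le_one norm_ge_zero less_le_not_le abs_norm_cancel abs_square_less_1)
    qed
    then have "emeasure lborel (ball (0::'a) 1) = 0"
      by (subst (asm) AE_iff_measurable[of "ball 0 1"]) auto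
    then show False using content_ball_pos[of 1 "0::'a"] by (simp add: measure_def)
  qed
  moreover have "g (- y) = g y" for y by (simp add: g')
  ultimately show ?thesis
    by (intro that[of "\<lambda>y. (1 / integral\<^sup>L lborel g) * g y"]) (rule kern_cmult[OF k], simp_all)
qed

subsection \<open>Affine changes of variables\<close>

lemma nn_integral_affine:
  fixes f :: "'a::euclidean_space \<Rightarrow> ennreal"
  assumes [measurable]: "f \<in> borel_measurable borel" and "r \<noteq> 0"
  shows "(\<integral>\<^sup>+x. f x \<partial>lborel) = ennreal (\<bar>r\<bar> ^ DIM('a)) * (\<integral>\<^sup>+x. f (t + r *\<^sub>R x) \<partial>lborel)"
  by (subst lborel_affine[OF assms(2), of t])
     (simp add: nn_integral_density nn_integral_distr nn_integral_cmult)

lemma nn_integral_translate: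
  fixes f :: "'a::euclidean_space \<Rightarrow> ennreal"
  assumes "f \<in> borel_measurable borel"
  shows "(\<integral>\<^sup>+x. f (x + t) \<partial>lborel) = (\<integral>\<^sup>+x. f x \<partial>lborel)"
  using nn_integral_affine[OF assms, of 1 t] by (simp add: add.commute)

lemma lborel_integral_affine:
  fixes f :: "'a::euclidean_space \<Rightarrow> real"
  assumes [measurable]: "f \<in> borel_measurable borel" and "r \<noteq> 0"
  shows "(\<integral>x. f x \<partial>lborel) = (\<bar>r\<bar> ^ DIM('a)) * (\<integral>x. f (t + r *\<^sub>R x) \<partial>lborel)"
  by (subst lborel_affine[OF assms(2), of t])
     (simp add: integral_density integral_distr)

lemma lborel_integral_translate:
  fixes f :: "'a::euclidean_space \<Rightarrow> real"
  assumes "f \<in> borel_measurable borel"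
  shows "(\<integral>x. f (x + t) \<partial>lborel) = (\<integral>x. f x \<partial>lborel)"
  using lborel_integral_affine[OF assms, of 1 t] by (simp add: add.commute)

lemma lborel_integrable_affine:
  fixes f :: "'a::euclidean_space \<Rightarrow> real"
  assumes f: "integrable lborel f" and "r \<noteq> 0"
  shows "integrable lborel (\<lambda>x. f (t + r *\<^sub>R x))"
proof (rule integrableI_bounded)
  have [measurable]: "f \<in> borel_measurable borel" using f by simp
  show "(\<lambda>x. f (t + r *\<^sub>R x)) \<in> borel_measurable lborel" by simp
  have pos: "\<not> \<bar>r\<bar> ^ DIM('a) \<le> 0" using zero_less_power[of "\<bar>r\<bar>" "DIM('a)"] assms(2) by linarith
  have "ennreal (\<bar>r\<bar> ^ DIM('a)) * (\<integral>\<^sup>+x. norm (f (t + r *\<^sub>R x)) \<partial>lborel) < \<infinity>"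
    using nn_integral_affine[of "\<lambda>x. norm (f x)" r t] f assms(2) by (simp add: integrable_iff_bounded)
  then show "(\<integral>\<^sup>+x. norm (f (t + r *\<^sub>R x)) \<partial>lborel) < \<infinity>"
    using pos by (auto simp: ennreal_mult_less_top ennreal_eq_0_iff)
qed

text \<open>Lebesgue measure is a positive multiple of its image under the map, so null sets
  correspond to null sets. With this, representatives can be exchanged under a mollification
  integral.\<close>

lemma AE_lborel_affine:
  fixes P :: "'a::euclidean_space \<Rightarrow> bool"
  assumes "AE x in lborel. P x" "r \<noteq> 0"
  shows "AE x in lborel. P (t + r *\<^sub>R x)"
proof -
  have m: "(\<lambda>x. t + r *\<^sub>R x) \<in> measurable lborel borel" by measurable
  from assms(1) have "AE x in density (distr lborel borel (\<lambda>x. t + r *\<^sub>R x)) (\<lambda>_. ennreal (\<bar>r\<bar> ^ DIM('a))). P x"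
    by (subst (asm) lborel_affine[OF assms(2), of t]) simp
  then have "AE x in distr lborel borel (\<lambda>x. t + r *\<^sub>R x). P x"
    using assms(2) by (subst (asm) AE_density) (auto simp: ennreal_zero_less_mult_iff)
  then show ?thesis
    using AE_distrD[OF m] by simp
qed

subsection \<open>Classical derivatives are weak derivatives\<close>

text \<open>Only the derivative along one line is recorded, together with continuity of function and
  derivative. This is enough for integration by parts and is what differentiation under the integral
  sign yields directly.\<close>

definition dir_deriv :: "'b::real_normed_vector set \<Rightarrow> 'b \<Rightarrow> ('b \<Rightarrow> real) \<Rightarrow> ('b \<Rightarrow> real) \<Rightarrow> bool" where
  "dir_deriv U b v w \<longleftrightarrow> continuous_on U v \<and> continuous_on U w \<and>
     (\<forall>q\<in>U. ((\<lambda>s. v (q + s *\<^sub>R b)) has_real_derivative w q) (at 0))"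

lemma dir_deriv_line:
  fixes v :: "'b::real_normed_vector \<Rightarrow> real"
  assumes "((\<lambda>s. v ((q + t *\<^sub>R b) + s *\<^sub>R b)) has_real_derivative d) (at 0)"
  shows "((\<lambda>s. v (q + s *\<^sub>R b)) has_real_derivative d) (at t)"
proof -
  have *: "q + t *\<^sub>R b + s *\<^sub>R b = q + (s + t) *\<^sub>R b" for s
    by (simp add: scaleR_add_left)
  have "((\<lambda>s. v (q + (s + t) *\<^sub>R b)) has_real_derivative d) (at 0)"
    using assms unfolding * .
  then show ?thesis using DERIV_shift[of "\<lambda>s. v (q + s *\<^sub>R b)" d 0 t] by simp
qed

text \<open>Difference quotients of \<psi> along b have integral zero by translation invariance, and
  they converge to \<eta> under an integrable majorant.\<close>

lemma integral_dir_deriv_eq_0: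
  fixes \<psi> \<eta> :: "'b::euclidean_space \<Rightarrow> real"
  assumes d: "dir_deriv UNIV b \<psi> \<eta>" and R: "\<And>q. norm q > R \<Longrightarrow> \<psi> q = 0"
  shows "integral\<^sup>L lborel \<eta> = 0"
proof -
  have c\<psi>: "continuous_on UNIV \<psi>" and c\<eta>: "continuous_on UNIV \<eta>"
    and D: "\<And>q. ((\<lambda>s. \<psi> (q + s *\<^sub>R b)) has_real_derivative \<eta> q) (at 0)"
    using d by (auto simp: dir_deriv_def)
  have [measurable]: "\<psi> \<in> borel_measurable borel" "\<eta> \<in> borel_measurable borel"
    by (simp_all add: borel_measurable_continuous_onI c\<psi> c\<eta>)
  have D': "((\<lambda>s. \<psi> (q + s *\<^sub>R b)) has_real_derivative \<eta> (q + t *\<^sub>R b)) (at t)" for q t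
    by (rule dir_deriv_line[OF D])
  have \<eta>0: "\<eta> q = 0" if "norm q > R" for q
  proof -
    have "\<forall>\<^sub>F s in at 0. norm (q + s *\<^sub>R b) > R"
    proof (rule order_tendstoD)
      show "((\<lambda>s::real. norm (q + s *\<^sub>R b)) \<longlongrightarrow> norm (q + 0 *\<^sub>R b)) (at 0)" by (intro tendsto_intros)
      show "R < norm (q + 0 *\<^sub>R b)" using that by simp
    qed
    then have ev: "\<forall>\<^sub>F s in nhds 0. \<psi> (q + s *\<^sub>R b) = 0"
      unfolding eventually_at_filter by (rule eventually_mono) (use R that in force)
    have "((\<lambda>s::real. 0) has_real_derivative \<eta> q) (at 0)"
      using DERIV_cong_ev[OF refl ev refl, of "\<eta> q"] D[of q] by simp
    then show ?thesis using DERIV_unique by (metis DERIV_const)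
  qed
  obtain C where C: "\<And>q. \<bar>\<eta> q\<bar> \<le> C" "C \<ge> 0"
  proof -
    have "bounded (\<eta> ` cball 0 R)"
      by (intro compact_imp_bounded compact_continuous_image continuous_on_subset[OF c\<eta>]) auto
    then obtain C where "C > 0" "\<And>y. y \<in> cball 0 R \<Longrightarrow> \<bar>\<eta> y\<bar> \<le> C"
      by (auto simp: bounded_pos)
    then show ?thesis using \<eta>0 by (intro that[of C]) (metis abs_zero less_le_not_le linear mem_cball_0, simp)
  qed
  \<comment> \<open>The mean value theorem bounds the difference quotients by the supremum C of
    \<eta>.\<close>
  have lip: "\<bar>\<psi> (q + s *\<^sub>R b) - \<psi> q\<bar> \<le> C * s" if "s > 0" for q s
  proof -
    have "\<exists>z>0. z < s \<and> \<psi> (q + s *\<^sub>R b) - \<psi> (q + 0 *\<^sub>R b) = (s - 0) * \<eta> (q + z *\<^sub>R b)"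
      by (rule MVT2[OF that]) (rule D')
    then obtain z where "\<psi> (q + s *\<^sub>R b) - \<psi> (q + 0 *\<^sub>R b) = (s - 0) * \<eta> (q + z *\<^sub>R b)"
      by blast
    then show ?thesis using C(1)[of "q + z *\<^sub>R b"] that by (simp add: abs_mult mult.commute)
  qed
  \<comment> \<open>Steps of length at most 1 keep all shifted supports inside the ball of radius R
    + norm b, on which the majorant lives.\<close>
  define s :: "nat \<Rightarrow> real" where "s k = inverse (real (Suc k))" for k
  have s: "s k > 0" "s k \<le> 1" for k by (auto simp: s_def divide_simps)
  have slim: "s \<longlonglongrightarrow> 0" unfolding s_def by (rule LIMSEQ_inverse_real_of_nat)
  have [measurable]: "ball (0::'b) r \<in> sets borel" "cball (0::'b) r \<in> sets borel" for r by auto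
  have int\<psi>: "integrable lborel \<psi>"
  proof -
    have "integrable lborel (\<lambda>x. indicator (cball 0 R) x *\<^sub>R \<psi> x)"
      by (rule borel_integrable_compact) (auto intro: continuous_on_subset[OF c\<psi>])
    moreover have "(\<lambda>x. indicator (cball 0 R) x *\<^sub>R \<psi> x) = \<psi>"
      using R by (auto simp: indicator_def fun_eq_iff)
    ultimately show ?thesis by simp
  qed
  have "(\<lambda>k. \<integral>q. (\<psi> (q + s k *\<^sub>R b) - \<psi> q) / s k \<partial>lborel) \<longlonglongrightarrow> integral\<^sup>L lborel \<eta>"
  proof (rule integral_dominated_convergence[where w="\<lambda>q. C * indicator (cball 0 (R + norm b)) q"])
    show "integrable lborel (\<lambda>q. C * indicat_real (cball 0 (R + norm b)) q)"
      by (intro integrable_mult_right integrable_real_indicator emeasure_bounded_finite bounded_cball) simp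
    show "AE q in lborel. (\<lambda>k. (\<psi> (q + s k *\<^sub>R b) - \<psi> q) / s k) \<longlonglongrightarrow> \<eta> q"
    proof (rule AE_I2)
      fix q
      have "((\<lambda>h. (\<psi> (q + h *\<^sub>R b) - \<psi> q) / h) \<longlongrightarrow> \<eta> q) (at 0)"
        using D[of q] by (simp add: has_field_derivative_iff)
      moreover have "filterlim s (at 0) sequentially"
        using slim s(1) by (simp add: filterlim_at less_imp_neq[symmetric] always_eventually)
      ultimately show "(\<lambda>k. (\<psi> (q + s k *\<^sub>R b) - \<psi> q) / s k) \<longlonglongrightarrow> \<eta> q"
        by (rule filterlim_compose)
    qed
    show "AE q in lborel. norm ((\<psi> (q + s k *\<^sub>R b) - \<psi> q) / s k) \<le> C * indicator (cball 0 (R + norm b)) q" for k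
    proof (rule AE_I2)
      fix q
      show "norm ((\<psi> (q + s k *\<^sub>R b) - \<psi> q) / s k) \<le> C * indicator (cball 0 (R + norm b)) q"
      proof (cases "norm q \<le> R + norm b")
        case True
        then show ?thesis using lip[OF s(1)[of k], of q] s(1)[of k] by (simp add: divide_simps)
      next
        case False
        have "norm (s k *\<^sub>R b) \<le> norm b" using s[of k] by (simp add: mult_left_le_one_le)
        then have "norm (q + s k *\<^sub>R b) > R"
          using False norm_triangle_ineq2[of q "- (s k *\<^sub>R b)"] by simp
        moreover have "norm q > R" using False norm_ge_zero[of b] by linarith
        ultimately show ?thesis using R False by simp
      qed
    qed
  qed simp_all
  moreover have "(\<integral>q. (\<psi> (q + s k *\<^sub>R b) - \<psi> q) / s k \<partial>lborel) = 0" for k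
  proof -
    have "integrable lborel (\<lambda>q. \<psi> (q + s k *\<^sub>R b))"
      using lborel_integrable_affine[OF int\<psi>, of 1 "s k *\<^sub>R b"] by (simp add: add.commute)
    then show ?thesis by (simp add: lborel_integral_translate int\<psi>)
  qed
  ultimately have "(\<lambda>k::nat. 0) \<longlonglongrightarrow> integral\<^sup>L lborel \<eta>" by (simp only:)
  then show ?thesis by (simp add: LIMSEQ_const_iff)
qed

lemma nn_integral_compact_finite:
  fixes f :: "'b::euclidean_space \<Rightarrow> real"
  assumes "compact K" "continuous_on K f"
  shows "(\<integral>\<^sup>+x\<in>K. ennreal (\<bar>f x\<bar>) \<partial>lebesgue) < \<infinity>"
proof -
  have "integrable lborel (\<lambda>x. indicator K x *\<^sub>R f x)" by (rule borel_integrable_compact[OF assms])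
  then have "(\<integral>\<^sup>+x. ennreal (norm (indicator K x *\<^sub>R f x)) \<partial>lborel) < \<infinity>"
    by (simp add: integrable_iff_bounded)
  also have "(\<integral>\<^sup>+x. ennreal (norm (indicator K x *\<^sub>R f x)) \<partial>lborel) = (\<integral>\<^sup>+x\<in>K. ennreal (\<bar>f x\<bar>) \<partial>lebesgue)"
    unfolding nn_integral_completion by (rule nn_integral_cong) (auto simp: indicator_def)
  finally show ?thesis .
qed

lemma in_Lp_loc_1_continuous:
  assumes "open U" "continuous_on U f"
  shows "in_Lp_loc 1 U f"
  unfolding in_Lp_loc_def
proof (intro conjI allI impI)
  show "f \<in> borel_measurable (lebesgue_on U)"
    using assms by (intro continuous_imp_measurable_on_sets_lebesgue) auto
  fix K assume "compact K \<and> K \<subseteq> U"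
  then show "(\<integral>\<^sup>+x\<in>K. ennreal (\<bar>f x\<bar> powr 1) \<partial>lebesgue) < \<infinity>"
    using nn_integral_compact_finite[of K f] assms(2) by (simp add: continuous_on_subset)
qed

lemma test_function_facts:
  assumes "test_function U \<phi>"
  shows "continuous_on S \<phi>" "b \<in> Basis \<Longrightarrow> continuous_on S (pd b \<phi>)"
    "(\<phi> has_derivative frechet_derivative \<phi> (at x)) (at x)"
    "\<phi> x \<noteq> 0 \<Longrightarrow> x \<in> U"
proof -
  have 1: "\<phi> differentiable (at x)" if "test_function U \<phi>" for \<phi> x
    using that by (rule test_function_differentiable)
  then have 2: "continuous_on S \<phi>" if "test_function U \<phi>" for \<phi>
    using that by (intro continuous_at_imp_continuous_on) (auto intro: differentiable_imp_continuous_within)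
  show "continuous_on S \<phi>" by (rule 2[OF assms])
  show "b \<in> Basis \<Longrightarrow> continuous_on S (pd b \<phi>)" by (rule 2[OF test_function_pd[OF assms]])
  show "(\<phi> has_derivative frechet_derivative \<phi> (at x)) (at x)"
    using 1[OF assms] frechet_derivative_works by blast
  show "\<phi> x \<noteq> 0 \<Longrightarrow> x \<in> U"
    using assms closure_subset[of "{x. \<phi> x \<noteq> 0}"] unfolding test_function_def by blast
qed

text \<open>The product v \<phi>, extended by zero to the whole space, again has a continuous
  derivative along b. That derivative integrates to zero, which is the integration by parts
  formula.\<close>

lemma has_weak_partial_dir_deriv:
  fixes v w :: "'b::euclidean_space \<Rightarrow> real"
  assumes U: "open U" and d: "dir_deriv U b v w" and b: "b \<in> Basis"
  shows "has_weak_partial U [b] v w"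
  unfolding has_weak_partial_def
proof (intro conjI allI impI)
  have cv: "continuous_on U v" and cw: "continuous_on U w"
    and D: "\<And>q. q \<in> U \<Longrightarrow> ((\<lambda>s. v (q + s *\<^sub>R b)) has_real_derivative w q) (at 0)"
    using d by (auto simp: dir_deriv_def)
  show "in_Lp_loc 1 U v" "in_Lp_loc 1 U w"
    using in_Lp_loc_1_continuous U cv cw by auto
  fix \<phi> assume t: "test_function U \<phi>"
  define K where "K = closure {x. \<phi> x \<noteq> 0}"
  have K: "compact K" "K \<subseteq> U" using t by (auto simp: test_function_def K_def)
  have K0: "\<phi> x = 0" "pd b \<phi> x = 0" if "x \<notin> K" for x
  proof -
    show "\<phi> x = 0" using that closure_subset[of "{x. \<phi> x \<noteq> 0}"] unfolding K_def by blast
    show "pd b \<phi> x = 0" using that pd_support[where b=b and f=\<phi>] unfolding K_def by blast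
  qed
  \<comment> \<open>U and the complement of the compact support K are open and cover the space; the
    two definitions are continuous on one of them each.\<close>
  have cont: "continuous_on UNIV (\<lambda>x. if x \<in> U then g x * h x else 0)"
    if "continuous_on U g" "continuous_on UNIV h" "\<And>x. x \<notin> K \<Longrightarrow> h x = 0" for g h :: "'b \<Rightarrow> real"
  proof -
    have o: "open (- K)" using K(1) by (simp add: compact_imp_closed open_Compl)
    have "continuous_on (U \<union> - K) (\<lambda>x. if x \<in> U then g x * h x else 0)"
    proof (rule continuous_on_open_Un[OF U o])
      show "continuous_on U (\<lambda>x. if x \<in> U then g x * h x else 0)"
        by (rule continuous_on_eq[of _ "\<lambda>x. g x * h x"])
           (use that(1) continuous_on_subset[OF that(2), of U] in \<open>auto intro!: continuous_intros\<close>)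
      show "continuous_on (- K) (\<lambda>x. if x \<in> U then g x * h x else 0)"
        by (rule continuous_on_eq[of _ "\<lambda>x. 0"]) (use that in auto)
    qed
    moreover have "U \<union> - K = UNIV" using K(2) by auto
    ultimately show ?thesis by simp
  qed
  define \<psi> where "\<psi> x = (if x \<in> U then v x * \<phi> x else 0)" for x
  define \<eta>1 where "\<eta>1 x = (if x \<in> U then v x * pd b \<phi> x else 0)" for x
  define \<eta>2 where "\<eta>2 x = (if x \<in> U then w x * \<phi> x else 0)" for x
  note tf = test_function_facts[OF t]
  have c1: "continuous_on UNIV \<eta>1" and c2: "continuous_on UNIV \<eta>2" and c0: "continuous_on UNIV \<psi>"
    unfolding \<psi>_def \<eta>1_def \<eta>2_def
    by (intro cont cv cw tf b; use K0 in simp)+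
  obtain R where "\<forall>x\<in>K. norm x \<le> R" using compact_imp_bounded[OF K(1)] unfolding bounded_iff by auto
  then have R: "K \<subseteq> cball 0 R" by auto
  have K': "x \<notin> K" if "norm x > R" for x using R that by auto
  have int: "integrable lborel f" if "continuous_on UNIV f" "\<And>x. x \<notin> K \<Longrightarrow> f x = 0" for f :: "'b \<Rightarrow> real"
  proof -
    have "integrable lborel (\<lambda>x. indicator K x *\<^sub>R f x)"
      by (rule borel_integrable_compact[OF K(1)]) (rule continuous_on_subset[OF that(1)], simp)
    moreover have "(\<lambda>x. indicator K x *\<^sub>R f x) = f" using that by (auto simp: indicator_def fun_eq_iff)
    ultimately show ?thesis by simp
  qed
  have "integral\<^sup>L lborel (\<lambda>x. \<eta>1 x + \<eta>2 x) = 0"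
  proof (rule integral_dir_deriv_eq_0)
    show "dir_deriv UNIV b \<psi> (\<lambda>x. \<eta>1 x + \<eta>2 x)"
      unfolding dir_deriv_def
    proof (intro conjI ballI continuous_intros c0 c1 c2)
      fix q :: 'b
      show "((\<lambda>s. \<psi> (q + s *\<^sub>R b)) has_real_derivative \<eta>1 q + \<eta>2 q) (at 0)"
      proof (cases "q \<in> U")
        case True
        have lin: "linear (frechet_derivative \<phi> (at q))" by (rule has_derivative_linear[OF tf(3)])
        have "((\<lambda>s. \<phi> (q + s *\<^sub>R b)) has_derivative (\<lambda>s. frechet_derivative \<phi> (at q) (s *\<^sub>R b))) (at 0)"
          by (rule has_derivative_compose[where f="\<lambda>s::real. q + s *\<^sub>R b" and g=\<phi>])
             (auto intro!: derivative_eq_intros tf(3))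
        then have "((\<lambda>s. \<phi> (q + s *\<^sub>R b)) has_real_derivative pd b \<phi> q) (at 0)"
          by (simp add: has_field_derivative_def linear_cmul[OF lin] mult_commute_abs)
        from DERIV_mult[OF D[OF True] this]
        have "((\<lambda>s. v (q + s *\<^sub>R b) * \<phi> (q + s *\<^sub>R b)) has_real_derivative \<eta>1 q + \<eta>2 q) (at 0)"
          using True by (simp add: \<eta>1_def \<eta>2_def algebra_simps)
        moreover have "\<forall>\<^sub>F s in nhds 0. v (q + s *\<^sub>R b) * \<phi> (q + s *\<^sub>R b) = \<psi> (q + s *\<^sub>R b)"
        proof -
          have "open ((\<lambda>s::real. q + s *\<^sub>R b) -` U)"
            by (rule open_vimage[OF U]) (intro continuous_intros)
          then have "\<forall>\<^sub>F s in nhds 0. q + s *\<^sub>R b \<in> U"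
            using True eventually_nhds_in_open[of "(\<lambda>s::real. q + s *\<^sub>R b) -` U" 0] by simp
          then show ?thesis by (rule eventually_mono) (simp add: \<psi>_def)
        qed
        ultimately show ?thesis
          using DERIV_cong_ev[OF refl, of "\<lambda>s. v (q + s *\<^sub>R b) * \<phi> (q + s *\<^sub>R b)" "\<lambda>s. \<psi> (q + s *\<^sub>R b)" 0, OF _ refl] by (simp only:)
      next
        case False
        then have q: "q \<notin> K" using K(2) by auto
        have "open ((\<lambda>s::real. q + s *\<^sub>R b) -` (- K))"
          by (rule open_vimage) (use K(1) in \<open>auto intro!: continuous_intros simp: compact_imp_closed\<close>)
        then have "\<forall>\<^sub>F s in nhds 0. q + s *\<^sub>R b \<notin> K"
          using q eventually_nhds_in_open[of "(\<lambda>s::real. q + s *\<^sub>R b) -` (- K)" 0] by simp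
        then have "\<forall>\<^sub>F s in nhds 0. 0 = \<psi> (q + s *\<^sub>R b)"
          by (rule eventually_mono) (simp add: \<psi>_def K0)
        moreover have "((\<lambda>s::real. 0) has_real_derivative \<eta>1 q + \<eta>2 q) (at 0)"
          using False by (simp add: \<eta>1_def \<eta>2_def)
        ultimately show ?thesis
          using DERIV_cong_ev[OF refl, of "\<lambda>s. 0" "\<lambda>s. \<psi> (q + s *\<^sub>R b)" 0, OF _ refl] by (simp only:)
      qed
    qed
    show "norm q > R \<Longrightarrow> \<psi> q = 0" for q by (simp add: \<psi>_def K0 K')
  qed
  moreover have "integrable lborel \<eta>1" "integrable lborel \<eta>2"
    by (auto intro!: int c1 c2 simp: \<eta>1_def \<eta>2_def K0)
  ultimately have "integral\<^sup>L lborel \<eta>1 = - integral\<^sup>L lborel \<eta>2"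
    by simp
  moreover have "(LINT x:U|lebesgue. v x * partials [b] \<phi> x) = integral\<^sup>L lborel \<eta>1"
  proof -
    have "(LINT x:U|lebesgue. v x * partials [b] \<phi> x) = integral\<^sup>L lebesgue \<eta>1"
      unfolding set_lebesgue_integral_def by (rule Bochner_Integration.integral_cong) (auto simp: \<eta>1_def indicator_def)
    then show ?thesis by (simp add: integral_completion borel_measurable_continuous_onI[OF c1])
  qed
  moreover have "(LINT x:U|lebesgue. w x * \<phi> x) = integral\<^sup>L lborel \<eta>2"
  proof -
    have "(LINT x:U|lebesgue. w x * \<phi> x) = integral\<^sup>L lebesgue \<eta>2"
      unfolding set_lebesgue_integral_def by (rule Bochner_Integration.integral_cong) (auto simp: \<eta>2_def indicator_def)
    then show ?thesis by (simp add: integral_completion borel_measurable_continuous_onI[OF c2])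
  qed
  ultimately show "(LINT x:U|lebesgue. v x * partials [b] \<phi> x) = (- 1) ^ length [b] * (LINT x:U|lebesgue. w x * \<phi> x)"
    by simp
qed

text \<open>The first identity is tested with \<open>pd j \<phi>\<close>, again a test function, the
  second with \<phi>; the two signs multiply.\<close>

lemma has_weak_partial_Cons:
  assumes "has_weak_partial U [i] u v" "has_weak_partial U [j] v w" "j \<in> Basis"
  shows "has_weak_partial U [i, j] u w"
  unfolding has_weak_partial_def
proof (intro conjI allI impI)
  show "in_Lp_loc 1 U u" "in_Lp_loc 1 U w"
    using assms unfolding has_weak_partial_def by blast+
  fix \<phi> assume t: "test_function U \<phi>"
  have "(LINT x:U|lebesgue. u x * partials [i] (pd j \<phi>) x) = (- 1) ^ length [i] * (LINT x:U|lebesgue. v x * pd j \<phi> x)"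
    using assms(1) test_function_pd[OF t assms(3)] unfolding has_weak_partial_def by blast
  moreover have "(LINT x:U|lebesgue. v x * partials [j] \<phi> x) = (- 1) ^ length [j] * (LINT x:U|lebesgue. w x * \<phi> x)"
    using assms(2) t unfolding has_weak_partial_def by blast
  ultimately show "(LINT x:U|lebesgue. u x * partials [i, j] \<phi> x) = (- 1) ^ length [i, j] * (LINT x:U|lebesgue. w x * \<phi> x)"
    by simp
qed

lemma kern_dir_deriv:
  assumes "kern \<Psi>" "b \<in> Basis" shows "dir_deriv UNIV b \<Psi> (pd b \<Psi>)"
  unfolding dir_deriv_def
proof (intro conjI ballI)
  show "continuous_on UNIV \<Psi>" "continuous_on UNIV (pd b \<Psi>)"
    using assms by (auto intro: kern_continuous kern_pd)
  fix q
  have d: "(\<Psi> has_derivative frechet_derivative \<Psi> (at x)) (at x)" for x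
    using assms(1) smooth_has_derivative by (auto simp: kern_def)
  have lin: "linear (frechet_derivative \<Psi> (at q))" by (rule has_derivative_linear[OF d])
  have "((\<lambda>s. \<Psi> (q + s *\<^sub>R b)) has_derivative (\<lambda>s. frechet_derivative \<Psi> (at q) (s *\<^sub>R b))) (at 0)"
    by (rule has_derivative_compose[where f="\<lambda>s::real. q + s *\<^sub>R b" and g=\<Psi>])
       (auto intro!: derivative_eq_intros d)
  then show "((\<lambda>s. \<Psi> (q + s *\<^sub>R b)) has_real_derivative pd b \<Psi> q) (at 0)"
    by (simp add: has_field_derivative_def linear_cmul[OF lin] mult_commute_abs)
qed

text \<open>The first source of kernels of mean zero: a tangential derivative of a mollification
  replaces the kernel by its partial derivative.\<close>

lemma integral_kern_pd:
  assumes "kern \<Psi>" "b \<in> Basis" shows "integral\<^sup>L lborel (pd b \<Psi>) = 0"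
proof (rule integral_dir_deriv_eq_0[OF kern_dir_deriv[OF assms]])
  show "\<Psi> q = 0" if "norm q > 1" for q using that assms(1) unfolding kern_def by blast
qed

subsection \<open>Integrals of powers\<close>

lemma powr_add_le:
  fixes a b p :: real assumes "p \<ge> 0"
  shows "\<bar>a + b\<bar> powr p \<le> 2 powr p * (\<bar>a\<bar> powr p + \<bar>b\<bar> powr p)"
proof -
  have "\<bar>a + b\<bar> powr p \<le> (2 * max \<bar>a\<bar> \<bar>b\<bar>) powr p"
    using assms by (intro powr_mono2) auto
  also have "\<dots> = 2 powr p * max \<bar>a\<bar> \<bar>b\<bar> powr p" by (simp add: powr_mult)
  also have "\<dots> \<le> 2 powr p * (\<bar>a\<bar> powr p + \<bar>b\<bar> powr p)"
    by (intro mult_left_mono) (auto simp: max_def)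
  finally show ?thesis .
qed

text \<open>The p-th power of the \<open>L^p\<close> norm. Without the root all estimates stay
  linear in the energies; the triangle inequality then carries a factor 2^p.\<close>

definition Lpp :: "real \<Rightarrow> 'a::euclidean_space set \<Rightarrow> ('a \<Rightarrow> real) \<Rightarrow> ennreal" where
  "Lpp p S f = (\<integral>\<^sup>+x\<in>S. ennreal (\<bar>f x\<bar> powr p) \<partial>lborel)"

text \<open>Measurability on S, expressed by extension with zero: the functions built below are
  continuous on the strip and carry no information outside it.\<close>

definition borel_on :: "'a::euclidean_space set \<Rightarrow> ('a \<Rightarrow> real) \<Rightarrow> bool" where
  "borel_on S f \<longleftrightarrow> S \<in> sets borel \<and> (\<lambda>x. indicator S x * f x) \<in> borel_measurable borel"

lemma borel_on_borel: "f \<in> borel_measurable borel \<Longrightarrow> S \<in> sets borel \<Longrightarrow> borel_on S f"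
  by (simp add: borel_on_def)

lemma borel_on_cont: "continuous_on S f \<Longrightarrow> S \<in> sets borel \<Longrightarrow> borel_on S f"
  using borel_measurable_continuous_on_indicator[of S f] by (simp add: borel_on_def)

lemma borel_on_add: "borel_on S f \<Longrightarrow> borel_on S g \<Longrightarrow> borel_on S (\<lambda>x. f x + g x)"
  by (auto simp: borel_on_def distrib_left intro!: borel_measurable_add)

lemma borel_on_sets: "borel_on S f \<Longrightarrow> S \<in> sets borel"
  by (simp add: borel_on_def)

lemma borel_on_powr:
  assumes "borel_on S f"
  shows "(\<lambda>x. ennreal (\<bar>f x\<bar> powr p) * indicator S x) \<in> borel_measurable borel"
proof -
  have [measurable]: "S \<in> sets borel" "(\<lambda>x. indicator S x * f x) \<in> borel_measurable borel"
    using assms by (auto simp: borel_on_def)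
  have "(\<lambda>x. ennreal (\<bar>indicator S x * f x\<bar> powr p) * indicator S x) \<in> borel_measurable borel"
    by measurable
  also have "(\<lambda>x. ennreal (\<bar>indicator S x * f x\<bar> powr p) * indicator S x) = (\<lambda>x. ennreal (\<bar>f x\<bar> powr p) * indicator S x)"
    by (auto simp: indicator_def fun_eq_iff)
  finally show ?thesis .
qed

lemma Lpp_mono:
  assumes "p \<ge> 0" "\<And>x. x \<in> S \<Longrightarrow> \<bar>f x\<bar> \<le> \<bar>g x\<bar>"
  shows "Lpp p S f \<le> Lpp p S g"
  unfolding Lpp_def
  by (rule nn_integral_mono) (use assms in \<open>auto simp: indicator_def intro!: ennreal_leI powr_mono2\<close>)

lemma Lpp_cong: "(\<And>x. x \<in> S \<Longrightarrow> \<bar>f x\<bar> = \<bar>g x\<bar>) \<Longrightarrow> Lpp p S f = Lpp p S g"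
  unfolding Lpp_def by (rule nn_integral_cong) (auto simp: indicator_def)

lemma Lpp_subset: "S \<subseteq> T \<Longrightarrow> Lpp p S f \<le> Lpp p T f"
  unfolding Lpp_def by (rule nn_integral_mono) (auto simp: indicator_def)

lemma Lpp_add:
  assumes "p \<ge> 0" "borel_on S f" "borel_on S g"
  shows "Lpp p S (\<lambda>x. f x + g x) \<le> ennreal (2 powr p) * (Lpp p S f + Lpp p S g)"
proof -
  have m: "(\<lambda>x. ennreal (\<bar>f x\<bar> powr p) * indicator S x) \<in> borel_measurable lborel"
    "(\<lambda>x. ennreal (\<bar>g x\<bar> powr p) * indicator S x) \<in> borel_measurable lborel"
    using borel_on_powr[OF assms(2)] borel_on_powr[OF assms(3)] by simp_all
  have "Lpp p S (\<lambda>x. f x + g x) \<le> (\<integral>\<^sup>+x. ennreal (2 powr p) * (ennreal (\<bar>f x\<bar> powr p) * indicator S x + ennreal (\<bar>g x\<bar> powr p) * indicator S x) \<partial>lborel)"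
    unfolding Lpp_def
    by (rule nn_integral_mono)
       (use powr_add_le[OF assms(1)] in \<open>auto simp: indicator_def ennreal_plus[symmetric] ennreal_mult[symmetric] simp del: ennreal_plus\<close>)
  also have "\<dots> = ennreal (2 powr p) * (Lpp p S f + Lpp p S g)"
    unfolding Lpp_def using m by (simp add: nn_integral_cmult nn_integral_add)
  finally show ?thesis .
qed

lemma Lpp_bounded_mult:
  assumes "p \<ge> 0" "borel_on S f" "C \<ge> 0" "\<And>x. x \<in> S \<Longrightarrow> \<bar>c x\<bar> \<le> C"
  shows "Lpp p S (\<lambda>x. c x * f x) \<le> ennreal (C powr p) * Lpp p S f"
proof -
  have m: "(\<lambda>x. ennreal (\<bar>f x\<bar> powr p) * indicator S x) \<in> borel_measurable lborel"
    using borel_on_powr[OF assms(2)] by simp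
  have "Lpp p S (\<lambda>x. c x * f x) \<le> (\<integral>\<^sup>+x. ennreal (C powr p) * (ennreal (\<bar>f x\<bar> powr p) * indicator S x) \<partial>lborel)"
    unfolding Lpp_def
  proof (rule nn_integral_mono)
    fix x
    have "\<bar>c x * f x\<bar> powr p \<le> C powr p * \<bar>f x\<bar> powr p" if "x \<in> S"
      using assms(1,3) assms(4)[OF that] by (auto simp: abs_mult powr_mult intro!: mult_right_mono powr_mono2)
    then show "ennreal (\<bar>c x * f x\<bar> powr p) * indicator S x \<le> ennreal (C powr p) * (ennreal (\<bar>f x\<bar> powr p) * indicator S x)"
      by (auto simp: indicator_def ennreal_mult[symmetric] intro!: ennreal_leI)
  qed
  also have "\<dots> = ennreal (C powr p) * Lpp p S f"
    unfolding Lpp_def using m by (simp add: nn_integral_cmult)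
  finally show ?thesis .
qed

text \<open>Convexity: the graph of the p-th power lies above its tangent at m. Obtained from
  Young's inequality with the weights 1/p and (p-1)/p.\<close>

lemma young_tangent:
  fixes x m p :: real
  assumes "x \<ge> 0" "m > 0" "p \<ge> 1"
  shows "p * m powr (p - 1) * x \<le> x powr p + (p - 1) * m powr p"
proof (cases "x = 0")
  case True
  then show ?thesis using assms by simp
next
  case False
  then have x: "x > 0" using assms(1) by simp
  have "(x powr p) powr (1 / p) * (m powr p) powr ((p - 1) / p) \<le> (1 / p) * x powr p + ((p - 1) / p) * m powr p"
    by (rule Youngs_inequality_0) (use assms x in \<open>auto simp: field_simps\<close>)
  then have "x * m powr (p - 1) \<le> (1 / p) * x powr p + ((p - 1) / p) * m powr p"
    using assms x by (simp add: powr_powr)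
  then have "p * (x * m powr (p - 1)) \<le> p * ((1 / p) * x powr p + ((p - 1) / p) * m powr p)"
    using assms by (intro mult_left_mono) auto
  also have "\<dots> = x powr p + (p - 1) * m powr p" using assms by (simp add: field_simps)
  finally show ?thesis by (simp add: ac_simps)
qed

text \<open>The pointwise bound y \<le> y^p + 1 suffices on a set of finite measure.\<close>

lemma integrable_of_Lpp:
  fixes G :: "'a::euclidean_space \<Rightarrow> real"
  assumes "p \<ge> 1" "borel_on S G" "emeasure lborel S < \<infinity>" "Lpp p S G < \<infinity>"
  shows "integrable lborel (\<lambda>x. indicator S x * G x)"
proof (rule integrableI_bounded)
  show "(\<lambda>x. indicator S x * G x) \<in> borel_measurable lborel" using assms(2) by (simp add: borel_on_def)
  have [measurable]: "S \<in> sets borel" using assms by (simp add: borel_on_def)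
  have m: "(\<lambda>x. ennreal (\<bar>G x\<bar> powr p) * indicator S x) \<in> borel_measurable lborel"
    using borel_on_powr[OF assms(2)] by simp
  have le: "y \<le> y powr p + 1" if "y \<ge> 0" for y :: real
  proof (cases "y \<le> 1")
    case True then show ?thesis using powr_ge_zero[of y p] by linarith
  next
    case False then show ?thesis using powr_mono[of 1 p y] assms(1) that by simp
  qed
  have le': "ennreal y \<le> ennreal (y powr p) + 1" if "y \<ge> 0" for y :: real
    using le[OF that] ennreal_leI[of y "y powr p + 1"] by simp
  have "(\<integral>\<^sup>+x. norm (indicator S x * G x) \<partial>lborel) \<le> (\<integral>\<^sup>+x. ennreal (\<bar>G x\<bar> powr p) * indicator S x + indicator S x \<partial>lborel)"
    by (rule nn_integral_mono) (use le' in \<open>auto simp: indicator_def\<close>)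
  also have "\<dots> = Lpp p S G + emeasure lborel S"
    unfolding Lpp_def using m by (simp add: nn_integral_add)
  also have "\<dots> < \<infinity>" using assms by simp
  finally show "(\<integral>\<^sup>+x. norm (indicator S x * G x) \<partial>lborel) < \<infinity>" .
qed

text \<open>Jensen's inequality for the average of |G| over S. The tangent inequality is applied at
  the mean value \<mu> = I / \<beta> and integrated over S; at this point the linear terms combine
  to \<mu>^p \<beta> \<le> J. The cases I = 0 and infinite right-hand side are separate.\<close>

lemma jensen_Lpp:
  fixes G :: "'a::euclidean_space \<Rightarrow> real"
  assumes p: "p \<ge> 1" and G: "borel_on S G" and S: "emeasure lborel S < \<infinity>"
  shows "ennreal ((\<integral>x. indicator S x * \<bar>G x\<bar> \<partial>lborel) powr p) \<le> ennreal ((measure lborel S) powr (p - 1)) * Lpp p S G"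
proof -
  define \<beta> where "\<beta> = measure lborel S"
  define I where "I = (\<integral>x. indicator S x * \<bar>G x\<bar> \<partial>lborel)"
  have Sm [measurable]: "S \<in> sets borel" using G by (simp add: borel_on_def)
  have m: "(\<lambda>x. ennreal (\<bar>G x\<bar> powr p) * indicator S x) \<in> borel_measurable lborel"
    using borel_on_powr[OF G] by simp
  have I0: "I \<ge> 0" unfolding I_def by (intro Bochner_Integration.integral_nonneg) auto
  show ?thesis
  proof (cases "I = 0")
    case True
    then show ?thesis using p by (simp add: I_def)
  next
    case False
    then have Ipos: "I > 0" using I0 by simp
    have \<beta>pos: "\<beta> > 0"
    proof (rule ccontr)
      assume "\<not> \<beta> > 0"
      then have "\<beta> = 0" using measure_nonneg[of lborel S] by (simp add: \<beta>_def)
      then have "emeasure lborel S = 0" using S by (auto simp: \<beta>_def measure_def enn2real_eq_0_iff)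
      then have "AE x in lborel. x \<notin> S" by (intro AE_not_in) (auto simp: null_sets_def)
      then have "I = 0" unfolding I_def by (intro integral_eq_zero_AE) (auto simp: indicator_def)
      then show False using Ipos by simp
    qed
    show ?thesis
    proof (cases "Lpp p S G < \<infinity>")
      case False
      then have "ennreal (\<beta> powr (p - 1)) * Lpp p S G = \<infinity>"
        using \<beta>pos by (simp add: ennreal_mult_eq_top_iff less_top[symmetric])
      then show ?thesis by (simp add: \<beta>_def)
    next
      case True
      have int: "integrable lborel (\<lambda>x. indicator S x * \<bar>G x\<bar>)"
        using integrable_abs[OF integrable_of_Lpp[OF p G S True]] by (simp add: abs_mult)
      have intp: "integrable lborel (\<lambda>x. indicator S x * \<bar>G x\<bar> powr p)"
      proof (rule integrableI_bounded)
        have "(\<lambda>x. enn2real (ennreal (\<bar>G x\<bar> powr p) * indicator S x)) \<in> borel_measurable lborel"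
          using m by measurable
        also have "(\<lambda>x. enn2real (ennreal (\<bar>G x\<bar> powr p) * indicator S x)) = (\<lambda>x. indicator S x * \<bar>G x\<bar> powr p)"
          by (auto simp: indicator_def fun_eq_iff)
        finally show "(\<lambda>x. indicator S x * \<bar>G x\<bar> powr p) \<in> borel_measurable lborel" .
        have "(\<integral>\<^sup>+x. norm (indicator S x * \<bar>G x\<bar> powr p) \<partial>lborel) = Lpp p S G"
          unfolding Lpp_def by (rule nn_integral_cong) (auto simp: indicator_def)
        then show "(\<integral>\<^sup>+x. norm (indicator S x * \<bar>G x\<bar> powr p) \<partial>lborel) < \<infinity>" using True by simp
      qed
      define J where "J = (\<integral>x. indicator S x * \<bar>G x\<bar> powr p \<partial>lborel)"
      have J: "Lpp p S G = ennreal J"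
      proof -
        have "Lpp p S G = (\<integral>\<^sup>+x. ennreal (indicator S x * \<bar>G x\<bar> powr p) \<partial>lborel)"
          unfolding Lpp_def by (rule nn_integral_cong) (auto simp: indicator_def)
        also have "\<dots> = ennreal J" unfolding J_def by (rule nn_integral_eq_integral[OF intp]) auto
        finally show ?thesis .
      qed
      define \<mu> where "\<mu> = I / \<beta>"
      have \<mu>: "\<mu> > 0" using Ipos \<beta>pos by (simp add: \<mu>_def)
      have ind: "integrable lborel (\<lambda>x. indicat_real S x)" using S by (simp add: less_top)
      have "(\<integral>x. p * \<mu> powr (p - 1) * (indicator S x * \<bar>G x\<bar>) \<partial>lborel)
        \<le> (\<integral>x. indicator S x * \<bar>G x\<bar> powr p + (p - 1) * \<mu> powr p * indicator S x \<partial>lborel)"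
      proof (rule integral_mono)
        fix x
        show "p * \<mu> powr (p - 1) * (indicator S x * \<bar>G x\<bar>)
          \<le> indicator S x * \<bar>G x\<bar> powr p + (p - 1) * \<mu> powr p * indicator S x"
          using young_tangent[of "\<bar>G x\<bar>" \<mu> p] \<mu> p by (auto simp: indicator_def)
      qed (use int intp ind in auto)
      then have "p * \<mu> powr (p - 1) * I \<le> J + (p - 1) * \<mu> powr p * \<beta>"
        using int intp ind by (simp add: I_def J_def \<beta>_def)
      then have "p * (\<mu> powr (p - 1) * I) \<le> J + (p - 1) * \<mu> powr p * \<beta>" by (simp only: mult.assoc)
      moreover have "\<mu> powr (p - 1) * I = \<mu> powr p * \<beta>"
        using \<mu> \<beta>pos Ipos by (simp add: \<mu>_def powr_diff powr_mult)
      ultimately have "p * (\<mu> powr p * \<beta>) \<le> J + (p - 1) * \<mu> powr p * \<beta>" by (simp only:)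
      then have le: "\<mu> powr p * \<beta> \<le> J" by (simp add: algebra_simps)
      have "I powr p = (\<mu> powr p * \<beta>) * \<beta> powr (p - 1)"
      proof -
        have "I powr p = \<mu> powr p * \<beta> powr p"
          using \<mu> \<beta>pos I0 by (simp add: \<mu>_def powr_mult[symmetric])
        also have "\<beta> powr p = \<beta> * \<beta> powr (p - 1)" using \<beta>pos by (simp add: powr_diff)
        finally show ?thesis by simp
      qed
      also have "\<dots> \<le> J * \<beta> powr (p - 1)" by (intro mult_right_mono le) simp
      finally have "I powr p \<le> \<beta> powr (p - 1) * J" by (simp add: mult.commute)
      then show ?thesis unfolding J \<beta>_def[symmetric] I_def[symmetric]
        by (subst ennreal_mult[symmetric]) (use J_def in \<open>auto intro!: ennreal_leI Bochner_Integration.integral_nonneg\<close>)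
    qed
  qed
qed

subsection \<open>Mollification\<close>

definition Lloc :: "real \<Rightarrow> ('a::euclidean_space \<Rightarrow> real) \<Rightarrow> bool" where
  "Lloc p f \<longleftrightarrow> f \<in> borel_measurable borel \<and> (\<forall>R. Lpp p (ball 0 R) f < \<infinity>)"

lemma emeasure_ball_finite: "emeasure lborel (ball (x::'a::euclidean_space) r) < top"
  "emeasure lborel (cball (x::'a::euclidean_space) r) < top"
  using emeasure_bounded_finite[of "ball x r"] emeasure_bounded_finite[of "cball x r"] by simp_all

lemma Lloc_1:
  assumes "Lloc p f" "p \<ge> 1" shows "Lloc 1 f"
proof -
  have [measurable]: "f \<in> borel_measurable borel" using assms by (simp add: Lloc_def)
  have "Lpp 1 (ball 0 R) f < \<infinity>" for R
  proof -
    have "integrable lborel (\<lambda>x. indicator (ball 0 R) x * f x)"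
      by (rule integrable_of_Lpp[OF assms(2)])
         (use assms in \<open>auto simp: Lloc_def intro: borel_on_borel emeasure_ball_finite\<close>)
    then have "(\<integral>\<^sup>+x. norm (indicator (ball 0 R) x * f x) \<partial>lborel) < \<infinity>"
      by (simp add: integrable_iff_bounded)
    also have "(\<integral>\<^sup>+x. norm (indicator (ball 0 R) x * f x) \<partial>lborel) = Lpp 1 (ball 0 R) f"
      unfolding Lpp_def by (rule nn_integral_cong) (auto simp: indicator_def)
    finally show ?thesis .
  qed
  then show ?thesis by (simp add: Lloc_def)
qed

lemma Lloc_integrable_ball:
  assumes "Lloc 1 f" shows "integrable lborel (\<lambda>x. indicator (ball 0 R) x * \<bar>f x\<bar>)"
proof -
  have [measurable]: "f \<in> borel_measurable borel" using assms by (simp add: Lloc_def)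
  have "integrable lborel (\<lambda>x. indicator (ball 0 R) x * f x)"
    by (rule integrable_of_Lpp[of 1]) (use assms in \<open>auto simp: Lloc_def intro: borel_on_borel emeasure_ball_finite\<close>)
  from integrable_abs[OF this] show ?thesis by (simp add: abs_mult)
qed

lemma Lloc_integrable_mult:
  assumes f: "Lloc 1 f" and [measurable]: "k \<in> borel_measurable borel"
    and k: "\<And>z. \<bar>k z\<bar> \<le> C * indicator (ball 0 R) z"
  shows "integrable lborel (\<lambda>z. f z * k z)"
proof (rule Bochner_Integration.integrable_bound)
  have [measurable]: "f \<in> borel_measurable borel" using f by (simp add: Lloc_def)
  show "integrable lborel (\<lambda>z. C * (indicator (ball 0 R) z * \<bar>f z\<bar>))"
    by (intro integrable_mult_right Lloc_integrable_ball f)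
  show "(\<lambda>z. f z * k z) \<in> borel_measurable lborel" by simp
  have "\<bar>f z * k z\<bar> \<le> C * (indicator (ball 0 R) z * \<bar>f z\<bar>)" for z
    using mult_left_mono[OF k[of z], of "\<bar>f z\<bar>"] by (simp add: abs_mult ac_simps)
  then show "AE z in lborel. norm (f z * k z) \<le> norm (C * (indicator (ball 0 R) z * \<bar>f z\<bar>))"
    by (intro AE_I2) (use abs_ge_self order_trans in \<open>fastforce simp del: abs_mult\<close>)
qed

text \<open>Dominated convergence along sequences, with C |f| on a ball as majorant. Ball and
  constant are common to all parameters in S, so applications restrict to a small neighbourhood of a
  parameter.\<close>

lemma continuous_on_integral_param:
  fixes f :: "'a::euclidean_space \<Rightarrow> real" and k :: "'q::metric_space \<Rightarrow> 'a \<Rightarrow> real"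
  assumes f: "Lloc 1 f" and km: "\<And>q. q \<in> S \<Longrightarrow> k q \<in> borel_measurable borel"
    and kc: "\<And>z. continuous_on S (\<lambda>q. k q z)"
    and k: "\<And>q z. q \<in> S \<Longrightarrow> \<bar>k q z\<bar> \<le> C * indicator (ball 0 R) z"
  shows "continuous_on S (\<lambda>q. \<integral>z. f z * k q z \<partial>lborel)"
  unfolding continuous_on_sequentially
proof (intro allI ballI impI)
  fix X a assume a: "a \<in> S" and X: "(\<forall>n. X n \<in> S) \<and> X \<longlonglongrightarrow> a"
  have [measurable]: "f \<in> borel_measurable borel" using f by (simp add: Lloc_def)
  note [measurable] = km[OF a] km[OF X[THEN conjunct1, rule_format]]
  show "((\<lambda>q. \<integral>z. f z * k q z \<partial>lborel) \<circ> X) \<longlonglongrightarrow> (\<integral>z. f z * k a z \<partial>lborel)"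
    unfolding comp_def
  proof (rule integral_dominated_convergence[where w="\<lambda>z. C * (indicator (ball 0 R) z * \<bar>f z\<bar>)"])
    show "integrable lborel (\<lambda>z. C * (indicator (ball 0 R) z * \<bar>f z\<bar>))"
      by (intro integrable_mult_right Lloc_integrable_ball f)
    show "AE z in lborel. (\<lambda>n. f z * k (X n) z) \<longlonglongrightarrow> f z * k a z"
    proof (intro AE_I2 tendsto_mult tendsto_const)
      fix z
      show "(\<lambda>n. k (X n) z) \<longlonglongrightarrow> k a z"
        using kc[of z, unfolded continuous_on_sequentially, rule_format, OF a X]
        by (simp add: comp_def)
    qed
    show "AE z in lborel. norm (f z * k (X n) z) \<le> C * (indicator (ball 0 R) z * \<bar>f z\<bar>)" for n
    proof (rule AE_I2)
      fix z
      show "norm (f z * k (X n) z) \<le> C * (indicator (ball 0 R) z * \<bar>f z\<bar>)"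
        using mult_left_mono[OF k[of "X n" z], of "\<bar>f z\<bar>"] X by (simp add: abs_mult ac_simps)
    qed
  qed simp_all
qed

text \<open>By the mean value theorem the difference quotients of the kernel are bounded by C' on a
  fixed ball; dominated convergence then carries the limit through the integral.\<close>

lemma DERIV_integral_param:
  fixes f :: "'a::euclidean_space \<Rightarrow> real" and k :: "real \<Rightarrow> 'a \<Rightarrow> real"
  assumes f: "Lloc 1 f" and e: "e > 0"
    and km: "\<And>s. \<bar>s\<bar> < e \<Longrightarrow> k s \<in> borel_measurable borel" and k'm: "k' 0 \<in> borel_measurable borel"
    and D: "\<And>s z. \<bar>s\<bar> < e \<Longrightarrow> ((\<lambda>s. k s z) has_real_derivative k' s z) (at s)"
    and k: "\<And>s z. \<bar>s\<bar> < e \<Longrightarrow> \<bar>k s z\<bar> \<le> C * indicator (ball 0 R) z"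
    and k': "\<And>s z. \<bar>s\<bar> < e \<Longrightarrow> \<bar>k' s z\<bar> \<le> C' * indicator (ball 0 R) z"
  shows "((\<lambda>s. \<integral>z. f z * k s z \<partial>lborel) has_real_derivative (\<integral>z. f z * k' 0 z \<partial>lborel)) (at 0)"
proof -
  have [measurable]: "f \<in> borel_measurable borel" using f by (simp add: Lloc_def)
  have lip: "\<bar>k s z - k 0 z\<bar> \<le> C' * indicator (ball 0 R) z * \<bar>s\<bar>" if "\<bar>s\<bar> < e" for s z
  proof (cases "s = 0")
    case False
    have "\<exists>t. \<bar>t\<bar> < e \<and> k s z - k 0 z = s * k' t z"
    proof (cases "s > 0")
      case True
      have "\<exists>t>0. t < s \<and> k s z - k 0 z = (s - 0) * k' t z"
        by (rule MVT2[OF True]) (use that D in auto)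
      then obtain t where "t > 0" "t < s" "k s z - k 0 z = (s - 0) * k' t z" by blast
      then show ?thesis using that by (intro exI[of _ t]) auto
    next
      case False
      then have "s < 0" using \<open>s \<noteq> 0\<close> by simp
      have "\<exists>t>s. t < 0 \<and> k 0 z - k s z = (0 - s) * k' t z"
        by (rule MVT2[OF \<open>s < 0\<close>]) (use that D in auto)
      then obtain t where "t > s" "t < 0" "k 0 z - k s z = (0 - s) * k' t z" by blast
      then show ?thesis using that by (intro exI[of _ t]) auto
    qed
    then obtain t where t: "\<bar>t\<bar> < e" "k s z - k 0 z = s * k' t z" by blast
    show ?thesis unfolding t(2) abs_mult
      using mult_right_mono[OF k'[OF t(1), of z], of "\<bar>s\<bar>"] by (simp add: ac_simps)
  qed simp
  have int: "integrable lborel (\<lambda>z. f z * k s z)" if "\<bar>s\<bar> < e" for s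
    by (rule Lloc_integrable_mult[OF f km[OF that] k[OF that]])
  have "((\<lambda>s. ((\<integral>z. f z * k s z \<partial>lborel) - (\<integral>z. f z * k 0 z \<partial>lborel)) / s) \<longlongrightarrow> (\<integral>z. f z * k' 0 z \<partial>lborel)) (at 0 within ball 0 e)"
    unfolding tendsto_at_iff_sequentially
  proof (intro allI impI)
    fix X assume X: "\<forall>i. X i \<in> ball 0 e - {0}" "X \<longlonglongrightarrow> (0::real)"
    have Xe: "\<bar>X i\<bar> < e" "X i \<noteq> 0" for i using X(1) by auto
    have [measurable]: "k (X i) \<in> borel_measurable borel" "k 0 \<in> borel_measurable borel" "k' 0 \<in> borel_measurable borel" for i
      using km k'm Xe e by auto
    have "(\<lambda>i. \<integral>z. f z * ((k (X i) z - k 0 z) / X i) \<partial>lborel) \<longlonglongrightarrow> (\<integral>z. f z * k' 0 z \<partial>lborel)"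
    proof (rule integral_dominated_convergence[where w="\<lambda>z. C' * (indicator (ball 0 R) z * \<bar>f z\<bar>)"])
      show "integrable lborel (\<lambda>z. C' * (indicator (ball 0 R) z * \<bar>f z\<bar>))"
        by (intro integrable_mult_right Lloc_integrable_ball f)
      show "AE z in lborel. (\<lambda>i. f z * ((k (X i) z - k 0 z) / X i)) \<longlonglongrightarrow> f z * k' 0 z"
      proof (intro AE_I2 tendsto_mult tendsto_const)
        fix z
        have "((\<lambda>s. (k s z - k 0 z) / s) \<longlongrightarrow> k' 0 z) (at 0)"
          using D[of 0 z] e by (simp add: has_field_derivative_iff)
        moreover have "filterlim X (at 0) sequentially"
          using X(2) Xe(2) by (simp add: filterlim_at always_eventually)
        ultimately show "(\<lambda>i. (k (X i) z - k 0 z) / X i) \<longlonglongrightarrow> k' 0 z"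
          by (rule filterlim_compose)
      qed
      show "AE z in lborel. norm (f z * ((k (X i) z - k 0 z) / X i)) \<le> C' * (indicator (ball 0 R) z * \<bar>f z\<bar>)" for i
      proof (rule AE_I2)
        fix z
        have "\<bar>(k (X i) z - k 0 z) / X i\<bar> \<le> C' * indicator (ball 0 R) z"
          using lip[OF Xe(1)[of i], of z] Xe(2)[of i] by (simp add: abs_divide divide_le_eq)
        from mult_left_mono[OF this, of "\<bar>f z\<bar>"]
        show "norm (f z * ((k (X i) z - k 0 z) / X i)) \<le> C' * (indicator (ball 0 R) z * \<bar>f z\<bar>)"
          by (simp add: abs_mult ac_simps)
      qed
    qed simp_all
    moreover have "(\<integral>z. f z * ((k (X i) z - k 0 z) / X i) \<partial>lborel) = ((\<integral>z. f z * k (X i) z \<partial>lborel) - (\<integral>z. f z * k 0 z \<partial>lborel)) / X i" for i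
    proof -
      have "(\<integral>z. f z * ((k (X i) z - k 0 z) / X i) \<partial>lborel) = (\<integral>z. (f z * k (X i) z - f z * k 0 z) / X i \<partial>lborel)"
        by (rule Bochner_Integration.integral_cong) (auto simp: algebra_simps)
      also have "\<dots> = ((\<integral>z. f z * k (X i) z \<partial>lborel) - (\<integral>z. f z * k 0 z \<partial>lborel)) / X i"
        using int[OF Xe(1)[of i]] int[of 0] e by simp
      finally show ?thesis .
    qed
    ultimately show "((\<lambda>s. ((\<integral>z. f z * k s z \<partial>lborel) - (\<integral>z. f z * k 0 z \<partial>lborel)) / s) \<circ> X) \<longlonglongrightarrow> (\<integral>z. f z * k' 0 z \<partial>lborel)"
      by (simp only: comp_def)
  qed
  then show ?thesis
    using e by (simp add: has_field_derivative_iff at_within_open[of 0 "ball 0 e"])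
qed

section \<open>Mollification as a function of centre and radius\<close>

text \<open>Centre and radius form one argument, so that joint continuity can be stated. The
  integrand samples f at x + r y, which for an even kernel is the usual convolution.\<close>

definition mol :: "('a::euclidean_space \<Rightarrow> real) \<Rightarrow> ('a \<Rightarrow> real) \<Rightarrow> 'a \<times> real \<Rightarrow> real" where
  "mol \<Psi> f q = (\<integral>y. f (fst q + snd q *\<^sub>R y) * \<Psi> y \<partial>lborel)"

text \<open>The substitution z = x + r y moves centre and radius into the smooth kernel, so that
  derivatives do not fall on f.\<close>

lemma mol_eq:
  fixes f :: "'a::euclidean_space \<Rightarrow> real"
  assumes [measurable]: "f \<in> borel_measurable borel" and k: "kern \<Psi>" and r: "r > 0"
  shows "mol \<Psi> f (x, r) = inverse (r ^ DIM('a)) * (\<integral>z. f z * \<Psi> ((1 / r) *\<^sub>R (z - x)) \<partial>lborel)"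
proof -
  have [measurable]: "\<Psi> \<in> borel_measurable borel" using k by (rule kern_measurable)
  have "(\<integral>z. f z * \<Psi> ((1 / r) *\<^sub>R (z - x)) \<partial>lborel) = r ^ DIM('a) * (\<integral>y. f (x + r *\<^sub>R y) * \<Psi> ((1 / r) *\<^sub>R (x + r *\<^sub>R y - x)) \<partial>lborel)"
    using lborel_integral_affine[of "\<lambda>z. f z * \<Psi> ((1 / r) *\<^sub>R (z - x))" r x] r by simp
  also have "\<dots> = r ^ DIM('a) * mol \<Psi> f (x, r)" using r by (simp add: mol_def)
  finally show ?thesis using r by simp
qed

text \<open>Supplies the majorant for the parameter lemmas: all rescaled kernels with radius below
  r' are supported in one ball and share one bound.\<close>

lemma kern_scaled_bound:
  fixes \<Psi> :: "'a::euclidean_space \<Rightarrow> real"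
  assumes "\<And>y. \<bar>\<Psi> y\<bar> \<le> B * indicator (cball 0 1) y" "0 < r" "r < r'" "B \<ge> 0" "norm x + r' \<le> R"
  shows "\<bar>\<Psi> ((1 / r) *\<^sub>R (z - x))\<bar> \<le> B * indicator (ball 0 R) z"
proof (cases "norm ((1 / r) *\<^sub>R (z - x)) \<le> 1")
  case True
  then have "norm (z - x) \<le> r" using assms(2) unfolding norm_scaleR by (simp add: field_simps)
  then have "norm z < R" using assms(3,5) norm_triangle_sub[of z x] by linarith
  then show ?thesis using assms(1)[of "(1 / r) *\<^sub>R (z - x)"] True assms(4) by (auto simp: indicator_def split: if_splits)
next
  case False
  then have "(1 / r) *\<^sub>R (z - x) \<notin> cball 0 1" by simp
  then show ?thesis using assms(1)[of "(1 / r) *\<^sub>R (z - x)"] assms(4) by (auto simp: indicator_def)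
qed

lemma mol_continuous:
  fixes f :: "'a::euclidean_space \<Rightarrow> real"
  assumes f: "Lloc 1 f" and \<Psi>: "kern \<Psi>"
  shows "continuous_on (UNIV \<times> {0<..}) (mol \<Psi> f)"
proof -
  have [measurable]: "f \<in> borel_measurable borel" using f by (simp add: Lloc_def)
  obtain B where B: "B > 0" "\<And>y. \<bar>\<Psi> y\<bar> \<le> B * indicator (cball 0 1) y" using kern_bounded[OF \<Psi>] by blast
  have op: "open (UNIV \<times> {0<..} :: ('a \<times> real) set)" by (intro open_Times) auto
  have "isCont (mol \<Psi> f) (x0, r0)" if r0: "r0 > 0" for x0 :: 'a and r0 :: real
  proof -
    \<comment> \<open>Centres within distance 1 and radii below 2 r0 put all supports into the ball
      of radius norm x0 + 1 + 2 r0.\<close>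
    define S where "S = ball x0 1 \<times> {0<..<2 * r0}"
    have S: "open S" "(x0, r0) \<in> S" using r0 by (auto simp: S_def intro: open_Times)
    have "continuous_on S (\<lambda>q. \<integral>z. f z * \<Psi> ((1 / snd q) *\<^sub>R (z - fst q)) \<partial>lborel)"
    proof (rule continuous_on_integral_param[OF f, where C=B and R="norm x0 + 1 + 2 * r0"])
      fix q assume q: "q \<in> S"
      show "(\<lambda>z. \<Psi> ((1 / snd q) *\<^sub>R (z - fst q))) \<in> borel_measurable borel"
        using kern_measurable[OF \<Psi>] by measurable
      show "\<bar>\<Psi> ((1 / snd q) *\<^sub>R (z - fst q))\<bar> \<le> B * indicator (ball 0 (norm x0 + 1 + 2 * r0)) z" for z
      proof (rule kern_scaled_bound[OF B(2), where r'="2 * r0"])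
        have "norm (fst q - x0) < 1" using q by (auto simp: S_def dist_norm norm_minus_commute)
        then show "norm (fst q) + 2 * r0 \<le> norm x0 + 1 + 2 * r0" using norm_triangle_sub[of "fst q" x0] by simp
      qed (use q B in \<open>auto simp: S_def\<close>)
    next
      fix z
      show "continuous_on S (\<lambda>q. \<Psi> ((1 / snd q) *\<^sub>R (z - fst q)))"
        by (rule continuous_on_compose2[OF kern_continuous[OF \<Psi>, of UNIV]])
           (auto intro!: continuous_intros simp: S_def)
    qed
    then have "continuous_on S (\<lambda>q. inverse (snd q ^ DIM('a)) * (\<integral>z. f z * \<Psi> ((1 / snd q) *\<^sub>R (z - fst q)) \<partial>lborel))"
      by (intro continuous_intros) (auto simp: S_def)
    moreover have "inverse (snd q ^ DIM('a)) * (\<integral>z. f z * \<Psi> ((1 / snd q) *\<^sub>R (z - fst q)) \<partial>lborel) = mol \<Psi> f q" if "q \<in> S" for q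
      using mol_eq[OF _ \<Psi>, of f "snd q" "fst q"] that f by (auto simp: S_def)
    ultimately have "continuous_on S (mol \<Psi> f)" by (rule continuous_on_eq)
    then show ?thesis using S continuous_on_eq_continuous_at by blast
  qed
  then show ?thesis by (intro continuous_at_imp_continuous_on) auto
qed

text \<open>The radial derivative of the kernel: \<open>eul \<Psi>\<close> at z / r is -r times the
  r-derivative of \<Psi>(z / r).\<close>

definition eul :: "('a::euclidean_space \<Rightarrow> real) \<Rightarrow> 'a \<Rightarrow> real" where
  "eul \<Psi> y = (\<Sum>b\<in>Basis. (y \<bullet> b) * pd b \<Psi> y)"

text \<open>The $r$-derivative of the mollification at radius $r$ is \<open>mol (star \<Psi>) f / r\<close>.  The divergence form
  shows that \<open>star \<Psi>\<close> has mean zero and lets the derivative be moved to \<open>f\<close>.\<close>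

definition star :: "('a::euclidean_space \<Rightarrow> real) \<Rightarrow> 'a \<Rightarrow> real" where
  "star \<Psi> y = (\<Sum>b\<in>Basis. - 1 * pd b (\<lambda>y. (y \<bullet> b) * \<Psi> y) y)"

lemma kern_has_derivative: "kern \<Psi> \<Longrightarrow> (\<Psi> has_derivative frechet_derivative \<Psi> (at x)) (at x)"
  by (auto simp: kern_def intro: smooth_has_derivative)

lemma kern_eul: "kern \<Psi> \<Longrightarrow> kern (eul \<Psi>)"
  unfolding eul_def[abs_def] by (intro kern_sum kern_inner kern_pd)

lemma kern_star: "kern \<Psi> \<Longrightarrow> kern (star \<Psi>)"
  unfolding star_def[abs_def] by (intro kern_sum kern_cmult kern_pd kern_inner)

lemma eul_eq: assumes "kern \<Psi>" shows "eul \<Psi> y = frechet_derivative \<Psi> (at y) y"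
proof -
  have lin: "linear (frechet_derivative \<Psi> (at y))" by (rule has_derivative_linear[OF kern_has_derivative[OF assms]])
  have "frechet_derivative \<Psi> (at y) (\<Sum>b\<in>Basis. (y \<bullet> b) *\<^sub>R b) = (\<Sum>b\<in>Basis. (y \<bullet> b) *\<^sub>R pd b \<Psi> y)"
    by (simp add: linear_sum[OF lin] linear_cmul[OF lin])
  then show ?thesis by (simp add: eul_def euclidean_representation)
qed

text \<open>Product rule in the divergence of y \<Psi>(y). The dimension accounts for the Jacobian
  factor of the substitution and \<open>eul\<close> for the kernel: together they are the two
  contributions to the radius derivative.\<close>

lemma star_eq:
  fixes \<Psi> :: "'a::euclidean_space \<Rightarrow> real"
  assumes "kern \<Psi>" shows "star \<Psi> y = - (real DIM('a) * \<Psi> y + eul \<Psi> y)"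
proof -
  have "pd b (\<lambda>y. (y \<bullet> b) * \<Psi> y) y = \<Psi> y + (y \<bullet> b) * pd b \<Psi> y" if "b \<in> Basis" for b
  proof -
    have "((\<lambda>y. (y \<bullet> b) * \<Psi> y) has_derivative (\<lambda>h. (y \<bullet> b) * frechet_derivative \<Psi> (at y) h + (h \<bullet> b) * \<Psi> y)) (at y)"
      by (intro has_derivative_mult kern_has_derivative[OF assms] bounded_linear_imp_has_derivative bounded_linear_inner_left)
    from pd_eq[OF this, of b] show ?thesis using that by simp
  qed
  then have "star \<Psi> y = (\<Sum>b\<in>Basis. - 1 * (\<Psi> y + (y \<bullet> b) * pd b \<Psi> y))"
    unfolding star_def by (intro sum.cong) auto
  also have "\<dots> = - (real DIM('a) * \<Psi> y + eul \<Psi> y)"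
    by (simp add: eul_def sum.distrib sum_negf algebra_simps sum_subtractf)
  finally show ?thesis .
qed

text \<open>The second source of kernels of mean zero: a divergence of kernels integrates to
  zero.\<close>

lemma integral_star: assumes "kern \<Psi>" shows "integral\<^sup>L lborel (star \<Psi>) = 0"
proof -
  have "integral\<^sup>L lborel (star \<Psi>) = (\<Sum>b\<in>Basis. - 1 * integral\<^sup>L lborel (pd b (\<lambda>y. (y \<bullet> b) * \<Psi> y)))"
    unfolding star_def[abs_def]
    by (subst Bochner_Integration.integral_sum) (auto intro!: kern_integrable kern_pd kern_inner assms)
  also have "\<dots> = 0" by (intro sum.neutral ballI) (simp add: integral_kern_pd kern_inner assms)
  finally show ?thesis .
qed

text \<open>After the substitution a shift of the centre acts on the kernel alone, and the chain
  rule leaves the factor -1/r.\<close>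

lemma mol_deriv_x:
  fixes f :: "'a::euclidean_space \<Rightarrow> real"
  assumes f: "Lloc 1 f" and \<Psi>: "kern \<Psi>" and b: "b \<in> Basis" and r: "r > 0"
  shows "((\<lambda>s. mol \<Psi> f (x + s *\<^sub>R b, r)) has_real_derivative - (1 / r) * mol (pd b \<Psi>) f (x, r)) (at 0)"
proof -
  have fm: "f \<in> borel_measurable borel" using f by (simp add: Lloc_def)
  obtain B where B: "B > 0" "\<And>y. \<bar>\<Psi> y\<bar> \<le> B * indicator (cball 0 1) y" using kern_bounded[OF \<Psi>] by blast
  obtain B' where B': "B' > 0" "\<And>y. \<bar>pd b \<Psi> y\<bar> \<le> B' * indicator (cball 0 1) y" using kern_bounded[OF kern_pd[OF \<Psi> b]] by blast
  have "((\<lambda>s. \<integral>z. f z * \<Psi> ((1 / r) *\<^sub>R (z - (x + s *\<^sub>R b))) \<partial>lborel) has_real_derivative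
    (\<integral>z. f z * (- (1 / r) * pd b \<Psi> ((1 / r) *\<^sub>R (z - (x + 0 *\<^sub>R b)))) \<partial>lborel)) (at 0)"
  proof (rule DERIV_integral_param[OF f, of 1 _ "\<lambda>s z. - (1 / r) * pd b \<Psi> ((1 / r) *\<^sub>R (z - (x + s *\<^sub>R b)))" B "norm x + 1 + 2 * r" "B' / r"])
    fix s :: real assume s: "\<bar>s\<bar> < 1"
    show "(\<lambda>z. \<Psi> ((1 / r) *\<^sub>R (z - (x + s *\<^sub>R b)))) \<in> borel_measurable borel"
      using kern_measurable[OF \<Psi>] by measurable
    fix z :: 'a
    have lin: "linear (frechet_derivative \<Psi> (at y))" for y by (rule has_derivative_linear[OF kern_has_derivative[OF \<Psi>]])
    have "((\<lambda>s. \<Psi> ((1 / r) *\<^sub>R (z - (x + s *\<^sub>R b)))) has_derivative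
      (\<lambda>t. frechet_derivative \<Psi> (at ((1 / r) *\<^sub>R (z - (x + s *\<^sub>R b)))) ((- t / r) *\<^sub>R b))) (at s)"
      by (rule has_derivative_compose[where g=\<Psi> and f="\<lambda>s. (1 / r) *\<^sub>R (z - (x + s *\<^sub>R b))"])
         (auto intro!: derivative_eq_intros kern_has_derivative[OF \<Psi>])
    then show "((\<lambda>s. \<Psi> ((1 / r) *\<^sub>R (z - (x + s *\<^sub>R b)))) has_real_derivative
      - (1 / r) * pd b \<Psi> ((1 / r) *\<^sub>R (z - (x + s *\<^sub>R b)))) (at s)"
      unfolding has_field_derivative_def linear_cmul[OF lin]
      by (rule has_derivative_eq_rhs) (auto simp: field_simps)
    have le: "norm (x + s *\<^sub>R b) + 2 * r \<le> norm x + 1 + 2 * r"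
      using norm_triangle_ineq[of x "s *\<^sub>R b"] s b by simp
    show "\<bar>\<Psi> ((1 / r) *\<^sub>R (z - (x + s *\<^sub>R b)))\<bar> \<le> B * indicator (ball 0 (norm x + 1 + 2 * r)) z"
      by (rule kern_scaled_bound[OF B(2), where r'="2 * r"]) (use r B le in auto)
    have "\<bar>pd b \<Psi> ((1 / r) *\<^sub>R (z - (x + s *\<^sub>R b)))\<bar> \<le> B' * indicator (ball 0 (norm x + 1 + 2 * r)) z"
      by (rule kern_scaled_bound[OF B'(2), where r'="2 * r"]) (use r B' le in auto)
    then show "\<bar>- (1 / r) * pd b \<Psi> ((1 / r) *\<^sub>R (z - (x + s *\<^sub>R b)))\<bar> \<le> B' / r * indicator (ball 0 (norm x + 1 + 2 * r)) z"
      using r by (simp add: abs_mult divide_right_mono)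
  next
    show "(\<lambda>z. - (1 / r) * pd b \<Psi> ((1 / r) *\<^sub>R (z - (x + 0 *\<^sub>R b)))) \<in> borel_measurable borel"
      using kern_measurable[OF kern_pd[OF \<Psi> b]] by measurable
  qed simp
  from DERIV_cmult[OF this, of "inverse (r ^ DIM('a))"]
  show ?thesis
    unfolding mol_eq[OF fm \<Psi> r] mol_eq[OF fm kern_pd[OF \<Psi> b] r]
    by (rule DERIV_cong) (simp add: mult.left_commute[of "f _"])
qed

text \<open>The Jacobian factor and the dilated kernel both depend on the radius; the product rule
  adds their derivatives, and \<open>star_eq\<close> recognizes the sum.\<close>

lemma mol_deriv_r:
  fixes f :: "'a::euclidean_space \<Rightarrow> real"
  assumes f: "Lloc 1 f" and \<Psi>: "kern \<Psi>" and r: "r > 0"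
  shows "((\<lambda>s. mol \<Psi> f (x, s)) has_real_derivative (1 / r) * mol (star \<Psi>) f (x, r)) (at r)"
proof -
  have fm: "f \<in> borel_measurable borel" using f by (simp add: Lloc_def)
  obtain B where B: "B > 0" "\<And>y. \<bar>\<Psi> y\<bar> \<le> B * indicator (cball 0 1) y" using kern_bounded[OF \<Psi>] by blast
  obtain B' where B': "B' > 0" "\<And>y. \<bar>eul \<Psi> y\<bar> \<le> B' * indicator (cball 0 1) y" using kern_bounded[OF kern_eul[OF \<Psi>]] by blast
  define F where "F s = (\<integral>z. f z * \<Psi> ((1 / s) *\<^sub>R (z - x)) \<partial>lborel)" for s
  define G where "G s = (\<integral>z. f z * eul \<Psi> ((1 / s) *\<^sub>R (z - x)) \<partial>lborel)" for s
  \<comment> \<open>The parameter is shifted to 0. For |s| < r/2 the radius s + r stays between r/2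
    and 2 r, which gives a common ball and the bound 2/r for the factor 1 / (s + r).\<close>
  have "((\<lambda>s. \<integral>z. f z * \<Psi> ((1 / (s + r)) *\<^sub>R (z - x)) \<partial>lborel) has_real_derivative
    (\<integral>z. f z * (- (1 / (0 + r)) * eul \<Psi> ((1 / (0 + r)) *\<^sub>R (z - x))) \<partial>lborel)) (at 0)"
  proof (rule DERIV_integral_param[OF f, of "r / 2" _ "\<lambda>s z. - (1 / (s + r)) * eul \<Psi> ((1 / (s + r)) *\<^sub>R (z - x))" B "norm x + 2 * r" "B' * (2 / r)"])
    fix s :: real assume s: "\<bar>s\<bar> < r / 2"
    then have sr: "s + r > r / 2" "s + r < 2 * r" by auto
    show "(\<lambda>z. \<Psi> ((1 / (s + r)) *\<^sub>R (z - x))) \<in> borel_measurable borel"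
      using kern_measurable[OF \<Psi>] by measurable
    fix z :: 'a
    define y where "y = (1 / (s + r)) *\<^sub>R (z - x)"
    have lin: "linear (frechet_derivative \<Psi> (at y))" for y by (rule has_derivative_linear[OF kern_has_derivative[OF \<Psi>]])
    have "((\<lambda>s. 1 / (s + r)) has_derivative (\<lambda>t. - (t / (s + r)\<^sup>2))) (at s)"
      using sr r by (auto intro!: derivative_eq_intros simp: power2_eq_square field_simps)
    then have "((\<lambda>s. (1 / (s + r)) *\<^sub>R (z - x)) has_derivative (\<lambda>t. (- (t / (s + r)\<^sup>2)) *\<^sub>R (z - x))) (at s)"
      by (rule has_derivative_scaleR_left)
    from has_derivative_compose[OF this kern_has_derivative[OF \<Psi>]]
    have "((\<lambda>s. \<Psi> ((1 / (s + r)) *\<^sub>R (z - x))) has_derivative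
      (\<lambda>t. frechet_derivative \<Psi> (at y) ((- (t / (s + r)\<^sup>2)) *\<^sub>R (z - x)))) (at s)"
      by (simp only: y_def)
    moreover have "frechet_derivative \<Psi> (at y) ((- (t / (s + r)\<^sup>2)) *\<^sub>R (z - x)) = - (1 / (s + r)) * eul \<Psi> y * t" for t
    proof -
      have "(- (t / (s + r)\<^sup>2)) *\<^sub>R (z - x) = (- (t / (s + r))) *\<^sub>R y"
        using sr r by (simp add: y_def power2_eq_square)
      then show ?thesis unfolding eul_eq[OF \<Psi>] by (simp only: linear_cmul[OF lin]) simp
    qed
    ultimately show "((\<lambda>s. \<Psi> ((1 / (s + r)) *\<^sub>R (z - x))) has_real_derivative
      - (1 / (s + r)) * eul \<Psi> ((1 / (s + r)) *\<^sub>R (z - x))) (at s)"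
      unfolding has_field_derivative_def y_def[symmetric] by (simp only:)
    show "\<bar>\<Psi> ((1 / (s + r)) *\<^sub>R (z - x))\<bar> \<le> B * indicator (ball 0 (norm x + 2 * r)) z"
      by (rule kern_scaled_bound[OF B(2), where r'="2 * r"]) (use sr r B in auto)
    have "\<bar>eul \<Psi> ((1 / (s + r)) *\<^sub>R (z - x))\<bar> \<le> B' * indicator (ball 0 (norm x + 2 * r)) z"
      by (rule kern_scaled_bound[OF B'(2), where r'="2 * r"]) (use sr r B' in auto)
    moreover have "1 / (s + r) \<le> 2 / r" using sr r by (simp add: field_simps)
    ultimately have "\<bar>eul \<Psi> ((1 / (s + r)) *\<^sub>R (z - x))\<bar> * (1 / (s + r)) \<le> B' * indicator (ball 0 (norm x + 2 * r)) z * (2 / r)"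
      using sr r B' by (intro mult_mono) auto
    then show "\<bar>- (1 / (s + r)) * eul \<Psi> ((1 / (s + r)) *\<^sub>R (z - x))\<bar> \<le> B' * (2 / r) * indicator (ball 0 (norm x + 2 * r)) z"
      using sr r by (simp add: abs_mult ac_simps)
  next
    show "(\<lambda>z. - (1 / (0 + r)) * eul \<Psi> ((1 / (0 + r)) *\<^sub>R (z - x))) \<in> borel_measurable borel"
      using kern_measurable[OF kern_eul[OF \<Psi>]] by measurable
  qed (use r in simp)
  then have "((\<lambda>s. F (s + r)) has_real_derivative - (1 / r) * G r) (at 0)"
    unfolding F_def G_def by (rule DERIV_cong) (simp add: mult.left_commute[of "f _"])
  then have F: "(F has_real_derivative - (1 / r) * G r) (at r)"
    using DERIV_shift[of F _ 0 r] by simp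
  have "((\<lambda>s. inverse (s ^ DIM('a))) has_real_derivative - (real DIM('a) * (1 / r) * inverse (r ^ DIM('a)))) (at r)"
  proof -
    have d: "((\<lambda>s. inverse (s ^ DIM('a))) has_real_derivative - (inverse (r ^ DIM('a)) * (real DIM('a) * r ^ (DIM('a) - 1)) * inverse (r ^ DIM('a)))) (at r)"
      using r by (auto intro!: derivative_eq_intros)
    have e: "r ^ (DIM('a) - 1) * inverse (r ^ DIM('a)) = 1 / r"
      using r DIM_positive[where 'a='a] by (cases "DIM('a)") (auto simp: field_simps)
    have "inverse (r ^ DIM('a)) * (real DIM('a) * r ^ (DIM('a) - 1)) * inverse (r ^ DIM('a)) =
      real DIM('a) * (r ^ (DIM('a) - 1) * inverse (r ^ DIM('a))) * inverse (r ^ DIM('a))"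
      by (simp only: ac_simps)
    with d show ?thesis unfolding e by (simp only:)
  qed
  from DERIV_mult[OF this F]
  have "((\<lambda>s. inverse (s ^ DIM('a)) * F s) has_real_derivative (1 / r) * mol (star \<Psi>) f (x, r)) (at r)"
  proof (rule DERIV_cong)
    have i: "integrable lborel (\<lambda>z. f z * k ((1 / r) *\<^sub>R (z - x)))" if k: "kern k" for k
    proof -
      obtain C where C: "C > 0" "\<And>y. \<bar>k y\<bar> \<le> C * indicator (cball 0 1) y" using kern_bounded[OF k] by blast
      have m: "(\<lambda>z. k ((1 / r) *\<^sub>R (z - x))) \<in> borel_measurable borel"
        using kern_measurable[OF k] by measurable
      show ?thesis
        by (rule Lloc_integrable_mult[OF f m kern_scaled_bound[OF C(2), where r'="2 * r" and R="norm x + 2 * r"]])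
           (use r C in auto)
    qed
    have "(\<integral>z. f z * star \<Psi> ((1 / r) *\<^sub>R (z - x)) \<partial>lborel) = (\<integral>z. - (real DIM('a) * (f z * \<Psi> ((1 / r) *\<^sub>R (z - x))) + f z * eul \<Psi> ((1 / r) *\<^sub>R (z - x))) \<partial>lborel)"
      by (rule Bochner_Integration.integral_cong) (auto simp: star_eq[OF \<Psi>] algebra_simps)
    also have "\<dots> = - (real DIM('a) * F r + G r)"
      using i[OF \<Psi>] i[OF kern_eul[OF \<Psi>]] by (simp add: F_def G_def)
    finally have st: "(\<integral>z. f z * star \<Psi> ((1 / r) *\<^sub>R (z - x)) \<partial>lborel) = - (real DIM('a) * F r + G r)" .
    show "- (real DIM('a) * (1 / r) * inverse (r ^ DIM('a))) * F r + - (1 / r) * G r * inverse (r ^ DIM('a)) = (1 / r) * mol (star \<Psi>) f (x, r)"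
      unfolding mol_eq[OF fm kern_star[OF \<Psi>] r] st by (simp add: algebra_simps)
  qed
  moreover have "\<forall>\<^sub>F s in nhds r. inverse (s ^ DIM('a)) * F s = mol \<Psi> f (x, s)"
    using eventually_nhds_in_open[of "{0<..}" r] r
    by (auto simp: F_def mol_eq[OF fm \<Psi>] elim!: eventually_mono)
  ultimately show ?thesis using DERIV_cong_ev[OF refl, of "\<lambda>s. inverse (s ^ DIM('a)) * F s" "\<lambda>s. mol \<Psi> f (x, s)" r, OF _ refl] by (simp only:)
qed

text \<open>The kernel is bounded by B on the unit ball of measure \<beta>, so Jensen's inequality
  gives the constant B^p \<beta>^(p-1), which depends on the kernel and on p but not on G.\<close>

lemma Lpp_ennreal_powr_integral:
  fixes \<Psi> :: "'a::euclidean_space \<Rightarrow> real"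
  assumes \<Psi>: "kern \<Psi>" and p: "p \<ge> 1"
  obtains C :: real where "C > 0" "\<And>G. G \<in> borel_measurable borel \<Longrightarrow>
    ennreal (\<bar>\<integral>y. G y * \<Psi> y \<partial>lborel\<bar> powr p) \<le> ennreal C * Lpp p (cball 0 1) G"
proof -
  obtain B where B: "B > 0" "\<And>y. \<bar>\<Psi> y\<bar> \<le> B * indicator (cball 0 1) y" using kern_bounded[OF \<Psi>] by blast
  define \<beta> where "\<beta> = measure lborel (cball (0::'a) 1)"
  have \<beta>: "\<beta> > 0" unfolding \<beta>_def using content_cball_pos[of 1 "0::'a"] by (simp add: measure_def)
  have fin: "emeasure lborel (cball (0::'a) 1) < \<infinity>" using emeasure_ball_finite by simp
  show ?thesis
  proof (rule that[of "B powr p * \<beta> powr (p - 1)"])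
    show "B powr p * \<beta> powr (p - 1) > 0" using B \<beta> by simp
    fix G :: "'a \<Rightarrow> real" assume [measurable]: "G \<in> borel_measurable borel"
    have m: "borel_on (cball 0 1) G" by (rule borel_on_borel) auto
    have [measurable]: "\<Psi> \<in> borel_measurable borel" using \<Psi> by (rule kern_measurable)
    show "ennreal (\<bar>\<integral>y. G y * \<Psi> y \<partial>lborel\<bar> powr p) \<le> ennreal (B powr p * \<beta> powr (p - 1)) * Lpp p (cball 0 1) G"
    proof (cases "Lpp p (cball 0 1) G < \<infinity>")
      case True
      have int: "integrable lborel (\<lambda>x. indicator (cball 0 1) x * \<bar>G x\<bar>)"
        using integrable_abs[OF integrable_of_Lpp[OF p m fin True]] by (simp add: abs_mult)
      have le: "\<bar>G y * \<Psi> y\<bar> \<le> B * (indicator (cball 0 1) y * \<bar>G y\<bar>)" for y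
        using mult_left_mono[OF B(2)[of y], of "\<bar>G y\<bar>"] by (simp add: abs_mult ac_simps)
      have "\<bar>\<integral>y. G y * \<Psi> y \<partial>lborel\<bar> \<le> (\<integral>y. \<bar>G y * \<Psi> y\<bar> \<partial>lborel)"
        using integral_norm_bound[of lborel "\<lambda>y. G y * \<Psi> y"] by simp
      also have "\<dots> \<le> (\<integral>y. B * (indicator (cball 0 1) y * \<bar>G y\<bar>) \<partial>lborel)"
        by (rule integral_mono_AE') (use int le B(1) in auto)
      finally have "\<bar>\<integral>y. G y * \<Psi> y \<partial>lborel\<bar> \<le> B * (\<integral>y. indicator (cball 0 1) y * \<bar>G y\<bar> \<partial>lborel)" by simp
      then have "\<bar>\<integral>y. G y * \<Psi> y \<partial>lborel\<bar> powr p \<le> (B * (\<integral>y. indicator (cball 0 1) y * \<bar>G y\<bar> \<partial>lborel)) powr p"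
        using p by (intro powr_mono2) auto
      also have "\<dots> = B powr p * (\<integral>y. indicator (cball 0 1) y * \<bar>G y\<bar> \<partial>lborel) powr p"
        using B by (intro powr_mult) 
      finally have "ennreal (\<bar>\<integral>y. G y * \<Psi> y \<partial>lborel\<bar> powr p) \<le> ennreal (B powr p) * ennreal ((\<integral>y. indicator (cball 0 1) y * \<bar>G y\<bar> \<partial>lborel) powr p)"
        by (subst ennreal_mult[symmetric]) (auto intro: ennreal_leI)
      also have "\<dots> \<le> ennreal (B powr p) * (ennreal (\<beta> powr (p - 1)) * Lpp p (cball 0 1) G)"
        unfolding \<beta>_def by (intro mult_left_mono jensen_Lpp p m fin) auto
      finally show ?thesis by (simp add: ennreal_mult mult.assoc)
    next
      case False
      have "B powr p * \<beta> powr (p - 1) > 0" using B \<beta> by simp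
      then have "ennreal (B powr p * \<beta> powr (p - 1)) * Lpp p (cball 0 1) G = top"
        using False by (auto simp: ennreal_mult_eq_top_iff less_top[symmetric])
      then show ?thesis by simp
    qed
  qed
qed

text \<open>The pointwise bound in x is integrated by Tonelli: for fixed y the integral in x is that
  of a translate by r y, of length at most r. The constant is the same for all radii. S' is any set
  containing the r-neighbourhood of S, which covers balls as well as the whole space.\<close>

lemma mol_Lpp:
  fixes \<Psi> :: "'a::euclidean_space \<Rightarrow> real"
  assumes \<Psi>: "kern \<Psi>" and p: "p \<ge> 1"
  obtains C :: real where "C > 0" "\<And>f S S' r. f \<in> borel_measurable borel \<Longrightarrow> S \<in> sets borel \<Longrightarrow> S' \<in> sets borel \<Longrightarrow>
    (\<And>x y. x \<in> S \<Longrightarrow> norm y \<le> r \<Longrightarrow> x + y \<in> S') \<Longrightarrow> r \<ge> 0 \<Longrightarrow>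
    Lpp p S (\<lambda>x. mol \<Psi> f (x, r)) \<le> ennreal C * Lpp p S' f"
proof -
  obtain C where C: "C > 0" "\<And>G. G \<in> borel_measurable borel \<Longrightarrow>
    ennreal (\<bar>\<integral>y. G y * \<Psi> y \<partial>lborel\<bar> powr p) \<le> ennreal C * Lpp p (cball 0 1) G"
    using Lpp_ennreal_powr_integral[OF \<Psi> p] by blast
  define \<beta> where "\<beta> = measure lborel (cball (0::'a) 1)"
  have \<beta>: "\<beta> > 0" unfolding \<beta>_def using content_cball_pos[of 1 "0::'a"] by (simp add: measure_def)
  have fin: "emeasure lborel (cball (0::'a) 1) = ennreal \<beta>"
    unfolding \<beta>_def by (rule emeasure_eq_ennreal_measure) (use emeasure_ball_finite(2)[of "0::'a" 1] in auto)
  show ?thesis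
  proof (rule that[of "C * \<beta>"])
    show "C * \<beta> > 0" using C \<beta> by simp
    fix f :: "'a \<Rightarrow> real" and S S' :: "'a set" and r :: real
    assume [measurable]: "f \<in> borel_measurable borel" "S \<in> sets borel" "S' \<in> sets borel"
      and S: "\<And>x y. x \<in> S \<Longrightarrow> norm y \<le> r \<Longrightarrow> x + y \<in> S'" and r: "r \<ge> 0"
    let ?I = "\<lambda>x y. ennreal (\<bar>f (x + r *\<^sub>R y)\<bar> powr p) * indicator (cball 0 1) y * indicator S x"
    have i1: "(\<lambda>z. indicator (cball 0 1) (snd z) :: ennreal) \<in> borel_measurable (lborel \<Otimes>\<^sub>M (lborel :: 'a measure))"
      by (rule measurable_compose[OF measurable_snd borel_measurable_indicator]) simp
    have i2: "(\<lambda>z. indicator S (fst z) :: ennreal) \<in> borel_measurable (lborel \<Otimes>\<^sub>M (lborel :: 'a measure))"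
      by (rule measurable_compose[OF measurable_fst borel_measurable_indicator]) simp
    have i3: "(\<lambda>z. ennreal (\<bar>f (fst z + r *\<^sub>R snd z)\<bar> powr p)) \<in> borel_measurable (lborel \<Otimes>\<^sub>M lborel)"
      by measurable
    have mI: "(\<lambda>(x, y). ?I x y) \<in> borel_measurable (lborel \<Otimes>\<^sub>M lborel)"
      unfolding split_beta by (intro borel_measurable_times_ennreal i1 i2 i3)
    have "Lpp p S (\<lambda>x. mol \<Psi> f (x, r)) \<le> (\<integral>\<^sup>+x. ennreal C * (\<integral>\<^sup>+y. ?I x y \<partial>lborel) \<partial>lborel)"
      unfolding Lpp_def
    proof (rule nn_integral_mono)
      fix x
      have "ennreal (\<bar>mol \<Psi> f (x, r)\<bar> powr p) \<le> ennreal C * Lpp p (cball 0 1) (\<lambda>y. f (x + r *\<^sub>R y))"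
        using C(2)[of "\<lambda>y. f (x + r *\<^sub>R y)"] by (simp add: mol_def)
      then show "ennreal (\<bar>mol \<Psi> f (x, r)\<bar> powr p) * indicator S x \<le> ennreal C * (\<integral>\<^sup>+y. ?I x y \<partial>lborel)"
        by (cases "x \<in> S") (simp_all add: Lpp_def)
    qed
    also have "\<dots> = ennreal C * (\<integral>\<^sup>+x. (\<integral>\<^sup>+y. ?I x y \<partial>lborel) \<partial>lborel)"
      by (rule nn_integral_cmult) (rule lborel.borel_measurable_nn_integral[OF mI])
    also have "(\<integral>\<^sup>+x. (\<integral>\<^sup>+y. ?I x y \<partial>lborel) \<partial>lborel) = (\<integral>\<^sup>+y. (\<integral>\<^sup>+x. ?I x y \<partial>lborel) \<partial>lborel)"
      by (rule lborel_pair.Fubini'[symmetric]) (rule mI)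
    also have "\<dots> \<le> (\<integral>\<^sup>+y. Lpp p S' f * indicator (cball 0 1) y \<partial>(lborel :: 'a measure))"
    proof (rule nn_integral_mono)
      fix y :: 'a
      have "(\<integral>\<^sup>+x. ?I x y \<partial>lborel) \<le> Lpp p S' f" if y: "norm y \<le> 1"
      proof -
        have ry: "norm (r *\<^sub>R y) \<le> r" using y r by (simp add: mult_left_le)
        have "(\<integral>\<^sup>+x. ?I x y \<partial>lborel) \<le> (\<integral>\<^sup>+x. (\<lambda>x. ennreal (\<bar>f x\<bar> powr p) * indicator S' x) (x + r *\<^sub>R y) \<partial>lborel)"
          by (rule nn_integral_mono) (use S ry in \<open>auto simp: indicator_def\<close>)
        also have "\<dots> = Lpp p S' f" unfolding Lpp_def by (rule nn_integral_translate) measurable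
        finally show ?thesis .
      qed
      then show "(\<integral>\<^sup>+x. ?I x y \<partial>lborel) \<le> Lpp p S' f * indicator (cball 0 1) y"
        by (cases "norm y \<le> 1") auto
    qed
    also have "\<dots> = Lpp p S' f * ennreal \<beta>"
      using fin by (simp add: nn_integral_cmult_indicator)
    finally have "Lpp p S (\<lambda>x. mol \<Psi> f (x, r)) \<le> ennreal C * (Lpp p S' f * ennreal \<beta>)"
      by (simp add: mult_left_mono)
    then show "Lpp p S (\<lambda>x. mol \<Psi> f (x, r)) \<le> ennreal (C * \<beta>) * Lpp p S' f"
      using C \<beta> by (simp add: ennreal_mult ac_simps)
  qed
qed

section \<open>Convergence of mollifications as the radius tends to zero\<close>

lemma Lpp_dominated:
  fixes h :: "nat \<Rightarrow> 'a::euclidean_space \<Rightarrow> real"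
  assumes "\<And>n. borel_on S (h n)" "borel_on S w" "Lpp p S w < \<infinity>" "p > 0"
    "\<And>n x. x \<in> S \<Longrightarrow> \<bar>h n x\<bar> \<le> \<bar>w x\<bar>" "AE x in lborel. x \<in> S \<longrightarrow> (\<lambda>n. h n x) \<longlonglongrightarrow> 0"
  shows "(\<lambda>n. Lpp p S (h n)) \<longlonglongrightarrow> 0"
proof -
  have "(\<lambda>n. \<integral>\<^sup>+x. ennreal (\<bar>h n x\<bar> powr p) * indicator S x \<partial>lborel) \<longlonglongrightarrow> (\<integral>\<^sup>+x. 0 \<partial>(lborel :: 'a measure))"
  proof (rule nn_integral_dominated_convergence[where w="\<lambda>x. ennreal (\<bar>w x\<bar> powr p) * indicator S x"])
    show "(\<lambda>x. ennreal (\<bar>h n x\<bar> powr p) * indicator S x) \<in> borel_measurable lborel" for n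
      using borel_on_powr[OF assms(1)] by simp
    show "(\<lambda>x. ennreal (\<bar>w x\<bar> powr p) * indicator S x) \<in> borel_measurable lborel"
      using borel_on_powr[OF assms(2)] by simp
    show "(\<integral>\<^sup>+x. ennreal (\<bar>w x\<bar> powr p) * indicator S x \<partial>lborel) < \<infinity>"
      using assms(3) by (simp add: Lpp_def)
    show "AE x in lborel. ennreal (\<bar>h n x\<bar> powr p) * indicator S x \<le> ennreal (\<bar>w x\<bar> powr p) * indicator S x" for n
      using assms(4,5) by (intro AE_I2) (auto simp: indicator_def intro!: ennreal_leI powr_mono2)
    show "AE x in lborel. (\<lambda>n. ennreal (\<bar>h n x\<bar> powr p) * indicator S x) \<longlonglongrightarrow> 0"
      using assms(6)
    proof eventually_elim
      fix x assume x: "x \<in> S \<longrightarrow> (\<lambda>n. h n x) \<longlonglongrightarrow> 0"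
      show "(\<lambda>n. ennreal (\<bar>h n x\<bar> powr p) * indicator S x) \<longlonglongrightarrow> 0"
      proof (cases "x \<in> S")
        case True
        with x have "(\<lambda>n. \<bar>h n x\<bar>) \<longlonglongrightarrow> 0" by (simp add: tendsto_rabs_zero)
        then have "(\<lambda>n. \<bar>h n x\<bar> powr p) \<longlonglongrightarrow> 0"
          using assms(4) tendsto_powr'[of "\<lambda>n. \<bar>h n x\<bar>" 0 sequentially "\<lambda>_. p" p] by auto
        from tendsto_ennrealI[OF this] show ?thesis using True by simp
      qed simp
    qed
  qed simp
  then show ?thesis by (simp add: Lpp_def)
qed

text \<open>A measurable function is almost everywhere a limit of continuous ones. Truncation at a
  height m supplies the majorant that turns this into convergence in \<open>L^p\<close> on a
  ball.\<close>

lemma Lloc_approx_continuous: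
  fixes f :: "'a::euclidean_space \<Rightarrow> real"
  assumes f: "Lloc p f" and p: "p \<ge> 1" and e: "e > (0::real)"
  obtains \<eta> where "continuous_on UNIV \<eta>" "Lpp p (ball 0 R) (\<lambda>x. f x - \<eta> x) < e"
proof -
  have fm [measurable]: "f \<in> borel_measurable borel" using f by (simp add: Lloc_def)
  have "f measurable_on UNIV"
    by (rule lebesgue_measurable_imp_measurable_on) (auto intro: measurable_completion)
  then obtain N g where N: "negligible N" and g: "\<And>n. continuous_on UNIV (g n)"
    and lim: "\<And>x. x \<notin> N \<Longrightarrow> (\<lambda>n. g n x) \<longlonglongrightarrow> f x"
    unfolding measurable_on_def by auto
  define cl :: "nat \<Rightarrow> real \<Rightarrow> real" where "cl m y = max (- real m) (min (real m) y)" for m y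
  have clb: "\<bar>cl m y\<bar> \<le> m" for m y by (auto simp: cl_def)
  have clc: "continuous_on UNIV (cl m)" for m unfolding cl_def by (intro continuous_intros)
  have [measurable]: "cl m \<in> borel_measurable borel" for m by (rule borel_measurable_continuous_onI[OF clc])
  \<comment> \<open>Two errors below e2 and the factor 2^p of the triangle inequality add up to
    e/2.\<close>
  define e2 where "e2 = ennreal (e / (4 * 2 powr p))"
  have e2: "0 < e2" "ennreal (2 powr p) * (e2 + e2) < e"
    using e by (auto simp: e2_def ennreal_plus[symmetric] ennreal_mult[symmetric] ennreal_less_iff simp del: ennreal_plus)
  have "(\<lambda>m. Lpp p (ball 0 R) (\<lambda>x. f x - cl m (f x))) \<longlonglongrightarrow> 0"
  proof (rule Lpp_dominated[where w="f"])
    show "borel_on (ball 0 R) (\<lambda>x. f x - cl n (f x))" for n by (rule borel_on_borel) auto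
    show "borel_on (ball 0 R) f" by (rule borel_on_borel) auto
    show "Lpp p (ball 0 R) f < \<infinity>" using f by (simp add: Lloc_def)
    show "\<bar>f x - cl n (f x)\<bar> \<le> \<bar>f x\<bar>" for n x by (auto simp: cl_def max_def min_def)
    show "AE x in lborel. x \<in> ball 0 R \<longrightarrow> (\<lambda>n. f x - cl n (f x)) \<longlonglongrightarrow> 0"
    proof (intro AE_I2 impI)
      fix x
      obtain m where m: "\<bar>f x\<bar> \<le> real m" using real_arch_simple by blast
      have "\<forall>\<^sub>F n in sequentially. f x - cl n (f x) = 0"
        using eventually_ge_at_top[of m] by eventually_elim (use m in \<open>auto simp: cl_def max_def min_def\<close>)
      then show "(\<lambda>n. f x - cl n (f x)) \<longlonglongrightarrow> 0" by (rule tendsto_eventually)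
    qed
  qed (use p in auto)
  then have "\<forall>\<^sub>F m in sequentially. Lpp p (ball 0 R) (\<lambda>x. f x - cl m (f x)) < e2"
    using e2(1) by (rule order_tendstoD)
  then obtain m where m: "Lpp p (ball 0 R) (\<lambda>x. f x - cl m (f x)) < e2"
    using eventually_happens'[OF sequentially_bot] by blast
  have gc: "continuous_on UNIV (\<lambda>x. cl m (g n x))" for n
    by (rule continuous_on_compose2[OF clc g]) auto
  have [measurable]: "(\<lambda>x. cl m (g n x)) \<in> borel_measurable borel" for n
    by (rule borel_measurable_continuous_onI[OF gc])
  have "(\<lambda>n. Lpp p (ball 0 R) (\<lambda>x. cl m (f x) - cl m (g n x))) \<longlonglongrightarrow> 0"
  proof (rule Lpp_dominated[where w="\<lambda>x. 2 * real m"])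
    show "borel_on (ball 0 R) (\<lambda>x. cl m (f x) - cl m (g n x))" for n by (rule borel_on_borel) auto
    show "borel_on (ball (0::'a) R) (\<lambda>x. 2 * real m)" by (rule borel_on_borel) auto
    show "Lpp p (ball (0::'a) R) (\<lambda>x. 2 * real m) < \<infinity>"
      unfolding Lpp_def using emeasure_ball_finite(1)[of "0::'a" R]
      by (simp add: nn_integral_cmult_indicator ennreal_mult_less_top)
    show "\<bar>cl m (f x) - cl m (g n x)\<bar> \<le> \<bar>2 * real m\<bar>" for n x
      using clb[of m "f x"] clb[of m "g n x"] by linarith
    have "AE x in lborel. x \<notin> N"
      using N by (metis AE_not_in AE_completion_iff negligible_iff_null_sets)
    then show "AE x in lborel. x \<in> ball 0 R \<longrightarrow> (\<lambda>n. cl m (f x) - cl m (g n x)) \<longlonglongrightarrow> 0"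
    proof eventually_elim
      fix x assume "x \<notin> N"
      then have "(\<lambda>n. cl m (g n x)) \<longlonglongrightarrow> cl m (f x)"
        using isCont_tendsto_compose[OF _ lim, of x "cl m"] clc[of m] by (simp add: continuous_on_eq_continuous_at)
      from tendsto_diff[OF tendsto_const[of "cl m (f x)"] this]
      show "x \<in> ball 0 R \<longrightarrow> (\<lambda>n. cl m (f x) - cl m (g n x)) \<longlonglongrightarrow> 0" by simp
    qed
  qed (use p in auto)
  then have "\<forall>\<^sub>F n in sequentially. Lpp p (ball 0 R) (\<lambda>x. cl m (f x) - cl m (g n x)) < e2"
    using e2(1) by (rule order_tendstoD)
  then obtain n where n: "Lpp p (ball 0 R) (\<lambda>x. cl m (f x) - cl m (g n x)) < e2"
    using eventually_happens'[OF sequentially_bot] by blast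
  have "Lpp p (ball 0 R) (\<lambda>x. (f x - cl m (f x)) + (cl m (f x) - cl m (g n x)))
    \<le> ennreal (2 powr p) * (Lpp p (ball 0 R) (\<lambda>x. f x - cl m (f x)) + Lpp p (ball 0 R) (\<lambda>x. cl m (f x) - cl m (g n x)))"
    by (rule Lpp_add) (use p in \<open>auto intro!: borel_on_borel\<close>)
  also have "\<dots> \<le> ennreal (2 powr p) * (e2 + e2)"
    using m n by (intro mult_left_mono add_mono) auto
  also have "\<dots> < e" by (rule e2)
  finally have "Lpp p (ball 0 R) (\<lambda>x. f x - cl m (g n x)) < e" by simp
  then show ?thesis by (rule that[OF gc])
qed

lemma Lloc_continuous:
  fixes f :: "'a::euclidean_space \<Rightarrow> real"
  assumes "continuous_on UNIV f" "p > 0" shows "Lloc p f"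
  unfolding Lloc_def
proof (intro conjI allI)
  show "f \<in> borel_measurable borel" using assms by (simp add: borel_measurable_continuous_onI)
  fix R
  have "bounded (f ` cball 0 R)"
    by (intro compact_imp_bounded compact_continuous_image continuous_on_subset[OF assms(1)]) auto
  then obtain C where C: "C > 0" "\<And>x. x \<in> cball 0 R \<Longrightarrow> \<bar>f x\<bar> \<le> C" by (auto simp: bounded_pos)
  have "Lpp p (ball 0 R) f \<le> Lpp p (ball (0::'a) R) (\<lambda>x. C)"
    by (rule Lpp_mono) (use assms C in \<open>auto intro!: order_trans[OF C(2)]\<close>)
  also have "\<dots> < \<infinity>"
    unfolding Lpp_def using emeasure_ball_finite(1)[of "0::'a" R]
    by (simp add: nn_integral_cmult_indicator ennreal_mult_less_top)
  finally show "Lpp p (ball 0 R) f < \<infinity>" .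
qed

lemma Lloc_add:
  assumes "Lloc p f" "Lloc p g" "p \<ge> 0" shows "Lloc p (\<lambda>x. f x + g x)"
  unfolding Lloc_def
proof (intro conjI allI)
  have m: "f \<in> borel_measurable borel" "g \<in> borel_measurable borel" using assms by (auto simp: Lloc_def)
  then show "(\<lambda>x. f x + g x) \<in> borel_measurable borel" by simp
  fix R
  have "Lpp p (ball 0 R) (\<lambda>x. f x + g x) \<le> ennreal (2 powr p) * (Lpp p (ball 0 R) f + Lpp p (ball 0 R) g)"
    by (rule Lpp_add) (use assms m in \<open>auto intro: borel_on_borel\<close>)
  also have "\<dots> < \<infinity>" using assms by (simp add: Lloc_def ennreal_mult_less_top)
  finally show "Lpp p (ball 0 R) (\<lambda>x. f x + g x) < \<infinity>" .
qed

lemma Lloc_cmult: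
  assumes "Lloc p f" "p \<ge> 0" shows "Lloc p (\<lambda>x. c * f x)"
  unfolding Lloc_def
proof (intro conjI allI)
  have m: "f \<in> borel_measurable borel" using assms by (auto simp: Lloc_def)
  then show "(\<lambda>x. c * f x) \<in> borel_measurable borel" by simp
  fix R
  have "Lpp p (ball 0 R) (\<lambda>x. c * f x) \<le> ennreal (\<bar>c\<bar> powr p) * Lpp p (ball 0 R) f"
    by (rule Lpp_bounded_mult) (use assms m in \<open>auto intro: borel_on_borel\<close>)
  also have "\<dots> < \<infinity>" using assms by (simp add: Lloc_def ennreal_mult_less_top)
  finally show "Lpp p (ball 0 R) (\<lambda>x. c * f x) < \<infinity>" .
qed

lemma Lloc_diff:
  assumes "Lloc p f" "Lloc p g" "p \<ge> 0" shows "Lloc p (\<lambda>x. f x - g x)"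
  using Lloc_add[OF assms(1) Lloc_cmult[OF assms(2,3), of "-1"] assms(3)] by simp

lemma mol_integrable:
  fixes f :: "'a::euclidean_space \<Rightarrow> real"
  assumes f: "Lloc 1 f" and \<Psi>: "kern \<Psi>" and r: "r > 0"
  shows "integrable lborel (\<lambda>y. f (x + r *\<^sub>R y) * \<Psi> y)"
proof -
  obtain C where C: "C > 0" "\<And>y. \<bar>\<Psi> y\<bar> \<le> C * indicator (cball 0 1) y" using kern_bounded[OF \<Psi>] by blast
  have m: "(\<lambda>z. \<Psi> ((1 / r) *\<^sub>R (z - x))) \<in> borel_measurable borel"
    using kern_measurable[OF \<Psi>] by measurable
  have "integrable lborel (\<lambda>z. f z * \<Psi> ((1 / r) *\<^sub>R (z - x)))"
    by (rule Lloc_integrable_mult[OF f m kern_scaled_bound[OF C(2), where r'="2 * r" and R="norm x + 2 * r"]])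
       (use r C in auto)
  from lborel_integrable_affine[OF this, of r x] show ?thesis using r by simp
qed

lemma mol_add:
  assumes "Lloc 1 f" "Lloc 1 g" "kern \<Psi>" "r > 0"
  shows "mol \<Psi> (\<lambda>x. f x + g x) (x, r) = mol \<Psi> f (x, r) + mol \<Psi> g (x, r)"
  using mol_integrable[OF assms(1,3,4), of x] mol_integrable[OF assms(2,3,4), of x]
  by (simp add: mol_def distrib_right)

lemma mol_cmult: "mol \<Psi> (\<lambda>x. c * f x) q = c * mol \<Psi> f q"
  by (simp add: mol_def mult.assoc)

lemma mol_diff:
  assumes "Lloc 1 f" "Lloc 1 g" "kern \<Psi>" "r > 0"
  shows "mol \<Psi> (\<lambda>x. f x - g x) (x, r) = mol \<Psi> f (x, r) - mol \<Psi> g (x, r)"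
  using mol_integrable[OF assms(1,3,4), of x] mol_integrable[OF assms(2,3,4), of x]
  by (simp add: mol_def left_diff_distrib)

text \<open>The point where differences of f enter: for a kernel of mean zero the second term on the
  left vanishes.\<close>

lemma mol_minus_const:
  assumes "Lloc 1 f" "kern \<Psi>" "r > 0"
  shows "mol \<Psi> f (x, r) - f x * integral\<^sup>L lborel \<Psi> = (\<integral>y. (f (x + r *\<^sub>R y) - f x) * \<Psi> y \<partial>lborel)"
  using mol_integrable[OF assms, of x] kern_integrable[OF assms(2)]
  by (simp add: mol_def left_diff_distrib)

text \<open>Uniform continuity on the ball of radius R + 1, which contains all sampled points once
  the radius is below 1.\<close>

lemma mol_continuous_uniform:
  fixes \<eta> :: "'a::euclidean_space \<Rightarrow> real"
  assumes \<eta>: "continuous_on UNIV \<eta>" and \<Psi>: "kern \<Psi>" and e: "e > 0"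
  shows "\<forall>\<^sub>F r in at_right 0. \<forall>x\<in>ball 0 R. \<bar>mol \<Psi> \<eta> (x, r) - \<eta> x * integral\<^sup>L lborel \<Psi>\<bar> \<le> e"
proof -
  \<comment> \<open>The summand 1 keeps A positive even for the zero kernel.\<close>
  define A where "A = (\<integral>y. \<bar>\<Psi> y\<bar> \<partial>lborel) + 1"
  have A: "A \<ge> 1" "(\<integral>y. \<bar>\<Psi> y\<bar> \<partial>lborel) \<le> A" unfolding A_def by (simp_all add: Bochner_Integration.integral_nonneg)
  have eA: "e / A > 0" using e A by simp
  have "uniformly_continuous_on (cball 0 (R + 1)) \<eta>"
    by (rule compact_uniformly_continuous) (auto intro: continuous_on_subset[OF \<eta>])
  then obtain d where d: "d > 0" "\<And>x y. x \<in> cball 0 (R + 1) \<Longrightarrow> y \<in> cball 0 (R + 1) \<Longrightarrow> dist y x < d \<Longrightarrow> dist (\<eta> y) (\<eta> x) < e / A"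
    unfolding uniformly_continuous_on_def using eA by blast
  have "\<bar>mol \<Psi> \<eta> (x, r) - \<eta> x * integral\<^sup>L lborel \<Psi>\<bar> \<le> e"
    if r: "r > 0" "r < min d 1" and x: "x \<in> ball 0 R" for x r
  proof -
    have "\<bar>mol \<Psi> \<eta> (x, r) - \<eta> x * integral\<^sup>L lborel \<Psi>\<bar> = \<bar>\<integral>y. (\<eta> (x + r *\<^sub>R y) - \<eta> x) * \<Psi> y \<partial>lborel\<bar>"
      using mol_minus_const[OF Lloc_continuous[OF \<eta>, of 1] \<Psi> r(1), of x] by simp
    also have "\<dots> \<le> (\<integral>y. \<bar>(\<eta> (x + r *\<^sub>R y) - \<eta> x) * \<Psi> y\<bar> \<partial>lborel)"
      using integral_norm_bound[of lborel "\<lambda>y. (\<eta> (x + r *\<^sub>R y) - \<eta> x) * \<Psi> y"] by simp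
    also have "\<dots> \<le> (\<integral>y. (e / A) * \<bar>\<Psi> y\<bar> \<partial>lborel)"
    proof (rule integral_mono_AE')
      show "integrable lborel (\<lambda>y. (e / A) * \<bar>\<Psi> y\<bar>)"
        by (intro integrable_mult_right integrable_abs kern_integrable \<Psi>)
      show "AE y in lborel. \<bar>(\<eta> (x + r *\<^sub>R y) - \<eta> x) * \<Psi> y\<bar> \<le> (e / A) * \<bar>\<Psi> y\<bar>"
      proof (rule AE_I2)
        fix y
        show "\<bar>(\<eta> (x + r *\<^sub>R y) - \<eta> x) * \<Psi> y\<bar> \<le> (e / A) * \<bar>\<Psi> y\<bar>"
        proof (cases "norm y \<le> 1")
          case True
          have n: "norm (r *\<^sub>R y) \<le> r" using True r by (simp add: mult_left_le)
          have "norm x < R" using x by simp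
          then have "norm (x + r *\<^sub>R y) \<le> R + 1" using norm_triangle_ineq[of x "r *\<^sub>R y"] n r by linarith
          moreover have "dist (x + r *\<^sub>R y) x < d" using n r unfolding dist_norm by (simp del: norm_scaleR)
          ultimately have "dist (\<eta> (x + r *\<^sub>R y)) (\<eta> x) < e / A" using d(2)[of x "x + r *\<^sub>R y"] x by simp
          then show ?thesis unfolding abs_mult by (intro mult_right_mono) (auto simp: dist_real_def)
        next
          case False
          then have "\<Psi> y = 0" using \<Psi> by (simp add: kern_def)
          then show ?thesis by simp
        qed
      qed
    qed (use e A in auto)
    also have "\<dots> = (e / A) * (\<integral>y. \<bar>\<Psi> y\<bar> \<partial>lborel)" by simp
    also have "\<dots> \<le> (e / A) * A" using e A by (intro mult_left_mono) auto
    also have "\<dots> = e" using A by simp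
    finally show ?thesis .
  qed
  moreover have "\<forall>\<^sub>F r in at_right 0. r > 0 \<and> r < min d (1::real)"
    using d(1) eventually_at_right_real[of 0 "min d 1"] by (auto elim: eventually_mono)
  ultimately show ?thesis by (auto elim: eventually_mono)
qed

text \<open>Approximation of f by a continuous \<eta>; mollification is bounded in
  \<open>L^p\<close> uniformly in the radius, so f - \<eta> stays small. The limit carries the
  integral of the kernel as a factor, hence is zero for kernels of mean zero. This is what removes
  such terms from the traces.\<close>

lemma mol_approx:
  fixes f :: "'a::euclidean_space \<Rightarrow> real"
  assumes f: "Lloc p f" and p: "p \<ge> 1" and \<Psi>: "kern \<Psi>"
  shows "((\<lambda>r. Lpp p (ball 0 R) (\<lambda>x. mol \<Psi> f (x, r) - f x * integral\<^sup>L lborel \<Psi>)) \<longlongrightarrow> 0) (at_right 0)"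
proof -
  define \<mu> where "\<mu> = integral\<^sup>L lborel \<Psi>"
  obtain C where C: "C > 0" "\<And>f S S' r. f \<in> borel_measurable borel \<Longrightarrow> S \<in> sets borel \<Longrightarrow> S' \<in> sets borel \<Longrightarrow>
    (\<And>x y. x \<in> S \<Longrightarrow> norm y \<le> r \<Longrightarrow> x + y \<in> S') \<Longrightarrow> r \<ge> 0 \<Longrightarrow>
    Lpp p S (\<lambda>x. mol \<Psi> f (x, r)) \<le> ennreal C * Lpp p S' f" using mol_Lpp[OF \<Psi> p] by blast
  define V where "V = measure lborel (ball (0::'a) R)"
  have V: "emeasure lborel (ball (0::'a) R) = ennreal V"
    unfolding V_def by (rule emeasure_eq_ennreal_measure) (use emeasure_ball_finite(1)[of "0::'a" R] in auto)
  \<comment> \<open>Collects the three pieces of the decomposition below, the mollified error, the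
    error times \<mu> and the continuous part, with one factor 2^p for each use of the triangle
    inequality.\<close>
  define K where "K = 2 powr p * (C + 2 powr p * (\<bar>\<mu>\<bar> powr p + V))"
  have V0: "V \<ge> 0" by (simp add: V_def)
  have K: "K > 0" unfolding K_def using C(1) V0 by (intro mult_pos_pos add_pos_nonneg) auto
  have key: "\<forall>\<^sub>F r in at_right 0. Lpp p (ball 0 R) (\<lambda>x. mol \<Psi> f (x, r) - f x * \<mu>) \<le> ennreal (K * e)" if e: "e > 0" for e :: real
  proof -
    obtain \<eta> where \<eta>: "continuous_on UNIV \<eta>" "Lpp p (ball 0 (R + 1)) (\<lambda>x. f x - \<eta> x) < ennreal e"
      using Lloc_approx_continuous[OF f p e] by blast
    have L\<eta>: "Lloc p \<eta>" "Lloc 1 \<eta>" using Lloc_continuous[OF \<eta>(1)] p by auto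
    have L: "Lloc 1 f" "Lloc 1 (\<lambda>x. f x - \<eta> x)" using Lloc_1[OF f p] Lloc_diff[OF _ L\<eta>(2)] by auto
    have [measurable]: "f \<in> borel_measurable borel" "\<eta> \<in> borel_measurable borel" using f L\<eta> by (auto simp: Lloc_def)
    \<comment> \<open>The p-th root makes the uniform error contribute e times the volume V to the
      p-th power of the norm.\<close>
    have "\<forall>\<^sub>F r in at_right 0. \<forall>x\<in>ball 0 R. \<bar>mol \<Psi> \<eta> (x, r) - \<eta> x * \<mu>\<bar> \<le> e powr (1 / p)"
      unfolding \<mu>_def by (rule mol_continuous_uniform[OF \<eta>(1) \<Psi>]) (use e in simp)
    moreover have "\<forall>\<^sub>F r in at_right 0. r > 0 \<and> r < (1::real)"
      using eventually_at_right_real[of 0 1] by (auto elim: eventually_mono)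
    ultimately show ?thesis
    proof eventually_elim
      fix r assume u: "\<forall>x\<in>ball 0 R. \<bar>mol \<Psi> \<eta> (x, r) - \<eta> x * \<mu>\<bar> \<le> e powr (1 / p)" and r: "r > 0 \<and> r < (1::real)"
      have mm: "borel_on (ball 0 R) (\<lambda>x. mol \<Psi> g (x, r))" if "Lloc 1 g" for g
      proof (rule borel_on_cont)
        show "continuous_on (ball 0 R) (\<lambda>x. mol \<Psi> g (x, r))"
          by (rule continuous_on_compose2[OF mol_continuous[OF that \<Psi>]]) (use r in \<open>auto intro!: continuous_intros\<close>)
      qed auto
      have "Lpp p (ball 0 R) (\<lambda>x. mol \<Psi> (\<lambda>x. f x - \<eta> x) (x, r)) \<le> ennreal C * Lpp p (ball 0 (R + 1)) (\<lambda>x. f x - \<eta> x)"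
      proof (rule C(2))
        fix x y :: 'a assume "x \<in> ball 0 R" "norm y \<le> r"
        then show "x + y \<in> ball 0 (R + 1)" using norm_triangle_ineq[of x y] r by simp
      qed (use r in auto)
      also have "\<dots> \<le> ennreal C * ennreal e" using \<eta>(2) by (intro mult_left_mono) auto
      finally have 1: "Lpp p (ball 0 R) (\<lambda>x. mol \<Psi> (\<lambda>x. f x - \<eta> x) (x, r)) \<le> ennreal C * ennreal e" .
      have "Lpp p (ball 0 R) (\<lambda>x. - \<mu> * (f x - \<eta> x)) \<le> ennreal (\<bar>\<mu>\<bar> powr p) * Lpp p (ball 0 R) (\<lambda>x. f x - \<eta> x)"
        by (rule Lpp_bounded_mult) (use p in \<open>auto intro!: borel_on_borel\<close>)
      also have "\<dots> \<le> ennreal (\<bar>\<mu>\<bar> powr p) * ennreal e"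
        by (rule mult_left_mono, rule order_trans[OF Lpp_subset[of _ "ball 0 (R + 1)"]]) (use \<eta>(2) in auto)
      finally have 2: "Lpp p (ball 0 R) (\<lambda>x. - \<mu> * (f x - \<eta> x)) \<le> ennreal (\<bar>\<mu>\<bar> powr p) * ennreal e" .
      have "Lpp p (ball 0 R) (\<lambda>x. mol \<Psi> \<eta> (x, r) - \<eta> x * \<mu>) \<le> Lpp p (ball (0::'a) R) (\<lambda>x. e powr (1 / p))"
        by (rule Lpp_mono) (use p u in auto)
      also have "\<dots> = ennreal e * ennreal V"
        unfolding Lpp_def using e p V by (simp add: nn_integral_cmult_indicator powr_powr)
      finally have 3: "Lpp p (ball 0 R) (\<lambda>x. mol \<Psi> \<eta> (x, r) - \<eta> x * \<mu>) \<le> ennreal e * ennreal V" .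
      have m2: "borel_on (ball 0 R) (\<lambda>x. - \<mu> * (f x - \<eta> x))" by (rule borel_on_borel) auto
      have m3: "borel_on (ball 0 R) (\<lambda>x. mol \<Psi> \<eta> (x, r) - \<eta> x * \<mu>)"
        using borel_on_add[OF mm[OF L\<eta>(2)], of "\<lambda>x. - (\<eta> x * \<mu>)"] by (simp add: borel_on_borel)
      have "Lpp p (ball 0 R) (\<lambda>x. mol \<Psi> f (x, r) - f x * \<mu>) =
        Lpp p (ball 0 R) (\<lambda>x. mol \<Psi> (\<lambda>x. f x - \<eta> x) (x, r) + (- \<mu> * (f x - \<eta> x) + (mol \<Psi> \<eta> (x, r) - \<eta> x * \<mu>)))"
        using r by (intro Lpp_cong) (simp add: mol_diff[OF L(1) L\<eta>(2) \<Psi>] algebra_simps)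
      also have "\<dots> \<le> ennreal (2 powr p) * (Lpp p (ball 0 R) (\<lambda>x. mol \<Psi> (\<lambda>x. f x - \<eta> x) (x, r)) +
        Lpp p (ball 0 R) (\<lambda>x. - \<mu> * (f x - \<eta> x) + (mol \<Psi> \<eta> (x, r) - \<eta> x * \<mu>)))"
        by (rule Lpp_add[OF _ mm[OF L(2)] borel_on_add[OF m2 m3]]) (use p in simp)
      also have "\<dots> \<le> ennreal (2 powr p) * (ennreal C * ennreal e + ennreal (2 powr p) * (ennreal (\<bar>\<mu>\<bar> powr p) * ennreal e + ennreal e * ennreal V))"
        by (intro mult_left_mono add_mono order_trans[OF Lpp_add[OF _ m2 m3]] 1 2 3) (use p in auto)
      also have "\<dots> = ennreal (K * e)"
        unfolding K_def using C(1) e V0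
        by (simp add: ennreal_mult[symmetric] ennreal_plus[symmetric] algebra_simps del: ennreal_plus)
      finally show "Lpp p (ball 0 R) (\<lambda>x. mol \<Psi> f (x, r) - f x * \<mu>) \<le> ennreal (K * e)" .
    qed
  qed
  show ?thesis
    unfolding \<mu>_def[symmetric]
  proof (rule order_tendstoI)
    fix a :: ennreal assume "0 < a"
    then obtain c where c: "0 < c" "c < a" using dense by blast
    then have "c < top" by (meson less_le_trans top_greatest)
    then obtain b where "c = ennreal b" "b \<ge> 0" by (cases c) auto
    with c have b: "0 < b" "ennreal b < a" by (auto simp: less_le)
    show "\<forall>\<^sub>F r in at_right 0. Lpp p (ball 0 R) (\<lambda>x. mol \<Psi> f (x, r) - f x * \<mu>) < a"
      using key[of "b / K"] b K by (auto elim!: eventually_mono)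
  qed simp
qed

subsection \<open>Uniqueness of weak derivatives\<close>

lemma in_Lp_loc_1_integrable_mult:
  fixes g :: "'b::euclidean_space \<Rightarrow> real"
  assumes g: "in_Lp_loc 1 U g" and U: "open U" and \<phi>: "test_function U \<phi>"
  shows "set_integrable lebesgue U (\<lambda>x. g x * \<phi> x)"
proof -
  define K where "K = closure {x. \<phi> x \<noteq> 0}"
  have K: "compact K" "K \<subseteq> U" using \<phi> by (auto simp: test_function_def K_def)
  have K0: "\<phi> x = 0" if "x \<notin> K" for x
    using that closure_subset[of "{x. \<phi> x \<noteq> 0}"] unfolding K_def by blast
  have cont: "continuous_on UNIV \<phi>" by (rule test_function_facts(1)[OF \<phi>])
  have "bounded (\<phi> ` K)" by (intro compact_imp_bounded compact_continuous_image continuous_on_subset[OF cont] K) auto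
  then obtain C where C: "C > 0" "\<And>x. x \<in> K \<Longrightarrow> \<bar>\<phi> x\<bar> \<le> C" by (auto simp: bounded_pos)
  have Um: "U \<in> sets lebesgue" using U by auto
  have gm: "(\<lambda>x. indicator U x *\<^sub>R g x) \<in> borel_measurable lebesgue"
    using g Um by (simp add: in_Lp_loc_def borel_measurable_restrict_space_iff)
  have pm: "\<phi> \<in> borel_measurable lebesgue" using borel_measurable_continuous_onI[OF cont] by (intro measurable_completion) simp
  have "(\<lambda>x. (indicator U x *\<^sub>R g x) * \<phi> x) \<in> borel_measurable lebesgue" using gm pm by (rule borel_measurable_times)
  then have m: "(\<lambda>x. indicator U x *\<^sub>R (g x * \<phi> x)) \<in> borel_measurable lebesgue" by (simp add: mult.assoc)
  have gK: "(\<lambda>x. ennreal (\<bar>g x\<bar> powr 1) * indicator K x) \<in> borel_measurable lebesgue"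
  proof -
    have "(\<lambda>x. ennreal \<bar>indicator U x *\<^sub>R g x\<bar> * indicator K x) \<in> borel_measurable lebesgue"
      using gm K(1) by (intro borel_measurable_times_ennreal borel_measurable_indicator measurable_compose[OF _ measurable_ennreal] borel_measurable_abs) (auto simp: compact_imp_closed)
    also have "(\<lambda>x. ennreal \<bar>indicator U x *\<^sub>R g x\<bar> * indicator K x) = (\<lambda>x. ennreal (\<bar>g x\<bar> powr 1) * indicator K x)"
      using K(2) by (auto simp: indicator_def fun_eq_iff)
    finally show ?thesis .
  qed
  show ?thesis unfolding set_integrable_def
  proof (rule integrableI_bounded[OF m])
    have "(\<integral>\<^sup>+x. norm (indicator U x *\<^sub>R (g x * \<phi> x)) \<partial>lebesgue) \<le> (\<integral>\<^sup>+x. ennreal C * (ennreal (\<bar>g x\<bar> powr 1) * indicator K x) \<partial>lebesgue)"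
    proof (rule nn_integral_mono)
      fix x
      have "norm (indicator U x *\<^sub>R (g x * \<phi> x)) \<le> C * \<bar>g x\<bar>" if "x \<in> K"
        using C(2)[OF that] mult_right_mono[OF C(2)[OF that], of "\<bar>g x\<bar>"] C(1) by (auto simp: indicator_def abs_mult mult.commute)
      then show "ennreal (norm (indicator U x *\<^sub>R (g x * \<phi> x))) \<le> ennreal C * (ennreal (\<bar>g x\<bar> powr 1) * indicator K x)"
        using C(1) K0 by (cases "x \<in> K") (auto simp: ennreal_mult[symmetric] intro!: ennreal_leI)
    qed
    also have "\<dots> = ennreal C * (\<integral>\<^sup>+x\<in>K. ennreal (\<bar>g x\<bar> powr 1) \<partial>lebesgue)" by (rule nn_integral_cmult[OF gK])
    also have "\<dots> < \<infinity>"
    proof -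
      have "(\<integral>\<^sup>+x\<in>K. ennreal (\<bar>g x\<bar> powr 1) \<partial>lebesgue) < \<infinity>" using g K unfolding in_Lp_loc_def by blast
      then show ?thesis by (simp add: ennreal_mult_less_top)
    qed
    finally show "(\<integral>\<^sup>+x. norm (indicator U x *\<^sub>R (g x * \<phi> x)) \<partial>lebesgue) < \<infinity>" .
  qed
qed

lemma AE_lebesgue_iff: "(AE x in lebesgue. P x) \<longleftrightarrow> (AE x in lborel. P x)"
  by (rule AE_completion_iff)

text \<open>The mollifications of \<open>g\<close> vanish and converge to \<open>g\<close> locally in $L^1$.\<close>

lemma test_functions_separate:
  fixes g :: "'b::euclidean_space \<Rightarrow> real"
  assumes U: "open U" and g: "in_Lp_loc 1 U g"
    and 0: "\<And>\<phi>. test_function U \<phi> \<Longrightarrow> (LINT x:U|lebesgue. g x * \<phi> x) = 0"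
  shows "AE x in lborel. x \<in> U \<longrightarrow> g x = 0"
proof -
  obtain \<phi> :: "'b \<Rightarrow> real" where \<phi>: "kern \<phi>" "integral\<^sup>L lborel \<phi> = 1" using exists_bump by blast
  have Um: "U \<in> sets lebesgue" using U by auto
  have gm: "(\<lambda>x. indicator U x *\<^sub>R g x) \<in> borel_measurable lebesgue"
    using g Um by (simp add: in_Lp_loc_def borel_measurable_restrict_space_iff)
  define N where "N = {x \<in> U. g x \<noteq> 0}"
  \<comment> \<open>Negligibility is a local property, so a small ball around each point of N is
    enough.\<close>
  have "\<exists>V. openin (top_of_set N) V \<and> x \<in> V \<and> negligible V" if "x \<in> N" for x
  proof -
    have "x \<in> U" using that by (simp add: N_def)
    then obtain \<rho>' where "\<rho>' > 0" "cball x \<rho>' \<subseteq> U" using U open_contains_cball by blast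
    define \<rho> where "\<rho> = \<rho>' / 2"
    have \<rho>: "\<rho> > 0" "cball x (2 * \<rho>) \<subseteq> U" using \<open>\<rho>' > 0\<close> \<open>cball x \<rho>' \<subseteq> U\<close> by (auto simp: \<rho>_def)
    \<comment> \<open>Cutting off to a closed ball inside U makes g integrable on the whole space.
      For centres within \<rho> of x and radii below \<rho> the kernel does not see the
      cut-off.\<close>
    define h where "h z = indicator (cball x (2 * \<rho>)) z * (indicator U z *\<^sub>R g z)" for z
    have hm: "h \<in> borel_measurable lebesgue"
      unfolding h_def by (intro borel_measurable_times gm borel_measurable_indicator) auto
    then obtain h' where h'm: "h' \<in> borel_measurable lborel" and h': "AE z in lborel. h z = h' z"
      using completion_ex_borel_measurable_real by blast
    have h'b: "h' \<in> borel_measurable borel" using h'm by simp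
    have fin: "(\<integral>\<^sup>+z. ennreal \<bar>h' z\<bar> \<partial>lborel) < \<infinity>"
    proof -
      have "(\<integral>\<^sup>+z. ennreal \<bar>h' z\<bar> \<partial>lborel) = (\<integral>\<^sup>+z. ennreal \<bar>h' z\<bar> \<partial>lebesgue)" by (simp add: nn_integral_completion)
      also have "\<dots> = (\<integral>\<^sup>+z\<in>cball x (2 * \<rho>). ennreal (\<bar>g z\<bar> powr 1) \<partial>lebesgue)"
      proof (rule nn_integral_cong_AE)
        show "AE z in lebesgue. ennreal \<bar>h' z\<bar> = ennreal (\<bar>g z\<bar> powr 1) * indicator (cball x (2 * \<rho>)) z"
          unfolding AE_lebesgue_iff using h'
        proof eventually_elim
          fix z assume "h z = h' z"
          then have "h' z = h z" by simp
          then show "ennreal \<bar>h' z\<bar> = ennreal (\<bar>g z\<bar> powr 1) * indicator (cball x (2 * \<rho>)) z"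
            using \<rho>(2) by (auto simp: h_def indicator_def)
        qed
      qed
      also have "\<dots> < \<infinity>" using g \<rho>(2) compact_cball unfolding in_Lp_loc_def by blast
      finally show ?thesis .
    qed
    have L: "Lloc 1 h'" unfolding Lloc_def Lpp_def
    proof (intro conjI allI h'b)
      fix R
      have "(\<integral>\<^sup>+x\<in>ball 0 R. ennreal (\<bar>h' x\<bar> powr 1) \<partial>lborel) \<le> (\<integral>\<^sup>+z. ennreal \<bar>h' z\<bar> \<partial>lborel)"
        by (rule nn_integral_mono) (auto simp: indicator_def)
      then show "(\<integral>\<^sup>+x\<in>ball 0 R. ennreal (\<bar>h' x\<bar> powr 1) \<partial>lborel) < \<infinity>" using fin by simp
    qed
    have m0: "mol \<phi> h' (y, r) = 0" if y: "y \<in> ball x \<rho>" and r: "r > 0" "r < \<rho>" for y r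
    proof -
      have cb: "cball y r \<subseteq> cball x (2 * \<rho>)"
      proof
        fix z assume z: "z \<in> cball y r"
        have "dist x z \<le> dist x y + dist y z" by (rule dist_triangle)
        then show "z \<in> cball x (2 * \<rho>)" using z y r by simp
      qed
      have tf: "test_function U (\<lambda>z. \<phi> ((1 / r) *\<^sub>R (z - y)))"
        by (rule kern_test_function[OF \<phi>(1) r(1)]) (use cb \<rho>(2) in auto)
      have m1: "(\<lambda>z. \<phi> ((1 / r) *\<^sub>R (z - y))) \<in> borel_measurable borel"
        using kern_measurable[OF \<phi>(1)] by measurable
      have m1': "(\<lambda>z. \<phi> ((1 / r) *\<^sub>R (z - y))) \<in> borel_measurable lebesgue" by (intro measurable_completion) (simp add: m1)
      have z0: "\<phi> ((1 / r) *\<^sub>R (z - y)) = 0" if "z \<notin> cball x (2 * \<rho>)" for z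
      proof -
        have "z \<notin> cball y r" using that cb by blast
        then have "r < norm (z - y)" by (simp add: dist_norm norm_minus_commute)
        then have "1 < norm ((1 / r) *\<^sub>R (z - y))" unfolding norm_scaleR using r by simp
        then show ?thesis using \<phi>(1) unfolding kern_def by blast
      qed
      have "(\<integral>z. h' z * \<phi> ((1 / r) *\<^sub>R (z - y)) \<partial>lborel) = (\<integral>z. h' z * \<phi> ((1 / r) *\<^sub>R (z - y)) \<partial>lebesgue)"
        by (rule integral_completion[symmetric]) (use h'b m1 in simp)
      also have "\<dots> = (\<integral>z. h z * \<phi> ((1 / r) *\<^sub>R (z - y)) \<partial>lebesgue)"
      proof (rule integral_cong_AE)
        show "(\<lambda>z. h' z * \<phi> ((1 / r) *\<^sub>R (z - y))) \<in> borel_measurable lebesgue"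
          by (intro borel_measurable_times m1' measurable_completion h'm)
        show "(\<lambda>z. h z * \<phi> ((1 / r) *\<^sub>R (z - y))) \<in> borel_measurable lebesgue"
          by (intro borel_measurable_times m1' hm)
        show "AE z in lebesgue. h' z * \<phi> ((1 / r) *\<^sub>R (z - y)) = h z * \<phi> ((1 / r) *\<^sub>R (z - y))"
          unfolding AE_lebesgue_iff using h' by eventually_elim simp
      qed
      also have "\<dots> = (LINT z:U|lebesgue. g z * \<phi> ((1 / r) *\<^sub>R (z - y)))"
        unfolding set_lebesgue_integral_def
        by (rule Bochner_Integration.integral_cong) (auto simp: h_def indicator_def z0)
      also have "\<dots> = 0" by (rule 0[OF tf])
      finally show ?thesis unfolding mol_eq[OF h'b \<phi>(1) r(1)] by simp
    qed
    define R where "R = norm x + \<rho>"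
    have sub: "ball x \<rho> \<subseteq> ball 0 R"
    proof
      fix y assume "y \<in> ball x \<rho>"
      then have "norm (y - x) < \<rho>" by (simp add: dist_norm norm_minus_commute)
      then show "y \<in> ball 0 R" using norm_triangle_sub[of y x] by (simp add: R_def)
    qed
    \<comment> \<open>Where the mollifications vanish, the approximation error is h' itself: a fixed
      quantity bounded by something that tends to zero.\<close>
    have le: "\<forall>\<^sub>F r in at_right 0. Lpp 1 (ball x \<rho>) h' \<le> Lpp 1 (ball 0 R) (\<lambda>y. mol \<phi> h' (y, r) - h' y * integral\<^sup>L lborel \<phi>)"
      using eventually_at_right_real[OF \<rho>(1)]
    proof eventually_elim
      fix r assume r: "r \<in> {0<..<\<rho>}"
      have "Lpp 1 (ball x \<rho>) h' = Lpp 1 (ball x \<rho>) (\<lambda>y. mol \<phi> h' (y, r) - h' y * integral\<^sup>L lborel \<phi>)"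
        by (rule Lpp_cong) (use m0 r \<phi>(2) in auto)
      also have "\<dots> \<le> Lpp 1 (ball 0 R) (\<lambda>y. mol \<phi> h' (y, r) - h' y * integral\<^sup>L lborel \<phi>)"
        by (rule Lpp_subset[OF sub])
      finally show "Lpp 1 (ball x \<rho>) h' \<le> Lpp 1 (ball 0 R) (\<lambda>y. mol \<phi> h' (y, r) - h' y * integral\<^sup>L lborel \<phi>)" .
    qed
    have "Lpp 1 (ball x \<rho>) h' \<le> 0"
      by (rule tendsto_lowerbound[OF mol_approx[OF L _ \<phi>(1), of R] le]) auto
    then have "(\<integral>\<^sup>+z. ennreal (\<bar>h' z\<bar> powr 1) * indicator (ball x \<rho>) z \<partial>lborel) = 0"
      by (simp add: Lpp_def)
    then have "AE z in lborel. ennreal (\<bar>h' z\<bar> powr 1) * indicator (ball x \<rho>) z = 0"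
    proof (subst (asm) nn_integral_0_iff_AE)
      have "(\<lambda>z. ennreal (\<bar>h' z\<bar> powr 1)) \<in> borel_measurable lborel" using h'b by measurable
      then show "(\<lambda>z. ennreal (\<bar>h' z\<bar> powr 1) * indicator (ball x \<rho>) z) \<in> borel_measurable lborel"
        by (intro borel_measurable_times_ennreal borel_measurable_indicator) auto
    qed
    with h' have "AE z in lborel. \<not> (z \<in> ball x \<rho> \<inter> N)"
    proof eventually_elim
      fix z assume "h z = h' z" "ennreal (\<bar>h' z\<bar> powr 1) * indicator (ball x \<rho>) z = 0"
      then show "\<not> (z \<in> ball x \<rho> \<inter> N)"
        using \<rho> by (auto simp: N_def h_def indicator_def split: if_splits)
    qed
    then obtain N' where N': "N' \<in> null_sets lborel" "{z. \<not> z \<notin> ball x \<rho> \<inter> N} \<subseteq> N'"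
      unfolding eventually_ae_filter by auto
    then have "N' \<in> null_sets lborel" "ball x \<rho> \<inter> N \<subseteq> N'" by auto
    then have "negligible (ball x \<rho> \<inter> N)"
      using negligible_subset null_sets_completionI negligible_iff_null_sets by blast
    moreover have "openin (top_of_set N) (N \<inter> ball x \<rho>)" by (simp add: openin_open_Int)
    ultimately show ?thesis using that \<rho>(1) by (intro exI[of _ "N \<inter> ball x \<rho>"]) (auto simp: Int_commute)
  qed
  then have "negligible N" by (subst locally_negligible_alt) blast
  then have "AE x in lebesgue. x \<notin> N" by (intro AE_not_in) (simp add: negligible_iff_null_sets)
  then have "AE x in lborel. x \<notin> N" by (simp add: AE_lebesgue_iff)
  then show ?thesis by eventually_elim (auto simp: N_def)
qed

lemma in_Lp_loc_1_diff:
  assumes f: "in_Lp_loc 1 U f" and g: "in_Lp_loc 1 U g" and U: "open U"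
  shows "in_Lp_loc 1 U (\<lambda>x. f x - g x)"
  unfolding in_Lp_loc_def
proof (intro conjI allI impI)
  have fm: "f \<in> borel_measurable (lebesgue_on U)" and gm: "g \<in> borel_measurable (lebesgue_on U)"
    using f g by (auto simp: in_Lp_loc_def)
  then show "(\<lambda>x. f x - g x) \<in> borel_measurable (lebesgue_on U)" by (rule borel_measurable_diff)
  have Um: "U \<in> sets lebesgue" using U by auto
  fix K assume K: "compact K \<and> K \<subseteq> U"
  have m: "(\<lambda>x. ennreal (\<bar>h x\<bar> powr 1) * indicator K x) \<in> borel_measurable lebesgue" if "h \<in> borel_measurable (lebesgue_on U)" for h :: "'a \<Rightarrow> real"
  proof -
    have "(\<lambda>x. indicator U x *\<^sub>R h x) \<in> borel_measurable lebesgue"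
      using that Um by (simp add: borel_measurable_restrict_space_iff)
    then have "(\<lambda>x. ennreal \<bar>indicator U x *\<^sub>R h x\<bar> * indicator K x) \<in> borel_measurable lebesgue"
      using K by (intro borel_measurable_times_ennreal borel_measurable_indicator measurable_compose[OF _ measurable_ennreal] borel_measurable_abs) (auto simp: compact_imp_closed)
    also have "(\<lambda>x. ennreal \<bar>indicator U x *\<^sub>R h x\<bar> * indicator K x) = (\<lambda>x. ennreal (\<bar>h x\<bar> powr 1) * indicator K x)"
      using K by (auto simp: indicator_def fun_eq_iff)
    finally show ?thesis .
  qed
  have "(\<integral>\<^sup>+x\<in>K. ennreal (\<bar>f x - g x\<bar> powr 1) \<partial>lebesgue) \<le> (\<integral>\<^sup>+x. ennreal (\<bar>f x\<bar> powr 1) * indicator K x + ennreal (\<bar>g x\<bar> powr 1) * indicator K x \<partial>lebesgue)"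
    by (rule nn_integral_mono) (auto simp: indicator_def ennreal_plus[symmetric] simp del: ennreal_plus intro!: ennreal_leI)
  also have "\<dots> = (\<integral>\<^sup>+x\<in>K. ennreal (\<bar>f x\<bar> powr 1) \<partial>lebesgue) + (\<integral>\<^sup>+x\<in>K. ennreal (\<bar>g x\<bar> powr 1) \<partial>lebesgue)"
    by (rule nn_integral_add[OF m[OF fm] m[OF gm]])
  also have "\<dots> < \<infinity>"
    using f g K unfolding in_Lp_loc_def by (simp add: ennreal_add_less_top)
  finally show "(\<integral>\<^sup>+x\<in>K. ennreal (\<bar>f x - g x\<bar> powr 1) \<partial>lebesgue) < \<infinity>" .
qed

lemma set_integral_mult_cong_AE:
  fixes u u' :: "'b::euclidean_space \<Rightarrow> real"
  assumes "u \<in> borel_measurable (lebesgue_on U)" "u' \<in> borel_measurable (lebesgue_on U)" "open U"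
    and "continuous_on UNIV \<phi>" "AE x in lborel. x \<in> U \<longrightarrow> u x = u' x"
  shows "(LINT x:U|lebesgue. u x * \<phi> x) = (LINT x:U|lebesgue. u' x * \<phi> x)"
  unfolding set_lebesgue_integral_def
proof (rule integral_cong_AE)
  have Um: "U \<in> sets lebesgue" using assms by auto
  have pm: "\<phi> \<in> borel_measurable lebesgue"
    using borel_measurable_continuous_onI[OF assms(4)] by (intro measurable_completion) simp
  have "(\<lambda>x. indicator U x *\<^sub>R (h x * \<phi> x)) \<in> borel_measurable lebesgue" if "h \<in> borel_measurable (lebesgue_on U)" for h :: "'b \<Rightarrow> real"
  proof -
    have "(\<lambda>x. indicator U x *\<^sub>R h x) \<in> borel_measurable lebesgue"
      using that Um by (simp add: borel_measurable_restrict_space_iff)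
    from borel_measurable_times[OF this pm] show ?thesis by (simp add: mult.assoc)
  qed
  then show "(\<lambda>x. indicator U x *\<^sub>R (u x * \<phi> x)) \<in> borel_measurable lebesgue" "(\<lambda>x. indicator U x *\<^sub>R (u' x * \<phi> x)) \<in> borel_measurable lebesgue"
    using assms by auto
  show "AE x in lebesgue. indicator U x *\<^sub>R (u x * \<phi> x) = indicator U x *\<^sub>R (u' x * \<phi> x)"
    unfolding AE_lebesgue_iff using assms(5) by eventually_elim (auto simp: indicator_def)
qed

lemma in_Lp_loc_AE:
  assumes "in_Lp_loc p U u" "u' \<in> borel_measurable (lebesgue_on U)" "AE x in lborel. x \<in> U \<longrightarrow> u x = u' x"
  shows "in_Lp_loc p U u'"
  unfolding in_Lp_loc_def
proof (intro conjI allI impI assms(2))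
  fix K assume K: "compact K \<and> K \<subseteq> U"
  have "(\<integral>\<^sup>+x\<in>K. ennreal (\<bar>u' x\<bar> powr p) \<partial>lebesgue) = (\<integral>\<^sup>+x\<in>K. ennreal (\<bar>u x\<bar> powr p) \<partial>lebesgue)"
    by (rule nn_integral_cong_AE, unfold AE_lebesgue_iff, use assms(3) in eventually_elim) (use K in \<open>auto simp: indicator_def\<close>)
  then show "(\<integral>\<^sup>+x\<in>K. ennreal (\<bar>u' x\<bar> powr p) \<partial>lebesgue) < \<infinity>" using assms(1) K unfolding in_Lp_loc_def by simp
qed

lemma test_function_partials:
  "test_function U \<phi> \<Longrightarrow> set bs \<subseteq> Basis \<Longrightarrow> test_function U (partials bs \<phi>)"
  by (induction bs) (auto intro: test_function_pd)

lemma has_weak_partial_AE: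
  fixes u u' :: "'b::euclidean_space \<Rightarrow> real"
  assumes w: "has_weak_partial U bs u g" and U: "open U" and bs: "set bs \<subseteq> Basis"
    and m: "u' \<in> borel_measurable (lebesgue_on U)" and ae: "AE x in lborel. x \<in> U \<longrightarrow> u x = u' x"
  shows "has_weak_partial U bs u' g"
  unfolding has_weak_partial_def
proof (intro conjI allI impI)
  have um: "u \<in> borel_measurable (lebesgue_on U)" using w by (auto simp: has_weak_partial_def in_Lp_loc_def)
  show "in_Lp_loc 1 U u'" by (rule in_Lp_loc_AE[OF _ m ae]) (use w in \<open>auto simp: has_weak_partial_def\<close>)
  show "in_Lp_loc 1 U g" using w by (auto simp: has_weak_partial_def)
  fix \<phi> assume t: "test_function U \<phi>"
  have "(LINT x:U|lebesgue. u x * partials bs \<phi> x) = (LINT x:U|lebesgue. u' x * partials bs \<phi> x)"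
    by (rule set_integral_mult_cong_AE[OF um m U test_function_facts(1)[OF test_function_partials[OF t bs]] ae])
  then show "(LINT x:U|lebesgue. u' x * partials bs \<phi> x) = (- 1) ^ length bs * (LINT x:U|lebesgue. g x * \<phi> x)"
    using w t by (simp add: has_weak_partial_def)
qed

lemma has_weak_partial_unique:
  assumes "has_weak_partial U bs u g" "has_weak_partial U bs u g'" "open U"
  shows "AE x in lborel. x \<in> U \<longrightarrow> g x = g' x"
proof -
  have l: "in_Lp_loc 1 U g" "in_Lp_loc 1 U g'" using assms by (auto simp: has_weak_partial_def)
  have "AE x in lborel. x \<in> U \<longrightarrow> g x - g' x = 0"
  proof (rule test_functions_separate[OF assms(3) in_Lp_loc_1_diff[OF l assms(3)]])
    fix \<phi> assume t: "test_function U \<phi>"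
    have "(LINT x:U|lebesgue. g x * \<phi> x) = (LINT x:U|lebesgue. g' x * \<phi> x)"
    proof -
      have "(- 1) ^ length bs * (LINT x:U|lebesgue. g x * \<phi> x) = (- 1) ^ length bs * (LINT x:U|lebesgue. g' x * \<phi> x)"
        using assms(1,2) t by (simp add: has_weak_partial_def)
      then show ?thesis by simp
    qed
    then show "(LINT x:U|lebesgue. (g x - g' x) * \<phi> x) = 0"
      using in_Lp_loc_1_integrable_mult[OF l(1) assms(3) t] in_Lp_loc_1_integrable_mult[OF l(2) assms(3) t]
      by (simp add: left_diff_distrib set_integral_diff)
  qed
  then show ?thesis by simp
qed

lemma weak_partial_works: "has_weak_partial U bs u g \<Longrightarrow> has_weak_partial U bs u (weak_partial U bs u)"
  unfolding weak_partial_def by (rule someI[of "has_weak_partial U bs u"])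

lemma weak_partial_AE_eq:
  assumes "has_weak_partial U bs u g" "open U"
  shows "AE x in lborel. x \<in> U \<longrightarrow> weak_partial U bs u x = g x"
  by (rule has_weak_partial_unique[OF weak_partial_works[OF assms(1)] assms])

text \<open>The derivative of the rescaled kernel \<zeta> is 1/r times the rescaled derivative of
  \<Psi>, so testing the weak derivative with \<zeta> moves it from the kernel to the function and
  gains a factor r. The functions f and g are Borel representatives of f0 and g0.\<close>

lemma mol_pd_weak_partial:
  fixes f0 g0 :: "'a::euclidean_space \<Rightarrow> real"
  assumes w: "has_weak_partial UNIV [b] f0 g0" and b: "b \<in> Basis"
    and f: "f \<in> borel_measurable borel" "AE x in lborel. f0 x = f x"
    and g: "g \<in> borel_measurable borel" "AE x in lborel. g0 x = g x"
    and \<Psi>: "kern \<Psi>" and r: "r > 0"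
  shows "mol (pd b \<Psi>) f (x, r) = - r * mol \<Psi> g (x, r)"
proof -
  define \<zeta> where "\<zeta> z = \<Psi> ((1 / r) *\<^sub>R (z - x))" for z
  have t: "test_function UNIV \<zeta>" unfolding \<zeta>_def by (rule kern_test_function[OF \<Psi> r]) simp
  have pd\<zeta>: "pd b \<zeta> z = (1 / r) * pd b \<Psi> ((1 / r) *\<^sub>R (z - x))" for z
  proof -
    have lin: "linear (frechet_derivative \<Psi> (at y))" for y by (rule has_derivative_linear[OF kern_has_derivative[OF \<Psi>]])
    have "(\<zeta> has_derivative (\<lambda>t. frechet_derivative \<Psi> (at ((1 / r) *\<^sub>R (z - x))) ((1 / r) *\<^sub>R t))) (at z)"
      unfolding \<zeta>_def
      by (rule has_derivative_compose[where g=\<Psi> and f="\<lambda>z. (1 / r) *\<^sub>R (z - x)"])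
         (auto intro!: derivative_eq_intros kern_has_derivative[OF \<Psi>])
    from pd_eq[OF this, of b] show ?thesis by (simp only: linear_cmul[OF lin]) simp
  qed
  have eq: "(LINT z:UNIV|lebesgue. u0 z * \<theta> z) = (\<integral>z. u z * \<theta> z \<partial>lborel)"
    if "u0 \<in> borel_measurable (lebesgue_on UNIV)" "u \<in> borel_measurable borel" "AE x in lborel. u0 x = u x" "continuous_on UNIV \<theta>" for u u0 \<theta> :: "'a \<Rightarrow> real"
  proof -
    have um: "u \<in> borel_measurable (lebesgue_on UNIV)"
      using that(2) by (simp add: lebesgue_on_UNIV_eq measurable_completion)
    have "(LINT z:UNIV|lebesgue. u0 z * \<theta> z) = (LINT z:UNIV|lebesgue. u z * \<theta> z)"
      by (rule set_integral_mult_cong_AE[OF that(1) um _ that(4)]) (use that(3) in auto)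
    also have "\<dots> = (\<integral>z. u z * \<theta> z \<partial>lborel)"
      unfolding set_lebesgue_integral_def
      using integral_completion[of "\<lambda>z. u z * \<theta> z" lborel] borel_measurable_continuous_onI[OF that(4)] that(2) by simp
    finally show ?thesis .
  qed
  have m: "f0 \<in> borel_measurable (lebesgue_on UNIV)" "g0 \<in> borel_measurable (lebesgue_on UNIV)"
    using w by (auto simp: has_weak_partial_def in_Lp_loc_def)
  have "(LINT z:UNIV|lebesgue. f0 z * pd b \<zeta> z) = - (LINT z:UNIV|lebesgue. g0 z * \<zeta> z)"
    using w t unfolding has_weak_partial_def by fastforce
  then have "(\<integral>z. f z * pd b \<zeta> z \<partial>lborel) = - (\<integral>z. g z * \<zeta> z \<partial>lborel)"
    using eq[OF m(1) f test_function_facts(2)[OF t b]] eq[OF m(2) g test_function_facts(1)[OF t]] by simp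
  then have "(1 / r) * (\<integral>z. f z * pd b \<Psi> ((1 / r) *\<^sub>R (z - x)) \<partial>lborel) = - (\<integral>z. g z * \<zeta> z \<partial>lborel)"
    unfolding pd\<zeta> by (simp add: mult.left_commute[of _ "1 / r"])
  then show ?thesis
    unfolding mol_eq[OF f(1) kern_pd[OF \<Psi> b] r] mol_eq[OF g(1) \<Psi> r] \<zeta>_def[symmetric]
    using r by (simp add: field_simps)
qed

subsection \<open>Mollification with variable radius\<close>

definition tau :: "real \<Rightarrow> real \<Rightarrow> real \<Rightarrow> real \<Rightarrow> real" where
  "tau \<kappa> bm bp t = \<kappa> * (t - bm) * (bp - t) / (bp - bm)"

lemma tau_pos: "\<kappa> > 0 \<Longrightarrow> t \<in> {bm<..<bp} \<Longrightarrow> tau \<kappa> bm bp t > 0"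
  by (auto simp: tau_def)

lemma tau_le: 
  assumes "\<kappa> > 0" "t \<in> {bm<..<bp}"
  shows "tau \<kappa> bm bp t \<le> \<kappa> * (t - bm)" "tau \<kappa> bm bp t \<le> \<kappa> * (bp - t)" "tau \<kappa> bm bp t < \<kappa> * (bp - bm)"
proof -
  have L: "bp - bm > 0" and t: "t - bm > 0" "bp - t > 0" using assms by auto
  have "\<kappa> * (t - bm) * (bp - t) \<le> \<kappa> * (t - bm) * (bp - bm)" using assms t by (intro mult_left_mono) auto
  then show 1: "tau \<kappa> bm bp t \<le> \<kappa> * (t - bm)" using L by (simp add: tau_def divide_le_eq)
  have "\<kappa> * (bp - t) * (t - bm) \<le> \<kappa> * (bp - t) * (bp - bm)" using assms t by (intro mult_left_mono) auto
  then show "tau \<kappa> bm bp t \<le> \<kappa> * (bp - t)" using L by (simp add: tau_def divide_le_eq mult.assoc mult.commute[of "t - bm"])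
  have "\<kappa> * (t - bm) < \<kappa> * (bp - bm)" using assms t by (intro mult_strict_left_mono) auto
  with 1 show "tau \<kappa> bm bp t < \<kappa> * (bp - bm)" by simp
qed

text \<open>The radius is comparable to \<kappa> times the distance to the nearer end, because the
  distance to the other end is at least half the width.\<close>

lemma tau_ge:
  assumes "\<kappa> > 0" "t \<in> {bm<..<bp}"
  shows "\<kappa> * (t - bm) / 2 \<le> tau \<kappa> bm bp t \<or> \<kappa> * (bp - t) / 2 \<le> tau \<kappa> bm bp t"
proof -
  have L: "bp - bm > 0" and t: "t - bm > 0" "bp - t > 0" using assms by auto
  show ?thesis
  proof (cases "bp - t \<ge> (bp - bm) / 2")
    case True
    have "\<kappa> * (t - bm) * ((bp - bm) / 2) \<le> \<kappa> * (t - bm) * (bp - t)" using assms t True by (intro mult_left_mono) auto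
    then show ?thesis using L by (simp add: tau_def le_divide_eq)
  next
    case False
    then have "\<kappa> * (bp - t) * ((bp - bm) / 2) \<le> \<kappa> * (bp - t) * (t - bm)" using assms t by (intro mult_left_mono) (auto simp: field_simps)
    then show ?thesis using L by (simp add: tau_def le_divide_eq mult.assoc mult.commute[of "t - bm"])
  qed
qed

lemma tau_deriv: "(tau \<kappa> bm bp has_real_derivative (\<kappa> * (bm + bp - 2 * t) / (bp - bm))) (at t)"
  unfolding tau_def[abs_def] divide_inverse by (auto intro!: derivative_eq_intros simp: algebra_simps)

lemma tau_continuous: "continuous_on S (tau \<kappa> bm bp)"
  unfolding tau_def[abs_def] divide_inverse by (intro continuous_intros)

lemma tau_measurable: "tau \<kappa> bm bp \<in> borel_measurable borel"
  by (rule borel_measurable_continuous_onI[OF tau_continuous])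

lemma nn_integral_tail:
  assumes "q > 1" "\<rho> > 0"
  shows "(\<integral>\<^sup>+s. ennreal (s powr (- q)) * indicator {\<rho>..} s \<partial>lborel) = ennreal (\<rho> powr (1 - q) / (q - 1))"
proof -
  have "(\<integral>\<^sup>+s. ennreal (s powr (- q)) * indicator {\<rho>..} s \<partial>lborel) = ennreal (0 - (- (\<rho> powr (1 - q) / (q - 1))))"
  proof (rule nn_integral_FTC_atLeast)
    show "(\<lambda>s. s powr (- q)) \<in> borel_measurable borel" by measurable
    show "((\<lambda>s. - (s powr (1 - q) / (q - 1))) has_real_derivative x powr (- q)) (at x)" if "\<rho> \<le> x" for x
    proof -
      have x: "x > 0" using that assms by simp
      have e: "- ((1 - q) * y / (q - 1)) = y" for y using assms(1) by (simp add: divide_simps) (simp add: algebra_simps)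
      have "((\<lambda>s. s powr (1 - q)) has_real_derivative ((1 - q) * x powr (1 - q - 1))) (at x)"
        by (rule has_real_derivative_powr[OF x])
      from DERIV_minus[OF DERIV_cdivide[OF this, of "q - 1"]] show ?thesis unfolding e by simp
    qed
    have "((\<lambda>s. s powr (1 - q)) \<longlongrightarrow> 0) at_top"
      by (rule tendsto_neg_powr) (use assms filterlim_ident in auto)
    then have "((\<lambda>s. - (s powr (1 - q) / (q - 1))) \<longlongrightarrow> - (0 / (q - 1))) at_top"
      using assms by (intro tendsto_intros) auto
    then show "((\<lambda>s. - (s powr (1 - q) / (q - 1))) \<longlongrightarrow> 0) at_top" by simp
  qed simp
  then show ?thesis by simp
qed

text \<open>Near each end the radius is comparable to the distance from it, so the integral is at
  most two tails of s^(-q). The constant depends on \<kappa> and q but not on the strip, since the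
  tails extend to infinity.\<close>

lemma tau_integral:
  assumes \<kappa>: "\<kappa> > 0" and q: "q > 1"
  obtains C :: real where "C > 0" "\<And>bm bp \<rho>. bm < bp \<Longrightarrow> \<rho> > 0 \<Longrightarrow>
    (\<integral>\<^sup>+t. ennreal (tau \<kappa> bm bp t powr (- q)) * (indicator {bm<..<bp} t * (if \<rho> \<le> tau \<kappa> bm bp t then 1 else 0)) \<partial>lborel)
      \<le> ennreal (C * \<rho> powr (1 - q))"
proof (rule that[of "2 * ((\<kappa> / 2) powr (- q) * (\<kappa> powr (q - 1) / (q - 1)))"])
  show "2 * ((\<kappa> / 2) powr (- q) * (\<kappa> powr (q - 1) / (q - 1))) > 0" using \<kappa> q by simp
  fix bm bp \<rho> :: real assume b: "bm < bp" and \<rho>: "\<rho> > 0"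
  \<comment> \<open>The majorant at distance s from an end: the lower bound \<kappa> s / 2 for the
    radius gives the constant, the upper bound \<kappa> s turns \<rho> \<le> \<tau> into s \<ge>
    \<rho> / \<kappa>.\<close>
  define \<phi> where "\<phi> s = ennreal ((\<kappa> / 2) powr (- q)) * (ennreal (s powr (- q)) * indicator {\<rho> / \<kappa>..} s)" for s
  have \<phi>m [measurable]: "\<phi> \<in> borel_measurable borel" unfolding \<phi>_def by measurable
  have le: "ennreal (tau \<kappa> bm bp t powr (- q)) * (indicator {bm<..<bp} t * (if \<rho> \<le> tau \<kappa> bm bp t then 1 else 0))
    \<le> \<phi> (- bm + 1 * t) + \<phi> (bp + (- 1) * t)" for t
  proof (cases "t \<in> {bm<..<bp} \<and> \<rho> \<le> tau \<kappa> bm bp t")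
    case True
    then have t: "t \<in> {bm<..<bp}" by simp
    have *: "ennreal (tau \<kappa> bm bp t powr (- q)) \<le> \<phi> s" if "s > 0" "\<kappa> * s / 2 \<le> tau \<kappa> bm bp t" "tau \<kappa> bm bp t \<le> \<kappa> * s" for s
    proof -
      have "tau \<kappa> bm bp t powr (- q) \<le> (\<kappa> / 2 * s) powr (- q)"
        using that \<kappa> q by (intro powr_mono2') auto
      also have "\<dots> = (\<kappa> / 2) powr (- q) * s powr (- q)" using \<kappa> that by (intro powr_mult)
      finally have "ennreal (tau \<kappa> bm bp t powr (- q)) \<le> ennreal ((\<kappa> / 2) powr (- q)) * ennreal (s powr (- q))"
        by (subst ennreal_mult[symmetric]) (auto intro: ennreal_leI)
      moreover have "s \<ge> \<rho> / \<kappa>" using True that(3) \<kappa> by (simp add: field_simps)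
      ultimately show ?thesis by (simp add: \<phi>_def)
    qed
    consider "\<kappa> * (t - bm) / 2 \<le> tau \<kappa> bm bp t" | "\<kappa> * (bp - t) / 2 \<le> tau \<kappa> bm bp t"
      using tau_ge[OF \<kappa> t] by blast
    then have "ennreal (tau \<kappa> bm bp t powr (- q)) \<le> \<phi> (t - bm) + \<phi> (bp - t)"
    proof cases
      case 1
      then have "ennreal (tau \<kappa> bm bp t powr (- q)) \<le> \<phi> (t - bm)"
        using * [of "t - bm"] t tau_le(1)[OF \<kappa> t] by simp
      then show ?thesis by (simp add: add_increasing2)
    next
      case 2
      then have "ennreal (tau \<kappa> bm bp t powr (- q)) \<le> \<phi> (bp - t)"
        using * [of "bp - t"] t tau_le(2)[OF \<kappa> t] by simp
      then show ?thesis by (simp add: add_increasing)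
    qed
    then show ?thesis using True by simp
  next
    case False
    then show ?thesis by (auto simp: indicator_def)
  qed
  have I: "(\<integral>\<^sup>+s. \<phi> s \<partial>lborel) = ennreal ((\<kappa> / 2) powr (- q) * (\<kappa> powr (q - 1) / (q - 1)) * \<rho> powr (1 - q))"
  proof -
    have "(\<integral>\<^sup>+s. \<phi> s \<partial>lborel) = ennreal ((\<kappa> / 2) powr (- q)) * ennreal ((\<rho> / \<kappa>) powr (1 - q) / (q - 1))"
      unfolding \<phi>_def using nn_integral_tail[OF q, of "\<rho> / \<kappa>"] \<rho> \<kappa> by (subst nn_integral_cmult) auto
    moreover have "(\<rho> / \<kappa>) powr (1 - q) = \<rho> powr (1 - q) * \<kappa> powr (q - 1)"
      using powr_minus[of \<kappa> "1 - q"] by (simp add: powr_divide) (simp add: divide_inverse)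
    ultimately show ?thesis using q by (simp add: ennreal_mult[symmetric] ac_simps)
  qed
  have "(\<integral>\<^sup>+t. ennreal (tau \<kappa> bm bp t powr (- q)) * (indicator {bm<..<bp} t * (if \<rho> \<le> tau \<kappa> bm bp t then 1 else 0)) \<partial>lborel)
    \<le> (\<integral>\<^sup>+t. \<phi> (- bm + 1 * t) + \<phi> (bp + (- 1) * t) \<partial>lborel)" by (rule nn_integral_mono) (rule le)
  also have "\<dots> = (\<integral>\<^sup>+t. \<phi> (- bm + 1 * t) \<partial>lborel) + (\<integral>\<^sup>+t. \<phi> (bp + (- 1) * t) \<partial>lborel)"
    by (rule nn_integral_add) measurable
  also have "\<dots> = (\<integral>\<^sup>+s. \<phi> s \<partial>lborel) + (\<integral>\<^sup>+s. \<phi> s \<partial>lborel)"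
    using nn_integral_real_affine[OF \<phi>m, of 1 "- bm"] nn_integral_real_affine[OF \<phi>m, of "- 1" bp] by simp
  also have "\<dots> = ennreal (2 * ((\<kappa> / 2) powr (- q) * (\<kappa> powr (q - 1) / (q - 1))) * \<rho> powr (1 - q))"
    unfolding I using q by (simp add: ennreal_plus[symmetric] del: ennreal_plus)
  finally show "(\<integral>\<^sup>+t. ennreal (tau \<kappa> bm bp t powr (- q)) * (indicator {bm<..<bp} t * (if \<rho> \<le> tau \<kappa> bm bp t then 1 else 0)) \<partial>lborel)
    \<le> ennreal (2 * ((\<kappa> / 2) powr (- q) * (\<kappa> powr (q - 1) / (q - 1))) * \<rho> powr (1 - q))" .
qed

definition tmol :: "real \<Rightarrow> real \<Rightarrow> real \<Rightarrow> ('a::euclidean_space \<Rightarrow> real) \<Rightarrow> ('a \<Rightarrow> real) \<Rightarrow> 'a \<times> real \<Rightarrow> real" where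
  "tmol \<kappa> bm bp \<Psi> f q = mol \<Psi> f (fst q, tau \<kappa> bm bp (snd q))"

text \<open>The seminorm for scalar functions over \<open>lborel\<close>, the measure in which all
  estimates run; gradients are treated by components.\<close>

definition tilde_W_scalar :: "real \<Rightarrow> real \<Rightarrow> ('a::euclidean_space \<Rightarrow> real) \<Rightarrow> ennreal" where
  "tilde_W_scalar a p g = (\<integral>\<^sup>+x. (\<integral>\<^sup>+h\<in>ball 0 a. ennreal (\<bar>g (x + h) - g x\<bar> powr p / norm h powr (p + real DIM('a) - 1)) \<partial>lborel) \<partial>lborel)"

text \<open>The core estimate. Write n for the dimension of the tangential space. Jensen's
  inequality and the substitution h = \<tau> y bound the integrand at (x, t) by the integral of
  |g(x+h) - g(x)|^p \<tau>^(-p-n) over |h| \<le> \<tau>(t). Integrating in t before h leaves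
  |h|^(1-p-n), exactly the weight of the seminorm.\<close>

lemma tmol_singular_Lpp:
  fixes \<Psi> :: "'a::euclidean_space \<Rightarrow> real"
  assumes \<Psi>: "kern \<Psi>" "integral\<^sup>L lborel \<Psi> = 0" and p: "p \<ge> 1" and \<kappa>: "\<kappa> > 0"
  obtains C :: real where "C > 0" "\<And>a bm bp g c. bm < bp \<Longrightarrow> \<kappa> * (bp - bm) \<le> a \<Longrightarrow> Lloc 1 g \<Longrightarrow>
    (\<And>t. t \<in> {bm<..<bp} \<Longrightarrow> \<bar>c t\<bar> \<le> M / tau \<kappa> bm bp t) \<Longrightarrow>
    Lpp p (strip bm bp) (\<lambda>q. c (snd q) * tmol \<kappa> bm bp \<Psi> g q) \<le> ennreal C * tilde_W_scalar a p g"
proof -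
  let ?n = "real DIM('a)"
  obtain C1 where C1: "C1 > 0" "\<And>G. G \<in> borel_measurable borel \<Longrightarrow>
    ennreal (\<bar>\<integral>y. G y * \<Psi> y \<partial>lborel\<bar> powr p) \<le> ennreal C1 * Lpp p (cball 0 1) G"
    using Lpp_ennreal_powr_integral[OF \<Psi>(1) p] by blast
  have n1: "?n \<ge> 1" using DIM_positive[where 'a='a] by linarith
  have pn: "p + ?n > 1" using p n1 by linarith
  obtain C2 where C2: "C2 > 0" "\<And>bm bp \<rho>. bm < bp \<Longrightarrow> \<rho> > 0 \<Longrightarrow>
    (\<integral>\<^sup>+t. ennreal (tau \<kappa> bm bp t powr (- (p + ?n))) * (indicator {bm<..<bp} t * (if \<rho> \<le> tau \<kappa> bm bp t then 1 else 0)) \<partial>lborel)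
      \<le> ennreal (C2 * \<rho> powr (1 - (p + ?n)))"
    using tau_integral[OF \<kappa> pn] by blast
  \<comment> \<open>The absolute value and the summand 1 make the constant positive for every
    M.\<close>
  define C where "C = (\<bar>M\<bar> powr p + 1) * (C1 * C2)"
  show ?thesis
  proof (rule that[of C])
    show "C > 0" unfolding C_def using C1 C2 by (intro mult_pos_pos add_nonneg_pos) auto
    fix a bm bp :: real and g :: "'a \<Rightarrow> real" and c :: "real \<Rightarrow> real"
    assume b: "bm < bp" and a: "\<kappa> * (bp - bm) \<le> a" and g: "Lloc 1 g"
      and c: "\<And>t. t \<in> {bm<..<bp} \<Longrightarrow> \<bar>c t\<bar> \<le> M / tau \<kappa> bm bp t"
    have gm: "g \<in> borel_measurable borel" using g by (simp add: Lloc_def)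
    define \<tau> where "\<tau> = tau \<kappa> bm bp"
    have \<tau>m: "\<tau> \<in> borel_measurable borel" unfolding \<tau>_def by (rule tau_measurable)
    define W where "W x h = ennreal (\<bar>g (x + h) - g x\<bar> powr p)" for x h
    \<comment> \<open>The weight that remains after the substitution; it separates from the
      difference of g, so the integral in t concerns k alone.\<close>
    define k where "k h t = ennreal (\<tau> t powr (- (p + ?n))) * (indicator {bm<..<bp} t * (if norm h \<le> \<tau> t then 1 else 0 :: ennreal))" for h :: 'a and t
    define N where "N = \<bar>M\<bar> powr p"
    have pt: "ennreal (\<bar>c (snd q) * tmol \<kappa> bm bp \<Psi> g q\<bar> powr p) * indicator (strip bm bp) q
      \<le> ennreal (N * C1) * (\<integral>\<^sup>+h. W (fst q) h * k h (snd q) \<partial>lborel)" for q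
    proof (cases "q \<in> strip bm bp")
      case True
      obtain x t where q: "q = (x, t)" by (cases q)
      have t: "t \<in> {bm<..<bp}" using True by (simp add: q strip_def)
      have \<tau>t: "\<tau> t > 0" unfolding \<tau>_def by (rule tau_pos[OF \<kappa> t])
      have e1: "tmol \<kappa> bm bp \<Psi> g q = (\<integral>y. (g (x + \<tau> t *\<^sub>R y) - g x) * \<Psi> y \<partial>lborel)"
        using mol_minus_const[OF g \<Psi>(1) \<tau>t, of x] \<Psi>(2) by (simp add: tmol_def q \<tau>_def)
      have "ennreal (\<bar>tmol \<kappa> bm bp \<Psi> g q\<bar> powr p) \<le> ennreal C1 * Lpp p (cball 0 1) (\<lambda>y. g (x + \<tau> t *\<^sub>R y) - g x)"
        unfolding e1 by (rule C1(2)) (use gm in measurable)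
      also have "Lpp p (cball 0 1) (\<lambda>y. g (x + \<tau> t *\<^sub>R y) - g x) = ennreal (\<tau> t powr (- ?n)) * (\<integral>\<^sup>+h. W x h * (if norm h \<le> \<tau> t then 1 else 0) \<partial>lborel)"
      proof -
        have m: "(\<lambda>h. W x h * (if norm h \<le> \<tau> t then 1 else 0)) \<in> borel_measurable borel"
          unfolding W_def using gm by measurable
        have "(\<integral>\<^sup>+h. W x h * (if norm h \<le> \<tau> t then 1 else 0) \<partial>lborel)
          = ennreal (\<tau> t ^ DIM('a)) * (\<integral>\<^sup>+y. W x (0 + \<tau> t *\<^sub>R y) * (if norm (0 + \<tau> t *\<^sub>R y) \<le> \<tau> t then 1 else 0) \<partial>lborel)"
          using nn_integral_affine[OF m, of "\<tau> t" 0] \<tau>t by simp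
        also have "(\<integral>\<^sup>+y. W x (0 + \<tau> t *\<^sub>R y) * (if norm (0 + \<tau> t *\<^sub>R y) \<le> \<tau> t then 1 else 0) \<partial>lborel)
          = Lpp p (cball 0 1) (\<lambda>y. g (x + \<tau> t *\<^sub>R y) - g x)"
          unfolding Lpp_def W_def by (rule nn_integral_cong) (use \<tau>t in \<open>auto simp: indicator_def\<close>)
        finally have "(\<integral>\<^sup>+h. W x h * (if norm h \<le> \<tau> t then 1 else 0) \<partial>lborel) = ennreal (\<tau> t ^ DIM('a)) * Lpp p (cball 0 1) (\<lambda>y. g (x + \<tau> t *\<^sub>R y) - g x)" .
        moreover have "ennreal (\<tau> t powr (- ?n)) * ennreal (\<tau> t ^ DIM('a)) = 1"
          using \<tau>t by (simp add: ennreal_mult[symmetric] powr_minus powr_realpow)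
        ultimately show ?thesis by (simp only: mult.assoc[symmetric] mult_1_left)
      qed
      finally have 1: "ennreal (\<bar>tmol \<kappa> bm bp \<Psi> g q\<bar> powr p) \<le> ennreal C1 * (ennreal (\<tau> t powr (- ?n)) * (\<integral>\<^sup>+h. W x h * (if norm h \<le> \<tau> t then 1 else 0) \<partial>lborel))" .
      have "\<bar>c t\<bar> \<le> \<bar>M\<bar> / \<tau> t" using c[OF t] \<tau>t unfolding \<tau>_def[symmetric] by (smt (verit) divide_right_mono)
      then have "\<bar>c t\<bar> powr p \<le> (\<bar>M\<bar> / \<tau> t) powr p" using p by (intro powr_mono2) auto
      also have "\<dots> = N * \<tau> t powr (- p)" using \<tau>t by (simp add: N_def powr_divide powr_minus) (simp add: divide_inverse)
      finally have c1: "\<bar>c t\<bar> powr p \<le> N * \<tau> t powr (- p)" .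
      have "ennreal (\<bar>c (snd q) * tmol \<kappa> bm bp \<Psi> g q\<bar> powr p) = ennreal (\<bar>c t\<bar> powr p) * ennreal (\<bar>tmol \<kappa> bm bp \<Psi> g q\<bar> powr p)"
        by (simp add: q abs_mult powr_mult ennreal_mult)
      also have "\<dots> \<le> ennreal (N * \<tau> t powr (- p)) * (ennreal C1 * (ennreal (\<tau> t powr (- ?n)) * (\<integral>\<^sup>+h. W x h * (if norm h \<le> \<tau> t then 1 else 0) \<partial>lborel)))"
        by (intro mult_mono ennreal_leI c1 1) auto
      also have "\<dots> = ennreal (N * C1) * (ennreal (\<tau> t powr (- p)) * ennreal (\<tau> t powr (- ?n))) * (\<integral>\<^sup>+h. W x h * (if norm h \<le> \<tau> t then 1 else 0) \<partial>lborel)"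
        using C1(1) by (simp add: N_def ennreal_mult ac_simps)
      also have "ennreal (\<tau> t powr (- p)) * ennreal (\<tau> t powr (- ?n)) = ennreal (\<tau> t powr (- (p + ?n)))"
        by (simp add: ennreal_mult[symmetric] powr_add[symmetric])
      also have "ennreal (N * C1) * ennreal (\<tau> t powr (- (p + ?n))) * (\<integral>\<^sup>+h. W x h * (if norm h \<le> \<tau> t then 1 else 0) \<partial>lborel)
        = ennreal (N * C1) * (\<integral>\<^sup>+h. ennreal (\<tau> t powr (- (p + ?n))) * (W x h * (if norm h \<le> \<tau> t then 1 else 0)) \<partial>lborel)"
        unfolding W_def using gm by (subst nn_integral_cmult) (auto simp: mult.assoc)
      also have "(\<integral>\<^sup>+h. ennreal (\<tau> t powr (- (p + ?n))) * (W x h * (if norm h \<le> \<tau> t then 1 else 0)) \<partial>lborel) = (\<integral>\<^sup>+h. W (fst q) h * k h (snd q) \<partial>lborel)"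
        by (rule nn_integral_cong) (use t in \<open>auto simp: q k_def ac_simps\<close>)
      finally show ?thesis using True by simp
    qed simp
    have km: "(\<lambda>z. k (fst z) (snd z)) \<in> borel_measurable (lborel \<Otimes>\<^sub>M lborel)"
      unfolding k_def using \<tau>m by measurable
    have Wm: "(\<lambda>z. W (fst z) (snd z)) \<in> borel_measurable (lborel \<Otimes>\<^sub>M lborel)"
      unfolding W_def using gm by measurable
    have km': "(\<lambda>z. k (u z) (v z)) \<in> borel_measurable N" if "u \<in> measurable N lborel" "v \<in> measurable N lborel" for u v and N :: "'z measure"
      using measurable_compose[OF measurable_Pair[OF that] km] by simp
    have Wm': "(\<lambda>z. W (u z) (v z)) \<in> borel_measurable N" if "u \<in> measurable N lborel" "v \<in> measurable N lborel" for u v and N :: "'z measure"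
      using measurable_compose[OF measurable_Pair[OF that] Wm] by simp
    have ml: "(\<lambda>q. \<integral>\<^sup>+h. W (fst q) h * k h (snd q) \<partial>lborel) \<in> borel_measurable (lborel \<Otimes>\<^sub>M lborel)"
      by (rule lborel.borel_measurable_nn_integral, unfold split_beta)
         (intro borel_measurable_times_ennreal km' Wm' measurable_compose[OF measurable_fst] measurable_fst measurable_snd)
    have "Lpp p (strip bm bp) (\<lambda>q. c (snd q) * tmol \<kappa> bm bp \<Psi> g q)
      \<le> (\<integral>\<^sup>+q. ennreal (N * C1) * (\<integral>\<^sup>+h. W (fst q) h * k h (snd q) \<partial>lborel) \<partial>lborel)"
      unfolding Lpp_def by (rule nn_integral_mono) (rule pt)
    also have "\<dots> = ennreal (N * C1) * (\<integral>\<^sup>+q. (\<integral>\<^sup>+h. W (fst q) h * k h (snd q) \<partial>lborel) \<partial>(lborel \<Otimes>\<^sub>M lborel))"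
      unfolding lborel_prod[symmetric] by (rule nn_integral_cmult[OF ml])
    also have "(\<integral>\<^sup>+q. (\<integral>\<^sup>+h. W (fst q) h * k h (snd q) \<partial>lborel) \<partial>(lborel \<Otimes>\<^sub>M lborel))
      = (\<integral>\<^sup>+x. (\<integral>\<^sup>+t. (\<integral>\<^sup>+h. W x h * k h t \<partial>lborel) \<partial>lborel) \<partial>lborel)"
      using lborel.nn_integral_fst[OF ml] by simp
    also have "\<dots> = (\<integral>\<^sup>+x. (\<integral>\<^sup>+h. (\<integral>\<^sup>+t. W x h * k h t \<partial>lborel) \<partial>lborel) \<partial>lborel)"
      by (intro nn_integral_cong lborel_pair.Fubini', unfold split_beta)
         (intro borel_measurable_times_ennreal km' Wm' measurable_fst measurable_snd measurable_const; simp)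
    also have "\<dots> \<le> (\<integral>\<^sup>+x. (\<integral>\<^sup>+h. ennreal C2 * (ennreal (\<bar>g (x + h) - g x\<bar> powr p / norm h powr (p + ?n - 1)) * indicator (ball 0 a) h) \<partial>lborel) \<partial>lborel)"
    proof (rule nn_integral_mono, rule nn_integral_mono_AE)
      fix x
      \<comment> \<open>The tail integral requires |h| > 0, so the origin is discarded as a null
        set.\<close>
      have "AE h in lborel. h \<noteq> (0::'a)" by (rule AE_lborel_singleton)
      then show "AE h in lborel. (\<integral>\<^sup>+t. W x h * k h t \<partial>lborel) \<le> ennreal C2 * (ennreal (\<bar>g (x + h) - g x\<bar> powr p / norm h powr (p + ?n - 1)) * indicator (ball 0 a) h)"
      proof eventually_elim
        fix h :: 'a assume h: "h \<noteq> 0"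
        have e: "(\<integral>\<^sup>+t. W x h * k h t \<partial>lborel) = W x h * (\<integral>\<^sup>+t. k h t \<partial>lborel)"
          by (rule nn_integral_cmult) (intro km' measurable_const measurable_ident_sets; simp)
        show "(\<integral>\<^sup>+t. W x h * k h t \<partial>lborel) \<le> ennreal C2 * (ennreal (\<bar>g (x + h) - g x\<bar> powr p / norm h powr (p + ?n - 1)) * indicator (ball 0 a) h)"
        proof (cases "norm h < a")
          case True
          have "(\<integral>\<^sup>+t. k h t \<partial>lborel) \<le> ennreal (C2 * norm h powr (1 - (p + ?n)))"
            unfolding k_def \<tau>_def by (rule C2(2)[OF b]) (use h in simp)
          then have "W x h * (\<integral>\<^sup>+t. k h t \<partial>lborel) \<le> W x h * ennreal (C2 * norm h powr (1 - (p + ?n)))"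
            by (rule mult_left_mono) simp
          also have "\<dots> = ennreal C2 * ennreal (\<bar>g (x + h) - g x\<bar> powr p / norm h powr (p + ?n - 1))"
            unfolding W_def using C2(1) h powr_minus[of "norm h" "p + ?n - 1"]
            by (simp add: ennreal_mult[symmetric] divide_inverse ac_simps)
          finally show ?thesis using True e by simp
        next
          case False
          \<comment> \<open>Translations of length a or more do not occur, because \<tau> < \<kappa>
            (b^+ - b^-) \<le> a.\<close>
          have "k h t = 0" for t
          proof (cases "t \<in> {bm<..<bp}")
            case True
            then have "\<tau> t < a" using tau_le(3)[OF \<kappa> True] a by (simp add: \<tau>_def)
            then show ?thesis using False by (simp add: k_def)
          qed (simp add: k_def)
          then show ?thesis by simp
        qed
      qed
    qed
    also have "\<dots> = ennreal C2 * tilde_W_scalar a p g"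
    proof -
      have m: "(\<lambda>z. ennreal (\<bar>g (fst z + snd z) - g (fst z)\<bar> powr p / norm (snd z) powr (p + ?n - 1)) * indicator (ball 0 a) (snd z)) \<in> borel_measurable (lborel \<Otimes>\<^sub>M lborel)"
      proof (rule borel_measurable_times_ennreal)
        show "(\<lambda>z. ennreal (\<bar>g (fst z + snd z) - g (fst z)\<bar> powr p / norm (snd z) powr (p + ?n - 1))) \<in> borel_measurable (lborel \<Otimes>\<^sub>M lborel)"
          using gm by measurable
        show "(\<lambda>z. indicator (ball 0 a) (snd z) :: ennreal) \<in> borel_measurable (lborel \<Otimes>\<^sub>M (lborel :: 'a measure))"
          by (rule measurable_compose[OF measurable_snd borel_measurable_indicator]) simp
      qed
      have m1: "(\<lambda>h. ennreal (\<bar>g (x + h) - g x\<bar> powr p / norm h powr (p + ?n - 1)) * indicator (ball 0 a) h) \<in> borel_measurable lborel" for x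
      proof (rule borel_measurable_times_ennreal)
        show "(\<lambda>h. ennreal (\<bar>g (x + h) - g x\<bar> powr p / norm h powr (p + ?n - 1))) \<in> borel_measurable lborel"
          using gm by measurable
      qed (rule borel_measurable_indicator, simp)
      have "(\<integral>\<^sup>+x. (\<integral>\<^sup>+h. ennreal C2 * (ennreal (\<bar>g (x + h) - g x\<bar> powr p / norm h powr (p + ?n - 1)) * indicator (ball 0 a) h) \<partial>lborel) \<partial>lborel)
        = (\<integral>\<^sup>+x. ennreal C2 * (\<integral>\<^sup>+h. ennreal (\<bar>g (x + h) - g x\<bar> powr p / norm h powr (p + ?n - 1)) * indicator (ball 0 a) h \<partial>lborel) \<partial>lborel)"
        by (intro nn_integral_cong nn_integral_cmult m1)
      also have "\<dots> = ennreal C2 * tilde_W_scalar a p g"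
        unfolding tilde_W_scalar_def
        by (rule nn_integral_cmult, rule lborel.borel_measurable_nn_integral) (use m in \<open>simp add: split_beta\<close>)
      finally show ?thesis .
    qed
    finally have "Lpp p (strip bm bp) (\<lambda>q. c (snd q) * tmol \<kappa> bm bp \<Psi> g q) \<le> ennreal (N * C1) * (ennreal C2 * tilde_W_scalar a p g)"
      by (simp add: mult_left_mono)
    also have "\<dots> = ennreal (N * C1 * C2) * tilde_W_scalar a p g"
      using C1 C2 by (simp add: N_def ennreal_mult ac_simps)
    also have "\<dots> \<le> ennreal C * tilde_W_scalar a p g"
      unfolding C_def N_def using C1 C2 by (intro mult_right_mono ennreal_leI) (auto simp: algebra_simps)
    finally show "Lpp p (strip bm bp) (\<lambda>q. c (snd q) * tmol \<kappa> bm bp \<Psi> g q) \<le> ennreal C * tilde_W_scalar a p g" .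
  qed
qed

section \<open>Derivatives of weighted mollifications\<close>

lemma dir_deriv_subset: "dir_deriv U b v w \<Longrightarrow> T \<subseteq> U \<Longrightarrow> dir_deriv T b v w"
  unfolding dir_deriv_def by (meson continuous_on_subset subsetD)

lemma dir_deriv_add: "dir_deriv U b v w \<Longrightarrow> dir_deriv U b v' w' \<Longrightarrow> dir_deriv U b (\<lambda>q. v q + v' q) (\<lambda>q. w q + w' q)"
  unfolding dir_deriv_def by (auto intro!: continuous_intros DERIV_add)

lemma dir_deriv_sum:
  "(\<And>i. i \<in> A \<Longrightarrow> dir_deriv U b (v i) (w i)) \<Longrightarrow> dir_deriv U b (\<lambda>q. \<Sum>i\<in>A. v i q) (\<lambda>q. \<Sum>i\<in>A. w i q)"
proof (induction A rule: infinite_finite_induct)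
  case (insert i A)
  then show ?case using dir_deriv_add[of U b "v i" "w i" "\<lambda>q. \<Sum>i\<in>A. v i q" "\<lambda>q. \<Sum>i\<in>A. w i q"] by simp
qed (simp_all add: dir_deriv_def continuous_on_const)

lemma dir_deriv_cong:
  assumes "dir_deriv U b v w" "\<And>q. q \<in> U \<Longrightarrow> w q = w' q"
  shows "dir_deriv U b v w'"
proof -
  have "continuous_on U w'" using assms by (simp add: dir_deriv_def cong: continuous_on_cong)
  then show ?thesis using assms by (simp add: dir_deriv_def)
qed

lemma strip_iff: "q \<in> strip bm bp \<longleftrightarrow> snd q \<in> {bm<..<bp}"
  by (cases q) (auto simp: strip_def)

lemma strip_open: "open (strip bm bp)"
  unfolding strip_def by (intro open_Times) auto

definition taud :: "real \<Rightarrow> real \<Rightarrow> real \<Rightarrow> real \<Rightarrow> real" where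
  "taud \<kappa> bm bp t = \<kappa> * (bm + bp - 2 * t) / (bp - bm)"

lemma taud_continuous: "continuous_on S (taud \<kappa> bm bp)"
  unfolding taud_def[abs_def] divide_inverse by (intro continuous_intros)

text \<open>The common form of the terms of u and of its derivatives. Differentiation stays within
  sums of this form: only coefficient, kernel and possibly the mollified function change.\<close>

definition wmol :: "real \<Rightarrow> real \<Rightarrow> real \<Rightarrow> (real \<Rightarrow> real) \<Rightarrow> ('a::euclidean_space \<Rightarrow> real) \<Rightarrow> ('a \<Rightarrow> real) \<Rightarrow> 'a \<times> real \<Rightarrow> real" where
  "wmol \<kappa> bm bp c \<Psi> f q = c (snd q) * tmol \<kappa> bm bp \<Psi> f q"

lemma tmol_continuous:
  assumes "\<kappa> > 0" "Lloc 1 f" "kern \<Psi>"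
  shows "continuous_on (strip bm bp) (tmol \<kappa> bm bp \<Psi> f)"
  unfolding tmol_def[abs_def]
  by (rule continuous_on_compose2[OF mol_continuous[OF assms(2,3)]])
     (auto intro!: continuous_intros continuous_on_compose2[OF tau_continuous[of UNIV]] simp: strip_iff intro: tau_pos[OF assms(1)])

lemma cont_snd_strip: "continuous_on {bm<..<bp} c \<Longrightarrow> continuous_on (strip bm bp) (\<lambda>q. c (snd q))"
  by (rule continuous_on_compose2[of "{bm<..<bp}" c]) (auto intro!: continuous_intros simp: strip_iff)

lemma wmol_continuous:
  assumes "\<kappa> > 0" "Lloc 1 f" "kern \<Psi>" "continuous_on {bm<..<bp} c"
  shows "continuous_on (strip bm bp) (wmol \<kappa> bm bp c \<Psi> f)"
  unfolding wmol_def[abs_def] by (intro continuous_on_mult tmol_continuous cont_snd_strip assms)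

lemma tau_quotient_continuous:
  assumes "\<kappa> > 0" "continuous_on {bm<..<bp} c"
  shows "continuous_on {bm<..<bp} (\<lambda>t. c t / tau \<kappa> bm bp t)"
  using tau_pos[OF assms(1)] by (intro continuous_on_divide assms tau_continuous) (metis less_irrefl)

lemma wmol_dx:
  fixes f :: "'a::euclidean_space \<Rightarrow> real"
  assumes \<kappa>: "\<kappa> > 0" and f: "Lloc 1 f" and \<Psi>: "kern \<Psi>" and c: "continuous_on {bm<..<bp} c" and b: "b \<in> Basis"
  shows "dir_deriv (strip bm bp) (b, 0) (wmol \<kappa> bm bp c \<Psi> f) (wmol \<kappa> bm bp (\<lambda>t. - (c t / tau \<kappa> bm bp t)) (pd b \<Psi>) f)"
  unfolding dir_deriv_def
proof (intro conjI ballI)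
  show "continuous_on (strip bm bp) (wmol \<kappa> bm bp c \<Psi> f)" by (rule wmol_continuous[OF \<kappa> f \<Psi> c])
  show "continuous_on (strip bm bp) (wmol \<kappa> bm bp (\<lambda>t. - (c t / tau \<kappa> bm bp t)) (pd b \<Psi>) f)"
    by (intro wmol_continuous[OF \<kappa> f kern_pd[OF \<Psi> b]] continuous_on_minus tau_quotient_continuous \<kappa> c)
  fix q :: "'a \<times> real" assume q: "q \<in> strip bm bp"
  obtain x t where xt: "q = (x, t)" by (cases q)
  have t: "t \<in> {bm<..<bp}" using q xt by (simp add: strip_iff)
  from DERIV_cmult[OF mol_deriv_x[OF f \<Psi> b tau_pos[OF \<kappa> t]], of "c t" x]
  show "((\<lambda>s. wmol \<kappa> bm bp c \<Psi> f (q + s *\<^sub>R (b, 0))) has_real_derivative wmol \<kappa> bm bp (\<lambda>t. - (c t / tau \<kappa> bm bp t)) (pd b \<Psi>) f q) (at 0)"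
    by (simp add: wmol_def tmol_def xt)
qed

text \<open>Product rule in the coefficient, and the chain rule through the radius, which
  contributes \<tau>' / \<tau> and the kernel \<open>star \<Psi>\<close>.\<close>

lemma wmol_dt:
  fixes f :: "'a::euclidean_space \<Rightarrow> real"
  assumes \<kappa>: "\<kappa> > 0" and f: "Lloc 1 f" and \<Psi>: "kern \<Psi>"
    and c: "\<And>t. t \<in> {bm<..<bp} \<Longrightarrow> (c has_real_derivative c' t) (at t)" and c': "continuous_on {bm<..<bp} c'"
  shows "dir_deriv (strip bm bp) (0, 1) (wmol \<kappa> bm bp c \<Psi> f)
    (\<lambda>q. wmol \<kappa> bm bp c' \<Psi> f q + wmol \<kappa> bm bp (\<lambda>t. c t * taud \<kappa> bm bp t / tau \<kappa> bm bp t) (star \<Psi>) f q)"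
  unfolding dir_deriv_def
proof (intro conjI ballI)
  have coeff_continuous: "continuous_on {bm<..<bp} c" by (rule DERIV_continuous_on) (rule has_field_derivative_at_within[OF c])
  show "continuous_on (strip bm bp) (wmol \<kappa> bm bp c \<Psi> f)" by (rule wmol_continuous[OF \<kappa> f \<Psi> coeff_continuous])
  show "continuous_on (strip bm bp) (\<lambda>q. wmol \<kappa> bm bp c' \<Psi> f q + wmol \<kappa> bm bp (\<lambda>t. c t * taud \<kappa> bm bp t / tau \<kappa> bm bp t) (star \<Psi>) f q)"
    by (intro continuous_on_add wmol_continuous[OF \<kappa> f] kern_star \<Psi> c' tau_quotient_continuous \<kappa> continuous_on_mult coeff_continuous taud_continuous)
  fix q :: "'a \<times> real" assume q: "q \<in> strip bm bp"
  obtain x t where xt: "q = (x, t)" by (cases q)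
  have t: "t \<in> {bm<..<bp}" using q xt by (simp add: strip_iff)
  have d0: "((\<lambda>s. mol \<Psi> f (x, s)) has_real_derivative (1 / tau \<kappa> bm bp t) * mol (star \<Psi>) f (x, tau \<kappa> bm bp t)) (at (tau \<kappa> bm bp t))"
    by (rule mol_deriv_r[OF f \<Psi> tau_pos[OF \<kappa> t]])
  have "((\<lambda>s. mol \<Psi> f (x, tau \<kappa> bm bp s)) has_real_derivative (1 / tau \<kappa> bm bp t) * mol (star \<Psi>) f (x, tau \<kappa> bm bp t) * taud \<kappa> bm bp t) (at t)"
    unfolding taud_def by (rule DERIV_chain2[OF d0 tau_deriv])
  from DERIV_mult[OF c[OF t] this]
  have "((\<lambda>s. wmol \<kappa> bm bp c \<Psi> f (x, s)) has_real_derivative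
     wmol \<kappa> bm bp c' \<Psi> f q + wmol \<kappa> bm bp (\<lambda>t. c t * taud \<kappa> bm bp t / tau \<kappa> bm bp t) (star \<Psi>) f q) (at t)"
    by (rule DERIV_cong[THEN DERIV_cong_ev[OF refl _ refl, THEN iffD1, rotated]])
       (auto simp: wmol_def tmol_def xt algebra_simps)
  then show "((\<lambda>s. wmol \<kappa> bm bp c \<Psi> f (q + s *\<^sub>R (0, 1))) has_real_derivative
     wmol \<kappa> bm bp c' \<Psi> f q + wmol \<kappa> bm bp (\<lambda>t. c t * taud \<kappa> bm bp t / tau \<kappa> bm bp t) (star \<Psi>) f q) (at 0)"
    using DERIV_shift[of "\<lambda>s. wmol \<kappa> bm bp c \<Psi> f (x, s)" _ 0 t] by (simp add: xt add.commute)
qed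

text \<open>That \<open>g b\<close> is the weak derivative of f along b, seen through
  mollifications. In this form it holds at every centre and radius, without exceptional sets, and
  for every kernel.\<close>

definition grad_mol :: "('a::euclidean_space \<Rightarrow> real) \<Rightarrow> ('a \<Rightarrow> 'a \<Rightarrow> real) \<Rightarrow> bool" where
  "grad_mol f g \<longleftrightarrow> (\<forall>b\<in>Basis. \<forall>\<Psi> x r. kern \<Psi> \<longrightarrow> r > 0 \<longrightarrow> mol (pd b \<Psi>) f (x, r) = - r * mol \<Psi> (g b) (x, r))"

definition coord_mult :: "'a::euclidean_space \<Rightarrow> ('a \<Rightarrow> real) \<Rightarrow> 'a \<Rightarrow> real" where
  "coord_mult b \<Psi> y = (y \<bullet> b) * \<Psi> y"

lemma kern_coord_mult: "kern \<Psi> \<Longrightarrow> kern (coord_mult b \<Psi>)"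
  unfolding coord_mult_def[abs_def] by (rule kern_inner)

text \<open>In divergence form \<open>star\<close> is a sum of derivatives of first-moment kernels.
  Moving them to f gains a factor r, which cancels the 1/r of the radius derivative.\<close>

lemma mol_star_grad:
  fixes f :: "'a::euclidean_space \<Rightarrow> real"
  assumes f: "Lloc 1 f" and g: "grad_mol f g" and \<Psi>: "kern \<Psi>" and r: "r > 0"
  shows "mol (star \<Psi>) f (x, r) = r * (\<Sum>b\<in>Basis. mol (coord_mult b \<Psi>) (g b) (x, r))"
proof -
  have "mol (star \<Psi>) f (x, r) = (\<integral>y. (\<Sum>b\<in>Basis. - (f (x + r *\<^sub>R y) * pd b (coord_mult b \<Psi>) y)) \<partial>lborel)"
    unfolding mol_def star_def coord_mult_def[abs_def] fst_conv snd_conv by (simp add: sum_distrib_left sum_negf)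
  also have "\<dots> = (\<Sum>b\<in>Basis. \<integral>y. - (f (x + r *\<^sub>R y) * pd b (coord_mult b \<Psi>) y) \<partial>lborel)"
    by (rule Bochner_Integration.integral_sum) (intro integrable_minus mol_integrable[OF f] kern_pd kern_coord_mult \<Psi> r)
  also have "\<dots> = (\<Sum>b\<in>Basis. r * mol (coord_mult b \<Psi>) (g b) (x, r))"
  proof (rule sum.cong[OF refl])
    fix b :: 'a assume b: "b \<in> Basis"
    have "mol (pd b (coord_mult b \<Psi>)) f (x, r) = - r * mol (coord_mult b \<Psi>) (g b) (x, r)"
      using g b kern_coord_mult[OF \<Psi>, of b] r unfolding grad_mol_def by blast
    then show "(\<integral>y. - (f (x + r *\<^sub>R y) * pd b (coord_mult b \<Psi>) y) \<partial>lborel) = r * mol (coord_mult b \<Psi>) (g b) (x, r)"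
      by (simp add: mol_def)
  qed
  finally show ?thesis by (simp add: sum_distrib_left)
qed

text \<open>Compared with \<open>wmol_dx\<close>, the factor 1/\<tau> has been absorbed by letting
  the derivative fall on f. The normal direction is treated likewise below.\<close>

lemma wmol_dx_grad:
  fixes f :: "'a::euclidean_space \<Rightarrow> real"
  assumes \<kappa>: "\<kappa> > 0" and f: "Lloc 1 f" and g: "grad_mol f g" and \<Psi>: "kern \<Psi>" and c: "continuous_on {bm<..<bp} c" and b: "b \<in> Basis"
  shows "dir_deriv (strip bm bp) (b, 0) (wmol \<kappa> bm bp c \<Psi> f) (wmol \<kappa> bm bp c \<Psi> (g b))"
proof (rule dir_deriv_cong[OF wmol_dx[OF \<kappa> f \<Psi> c b]])
  fix q :: "'a \<times> real" assume "q \<in> strip bm bp"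
  then have p: "tau \<kappa> bm bp (snd q) > 0" using tau_pos[OF \<kappa>] by (simp add: strip_iff)
  then have "mol (pd b \<Psi>) f (fst q, tau \<kappa> bm bp (snd q)) = - tau \<kappa> bm bp (snd q) * mol \<Psi> (g b) (fst q, tau \<kappa> bm bp (snd q))"
    using g b \<Psi> unfolding grad_mol_def by blast
  then show "wmol \<kappa> bm bp (\<lambda>t. - (c t / tau \<kappa> bm bp t)) (pd b \<Psi>) f q = wmol \<kappa> bm bp c \<Psi> (g b) q"
    using p by (simp add: wmol_def tmol_def)
qed

lemma wmol_dt_grad:
  fixes f :: "'a::euclidean_space \<Rightarrow> real"
  assumes \<kappa>: "\<kappa> > 0" and f: "Lloc 1 f" and g: "grad_mol f g" and \<Psi>: "kern \<Psi>"
    and c: "\<And>t. t \<in> {bm<..<bp} \<Longrightarrow> (c has_real_derivative c' t) (at t)" and c': "continuous_on {bm<..<bp} c'"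
  shows "dir_deriv (strip bm bp) (0, 1) (wmol \<kappa> bm bp c \<Psi> f)
    (\<lambda>q. wmol \<kappa> bm bp c' \<Psi> f q + (\<Sum>b\<in>Basis. wmol \<kappa> bm bp (\<lambda>t. c t * taud \<kappa> bm bp t) (coord_mult b \<Psi>) (g b) q))"
proof (rule dir_deriv_cong[OF wmol_dt[OF \<kappa> f \<Psi> c c']])
  fix q :: "'a \<times> real" assume "q \<in> strip bm bp"
  then have p: "tau \<kappa> bm bp (snd q) > 0" using tau_pos[OF \<kappa>] by (simp add: strip_iff)
  show "wmol \<kappa> bm bp c' \<Psi> f q + wmol \<kappa> bm bp (\<lambda>t. c t * taud \<kappa> bm bp t / tau \<kappa> bm bp t) (star \<Psi>) f q =
    wmol \<kappa> bm bp c' \<Psi> f q + (\<Sum>b\<in>Basis. wmol \<kappa> bm bp (\<lambda>t. c t * taud \<kappa> bm bp t) (coord_mult b \<Psi>) (g b) q)"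
    using p by (simp add: wmol_def tmol_def mol_star_grad[OF f g \<Psi> p] sum_distrib_left mult.assoc)
qed

lemma Lpp_Times:
  fixes S :: "'a::euclidean_space set" and I :: "real set"
  assumes "borel_on (S \<times> I) F"
  shows "Lpp p (S \<times> I) F = (\<integral>\<^sup>+t. (\<integral>\<^sup>+x. ennreal (\<bar>F (x, t)\<bar> powr p) * indicator (S \<times> I) (x, t) \<partial>lborel) \<partial>lborel)"
proof -
  have m: "(\<lambda>q. ennreal (\<bar>F q\<bar> powr p) * indicator (S \<times> I) q) \<in> borel_measurable (lborel \<Otimes>\<^sub>M lborel)"
    using borel_on_powr[OF assms, of p] by (simp add: lborel_prod)
  show ?thesis unfolding Lpp_def lborel_prod[symmetric] using lborel_pair.nn_integral_snd[OF m] by simp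
qed

text \<open>Each slice is bounded by \<open>mol_Lpp\<close> with a constant independent of the
  radius; the integral in t contributes the width. All radii are below \<kappa> (b^+ - b^-), so one
  neighbourhood S' serves for all slices.\<close>

lemma wmol_Lpp:
  fixes \<Psi> :: "'a::euclidean_space \<Rightarrow> real"
  assumes \<Psi>: "kern \<Psi>" and p: "p \<ge> 1"
  obtains C :: real where "C > 0" "\<And>\<kappa> bm bp c f M S S'. \<kappa> > 0 \<Longrightarrow> bm < bp \<Longrightarrow> Lloc 1 f \<Longrightarrow> continuous_on {bm<..<bp} c \<Longrightarrow>
    M \<ge> 0 \<Longrightarrow> (\<And>t. t \<in> {bm<..<bp} \<Longrightarrow> \<bar>c t\<bar> \<le> M) \<Longrightarrow> S \<in> sets borel \<Longrightarrow> S' \<in> sets borel \<Longrightarrow>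
    (\<And>x y. x \<in> S \<Longrightarrow> norm y \<le> \<kappa> * (bp - bm) \<Longrightarrow> x + y \<in> S') \<Longrightarrow>
    Lpp p (S \<times> {bm<..<bp}) (wmol \<kappa> bm bp c \<Psi> f) \<le> ennreal (M powr p * (C * (bp - bm))) * Lpp p S' f"
proof -
  obtain C where C: "C > 0" "\<And>f S S' r. f \<in> borel_measurable borel \<Longrightarrow> S \<in> sets borel \<Longrightarrow> S' \<in> sets borel \<Longrightarrow>
    (\<And>x y. x \<in> S \<Longrightarrow> norm y \<le> r \<Longrightarrow> x + y \<in> S') \<Longrightarrow> r \<ge> 0 \<Longrightarrow>
    Lpp p S (\<lambda>x. mol \<Psi> f (x, r)) \<le> ennreal C * Lpp p S' f" using mol_Lpp[OF \<Psi> p] by blast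
  show ?thesis
  proof (rule that[OF C(1)])
    fix \<kappa> bm bp :: real and c :: "real \<Rightarrow> real" and f :: "'a \<Rightarrow> real" and M :: real and S S' :: "'a set"
    assume \<kappa>: "\<kappa> > 0" and b: "bm < bp" and f: "Lloc 1 f" and c: "continuous_on {bm<..<bp} c"
      and M: "M \<ge> 0" "\<And>t. t \<in> {bm<..<bp} \<Longrightarrow> \<bar>c t\<bar> \<le> M" and S: "S \<in> sets borel" "S' \<in> sets borel"
      and S': "\<And>x y. x \<in> S \<Longrightarrow> norm y \<le> \<kappa> * (bp - bm) \<Longrightarrow> x + y \<in> S'"
    let ?I = "{bm<..<bp}"
    have fm: "f \<in> borel_measurable borel" using f by (simp add: Lloc_def)
    have SI: "S \<times> ?I \<in> sets borel" using S by (intro borel_Times) auto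
    have mt: "borel_on (S \<times> ?I) (tmol \<kappa> bm bp \<Psi> f)"
      by (rule borel_on_cont[OF continuous_on_subset[OF tmol_continuous[OF \<kappa> f \<Psi>]] SI]) (auto simp: strip_iff)
    have "Lpp p (S \<times> ?I) (wmol \<kappa> bm bp c \<Psi> f) \<le> ennreal (M powr p) * Lpp p (S \<times> ?I) (tmol \<kappa> bm bp \<Psi> f)"
      unfolding wmol_def[abs_def] by (rule Lpp_bounded_mult) (use p mt M in auto)
    also have "Lpp p (S \<times> ?I) (tmol \<kappa> bm bp \<Psi> f) \<le> (\<integral>\<^sup>+t. (ennreal C * Lpp p S' f) * indicator ?I t \<partial>lborel)"
      unfolding Lpp_Times[OF mt]
    proof (rule nn_integral_mono)
      fix t
      show "(\<integral>\<^sup>+x. ennreal (\<bar>tmol \<kappa> bm bp \<Psi> f (x, t)\<bar> powr p) * indicator (S \<times> ?I) (x, t) \<partial>lborel) \<le> (ennreal C * Lpp p S' f) * indicator ?I t"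
      proof (cases "t \<in> ?I")
        case True
        have "(\<integral>\<^sup>+x. ennreal (\<bar>tmol \<kappa> bm bp \<Psi> f (x, t)\<bar> powr p) * indicator (S \<times> ?I) (x, t) \<partial>lborel) = Lpp p S (\<lambda>x. mol \<Psi> f (x, tau \<kappa> bm bp t))"
          unfolding Lpp_def tmol_def by (rule nn_integral_cong) (use True in \<open>auto simp: indicator_def\<close>)
        also have "\<dots> \<le> ennreal C * Lpp p S' f"
          by (rule C(2)[OF fm S]) (use S' tau_le(3)[OF \<kappa> True] tau_pos[OF \<kappa> True] in auto)
        finally show ?thesis using True by simp
      qed simp
    qed
    also have "\<dots> = ennreal C * Lpp p S' f * ennreal (bp - bm)"
      using b by (simp add: nn_integral_cmult_indicator)
    finally have "Lpp p (S \<times> ?I) (wmol \<kappa> bm bp c \<Psi> f) \<le> ennreal (M powr p) * (ennreal C * Lpp p S' f * ennreal (bp - bm))"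
      by (simp add: mult_left_mono)
    then show "Lpp p (S \<times> ?I) (wmol \<kappa> bm bp c \<Psi> f) \<le> ennreal (M powr p * (C * (bp - bm))) * Lpp p S' f"
      using C(1) b by (simp add: ennreal_mult ac_simps)
  qed
qed

subsection \<open>Traces\<close>

text \<open>Convergence of the slices of v to g in \<open>L^p\<close> of a ball: the sense in which
  the construction attains its boundary values, converted into \<open>has_trace\<close> by
  \<open>has_traceI\<close>.\<close>

definition Lp_tends :: "real \<Rightarrow> real \<Rightarrow> real filter \<Rightarrow> ('a::euclidean_space \<times> real \<Rightarrow> real) \<Rightarrow> ('a \<Rightarrow> real) \<Rightarrow> bool" where
  "Lp_tends p R F v g \<longleftrightarrow> ((\<lambda>s. Lpp p (ball 0 R) (\<lambda>x. v (x, s) - g x)) \<longlongrightarrow> 0) F"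

lemma ennreal_tendsto_0_le:
  fixes f g :: "'x \<Rightarrow> ennreal"
  assumes "(g \<longlongrightarrow> 0) F" "\<forall>\<^sub>F x in F. f x \<le> g x"
  shows "(f \<longlongrightarrow> 0) F"
  by (rule tendsto_sandwich[OF _ assms(2) tendsto_const assms(1)]) simp

lemma Lp_tends_add:
  fixes v w :: "'a::euclidean_space \<times> real \<Rightarrow> real"
  assumes "Lp_tends p R F v g" "Lp_tends p R F w h" "p \<ge> 0"
    "\<forall>\<^sub>F s in F. borel_on (ball 0 R) (\<lambda>x. v (x, s))" "\<forall>\<^sub>F s in F. borel_on (ball 0 R) (\<lambda>x. w (x, s))"
    "g \<in> borel_measurable borel" "h \<in> borel_measurable borel"
  shows "Lp_tends p R F (\<lambda>q. v q + w q) (\<lambda>x. g x + h x)"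
  unfolding Lp_tends_def
proof (rule ennreal_tendsto_0_le)
  have "((\<lambda>s. ennreal (2 powr p) * (Lpp p (ball 0 R) (\<lambda>x. v (x, s) - g x) + Lpp p (ball 0 R) (\<lambda>x. w (x, s) - h x))) \<longlongrightarrow> ennreal (2 powr p) * (0 + 0)) F"
    using assms(1,2) unfolding Lp_tends_def by (intro ennreal_tendsto_cmult tendsto_add) auto
  then show "((\<lambda>s. ennreal (2 powr p) * (Lpp p (ball 0 R) (\<lambda>x. v (x, s) - g x) + Lpp p (ball 0 R) (\<lambda>x. w (x, s) - h x))) \<longlongrightarrow> 0) F"
    by simp
  show "\<forall>\<^sub>F s in F. Lpp p (ball 0 R) (\<lambda>x. v (x, s) + w (x, s) - (g x + h x)) \<le>
    ennreal (2 powr p) * (Lpp p (ball 0 R) (\<lambda>x. v (x, s) - g x) + Lpp p (ball 0 R) (\<lambda>x. w (x, s) - h x))"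
    using assms(4,5)
  proof eventually_elim
    fix s assume m: "borel_on (ball 0 R) (\<lambda>x. v (x, s))" "borel_on (ball 0 R) (\<lambda>x. w (x, s))"
    have "Lpp p (ball 0 R) (\<lambda>x. v (x, s) + w (x, s) - (g x + h x)) = Lpp p (ball 0 R) (\<lambda>x. (v (x, s) + - g x) + (w (x, s) + - h x))"
      by (rule Lpp_cong) (simp add: algebra_simps)
    also have "\<dots> \<le> ennreal (2 powr p) * (Lpp p (ball 0 R) (\<lambda>x. v (x, s) + - g x) + Lpp p (ball 0 R) (\<lambda>x. w (x, s) + - h x))"
      by (rule Lpp_add[OF assms(3)]) (intro borel_on_add m borel_on_borel; use assms(6,7) in simp)+
    finally show "Lpp p (ball 0 R) (\<lambda>x. v (x, s) + w (x, s) - (g x + h x)) \<le>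
      ennreal (2 powr p) * (Lpp p (ball 0 R) (\<lambda>x. v (x, s) - g x) + Lpp p (ball 0 R) (\<lambda>x. w (x, s) - h x))" by simp
  qed
qed

lemma mol_borel_on:
  assumes "Lloc 1 f" "kern \<Psi>" "r > 0" "S \<in> sets borel"
  shows "borel_on S (\<lambda>x. mol \<Psi> f (x, r))"
  by (rule borel_on_cont[OF continuous_on_compose2[OF mol_continuous[OF assms(1,2)]] assms(4)])
     (use assms(3) in \<open>auto intro!: continuous_intros\<close>)

lemma tau_filterlim:
  assumes \<kappa>: "\<kappa> > 0" and t: "t \<in> {bm, bp}"
  shows "filterlim (tau \<kappa> bm bp) (at_right 0) (at t within {bm<..<bp})"
proof -
  have "(tau \<kappa> bm bp \<longlongrightarrow> tau \<kappa> bm bp t) (at t within {bm<..<bp})"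
    using tau_continuous[of UNIV \<kappa> bm bp] by (metis continuous_on_eq_continuous_within continuous_within iso_tuple_UNIV_I tendsto_within_subset top_greatest)
  moreover have "tau \<kappa> bm bp t = 0" using t by (auto simp: tau_def)
  moreover have "\<forall>\<^sub>F s in at t within {bm<..<bp}. tau \<kappa> bm bp s \<in> {0<..}"
    using tau_pos[OF \<kappa>] by (auto simp: eventually_at_filter)
  ultimately show ?thesis by (auto simp: filterlim_at elim: eventually_mono)
qed

text \<open>The radius tends to zero at the boundary. The error splits into c(s) times the
  mollification error and c(s) - c0 times a fixed multiple of f.\<close>

lemma wmol_trace:
  fixes f :: "'a::euclidean_space \<Rightarrow> real"
  assumes \<kappa>: "\<kappa> > 0" and f: "Lloc p f" and p: "p \<ge> 1" and \<Psi>: "kern \<Psi>" and t: "t \<in> {bm, bp}"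
    and c: "(c \<longlongrightarrow> c0) (at t within {bm<..<bp})"
  shows "Lp_tends p R (at t within {bm<..<bp}) (wmol \<kappa> bm bp c \<Psi> f) (\<lambda>x. c0 * integral\<^sup>L lborel \<Psi> * f x)"
  unfolding Lp_tends_def
proof (rule ennreal_tendsto_0_le)
  let ?F = "at t within {bm<..<bp}" and ?\<mu> = "integral\<^sup>L lborel \<Psi>"
  define G where "G s = Lpp p (ball 0 R) (\<lambda>x. mol \<Psi> f (x, tau \<kappa> bm bp s) - f x * ?\<mu>)" for s
  have p0: "p \<noteq> 0" "p > 0" using p by auto
  have fin: "Lpp p (ball 0 R) f < \<infinity>" and fm: "f \<in> borel_measurable borel" using f by (auto simp: Lloc_def)
  have L: "Lloc 1 f" by (rule Lloc_1[OF f p])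
  have "(G \<longlongrightarrow> 0) ?F"
    unfolding G_def using filterlim_compose[OF mol_approx[OF f p \<Psi>, of R] tau_filterlim[OF \<kappa> t]] .
  then have 1: "((\<lambda>s. ennreal ((\<bar>c0\<bar> + 1) powr p) * G s) \<longlongrightarrow> ennreal ((\<bar>c0\<bar> + 1) powr p) * 0) ?F"
    by (intro ennreal_tendsto_cmult) auto
  have "((\<lambda>s. \<bar>(c s - c0) * ?\<mu>\<bar>) \<longlongrightarrow> \<bar>(c0 - c0) * ?\<mu>\<bar>) ?F" by (intro tendsto_intros c)
  then have "((\<lambda>s. \<bar>(c s - c0) * ?\<mu>\<bar>) \<longlongrightarrow> 0) ?F" by simp
  then have "((\<lambda>s. \<bar>(c s - c0) * ?\<mu>\<bar> powr p) \<longlongrightarrow> 0) ?F"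
    using tendsto_powr'[of "\<lambda>s. \<bar>(c s - c0) * ?\<mu>\<bar>" 0 ?F "\<lambda>_. p" p] p0 by auto
  from tendsto_ennrealI[OF this]
  have 2: "((\<lambda>s. ennreal (\<bar>(c s - c0) * ?\<mu>\<bar> powr p) * Lpp p (ball 0 R) f) \<longlongrightarrow> 0 * Lpp p (ball 0 R) f) ?F"
    using fin by (intro tendsto_mult_ennreal tendsto_const) auto
  have "((\<lambda>s. ennreal (2 powr p) * (ennreal ((\<bar>c0\<bar> + 1) powr p) * G s + ennreal (\<bar>(c s - c0) * ?\<mu>\<bar> powr p) * Lpp p (ball 0 R) f)) \<longlongrightarrow>
    ennreal (2 powr p) * (ennreal ((\<bar>c0\<bar> + 1) powr p) * 0 + 0 * Lpp p (ball 0 R) f)) ?F"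
    by (intro ennreal_tendsto_cmult tendsto_add 1 2) simp
  then show "((\<lambda>s. ennreal (2 powr p) * (ennreal ((\<bar>c0\<bar> + 1) powr p) * G s + ennreal (\<bar>(c s - c0) * ?\<mu>\<bar> powr p) * Lpp p (ball 0 R) f)) \<longlongrightarrow> 0) ?F"
    by simp
  have "\<forall>\<^sub>F s in ?F. \<bar>c s\<bar> < \<bar>c0\<bar> + 1" by (rule order_tendstoD(2)[OF tendsto_rabs[OF c]]) simp
  moreover have "\<forall>\<^sub>F s in ?F. s \<in> {bm<..<bp}" by (auto simp: eventually_at_filter)
  ultimately show "\<forall>\<^sub>F s in ?F. Lpp p (ball 0 R) (\<lambda>x. wmol \<kappa> bm bp c \<Psi> f (x, s) - c0 * ?\<mu> * f x)
    \<le> ennreal (2 powr p) * (ennreal ((\<bar>c0\<bar> + 1) powr p) * G s + ennreal (\<bar>(c s - c0) * ?\<mu>\<bar> powr p) * Lpp p (ball 0 R) f)"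
  proof eventually_elim
    fix s assume cs: "\<bar>c s\<bar> < \<bar>c0\<bar> + 1" and s: "s \<in> {bm<..<bp}"
    have \<tau>s: "tau \<kappa> bm bp s > 0" by (rule tau_pos[OF \<kappa> s])
    have m1: "borel_on (ball 0 R) (\<lambda>x. mol \<Psi> f (x, tau \<kappa> bm bp s) - f x * ?\<mu>)"
      using borel_on_add[OF mol_borel_on[OF L \<Psi> \<tau>s, of "ball 0 R"], of "\<lambda>x. - (f x * ?\<mu>)"] fm by (simp add: borel_on_borel)
    have m2: "borel_on (ball 0 R) (\<lambda>x. c s * (mol \<Psi> f (x, tau \<kappa> bm bp s) - f x * ?\<mu>))"
      using m1 by (simp add: borel_on_def mult.left_commute[of _ "c s"])
    have m3: "borel_on (ball 0 R) (\<lambda>x. ((c s - c0) * ?\<mu>) * f x)" by (rule borel_on_borel) (use fm in auto)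
    have "Lpp p (ball 0 R) (\<lambda>x. wmol \<kappa> bm bp c \<Psi> f (x, s) - c0 * ?\<mu> * f x) =
      Lpp p (ball 0 R) (\<lambda>x. c s * (mol \<Psi> f (x, tau \<kappa> bm bp s) - f x * ?\<mu>) + ((c s - c0) * ?\<mu>) * f x)"
      by (rule Lpp_cong) (simp add: wmol_def tmol_def algebra_simps)
    also have "\<dots> \<le> ennreal (2 powr p) * (Lpp p (ball 0 R) (\<lambda>x. c s * (mol \<Psi> f (x, tau \<kappa> bm bp s) - f x * ?\<mu>)) + Lpp p (ball 0 R) (\<lambda>x. ((c s - c0) * ?\<mu>) * f x))"
      by (rule Lpp_add[OF _ m2 m3]) (use p in simp)
    also have "\<dots> \<le> ennreal (2 powr p) * (ennreal ((\<bar>c0\<bar> + 1) powr p) * G s + ennreal (\<bar>(c s - c0) * ?\<mu>\<bar> powr p) * Lpp p (ball 0 R) f)"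
      unfolding G_def
      by (intro mult_left_mono add_mono Lpp_bounded_mult m1 borel_on_borel[OF fm]) (use p cs in auto)
    finally show "Lpp p (ball 0 R) (\<lambda>x. wmol \<kappa> bm bp c \<Psi> f (x, s) - c0 * ?\<mu> * f x)
      \<le> ennreal (2 powr p) * (ennreal ((\<bar>c0\<bar> + 1) powr p) * G s + ennreal (\<bar>(c s - c0) * ?\<mu>\<bar> powr p) * Lpp p (ball 0 R) f)" .
  qed
qed

text \<open>Signed powers turn convergence in $L^p$ into convergence in $L^1$, where Scheffe's lemma applies.\<close>

definition signed_powr :: "real \<Rightarrow> real \<Rightarrow> real" where
  "signed_powr p x = sgn x * \<bar>x\<bar> powr p"

text \<open>For z = x and z = y the power z^p is at most z (x + y)^(p-1); the two bounds add
  up.\<close>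

lemma powr_superadd:
  fixes x y p :: real
  assumes "x \<ge> 0" "y \<ge> 0" "p \<ge> 1" shows "x powr p + y powr p \<le> (x + y) powr p"
proof (cases "x + y = 0")
  case True
  then show ?thesis using assms by (simp add: add_nonneg_eq_0_iff)
next
  case False
  then have s: "x + y > 0" using assms by simp
  have *: "z powr p \<le> z * (x + y) powr (p - 1)" if "0 \<le> z" "z \<le> x + y" for z
  proof (cases "z = 0")
    case False
    then have "z powr p = z * z powr (p - 1)" using that by (simp add: powr_diff)
    also have "\<dots> \<le> z * (x + y) powr (p - 1)" using that assms by (intro mult_left_mono powr_mono2) auto
    finally show ?thesis .
  qed (use assms in simp)
  have "x powr p + y powr p \<le> (x + y) * (x + y) powr (p - 1)"
    using *[of x] *[of y] assms by (simp add: distrib_right)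
  also have "\<dots> = (x + y) powr p" using s by (simp add: powr_diff)
  finally show ?thesis .
qed

text \<open>For equal signs this is superadditivity of the power. For opposite signs the signed
  powers differ by the sum of the absolute powers, and the elementary triangle inequality with its
  2^p applies.\<close>

lemma signed_powr_diff:
  fixes a b p :: real
  assumes p: "p \<ge> 1" shows "\<bar>a - b\<bar> powr p \<le> 2 powr p * \<bar>signed_powr p a - signed_powr p b\<bar>"
proof -
  have two: "(1::real) \<le> 2 powr p" using p by (simp add: ge_one_powr_ge_zero)
  have same: "\<bar>x - y\<bar> powr p \<le> \<bar>x powr p - y powr p\<bar>" if "x \<ge> 0" "y \<ge> 0" for x y :: real
  proof (cases "x \<ge> y")
    case True
    then show ?thesis using powr_superadd[of "x - y" y p] that p by simp
  next
    case False
    then show ?thesis using powr_superadd[of "y - x" x p] that p by simp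
  qed
  have S: "\<bar>signed_powr p a - signed_powr p b\<bar> = (if (a \<ge> 0) = (b \<ge> 0) then \<bar>\<bar>a\<bar> powr p - \<bar>b\<bar> powr p\<bar> else \<bar>a\<bar> powr p + \<bar>b\<bar> powr p)"
  proof -
    have s: "signed_powr p z = (if z \<ge> 0 then \<bar>z\<bar> powr p else - (\<bar>z\<bar> powr p))" for z by (simp add: signed_powr_def sgn_if)
    obtain x y where xy: "x = \<bar>a\<bar> powr p" "y = \<bar>b\<bar> powr p" "x \<ge> 0" "y \<ge> 0" by simp
    show ?thesis unfolding s xy(1,2)[symmetric] using xy(3,4) by auto
  qed
  show ?thesis
  proof (cases "(a \<ge> 0) = (b \<ge> 0)")
    case True
    then have "\<bar>a - b\<bar> = \<bar>\<bar>a\<bar> - \<bar>b\<bar>\<bar>" by (auto simp: abs_if)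
    then have "\<bar>a - b\<bar> powr p \<le> \<bar>signed_powr p a - signed_powr p b\<bar>" using same[of "\<bar>a\<bar>" "\<bar>b\<bar>"] S True by simp
    also have "\<dots> \<le> 2 powr p * \<bar>signed_powr p a - signed_powr p b\<bar>" using mult_right_mono[OF two, of "\<bar>signed_powr p a - signed_powr p b\<bar>"] by simp
    finally show ?thesis .
  next
    case False
    then show ?thesis using powr_add_le[of p a "- b"] p S by simp
  qed
qed

lemma continuous_signed_powr: "p \<ge> 1 \<Longrightarrow> continuous_on UNIV (signed_powr p)"
proof (rule continuous_at_imp_continuous_on, rule ballI)
  fix x assume p: "p \<ge> (1::real)"
  have "((\<lambda>y. sgn y * \<bar>y\<bar> powr p) \<longlongrightarrow> sgn x * \<bar>x\<bar> powr p) (at x)"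
  proof (cases "x = 0")
    case False
    then show ?thesis using p by (intro tendsto_intros) auto
  next
    case True
    have "((\<lambda>y. \<bar>y\<bar> powr p) \<longlongrightarrow> 0) (at (0::real))"
      using tendsto_powr'[of "\<lambda>y::real. \<bar>y\<bar>" 0 "at 0" "\<lambda>_. p" p] p tendsto_rabs[OF tendsto_ident_at, of 0] by auto
    then have "((\<lambda>y. sgn y * \<bar>y\<bar> powr p) \<longlongrightarrow> 0) (at (0::real))"
      by (rule Lim_null_comparison[rotated]) (auto simp: abs_mult sgn_if intro!: always_eventually)
    then show ?thesis using True by simp
  qed
  then show "isCont (signed_powr p) x" unfolding isCont_def signed_powr_def[abs_def] by simp
qed

lemma abs_signed_powr: "p > 0 \<Longrightarrow> \<bar>signed_powr p x\<bar> = \<bar>x\<bar> powr p"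
  by (simp add: signed_powr_def abs_mult sgn_if)

text \<open>Pointwise convergence without gain of norm in the limit implies convergence in norm. It
  serves for contractions of v, where a change of variables controls the norm but no majorant is at
  hand. The p-th power integral of F is exactly the \<open>L^1\<close> norm of its signed
  power.\<close>

lemma Lpp_scheffe:
  fixes F :: "'a::euclidean_space \<Rightarrow> real"
  assumes p: "p \<ge> 1" and m: "borel_on S F" "\<And>k. borel_on S (Fk k)" and fin: "Lpp p S F < \<infinity>"
    and lim: "\<And>x. x \<in> S \<Longrightarrow> (\<lambda>k. Fk k x) \<longlonglongrightarrow> F x"
    and le: "\<And>k. Lpp p S (Fk k) \<le> ennreal (l k) * Lpp p S F" and l: "l \<longlonglongrightarrow> 1"
  shows "(\<lambda>k. Lpp p S (\<lambda>x. Fk k x - F x)) \<longlonglongrightarrow> 0"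
proof -
  have sp: "signed_powr p \<in> borel_measurable borel" by (rule borel_measurable_continuous_onI[OF continuous_signed_powr[OF p]])
  have Sm: "S \<in> sets borel" using m(1) by (rule borel_on_sets)
  define G where "G H x = signed_powr p (indicator S x * H x)" for H :: "'a \<Rightarrow> real" and x
  have Gm: "G H \<in> borel_measurable lborel" if "borel_on S H" for H
    unfolding G_def[abs_def] by (rule measurable_compose[OF _ sp]) (use that in \<open>simp add: borel_on_def\<close>)
  have GL: "(\<integral>\<^sup>+x. norm (G H x) \<partial>lborel) = Lpp p S H" for H
    unfolding Lpp_def G_def by (rule nn_integral_cong) (use p in \<open>auto simp: indicator_def abs_signed_powr\<close>)
  have int: "integrable lborel (G H)" if "borel_on S H" "Lpp p S H < \<infinity>" for H
    using Gm[OF that(1)] that(2) GL[of H] by (intro integrableI_bounded) auto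
  have fink: "Lpp p S (Fk k) < \<infinity>" for k
    using le[of k] fin by (auto intro: le_less_trans simp: ennreal_mult_less_top)
  have "(\<lambda>n. \<integral>\<^sup>+x. norm (G (Fk n) x - G F x) \<partial>lborel) \<longlonglongrightarrow> 0"
  proof (rule Scheffe_lemma1)
    show "integrable lborel (G (Fk n))" for n by (rule int[OF m(2) fink])
    show "integrable lborel (G F)" by (rule int[OF m(1) fin])
    show "AE x in lborel. (\<lambda>n. G (Fk n) x) \<longlonglongrightarrow> G F x"
    proof (rule AE_I2)
      fix x
      have "(\<lambda>n. indicator S x * Fk n x) \<longlonglongrightarrow> indicator S x * F x"
        using lim[of x] by (cases "x \<in> S") auto
      then show "(\<lambda>n. G (Fk n) x) \<longlonglongrightarrow> G F x"
        unfolding G_def using isCont_tendsto_compose[of "indicator S x * F x" "signed_powr p"] continuous_signed_powr[OF p]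
        by (simp add: continuous_on_eq_continuous_at)
    qed
    have "(\<lambda>k. ennreal (l k) * Lpp p S F) \<longlonglongrightarrow> ennreal 1 * Lpp p S F"
      using fin by (intro tendsto_mult_ennreal tendsto_ennrealI l tendsto_const) auto
    then have "limsup (\<lambda>k. ennreal (l k) * Lpp p S F) = Lpp p S F"
      by (intro lim_imp_Limsup) auto
    moreover have "limsup (\<lambda>n. \<integral>\<^sup>+x. norm (G (Fk n) x) \<partial>lborel) \<le> limsup (\<lambda>k. ennreal (l k) * Lpp p S F)"
      unfolding GL by (intro Limsup_mono always_eventually allI le)
    ultimately show "limsup (\<lambda>n. \<integral>\<^sup>+x. norm (G (Fk n) x) \<partial>lborel) \<le> (\<integral>\<^sup>+x. norm (G F x) \<partial>lborel)"
      unfolding GL[of F] by simp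
  qed
  from ennreal_tendsto_cmult[OF _ this, of "ennreal (2 powr p)"]
  have "(\<lambda>n. ennreal (2 powr p) * (\<integral>\<^sup>+x. norm (G (Fk n) x - G F x) \<partial>lborel)) \<longlonglongrightarrow> 0" by simp
  then show ?thesis
  proof (rule ennreal_tendsto_0_le, intro always_eventually allI)
    fix k
    have "Lpp p S (\<lambda>x. Fk k x - F x) \<le> (\<integral>\<^sup>+x. ennreal (2 powr p) * ennreal (norm (G (Fk k) x - G F x)) \<partial>lborel)"
      unfolding Lpp_def
      by (rule nn_integral_mono)
         (use signed_powr_diff[OF p] in \<open>auto simp: indicator_def G_def ennreal_mult[symmetric] intro!: ennreal_leI\<close>)
    also have "\<dots> = ennreal (2 powr p) * (\<integral>\<^sup>+x. norm (G (Fk k) x - G F x) \<partial>lborel)"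
    proof (rule nn_integral_cmult)
      have [measurable]: "G (Fk k) \<in> borel_measurable borel" "G F \<in> borel_measurable borel"
        using Gm[OF m(1)] Gm[OF m(2)] by simp_all
      show "(\<lambda>x. ennreal (norm (G (Fk k) x - G F x))) \<in> borel_measurable lborel" by measurable
    qed
    finally show "Lpp p S (\<lambda>x. Fk k x - F x) \<le> ennreal (2 powr p) * (\<integral>\<^sup>+x. norm (G (Fk k) x - G F x) \<partial>lborel)" .
  qed
qed

lemma nn_integral_lebesgue_eq_Lpp:
  "(\<integral>\<^sup>+x\<in>S. ennreal (\<bar>f x\<bar> powr p) \<partial>lebesgue) = Lpp p S f"
  by (simp add: Lpp_def nn_integral_completion)

lemma in_Lp_iff: "in_Lp p U f \<longleftrightarrow> f \<in> borel_measurable (lebesgue_on U) \<and> Lpp p U f < \<infinity>"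
  by (simp add: in_Lp_def nn_integral_lebesgue_eq_Lpp)

lemma in_Lp_continuous: "open U \<Longrightarrow> continuous_on U f \<Longrightarrow> Lpp p U f < \<infinity> \<Longrightarrow> in_Lp p U f"
  by (auto simp: in_Lp_iff intro!: continuous_imp_measurable_on_sets_lebesgue)

lemma Lpp_cong_AE:
  assumes "AE x in lborel. x \<in> S \<longrightarrow> f x = g x"
  shows "Lpp p S f = Lpp p S g"
  unfolding Lpp_def by (rule nn_integral_cong_AE, use assms in eventually_elim) (auto simp: indicator_def)

text \<open>Contraction of the interval towards its midpoint. For l < 1 it sends the closed interval
  into the open one, so composition with it makes a function continuous up to the boundary.\<close>

definition squeeze :: "real \<Rightarrow> real \<Rightarrow> real \<Rightarrow> real \<Rightarrow> real" where
  "squeeze bm bp l t = (bm + bp) / 2 + l * (t - (bm + bp) / 2)"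

lemma squeeze_in:
  assumes "0 < l" "l < 1" "bm < bp" "bm \<le> t" "t \<le> bp"
  shows "bm < squeeze bm bp l t" "squeeze bm bp l t < bp"
proof -
  have "\<bar>l * (t - (bm + bp) / 2)\<bar> \<le> l * ((bp - bm) / 2)"
    unfolding abs_mult using assms by (intro mult_mono) (auto simp: abs_if field_simps)
  also have "\<dots> < 1 * ((bp - bm) / 2)" using assms by (intro mult_strict_right_mono) auto
  finally have "\<bar>l * (t - (bm + bp) / 2)\<bar> < (bp - bm) / 2" by simp
  then show "bm < squeeze bm bp l t" "squeeze bm bp l t < bp" unfolding squeeze_def by (auto simp: abs_if field_simps split: if_splits)
qed

lemma squeeze_cont: "continuous_on S (squeeze bm bp l)"
  unfolding squeeze_def[abs_def] by (intro continuous_intros) auto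

lemma squeeze_tendsto: "l \<longlonglongrightarrow> 1 \<Longrightarrow> (\<lambda>k. squeeze bm bp (l k) t) \<longlonglongrightarrow> t"
proof -
  assume "l \<longlonglongrightarrow> 1"
  then have "(\<lambda>k. squeeze bm bp (l k) t) \<longlonglongrightarrow> (bm + bp) / 2 + 1 * (t - (bm + bp) / 2)"
    unfolding squeeze_def by (intro tendsto_intros)
  then show ?thesis by simp
qed

text \<open>A linear change of variables in t produces 1/l; the image of the interval lies inside
  the interval, so nothing else is added.\<close>

lemma Lpp_squeeze:
  fixes F :: "'a::euclidean_space \<times> real \<Rightarrow> real"
  assumes F: "continuous_on (strip bm bp) F" and l: "0 < l" "l < 1" and b: "bm < bp" and S: "S \<in> sets borel"
  shows "Lpp p (S \<times> {bm<..<bp}) (\<lambda>q. F (fst q, squeeze bm bp l (snd q))) \<le> ennreal (1 / l) * Lpp p (S \<times> {bm<..<bp}) F"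
proof -
  let ?I = "{bm<..<bp}"
  have SI: "S \<times> ?I \<in> sets borel" using S by (intro borel_Times) auto
  have sub: "S \<times> ?I \<subseteq> strip bm bp" by (auto simp: strip_iff)
  have m: "borel_on (S \<times> ?I) F" by (rule borel_on_cont[OF continuous_on_subset[OF F sub] SI])
  have cG: "continuous_on (strip bm bp) (\<lambda>q. F (fst q, squeeze bm bp l (snd q)))"
    by (rule continuous_on_compose2[OF F])
       (use squeeze_in[OF l b] in \<open>auto intro!: continuous_intros continuous_on_compose2[OF squeeze_cont[of UNIV]] simp: strip_iff\<close>)
  have mG: "borel_on (S \<times> ?I) (\<lambda>q. F (fst q, squeeze bm bp l (snd q)))" by (rule borel_on_cont[OF continuous_on_subset[OF cG sub] SI])
  define H where "H t = (\<integral>\<^sup>+x. ennreal (\<bar>F (x, t)\<bar> powr p) * indicator (S \<times> ?I) (x, t) \<partial>lborel)" for t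
  have Hm: "H \<in> borel_measurable borel"
  proof -
    have "(\<lambda>(t, x). ennreal (\<bar>F (x, t)\<bar> powr p) * indicator (S \<times> ?I) (x, t)) \<in> borel_measurable (lborel \<Otimes>\<^sub>M lborel)"
      unfolding split_beta
      using measurable_compose[OF measurable_Pair[OF measurable_snd measurable_fst], of "\<lambda>q. ennreal (\<bar>F q\<bar> powr p) * indicator (S \<times> ?I) q" lborel lborel] borel_on_powr[OF m, of p]
      by (simp add: lborel_prod)
    from lborel.borel_measurable_nn_integral[OF this] show ?thesis by (simp add: H_def[abs_def])
  qed
  have "Lpp p (S \<times> ?I) (\<lambda>q. F (fst q, squeeze bm bp l (snd q))) \<le> (\<integral>\<^sup>+t. H (((bm + bp) / 2 - l * ((bm + bp) / 2)) + l * t) \<partial>lborel)"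
    unfolding Lpp_Times[OF mG]
  proof (rule nn_integral_mono)
    fix t
    have e: "((bm + bp) / 2 - l * ((bm + bp) / 2)) + l * t = squeeze bm bp l t" by (simp add: squeeze_def algebra_simps)
    show "(\<integral>\<^sup>+x. ennreal (\<bar>F (fst (x, t), squeeze bm bp l (snd (x, t)))\<bar> powr p) * indicator (S \<times> ?I) (x, t) \<partial>lborel) \<le> H (((bm + bp) / 2 - l * ((bm + bp) / 2)) + l * t)"
      unfolding e H_def by (rule nn_integral_mono) (use squeeze_in[OF l b, of t] in \<open>auto simp: indicator_def\<close>)
  qed
  also have "\<dots> = ennreal (1 / l) * (ennreal \<bar>l\<bar> * (\<integral>\<^sup>+t. H (((bm + bp) / 2 - l * ((bm + bp) / 2)) + l * t) \<partial>lborel))"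
    using l by (simp add: mult.assoc[symmetric] ennreal_mult[symmetric])
  also have "ennreal \<bar>l\<bar> * (\<integral>\<^sup>+t. H (((bm + bp) / 2 - l * ((bm + bp) / 2)) + l * t) \<partial>lborel) = (\<integral>\<^sup>+t. H t \<partial>lborel)"
    using l by (intro nn_integral_real_affine[symmetric] Hm) auto
  also have "\<dots> = Lpp p (S \<times> ?I) F" unfolding Lpp_Times[OF m] H_def ..
  finally show ?thesis .
qed

text \<open>The contracted functions are continuous on the closed cylinder. They and their
  derivatives converge by the Scheffe argument, and their values at the boundary height are slices
  of v at interior heights tending to t. The continuous v with its classical derivatives is kept
  apart from v0 and g0, which are known only up to null sets.\<close>

lemma has_traceI:
  fixes v v0 :: "'a::euclidean_space \<times> real \<Rightarrow> real" and V :: "'a \<times> real \<Rightarrow> 'a \<times> real \<Rightarrow> real"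
  assumes p: "p \<ge> 1" and b: "bm < bp" and t: "t \<in> {bm, bp}"
    and d: "\<And>e. e \<in> Basis \<Longrightarrow> dir_deriv (strip bm bp) e v (V e)"
    and fin: "\<And>R. Lpp p (ball 0 R \<times> {bm<..<bp}) v < \<infinity>"
    and finV: "\<And>e R. e \<in> Basis \<Longrightarrow> Lpp p (ball 0 R \<times> {bm<..<bp}) (V e) < \<infinity>"
    and tr: "\<And>R. Lp_tends p R (at t within {bm<..<bp}) v g"
    and g: "in_Lp_loc p UNIV g0" "AE x in lborel. g0 x = g x"
    and v0: "v0 \<in> borel_measurable (lebesgue_on (strip bm bp))" "AE q in lborel. q \<in> strip bm bp \<longrightarrow> v q = v0 q"
  shows "has_trace p bm bp t v0 g0"
  unfolding has_trace_def Let_def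
proof (intro conjI allI impI g(1))
  fix R :: real assume R: "R > 0"
  let ?I = "{bm<..<bp}"
  define Q where "Q = ball (0::'a) R \<times> ?I"
  have oQ: "open Q" unfolding Q_def by (intro open_Times) auto
  have sub: "Q \<subseteq> strip bm bp" by (auto simp: Q_def strip_iff)
  have Qs: "Q \<in> sets borel" using oQ by simp
  have v0m: "v0 \<in> borel_measurable (lebesgue_on Q)"
    using measurable_restrict_mono[OF v0(1) sub] .
  have ae: "AE q in lborel. q \<in> Q \<longrightarrow> v q = v0 q" using v0(2) by eventually_elim (use sub in auto)
  have dQ: "dir_deriv Q e v (V e)" if "e \<in> Basis" for e using dir_deriv_subset[OF d[OF that] sub] .
  have bne: "Basis \<noteq> ({} :: ('a \<times> real) set)" by simp
  obtain e0 :: "'a \<times> real" where e0: "e0 \<in> Basis" using bne by blast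
  have cv: "continuous_on (strip bm bp) v" using d[OF e0] by (simp add: dir_deriv_def)
  have cV: "continuous_on (strip bm bp) (V e)" if "e \<in> Basis" for e using d[OF that] by (simp add: dir_deriv_def)
  have hw: "has_weak_partial Q [e] v (V e)" if "e \<in> Basis" for e
    by (rule has_weak_partial_dir_deriv[OF oQ dQ[OF that] that])
  have hw0: "has_weak_partial Q [e] v0 (V e)" if "e \<in> Basis" for e
    by (rule has_weak_partial_AE[OF hw[OF that] oQ _ v0m ae]) (use that in simp)
  have LV: "in_Lp p Q (V e)" if "e \<in> Basis" for e
    by (rule in_Lp_continuous[OF oQ continuous_on_subset[OF cV[OF that] sub]]) (use finV[OF that] in \<open>simp add: Q_def\<close>)
  have "Lpp p Q v0 = Lpp p Q v" by (rule Lpp_cong_AE[symmetric, OF ae])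
  then have "in_Lp p Q v0" using v0m fin by (simp add: in_Lp_iff Q_def)
  then show "in_W1p p (ball 0 R \<times> ?I) v0"
    unfolding in_W1p_def Q_def[symmetric] using LV hw0 by blast
  \<comment> \<open>The shift by 2 makes l positive already for k = 0.\<close>
  define l :: "nat \<Rightarrow> real" where "l k = 1 - 1 / (real k + 2)" for k
  have l: "0 < l k" "l k < 1" for k by (auto simp: l_def field_simps)
  have l1: "l \<longlonglongrightarrow> 1"
  proof -
    have "(\<lambda>k. 1 + - inverse (real (Suc (Suc k)))) \<longlonglongrightarrow> 1"
      by (rule LIMSEQ_Suc[OF LIMSEQ_inverse_real_of_nat_add_minus])
    then show ?thesis by (simp add: l_def[abs_def] inverse_eq_divide add.commute)
  qed
  define \<theta> where "\<theta> k q = (fst q, squeeze bm bp (l k) (snd q))" for k and q :: "'a \<times> real"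
  define w where "w k q = v (\<theta> k q)" for k q
  \<comment> \<open>Contraction scales only the normal derivative, by the factor l k; tangential
    derivatives are unchanged.\<close>
  define cf where "cf e k = (if snd e = 0 then 1 else l k)" for e :: "'a \<times> real" and k
  define W where "W e k q = cf e k * V e (\<theta> k q)" for e k q
  have \<theta>in: "\<theta> k q \<in> strip bm bp" if "snd q \<in> {bm..bp}" for k q
    using squeeze_in[OF l b, of "snd q" k] that by (auto simp: \<theta>_def strip_iff)
  have \<theta>c: "continuous_on S (\<theta> k)" for S k
    unfolding \<theta>_def by (intro continuous_intros continuous_on_compose2[OF squeeze_cont[of UNIV]]) auto
  have cw: "continuous_on (UNIV \<times> {bm..bp}) (\<lambda>q. F (\<theta> k q))" if "continuous_on (strip bm bp) F" for F :: "'a \<times> real \<Rightarrow> real" and k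
    by (rule continuous_on_compose2[OF that \<theta>c]) (use \<theta>in in auto)
  have cwQ: "continuous_on Q (\<lambda>q. F (\<theta> k q))" if "continuous_on (strip bm bp) F" for F :: "'a \<times> real \<Rightarrow> real" and k
    by (rule continuous_on_subset[OF cw[OF that]]) (auto simp: Q_def)
  have cf: "0 \<le> cf e k" "cf e k \<le> 1" for e k using l[of k] by (auto simp: cf_def)
  have dw: "dir_deriv Q e (w k) (W e k)" if e: "e \<in> Basis" for e k
    unfolding dir_deriv_def
  proof (intro conjI ballI)
    show "continuous_on Q (w k)" unfolding w_def[abs_def] by (rule cwQ[OF cv])
    show "continuous_on Q (W e k)" unfolding W_def[abs_def] by (intro continuous_on_mult continuous_on_const cwQ cV e)
    fix q assume q: "q \<in> Q"
    have in': "\<theta> k q \<in> strip bm bp" by (rule \<theta>in) (use q in \<open>auto simp: Q_def\<close>)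
    have eq: "\<theta> k (q + s *\<^sub>R e) = \<theta> k q + (cf e k * s) *\<^sub>R e" for s
    proof -
      from e have "snd e = 0 \<or> fst e = 0 \<and> snd e = 1" by (auto simp: Basis_prod_def)
      then show ?thesis by (auto simp: \<theta>_def cf_def squeeze_def prod_eq_iff algebra_simps)
    qed
    have "((\<lambda>s. v (\<theta> k q + s *\<^sub>R e)) has_real_derivative V e (\<theta> k q)) (at (cf e k * 0))"
      using d[OF e] in' by (simp add: dir_deriv_def)
    from DERIV_chain2[where f="\<lambda>s. v (\<theta> k q + s *\<^sub>R e)" and g="\<lambda>s. cf e k * s" and x=0 and Db="cf e k" and s=UNIV, OF this DERIV_cmult_Id]
    show "((\<lambda>s. w k (q + s *\<^sub>R e)) has_real_derivative W e k q) (at 0)"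
      unfolding w_def W_def eq by (simp add: mult.commute DERIV_cmult_Id)
  qed
  have hww: "has_weak_partial Q [e] (w k) (W e k)" if "e \<in> Basis" for e k
    by (rule has_weak_partial_dir_deriv[OF oQ dw[OF that] that])
  have le: "Lpp p Q (\<lambda>q. F (\<theta> k q)) \<le> ennreal (1 / l k) * Lpp p Q F" if "continuous_on (strip bm bp) F" for F :: "'a \<times> real \<Rightarrow> real" and k
    unfolding \<theta>_def Q_def by (rule Lpp_squeeze[OF that l b]) simp
  have leW: "Lpp p Q (W e k) \<le> ennreal (1 / l k) * Lpp p Q (V e)" if "e \<in> Basis" for e k
  proof (rule order_trans[OF Lpp_mono le[OF cV[OF that]]])
    show "\<bar>W e k q\<bar> \<le> \<bar>V e (\<theta> k q)\<bar>" for q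
      unfolding W_def abs_mult using cf[of e k] by (simp add: mult_left_le_one_le)
  qed (use p in simp)
  have finw: "Lpp p Q (w k) < \<infinity>" for k
    using le[OF cv, of k] fin[of R] unfolding w_def Q_def by (auto intro: le_less_trans simp: ennreal_mult_less_top)
  have finW: "Lpp p Q (W e k) < \<infinity>" if "e \<in> Basis" for e k
    using leW[OF that, of k] finV[OF that, of R] unfolding Q_def by (auto intro: le_less_trans simp: ennreal_mult_less_top)
  have Wc: "continuous_on Q (W e k)" "continuous_on Q (w k)" if "e \<in> Basis" for e k
    using dw[OF that] by (auto simp: dir_deriv_def)
  have linv: "(\<lambda>k. 1 / l k) \<longlonglongrightarrow> 1" using tendsto_divide[OF tendsto_const[of 1] l1] by simp
  have \<theta>lim: "(\<lambda>k. F (\<theta> k q)) \<longlonglongrightarrow> F q" if "continuous_on (strip bm bp) F" "q \<in> Q" for F :: "'a \<times> real \<Rightarrow> real" and q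
  proof -
    have "(\<lambda>k. \<theta> k q) \<longlonglongrightarrow> q" unfolding \<theta>_def using tendsto_Pair[OF tendsto_const squeeze_tendsto[OF l1], of "fst q" bm bp "snd q"] by simp
    moreover have "isCont F q" using continuous_on_eq_continuous_at[OF strip_open, of bm bp F] that sub by blast
    ultimately show ?thesis using isCont_tendsto_compose by blast
  qed
  have conv0: "(\<lambda>k. Lpp p Q (\<lambda>q. w k q - v q)) \<longlonglongrightarrow> 0"
    by (rule Lpp_scheffe[OF p borel_on_cont[OF continuous_on_subset[OF cv sub] Qs] borel_on_cont[OF Wc(2)[OF e0] Qs] _ _ _ linv])
       (use fin le[OF cv] \<theta>lim[OF cv] in \<open>auto simp: w_def[abs_def] Q_def\<close>)
  have conv1: "(\<lambda>k. Lpp p Q (\<lambda>q. W e k q - V e q)) \<longlonglongrightarrow> 0" if e: "e \<in> Basis" for e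
  proof (rule Lpp_scheffe[OF p borel_on_cont[OF continuous_on_subset[OF cV[OF e] sub] Qs] borel_on_cont[OF Wc(1)[OF e] Qs] _ _ leW[OF e] linv])
    show "Lpp p Q (V e) < \<infinity>" using finV[OF e] by (simp add: Q_def)
    fix q assume q: "q \<in> Q"
    have "cf e \<longlonglongrightarrow> 1" unfolding cf_def using l1 by (cases "snd e = 0") (auto simp: l_def[abs_def])
    from tendsto_mult[OF this \<theta>lim[OF cV[OF e] q]] show "(\<lambda>k. W e k q) \<longlonglongrightarrow> V e q" by (simp add: W_def)
  qed
  have dist: "W1p_dist_pow p Q (w k) v0 = Lpp p Q (\<lambda>q. w k q - v q) + (\<Sum>e\<in>Basis. Lpp p Q (\<lambda>q. W e k q - V e q))" for k
  proof -
    have "Lpp p Q (\<lambda>q. w k q - v0 q) = Lpp p Q (\<lambda>q. w k q - v q)"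
      by (rule Lpp_cong_AE) (use ae in \<open>eventually_elim, auto\<close>)
    moreover have "Lpp p Q (\<lambda>q. weak_partial Q [e] (w k) q - weak_partial Q [e] v0 q) = Lpp p Q (\<lambda>q. W e k q - V e q)" if e: "e \<in> Basis" for e
      by (rule Lpp_cong_AE, use weak_partial_AE_eq[OF hww[OF e, of k] oQ] weak_partial_AE_eq[OF hw0[OF e] oQ] in eventually_elim) auto
    ultimately show ?thesis by (simp add: W1p_dist_pow_def nn_integral_lebesgue_eq_Lpp)
  qed
  have "(\<lambda>k. W1p_dist_pow p Q (w k) v0) \<longlonglongrightarrow> 0 + (\<Sum>e\<in>(Basis :: ('a \<times> real) set). 0)"
    unfolding dist by (intro tendsto_add tendsto_sum conv0 conv1)
  then have distlim: "(\<lambda>k. W1p_dist_pow p Q (w k) v0) \<longlonglongrightarrow> 0" by simp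
  have tt: "t \<in> {bm..bp}" using t b by auto
  have sin: "squeeze bm bp (l k) t \<in> ?I" for k using squeeze_in[OF l b, of t k] tt by auto
  \<comment> \<open>The contracted boundary height is strictly inside the interval, so the
    convergence of slices applies along this sequence.\<close>
  have "filterlim (\<lambda>k. squeeze bm bp (l k) t) (at t within ?I) sequentially"
    unfolding filterlim_at
  proof (intro conjI squeeze_tendsto[OF l1] always_eventually allI)
    fix k
    show "squeeze bm bp (l k) t \<in> ?I" by (rule sin)
    show "squeeze bm bp (l k) t \<noteq> t" using sin[of k] t by auto
  qed
  from filterlim_compose[OF tr[of R, unfolded Lp_tends_def] this]
  have trl: "(\<lambda>k. Lpp p (ball 0 R) (\<lambda>x. w k (x, t) - g x)) \<longlonglongrightarrow> 0" by (simp add: w_def \<theta>_def)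
  have "Lpp p (ball 0 R) (\<lambda>x. w k (x, t) - g0 x) = Lpp p (ball 0 R) (\<lambda>x. w k (x, t) - g x)" for k
    by (rule Lpp_cong_AE) (use g(2) in \<open>eventually_elim, auto\<close>)
  with trl have trl0: "(\<lambda>k. Lpp p (ball 0 R) (\<lambda>x. w k (x, t) - g0 x)) \<longlonglongrightarrow> 0" by simp
  show "\<exists>w. (\<forall>k. in_W1p p (ball 0 R \<times> ?I) (w k) \<and> continuous_on (cball 0 R \<times> {bm..bp}) (w k)) \<and>
    (\<lambda>k. W1p_dist_pow p (ball 0 R \<times> ?I) (w k) v0) \<longlonglongrightarrow> 0 \<and>
    (\<lambda>k. \<integral>\<^sup>+x\<in>ball 0 R. ennreal (\<bar>w k (x, t) - g0 x\<bar> powr p) \<partial>lebesgue) \<longlonglongrightarrow> 0"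
    unfolding Q_def[symmetric] nn_integral_lebesgue_eq_Lpp
  proof (intro exI[of _ w] conjI allI distlim trl0)
    fix k
    show "continuous_on (cball 0 R \<times> {bm..bp}) (w k)"
      unfolding w_def[abs_def] by (rule continuous_on_subset[OF cw[OF cv]]) auto
    show "in_W1p p Q (w k)" unfolding in_W1p_def
      using in_Lp_continuous[OF oQ Wc(2)[OF e0] finw] in_Lp_continuous[OF oQ Wc(1) finW] hww by blast
  qed
qed

subsection \<open>The Hermite interpolant\<close>

text \<open>The boolean index names the boundary hyperplane, True for the upper and False for the
  lower one; \<open>g \<sigma> i\<close> is the derivative of \<open>f0 \<sigma>\<close> along i.
  The data are Borel functions here.\<close>

locale hermite =
  fixes p \<kappa> bm bp :: real and \<phi> :: "'a::euclidean_space \<Rightarrow> real"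
    and f0 f1 :: "bool \<Rightarrow> 'a \<Rightarrow> real" and g :: "bool \<Rightarrow> 'a \<Rightarrow> 'a \<Rightarrow> real"
  assumes p: "p \<ge> 1" and \<kappa>: "\<kappa> > 0" and b: "bm < bp"
    and \<phi>: "kern \<phi>" "\<And>y. \<phi> (- y) = \<phi> y" "integral\<^sup>L lborel \<phi> = 1"
    and f0: "\<And>\<sigma>. Lloc p (f0 \<sigma>)" and f1: "\<And>\<sigma>. Lloc p (f1 \<sigma>)"
    and g: "\<And>\<sigma> i. i \<in> Basis \<Longrightarrow> Lloc p (g \<sigma> i)" and gm: "\<And>\<sigma>. grad_mol (f0 \<sigma>) (g \<sigma>)"
begin

abbreviation "I \<equiv> {bm<..<bp}"
abbreviation "\<Omega> \<equiv> strip bm bp :: ('a \<times> real) set"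
abbreviation "\<tau> \<equiv> tau \<kappa> bm bp"
abbreviation "\<tau>1 \<equiv> taud \<kappa> bm bp"
abbreviation "T \<equiv> wmol \<kappa> bm bp"

definition "s t = (t - bm) / (bp - bm)"
definition "\<tau>2 = - 2 * \<kappa> / (bp - bm)"
definition "A \<sigma> t = (if \<sigma> then 3 * (s t)\<^sup>2 - 2 * (s t) ^ 3 else 1 - 3 * (s t)\<^sup>2 + 2 * (s t) ^ 3)"
definition "A1 \<sigma> t = (if \<sigma> then 1 else - 1) * (6 * s t - 6 * (s t)\<^sup>2) / (bp - bm)"
definition "A2 \<sigma> t = (if \<sigma> then 1 else - 1) * (6 - 12 * s t) / (bp - bm)\<^sup>2"
text \<open>What remains of the second kind of Hermite function after division by \<tau>. With L the
  width, \<tau> = \<kappa> L s (1 - s), so \<open>B False\<close> is L s (1 - s)^2 and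
  \<open>B True\<close> is -L s^2 (1 - s); the 1/\<kappa> cancels the \<kappa> of the
  radius.\<close>

definition "\<beta> \<sigma> t = (if \<sigma> then - s t else 1 - s t) / \<kappa>"
definition "\<beta>1 = - 1 / (\<kappa> * (bp - bm))"
definition "B \<sigma> t = \<tau> t * \<beta> \<sigma> t"
definition "B1 \<sigma> t = \<tau>1 t * \<beta> \<sigma> t + \<tau> t * \<beta>1"
definition "B2 \<sigma> t = \<tau>2 * \<beta> \<sigma> t + 2 * \<tau>1 t * \<beta>1"

lemma s_deriv: "(s has_real_derivative 1 / (bp - bm)) (at t)"
  unfolding s_def[abs_def] divide_inverse by (auto intro!: derivative_eq_intros)

lemma \<tau>_deriv: "(\<tau> has_real_derivative \<tau>1 t) (at t)"
  unfolding taud_def by (rule tau_deriv)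

lemma \<tau>1_deriv: "(\<tau>1 has_real_derivative \<tau>2) (at t)"
  unfolding taud_def[abs_def] \<tau>2_def divide_inverse by (auto intro!: derivative_eq_intros)

lemma A_deriv: "(A \<sigma> has_real_derivative A1 \<sigma> t) (at t)"
  unfolding A_def[abs_def] A1_def
  by (cases \<sigma>) (auto intro!: derivative_eq_intros s_deriv[THEN DERIV_cong]
      simp: algebra_simps power2_eq_square add_divide_distrib diff_divide_distrib)

lemma A1_deriv: "(A1 \<sigma> has_real_derivative A2 \<sigma> t) (at t)"
proof -
  have "((\<lambda>t. (if \<sigma> then 1 else - 1) * (6 * s t - 6 * (s t)\<^sup>2) / (bp - bm)) has_real_derivative
    (if \<sigma> then 1 else - 1) * (6 * (1 / (bp - bm)) - 6 * (of_nat 2 * (1 / (bp - bm) * (s t) ^ (2 - Suc 0)))) / (bp - bm)) (at t)"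
    by (intro DERIV_cdivide DERIV_cmult DERIV_diff DERIV_power s_deriv)
  moreover have "c * (6 * (1 / L) - 6 * (of_nat 2 * (1 / L * x ^ (2 - Suc 0)))) / L = c * (6 - 12 * x) / L\<^sup>2"
    if "L \<noteq> 0" for c L x :: real
    using that by (simp add: field_simps power2_eq_square)
  ultimately show ?thesis unfolding A1_def[abs_def] A2_def using b by simp
qed

lemma \<beta>_deriv: "(\<beta> \<sigma> has_real_derivative \<beta>1) (at t)"
proof -
  have "((\<lambda>t. ((if \<sigma> then 0 else 1) - s t) / \<kappa>) has_real_derivative (0 - 1 / (bp - bm)) / \<kappa>) (at t)"
    by (intro DERIV_cdivide DERIV_diff s_deriv DERIV_const)
  moreover have "(\<lambda>t. ((if \<sigma> then 0 else 1) - s t) / \<kappa>) = \<beta> \<sigma>" by (auto simp: \<beta>_def fun_eq_iff)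
  ultimately show ?thesis by (simp add: \<beta>1_def mult.commute)
qed

lemma B_deriv: "(B \<sigma> has_real_derivative B1 \<sigma> t) (at t)"
  unfolding B_def[abs_def] B1_def
  by (rule DERIV_cong[OF DERIV_mult[OF \<tau>_deriv \<beta>_deriv]]) (simp add: algebra_simps)

lemma B1_deriv: "(B1 \<sigma> has_real_derivative B2 \<sigma> t) (at t)"
  unfolding B1_def[abs_def] B2_def
  by (rule DERIV_cong[OF DERIV_add[OF DERIV_mult[OF \<tau>1_deriv \<beta>_deriv] DERIV_cmult_right[OF \<tau>_deriv]]]) (simp add: algebra_simps)

lemma DERIV_cont: "(\<And>t. (f has_real_derivative f' t) (at t)) \<Longrightarrow> continuous_on S f"
  by (rule DERIV_continuous_on) (rule has_field_derivative_at_within)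

lemmas conts = DERIV_cont[OF A_deriv] DERIV_cont[OF A1_deriv] DERIV_cont[OF \<beta>_deriv] DERIV_cont[OF B_deriv]
  DERIV_cont[OF B1_deriv] DERIV_cont[OF s_deriv] tau_continuous taud_continuous

lemma A2_cont: "continuous_on S (A2 \<sigma>)" unfolding A2_def[abs_def] divide_inverse by (intro continuous_intros conts)
lemma B2_cont: "continuous_on S (B2 \<sigma>)" unfolding B2_def[abs_def] by (intro continuous_intros conts)

lemmas coeff_continuous = conts A2_cont B2_cont continuous_on_mult continuous_on_add continuous_on_minus continuous_on_const
  tau_quotient_continuous[OF \<kappa>]

lemmas f0' = Lloc_1[OF f0 p] and f1' = Lloc_1[OF f1 p] and g' = Lloc_1[OF g p]

lemmas kernels = \<phi>(1) kern_pd kern_star kern_coord_mult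

definition "u q = (\<Sum>\<sigma>\<in>UNIV. T (A \<sigma>) \<phi> (f0 \<sigma>) q + T (B \<sigma>) \<phi> (f1 \<sigma>) q)"
text \<open>The derivatives of u in closed form, the letters giving the directions in order. Both
  orders of the mixed derivatives appear because the Hessian ranges over ordered pairs, and each is
  estimated in the form in which it arises. The functions f0 themselves survive only where no
  derivative has to be gained, so that their terms can be regrouped later.\<close>

definition "Ux i q = (\<Sum>\<sigma>\<in>UNIV. T (A \<sigma>) \<phi> (g \<sigma> i) q + T (\<lambda>t. - \<beta> \<sigma> t) (pd i \<phi>) (f1 \<sigma>) q)"
definition "Ut q = (\<Sum>\<sigma>\<in>UNIV. (T (A1 \<sigma>) \<phi> (f0 \<sigma>) q + (\<Sum>k\<in>Basis. T (\<lambda>t. A \<sigma> t * \<tau>1 t) (coord_mult k \<phi>) (g \<sigma> k) q))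
  + (T (B1 \<sigma>) \<phi> (f1 \<sigma>) q + T (\<lambda>t. \<beta> \<sigma> t * \<tau>1 t) (star \<phi>) (f1 \<sigma>) q))"
definition "Uxx i j q = (\<Sum>\<sigma>\<in>UNIV. T (\<lambda>t. - (A \<sigma> t / \<tau> t)) (pd j \<phi>) (g \<sigma> i) q + T (\<lambda>t. - (- \<beta> \<sigma> t / \<tau> t)) (pd j (pd i \<phi>)) (f1 \<sigma>) q)"
definition "Uxt i q = (\<Sum>\<sigma>\<in>UNIV. (T (A1 \<sigma>) \<phi> (g \<sigma> i) q + T (\<lambda>t. A \<sigma> t * \<tau>1 t / \<tau> t) (star \<phi>) (g \<sigma> i) q)
  + (T (\<lambda>t. - \<beta>1) (pd i \<phi>) (f1 \<sigma>) q + T (\<lambda>t. - \<beta> \<sigma> t * \<tau>1 t / \<tau> t) (star (pd i \<phi>)) (f1 \<sigma>) q))"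
definition "Utx i q = (\<Sum>\<sigma>\<in>UNIV. (T (A1 \<sigma>) \<phi> (g \<sigma> i) q + (\<Sum>k\<in>Basis. T (\<lambda>t. - (A \<sigma> t * \<tau>1 t / \<tau> t)) (pd i (coord_mult k \<phi>)) (g \<sigma> k) q))
  + (T (\<lambda>t. - (B1 \<sigma> t / \<tau> t)) (pd i \<phi>) (f1 \<sigma>) q + T (\<lambda>t. - (\<beta> \<sigma> t * \<tau>1 t / \<tau> t)) (pd i (star \<phi>)) (f1 \<sigma>) q))"
definition "Utt q = (\<Sum>\<sigma>\<in>UNIV. ((T (A2 \<sigma>) \<phi> (f0 \<sigma>) q + (\<Sum>k\<in>Basis. T (\<lambda>t. A1 \<sigma> t * \<tau>1 t) (coord_mult k \<phi>) (g \<sigma> k) q))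
   + (\<Sum>k\<in>Basis. T (\<lambda>t. A1 \<sigma> t * \<tau>1 t + A \<sigma> t * \<tau>2) (coord_mult k \<phi>) (g \<sigma> k) q
        + T (\<lambda>t. A \<sigma> t * \<tau>1 t * \<tau>1 t / \<tau> t) (star (coord_mult k \<phi>)) (g \<sigma> k) q))
  + ((T (B2 \<sigma>) \<phi> (f1 \<sigma>) q + T (\<lambda>t. B1 \<sigma> t * \<tau>1 t / \<tau> t) (star \<phi>) (f1 \<sigma>) q)
   + (T (\<lambda>t. \<beta>1 * \<tau>1 t + \<beta> \<sigma> t * \<tau>2) (star \<phi>) (f1 \<sigma>) q + T (\<lambda>t. \<beta> \<sigma> t * \<tau>1 t * \<tau>1 t / \<tau> t) (star (star \<phi>)) (f1 \<sigma>) q)))"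

lemma wmol_cong: "(\<And>t. t \<in> I \<Longrightarrow> c t = c' t) \<Longrightarrow> q \<in> \<Omega> \<Longrightarrow> T c \<Psi> f q = T c' \<Psi> f q"
  by (simp add: wmol_def strip_iff)

text \<open>Here the radius contained in B cancels the 1/\<tau> caused by the first derivative of a
  mollification of f1.\<close>

lemma B_over_tau: "t \<in> I \<Longrightarrow> B \<sigma> t / \<tau> t = \<beta> \<sigma> t"
  using tau_pos[OF \<kappa>, of t bm bp] by (simp add: B_def)

lemma dU_x:
  assumes i: "i \<in> Basis" shows "dir_deriv \<Omega> (i, 0) u (Ux i)"
  unfolding u_def[abs_def] Ux_def[abs_def]
proof (intro dir_deriv_sum dir_deriv_add)
  fix \<sigma> :: bool
  show "dir_deriv \<Omega> (i, 0) (T (A \<sigma>) \<phi> (f0 \<sigma>)) (T (A \<sigma>) \<phi> (g \<sigma> i))"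
    by (intro wmol_dx_grad \<kappa> f0' gm \<phi> coeff_continuous i)
  show "dir_deriv \<Omega> (i, 0) (T (B \<sigma>) \<phi> (f1 \<sigma>)) (T (\<lambda>t. - \<beta> \<sigma> t) (pd i \<phi>) (f1 \<sigma>))"
    by (rule dir_deriv_cong[OF wmol_dx[OF \<kappa> f1' \<phi>(1) _ i]]) (auto intro!: wmol_cong coeff_continuous simp: B_over_tau)
qed

lemma dU_t: "dir_deriv \<Omega> (0, 1) u Ut"
  unfolding u_def[abs_def] Ut_def[abs_def]
proof (intro dir_deriv_sum dir_deriv_add[of _ _ "T (A _) \<phi> (f0 _)"])
  fix \<sigma> :: bool
  show "dir_deriv \<Omega> (0, 1) (T (A \<sigma>) \<phi> (f0 \<sigma>)) (\<lambda>q. T (A1 \<sigma>) \<phi> (f0 \<sigma>) q + (\<Sum>k\<in>Basis. T (\<lambda>t. A \<sigma> t * \<tau>1 t) (coord_mult k \<phi>) (g \<sigma> k) q))"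
    by (intro wmol_dt_grad \<kappa> f0' gm \<phi> A_deriv coeff_continuous)
  show "dir_deriv \<Omega> (0, 1) (T (B \<sigma>) \<phi> (f1 \<sigma>)) (\<lambda>q. T (B1 \<sigma>) \<phi> (f1 \<sigma>) q + T (\<lambda>t. \<beta> \<sigma> t * \<tau>1 t) (star \<phi>) (f1 \<sigma>) q)"
  proof (rule dir_deriv_cong[OF wmol_dt[OF \<kappa> f1' \<phi>(1) B_deriv]])
    fix q :: "'a \<times> real" assume q: "q \<in> \<Omega>"
    have "T (\<lambda>t. B \<sigma> t * \<tau>1 t / \<tau> t) (star \<phi>) (f1 \<sigma>) q = T (\<lambda>t. \<beta> \<sigma> t * \<tau>1 t) (star \<phi>) (f1 \<sigma>) q"
      by (rule wmol_cong[OF _ q]) (simp add: B_over_tau[symmetric])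
    then show "T (B1 \<sigma>) \<phi> (f1 \<sigma>) q + T (\<lambda>t. B \<sigma> t * \<tau>1 t / \<tau> t) (star \<phi>) (f1 \<sigma>) q = T (B1 \<sigma>) \<phi> (f1 \<sigma>) q + T (\<lambda>t. \<beta> \<sigma> t * \<tau>1 t) (star \<phi>) (f1 \<sigma>) q"
      by simp
  qed (rule coeff_continuous)
qed

lemma dUx_x:
  assumes i: "i \<in> Basis" and j: "j \<in> Basis" shows "dir_deriv \<Omega> (j, 0) (Ux i) (Uxx i j)"
  unfolding Ux_def[abs_def] Uxx_def[abs_def]
  by (intro dir_deriv_sum dir_deriv_add wmol_dx \<kappa> f1' g' kernels i j coeff_continuous)

lemma dUx_t:
  assumes i: "i \<in> Basis" shows "dir_deriv \<Omega> (0, 1) (Ux i) (Uxt i)"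
  unfolding Ux_def[abs_def] Uxt_def[abs_def]
proof (rule dir_deriv_sum, rule dir_deriv_add)
  fix \<sigma> :: bool
  show "dir_deriv \<Omega> (0, 1) (T (A \<sigma>) \<phi> (g \<sigma> i)) (\<lambda>q. T (A1 \<sigma>) \<phi> (g \<sigma> i) q + T (\<lambda>t. A \<sigma> t * \<tau>1 t / \<tau> t) (star \<phi>) (g \<sigma> i) q)"
    by (intro wmol_dt \<kappa> g' i \<phi> A_deriv coeff_continuous)
  show "dir_deriv \<Omega> (0, 1) (T (\<lambda>t. - \<beta> \<sigma> t) (pd i \<phi>) (f1 \<sigma>)) (\<lambda>q. T (\<lambda>t. - \<beta>1) (pd i \<phi>) (f1 \<sigma>) q + T (\<lambda>t. - \<beta> \<sigma> t * \<tau>1 t / \<tau> t) (star (pd i \<phi>)) (f1 \<sigma>) q)"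
    by (intro wmol_dt \<kappa> f1' kernels i DERIV_minus \<beta>_deriv coeff_continuous)
qed

lemma dUt_x:
  assumes i: "i \<in> Basis" shows "dir_deriv \<Omega> (i, 0) Ut (Utx i)"
  unfolding Ut_def[abs_def] Utx_def[abs_def]
proof (rule dir_deriv_sum, rule dir_deriv_add)
  fix \<sigma> :: bool
  show "dir_deriv \<Omega> (i, 0) (\<lambda>q. T (A1 \<sigma>) \<phi> (f0 \<sigma>) q + (\<Sum>k\<in>Basis. T (\<lambda>t. A \<sigma> t * \<tau>1 t) (coord_mult k \<phi>) (g \<sigma> k) q))
    (\<lambda>q. T (A1 \<sigma>) \<phi> (g \<sigma> i) q + (\<Sum>k\<in>Basis. T (\<lambda>t. - (A \<sigma> t * \<tau>1 t / \<tau> t)) (pd i (coord_mult k \<phi>)) (g \<sigma> k) q))"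
    by (intro dir_deriv_add dir_deriv_sum wmol_dx_grad wmol_dx \<kappa> f0' gm g' kernels i coeff_continuous)
  show "dir_deriv \<Omega> (i, 0) (\<lambda>q. T (B1 \<sigma>) \<phi> (f1 \<sigma>) q + T (\<lambda>t. \<beta> \<sigma> t * \<tau>1 t) (star \<phi>) (f1 \<sigma>) q)
    (\<lambda>q. T (\<lambda>t. - (B1 \<sigma> t / \<tau> t)) (pd i \<phi>) (f1 \<sigma>) q + T (\<lambda>t. - (\<beta> \<sigma> t * \<tau>1 t / \<tau> t)) (pd i (star \<phi>)) (f1 \<sigma>) q)"
    by (intro dir_deriv_add wmol_dx \<kappa> f1' kernels i coeff_continuous)
qed

lemma A\<tau>1_deriv: "((\<lambda>t. A \<sigma> t * \<tau>1 t) has_real_derivative A1 \<sigma> t * \<tau>1 t + A \<sigma> t * \<tau>2) (at t)"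
  by (rule DERIV_cong[OF DERIV_mult[OF A_deriv \<tau>1_deriv]]) simp

lemma \<beta>\<tau>1_deriv: "((\<lambda>t. \<beta> \<sigma> t * \<tau>1 t) has_real_derivative \<beta>1 * \<tau>1 t + \<beta> \<sigma> t * \<tau>2) (at t)"
  by (rule DERIV_cong[OF DERIV_mult[OF \<beta>_deriv \<tau>1_deriv]]) simp

lemma dUt_t: "dir_deriv \<Omega> (0, 1) Ut Utt"
  unfolding Ut_def[abs_def] Utt_def[abs_def]
proof (rule dir_deriv_sum, rule dir_deriv_add)
  fix \<sigma> :: bool
  show "dir_deriv \<Omega> (0, 1) (\<lambda>q. T (A1 \<sigma>) \<phi> (f0 \<sigma>) q + (\<Sum>k\<in>Basis. T (\<lambda>t. A \<sigma> t * \<tau>1 t) (coord_mult k \<phi>) (g \<sigma> k) q))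
    (\<lambda>q. (T (A2 \<sigma>) \<phi> (f0 \<sigma>) q + (\<Sum>k\<in>Basis. T (\<lambda>t. A1 \<sigma> t * \<tau>1 t) (coord_mult k \<phi>) (g \<sigma> k) q))
   + (\<Sum>k\<in>Basis. T (\<lambda>t. A1 \<sigma> t * \<tau>1 t + A \<sigma> t * \<tau>2) (coord_mult k \<phi>) (g \<sigma> k) q
        + T (\<lambda>t. A \<sigma> t * \<tau>1 t * \<tau>1 t / \<tau> t) (star (coord_mult k \<phi>)) (g \<sigma> k) q))"
    by (rule dir_deriv_add, intro wmol_dt_grad \<kappa> f0' gm \<phi> A1_deriv coeff_continuous, intro dir_deriv_sum wmol_dt \<kappa> g' kernels A\<tau>1_deriv coeff_continuous)
  show "dir_deriv \<Omega> (0, 1) (\<lambda>q. T (B1 \<sigma>) \<phi> (f1 \<sigma>) q + T (\<lambda>t. \<beta> \<sigma> t * \<tau>1 t) (star \<phi>) (f1 \<sigma>) q)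
    (\<lambda>q. (T (B2 \<sigma>) \<phi> (f1 \<sigma>) q + T (\<lambda>t. B1 \<sigma> t * \<tau>1 t / \<tau> t) (star \<phi>) (f1 \<sigma>) q)
   + (T (\<lambda>t. \<beta>1 * \<tau>1 t + \<beta> \<sigma> t * \<tau>2) (star \<phi>) (f1 \<sigma>) q + T (\<lambda>t. \<beta> \<sigma> t * \<tau>1 t * \<tau>1 t / \<tau> t) (star (star \<phi>)) (f1 \<sigma>) q))"
    by (rule dir_deriv_add, intro wmol_dt \<kappa> f1' kernels B1_deriv coeff_continuous, intro wmol_dt \<kappa> f1' kernels \<beta>\<tau>1_deriv coeff_continuous)
qed

end

section \<open>Boundary values and local integrability of sums of weighted mollifications\<close>

text \<open>Continuity on the strip is included because it makes every slice measurable, as the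
  triangle inequality requires when traces are added.\<close>

definition Lp_trace :: "real \<Rightarrow> real \<Rightarrow> real \<Rightarrow> real \<Rightarrow> ('a::euclidean_space \<times> real \<Rightarrow> real) \<Rightarrow> ('a \<Rightarrow> real) \<Rightarrow> bool" where
  "Lp_trace p bm bp t v g \<longleftrightarrow> continuous_on (strip bm bp) v \<and> g \<in> borel_measurable borel \<and>
     (\<forall>R. Lp_tends p R (at t within {bm<..<bp}) v g)"

lemma Lp_trace_add:
  fixes v w :: "'a::euclidean_space \<times> real \<Rightarrow> real"
  assumes "Lp_trace p bm bp t v g" "Lp_trace p bm bp t w h" "p \<ge> 0"
  shows "Lp_trace p bm bp t (\<lambda>q. v q + w q) (\<lambda>x. g x + h x)"
proof -
  have e: "\<forall>\<^sub>F s in at t within {bm<..<bp}. borel_on (ball 0 R) (\<lambda>x. v (x, s))"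
    if "continuous_on (strip bm bp) v" for v :: "'a \<times> real \<Rightarrow> real" and R
  proof -
    have "\<forall>\<^sub>F s in at t within {bm<..<bp}. s \<in> {bm<..<bp}" by (auto simp: eventually_at_filter)
    then show ?thesis
    proof eventually_elim
      fix s assume s: "s \<in> {bm<..<bp}"
      show "borel_on (ball 0 R) (\<lambda>x. v (x, s))"
        by (rule borel_on_cont[OF continuous_on_compose2[OF that]])
           (use s in \<open>auto intro!: continuous_intros simp: strip_iff\<close>)
    qed
  qed
  show ?thesis
    using assms unfolding Lp_trace_def by (auto intro!: Lp_tends_add e continuous_on_add)
qed

lemma Lp_trace_0: "p > 0 \<Longrightarrow> Lp_trace p bm bp t (\<lambda>q. 0) (\<lambda>x. 0)"
  by (simp add: Lp_trace_def Lp_tends_def Lpp_def continuous_on_const)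

lemma Lp_trace_sum:
  assumes "\<And>i. i \<in> S \<Longrightarrow> Lp_trace p bm bp t (v i) (g i)" "p > 0"
  shows "Lp_trace p bm bp t (\<lambda>q. \<Sum>i\<in>S. v i q) (\<lambda>x. \<Sum>i\<in>S. g i x)"
  using assms(1)
proof (induction S rule: infinite_finite_induct)
  case (insert i S)
  then show ?case using Lp_trace_add[of p bm bp t "v i" "g i" "\<lambda>q. \<Sum>i\<in>S. v i q" "\<lambda>x. \<Sum>i\<in>S. g i x"] assms(2) by simp
qed (use assms(2) in \<open>simp_all add: Lp_trace_0\<close>)

lemma Lp_trace_tm:
  fixes f :: "'a::euclidean_space \<Rightarrow> real"
  assumes \<kappa>: "\<kappa> > 0" and f: "Lloc p f" and p: "p \<ge> 1" and \<Psi>: "kern \<Psi>" and t: "t \<in> {bm, bp}"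
    and c: "continuous_on UNIV c"
  shows "Lp_trace p bm bp t (wmol \<kappa> bm bp c \<Psi> f) (\<lambda>x. c t * integral\<^sup>L lborel \<Psi> * f x)"
  unfolding Lp_trace_def
proof (intro conjI allI)
  show "continuous_on (strip bm bp) (wmol \<kappa> bm bp c \<Psi> f)"
    by (intro wmol_continuous \<kappa> Lloc_1[OF f p] \<Psi> continuous_on_subset[OF c]) simp
  show "(\<lambda>x. c t * integral\<^sup>L lborel \<Psi> * f x) \<in> borel_measurable borel"
    using f by (auto simp: Lloc_def intro!: borel_measurable_times)
  have "isCont c t" using c by (simp add: continuous_on_eq_continuous_at)
  then have "(c \<longlongrightarrow> c t) (at t within {bm<..<bp})"
    unfolding isCont_def by (rule tendsto_within_subset) simp
  then show "Lp_tends p R (at t within {bm<..<bp}) (wmol \<kappa> bm bp c \<Psi> f) (\<lambda>x. c t * integral\<^sup>L lborel \<Psi> * f x)" for R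
    by (rule wmol_trace[OF \<kappa> f p \<Psi> t])
qed

definition loc_Lp :: "real \<Rightarrow> real \<Rightarrow> real \<Rightarrow> ('a::euclidean_space \<times> real \<Rightarrow> real) \<Rightarrow> bool" where
  "loc_Lp p bm bp v \<longleftrightarrow> continuous_on (strip bm bp) v \<and> (\<forall>R. Lpp p (ball 0 R \<times> {bm<..<bp}) v < \<infinity>)"

lemma loc_Lp_add:
  fixes v w :: "'a::euclidean_space \<times> real \<Rightarrow> real"
  assumes "loc_Lp p bm bp v" "loc_Lp p bm bp w" "p \<ge> 0" shows "loc_Lp p bm bp (\<lambda>q. v q + w q)"
  unfolding loc_Lp_def
proof (intro conjI allI)
  show "continuous_on (strip bm bp) (\<lambda>q. v q + w q)" using assms by (auto simp: loc_Lp_def intro!: continuous_on_add)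
  fix R
  have m: "borel_on (ball 0 R \<times> {bm<..<bp}) v" if "loc_Lp p bm bp v" for v :: "'a \<times> real \<Rightarrow> real"
  proof (rule borel_on_cont)
    show "continuous_on (ball 0 R \<times> {bm<..<bp}) v"
      using that unfolding loc_Lp_def by (auto elim!: continuous_on_subset simp: strip_iff)
  qed (auto intro!: borel_open open_Times)
  have "Lpp p (ball 0 R \<times> {bm<..<bp}) (\<lambda>q. v q + w q) \<le> ennreal (2 powr p) * (Lpp p (ball 0 R \<times> {bm<..<bp}) v + Lpp p (ball 0 R \<times> {bm<..<bp}) w)"
    by (intro Lpp_add m assms)
  also have "\<dots> < \<infinity>" using assms by (simp add: loc_Lp_def ennreal_mult_less_top)
  finally show "Lpp p (ball 0 R \<times> {bm<..<bp}) (\<lambda>q. v q + w q) < \<infinity>" .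
qed

lemma loc_Lp_sum:
  assumes "\<And>i. i \<in> S \<Longrightarrow> loc_Lp p bm bp (v i)" "p > 0" shows "loc_Lp p bm bp (\<lambda>q. \<Sum>i\<in>S. v i q)"
  using assms(1)
proof (induction S rule: infinite_finite_induct)
  case (insert i S)
  then show ?case using loc_Lp_add[of p bm bp "v i" "\<lambda>q. \<Sum>i\<in>S. v i q"] assms(2) by simp
qed (use assms(2) in \<open>simp_all add: loc_Lp_def Lpp_def continuous_on_const\<close>)

lemma loc_Lp_tm:
  fixes f :: "'a::euclidean_space \<Rightarrow> real"
  assumes \<kappa>: "\<kappa> > 0" and b: "bm < bp" and f: "Lloc p f" and p: "p \<ge> 1" and \<Psi>: "kern \<Psi>" and c: "continuous_on UNIV c"
  shows "loc_Lp p bm bp (wmol \<kappa> bm bp c \<Psi> f)"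
  unfolding loc_Lp_def
proof (intro conjI allI)
  show "continuous_on (strip bm bp) (wmol \<kappa> bm bp c \<Psi> f)"
    by (intro wmol_continuous \<kappa> Lloc_1[OF f p] \<Psi> continuous_on_subset[OF c]) simp
  fix R
  obtain C where C: "C > 0" "\<And>\<kappa> bm bp c f M S S'. \<kappa> > 0 \<Longrightarrow> bm < bp \<Longrightarrow> Lloc 1 f \<Longrightarrow> continuous_on {bm<..<bp} c \<Longrightarrow>
    M \<ge> 0 \<Longrightarrow> (\<And>t. t \<in> {bm<..<bp} \<Longrightarrow> \<bar>c t\<bar> \<le> M) \<Longrightarrow> S \<in> sets borel \<Longrightarrow> S' \<in> sets borel \<Longrightarrow>
    (\<And>x y. x \<in> S \<Longrightarrow> norm y \<le> \<kappa> * (bp - bm) \<Longrightarrow> x + y \<in> S') \<Longrightarrow>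
    Lpp p (S \<times> {bm<..<bp}) (wmol \<kappa> bm bp c \<Psi> f) \<le> ennreal (M powr p * (C * (bp - bm))) * Lpp p S' f"
    using wmol_Lpp[OF \<Psi> p] by blast
  have "bounded (c ` {bm..bp})" by (intro compact_imp_bounded compact_continuous_image continuous_on_subset[OF c]) auto
  then obtain M where M: "M > 0" "\<And>t. t \<in> {bm..bp} \<Longrightarrow> \<bar>c t\<bar> \<le> M" by (auto simp: bounded_pos)
  have "Lpp p (ball 0 R \<times> {bm<..<bp}) (wmol \<kappa> bm bp c \<Psi> f) \<le> ennreal (M powr p * (C * (bp - bm))) * Lpp p (ball 0 (R + \<kappa> * (bp - bm))) f"
  proof (rule C(2)[OF \<kappa> b Lloc_1[OF f p] continuous_on_subset[OF c]])
    fix x y :: 'a assume "x \<in> ball 0 R" "norm y \<le> \<kappa> * (bp - bm)"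
    then show "x + y \<in> ball 0 (R + \<kappa> * (bp - bm))" using norm_triangle_ineq[of x y] by simp
  qed (use M in auto)
  also have "\<dots> < \<infinity>" using f by (simp add: Lloc_def ennreal_mult_less_top)
  finally show "Lpp p (ball 0 R \<times> {bm<..<bp}) (wmol \<kappa> bm bp c \<Psi> f) < \<infinity>" .
qed

text \<open>The third source of kernels of mean zero: a coordinate times an even function is
  odd.\<close>

lemma integral_coord_mult:
  fixes \<phi> :: "'a::euclidean_space \<Rightarrow> real"
  assumes "kern \<phi>" "\<And>y. \<phi> (- y) = \<phi> y" shows "integral\<^sup>L lborel (coord_mult b \<phi>) = 0"
proof -
  have "integral\<^sup>L lborel (coord_mult b \<phi>) = (\<integral>y. coord_mult b \<phi> (- y) \<partial>lborel)"
    using lborel_integral_affine[OF kern_measurable[OF kern_coord_mult[OF assms(1)]], where r="- 1" and t=0] by simp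
  also have "\<dots> = - integral\<^sup>L lborel (coord_mult b \<phi>)" by (simp add: coord_mult_def[abs_def] assms(2))
  finally show ?thesis by simp
qed

section \<open>Boundary values of the interpolant and bounds for its coefficients\<close>

context hermite begin

lemma pp: "p > 0" "p \<ge> 0" using p by auto

text \<open>The Hermite interpolation conditions. The boolean \<open>t = bp\<close> is the index of
  the end at which t lies.\<close>

lemma coeffs_at_ends:
  assumes "t \<in> {bm, bp}"
  shows "A \<sigma> t = (if \<sigma> = (t = bp) then 1 else 0)" "A1 \<sigma> t = 0" "B \<sigma> t = 0" "B1 \<sigma> t = (if \<sigma> = (t = bp) then 1 else 0)"
proof -
  have L: "bp - bm \<noteq> 0" using b by simp
  have "s bm = 0" "s bp = 1" "\<tau> bm = 0" "\<tau> bp = 0" using b by (auto simp: s_def tau_def)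
  moreover have "\<tau>1 bm = \<kappa>" "\<tau>1 bp = - \<kappa>" using L by (auto simp: taud_def field_simps)
  ultimately show "A \<sigma> t = (if \<sigma> = (t = bp) then 1 else 0)" "A1 \<sigma> t = 0" "B \<sigma> t = 0" "B1 \<sigma> t = (if \<sigma> = (t = bp) then 1 else 0)"
    using assms b \<kappa> by (auto simp: A_def A1_def B_def B1_def \<beta>_def)
qed

lemma u_trace:
  assumes t: "t \<in> {bm, bp}" shows "Lp_trace p bm bp t u (f0 (t = bp))"
proof -
  have "Lp_trace p bm bp t u (\<lambda>x. \<Sum>\<sigma>\<in>UNIV. A \<sigma> t * integral\<^sup>L lborel \<phi> * f0 \<sigma> x + B \<sigma> t * integral\<^sup>L lborel \<phi> * f1 \<sigma> x)"
    unfolding u_def[abs_def] by (intro Lp_trace_sum Lp_trace_add Lp_trace_tm \<kappa> f0 f1 p pp \<phi> t coeff_continuous)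
  also have "(\<lambda>x. \<Sum>\<sigma>\<in>UNIV. A \<sigma> t * integral\<^sup>L lborel \<phi> * f0 \<sigma> x + B \<sigma> t * integral\<^sup>L lborel \<phi> * f1 \<sigma> x) = f0 (t = bp)"
    by (auto simp: coeffs_at_ends[OF t] UNIV_bool fun_eq_iff \<phi>(3))
  finally show ?thesis .
qed

text \<open>The terms with coefficients A \<tau>' and \<beta> \<tau>' do not vanish at the boundary,
  where \<tau>' is \<kappa> or -\<kappa>. They disappear because first-moment kernels and
  \<open>star \<phi>\<close> have mean zero.\<close>

lemma Ut_trace:
  assumes t: "t \<in> {bm, bp}" shows "Lp_trace p bm bp t Ut (f1 (t = bp))"
proof -
  have "Lp_trace p bm bp t Ut (\<lambda>x. \<Sum>\<sigma>\<in>UNIV. (A1 \<sigma> t * integral\<^sup>L lborel \<phi> * f0 \<sigma> x + (\<Sum>k\<in>Basis. A \<sigma> t * \<tau>1 t * integral\<^sup>L lborel (coord_mult k \<phi>) * g \<sigma> k x))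
    + (B1 \<sigma> t * integral\<^sup>L lborel \<phi> * f1 \<sigma> x + \<beta> \<sigma> t * \<tau>1 t * integral\<^sup>L lborel (star \<phi>) * f1 \<sigma> x))"
    unfolding Ut_def[abs_def]
    by (intro Lp_trace_sum Lp_trace_add Lp_trace_tm[where c="\<lambda>t. A _ t * \<tau>1 t"] Lp_trace_tm[where c="\<lambda>t. \<beta> _ t * \<tau>1 t"] Lp_trace_tm \<kappa> f0 f1 g p pp kernels t coeff_continuous)
  also have "(\<lambda>x. \<Sum>\<sigma>\<in>UNIV. (A1 \<sigma> t * integral\<^sup>L lborel \<phi> * f0 \<sigma> x + (\<Sum>k\<in>Basis. A \<sigma> t * \<tau>1 t * integral\<^sup>L lborel (coord_mult k \<phi>) * g \<sigma> k x))
    + (B1 \<sigma> t * integral\<^sup>L lborel \<phi> * f1 \<sigma> x + \<beta> \<sigma> t * \<tau>1 t * integral\<^sup>L lborel (star \<phi>) * f1 \<sigma> x)) = f1 (t = bp)"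
    by (auto simp: coeffs_at_ends[OF t] UNIV_bool fun_eq_iff \<phi>(3) integral_coord_mult[OF \<phi>(1,2)] integral_star[OF \<phi>(1)])
  finally show ?thesis .
qed

lemma loc_Lp_u: "loc_Lp p bm bp u"
  unfolding u_def[abs_def] by (intro loc_Lp_sum loc_Lp_add loc_Lp_tm \<kappa> b f0 f1 p pp \<phi> coeff_continuous)

lemma loc_Lp_Ux: "i \<in> Basis \<Longrightarrow> loc_Lp p bm bp (Ux i)"
  unfolding Ux_def[abs_def] by (intro loc_Lp_sum loc_Lp_add loc_Lp_tm \<kappa> b g f1 p pp kernels coeff_continuous)

lemma loc_Lp_Ut: "loc_Lp p bm bp Ut"
  unfolding Ut_def[abs_def] by (intro loc_Lp_sum loc_Lp_add loc_Lp_tm \<kappa> b f0 f1 g p pp kernels coeff_continuous)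

text \<open>Since \<tau> is below \<kappa> times the width, a coefficient of size 1 / (b^+ - b^-) is
  also of size 1/\<tau>. With a kernel of mean zero it can thus be charged to the seminorm.\<close>

lemma L_tau: assumes t: "t \<in> I" shows "\<tau> t > 0" "1 / (bp - bm) \<le> \<kappa> / \<tau> t"
proof -
  show 1: "\<tau> t > 0" by (rule tau_pos[OF \<kappa> t])
  show "1 / (bp - bm) \<le> \<kappa> / \<tau> t" using tau_le(3)[OF \<kappa> t] 1 b by (simp add: field_simps)
qed

lemma s01: assumes t: "t \<in> I" shows "0 \<le> s t" "s t \<le> 1"
  using t b by (auto simp: s_def field_simps)

lemma A_bd: assumes t: "t \<in> I" shows "\<bar>A \<sigma> t\<bar> \<le> 6"
proof -
  have "\<bar>3 * x - 2 * y\<bar> \<le> 6 \<and> \<bar>1 - 3 * x + 2 * y\<bar> \<le> 6" if "0 \<le> x" "x \<le> 1" "0 \<le> y" "y \<le> 1" for x y :: real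
    using that by (auto simp: abs_le_iff)
  moreover have "0 \<le> (s t)\<^sup>2" "(s t)\<^sup>2 \<le> 1" "0 \<le> (s t) ^ 3" "(s t) ^ 3 \<le> 1" using s01[OF t] by (auto intro: power_le_one)
  ultimately show ?thesis unfolding A_def by presburger
qed

lemma \<beta>_bd: assumes t: "t \<in> I" shows "\<bar>\<beta> \<sigma> t\<bar> \<le> 1 / \<kappa>"
  using s01[OF t] \<kappa> by (auto simp: \<beta>_def field_simps)

lemma \<tau>1_bd: assumes t: "t \<in> I" shows "\<bar>\<tau>1 t\<bar> \<le> \<kappa>"
proof -
  have "\<bar>bm + bp - 2 * t\<bar> \<le> bp - bm" using t by auto
  then have "\<kappa> * \<bar>bm + bp - 2 * t\<bar> \<le> \<kappa> * (bp - bm)" using \<kappa> by simp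
  then show ?thesis using b \<kappa> by (simp add: taud_def abs_mult divide_le_eq)
qed

lemma \<tau>2_bd: assumes t: "t \<in> I" shows "\<bar>\<tau>2\<bar> \<le> 2 * \<kappa>\<^sup>2 / \<tau> t"
proof -
  have "\<bar>\<tau>2\<bar> = 2 * \<kappa> * (1 / (bp - bm))" using b \<kappa> by (simp add: \<tau>2_def)
  also have "\<dots> \<le> 2 * \<kappa> * (\<kappa> / \<tau> t)" using \<kappa> by (intro mult_left_mono L_tau t) auto
  finally show ?thesis by (simp add: power2_eq_square)
qed

lemma A1_bd': assumes t: "t \<in> I" shows "\<bar>A1 \<sigma> t\<bar> \<le> 6 / (bp - bm)"
proof -
  have "\<bar>6 * x - 6 * y\<bar> \<le> 6" if "0 \<le> y" "y \<le> x" "x \<le> 1" for x y :: real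
    using that by (auto simp: abs_le_iff)
  moreover have "0 \<le> (s t)\<^sup>2" "(s t)\<^sup>2 \<le> s t" using s01[OF t] by (auto simp: power2_eq_square mult_left_le)
  ultimately have "\<bar>6 * s t - 6 * (s t)\<^sup>2\<bar> \<le> 6" using s01[OF t] by blast
  then show ?thesis using b by (auto simp: A1_def abs_mult intro!: divide_right_mono)
qed

lemma A1_bd: assumes t: "t \<in> I" shows "\<bar>A1 \<sigma> t\<bar> \<le> 6 * \<kappa> / \<tau> t"
  using A1_bd'[OF t, of \<sigma>] L_tau(2)[OF t] by simp

lemma A2_bd: assumes t: "t \<in> I" shows "\<bar>A2 \<sigma> t\<bar> \<le> 6 / (bp - bm)\<^sup>2"
proof -
  have "\<bar>6 - 12 * s t\<bar> \<le> 6" using s01[OF t] by auto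
  then show ?thesis using b by (auto simp: A2_def abs_mult intro!: divide_right_mono)
qed

lemma \<beta>1_bd: assumes t: "t \<in> I" shows "\<bar>\<beta>1\<bar> \<le> 1 / \<tau> t"
proof -
  have "\<bar>\<beta>1\<bar> = (1 / \<kappa>) * (1 / (bp - bm))" using b \<kappa> by (simp add: \<beta>1_def abs_mult)
  also have "\<dots> \<le> (1 / \<kappa>) * (\<kappa> / \<tau> t)" using \<kappa> by (intro mult_left_mono L_tau t) auto
  finally show ?thesis using \<kappa> by simp
qed

lemma abs_mult_le: "\<bar>x\<bar> \<le> X \<Longrightarrow> \<bar>y\<bar> \<le> Y \<Longrightarrow> \<bar>x * y\<bar> \<le> X * (Y::real)"
  unfolding abs_mult by (rule mult_mono) auto

lemma abs_div_le: "\<bar>x\<bar> \<le> X \<Longrightarrow> t \<in> I \<Longrightarrow> \<bar>x / \<tau> t\<bar> \<le> X / \<tau> t"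
  using L_tau(1)[of t] by (simp add: abs_divide divide_right_mono)

lemma B1_bd: assumes t: "t \<in> I" shows "\<bar>B1 \<sigma> t\<bar> \<le> 2"
proof -
  have "\<bar>\<tau>1 t * \<beta> \<sigma> t\<bar> \<le> \<kappa> * (1 / \<kappa>)" by (intro abs_mult_le \<tau>1_bd \<beta>_bd t)
  moreover have "\<bar>\<tau> t * \<beta>1\<bar> \<le> \<tau> t * (1 / \<tau> t)" by (intro abs_mult_le \<beta>1_bd t) (use L_tau(1)[OF t] in simp)
  ultimately show ?thesis using \<kappa> L_tau(1)[OF t] unfolding B1_def by (simp add: abs_le_iff)
qed

text \<open>A generous common bound for \<tau> times any singular coefficient; it dominates all the
  numbers listed in \<open>M_ge\<close>. It depends on \<kappa> alone, so the constants are the same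
  for all strips.\<close>

definition "M = 20 * (1 + \<kappa>)\<^sup>2 + 20 / \<kappa>"

lemma M_ge: "x \<le> M" if "x \<in> {6, 1 / \<kappa>, 6 * \<kappa>, 1, 2, 6 * \<kappa>\<^sup>2, 18 * \<kappa>\<^sup>2, 2 * \<kappa>, 3 * \<kappa>, \<kappa>}"
proof -
  obtain z y where zy: "\<kappa>\<^sup>2 = z" "z \<ge> 0" "1 / \<kappa> = y" "y \<ge> 0" using \<kappa> by simp
  have "20 / \<kappa> = 20 * (1 / \<kappa>)" by simp
  then have "M = 20 + 40 * \<kappa> + 20 * z + 20 * y"
    unfolding M_def zy by (simp add: power2_eq_square algebra_simps zy(1)[symmetric])
  with that[unfolded zy] \<kappa> zy(2,4) show ?thesis by auto
qed

lemma bd_M: "\<bar>x\<bar> \<le> y / \<tau> t \<Longrightarrow> y \<in> {6, 1 / \<kappa>, 6 * \<kappa>, 1, 2, 6 * \<kappa>\<^sup>2, 18 * \<kappa>\<^sup>2, 2 * \<kappa>, 3 * \<kappa>, \<kappa>} \<Longrightarrow> t \<in> I \<Longrightarrow> \<bar>x\<bar> \<le> M / \<tau> t"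
  using divide_right_mono[OF M_ge[of y], of "\<tau> t"] L_tau(1)[of t] by (meson less_imp_le order_trans)

text \<open>From |A| \<le> 6, |B'| \<le> 2, |\<beta>| \<le> 1/\<kappa> and |\<tau>'| \<le> \<kappa>,
  with at most one factor 1/\<tau> per coefficient. The order is that of the terms in
  \<open>Uxx\<close>, \<open>Uxt\<close>, \<open>Utx\<close> and \<open>Utt\<close>.\<close>

lemma coeff_bounds:
  assumes t: "t \<in> I"
  shows "\<bar>- (A \<sigma> t / \<tau> t)\<bar> \<le> M / \<tau> t" "\<bar>- (- \<beta> \<sigma> t / \<tau> t)\<bar> \<le> M / \<tau> t" "\<bar>A \<sigma> t * \<tau>1 t / \<tau> t\<bar> \<le> M / \<tau> t"
    "\<bar>- \<beta>1\<bar> \<le> M / \<tau> t" "\<bar>- \<beta> \<sigma> t * \<tau>1 t / \<tau> t\<bar> \<le> M / \<tau> t" "\<bar>- (A \<sigma> t * \<tau>1 t / \<tau> t)\<bar> \<le> M / \<tau> t"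
    "\<bar>- (B1 \<sigma> t / \<tau> t)\<bar> \<le> M / \<tau> t" "\<bar>- (\<beta> \<sigma> t * \<tau>1 t / \<tau> t)\<bar> \<le> M / \<tau> t"
    "\<bar>A1 \<sigma> t * \<tau>1 t\<bar> \<le> M / \<tau> t" "\<bar>A1 \<sigma> t * \<tau>1 t + A \<sigma> t * \<tau>2\<bar> \<le> M / \<tau> t" "\<bar>A \<sigma> t * \<tau>1 t * \<tau>1 t / \<tau> t\<bar> \<le> M / \<tau> t"
    "\<bar>B1 \<sigma> t * \<tau>1 t / \<tau> t\<bar> \<le> M / \<tau> t" "\<bar>\<beta>1 * \<tau>1 t + \<beta> \<sigma> t * \<tau>2\<bar> \<le> M / \<tau> t" "\<bar>\<beta> \<sigma> t * \<tau>1 t * \<tau>1 t / \<tau> t\<bar> \<le> M / \<tau> t"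
proof -
  note [simp] = abs_minus_cancel
  have \<kappa>1: "1 / \<kappa> * \<kappa> = 1" using \<kappa> by simp
  have a: "\<bar>A \<sigma> t * \<tau>1 t\<bar> \<le> 6 * \<kappa>" by (intro abs_mult_le A_bd \<tau>1_bd t)
  have b: "\<bar>\<beta> \<sigma> t * \<tau>1 t\<bar> \<le> 1" using abs_mult_le[OF \<beta>_bd[OF t, of \<sigma>] \<tau>1_bd[OF t]] \<kappa>1 by simp
  show "\<bar>- (A \<sigma> t / \<tau> t)\<bar> \<le> M / \<tau> t"
    unfolding abs_minus_cancel by (rule bd_M[OF abs_div_le[OF A_bd[OF t] t] _ t]) simp
  show "\<bar>- (- \<beta> \<sigma> t / \<tau> t)\<bar> \<le> M / \<tau> t"
    using bd_M[OF abs_div_le[OF \<beta>_bd[OF t, of \<sigma>] t] _ t] by simp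
  show 3: "\<bar>A \<sigma> t * \<tau>1 t / \<tau> t\<bar> \<le> M / \<tau> t" by (rule bd_M[OF abs_div_le[OF a t] _ t]) simp
  then show "\<bar>- (A \<sigma> t * \<tau>1 t / \<tau> t)\<bar> \<le> M / \<tau> t" by simp
  show "\<bar>- \<beta>1\<bar> \<le> M / \<tau> t" unfolding abs_minus_cancel by (rule bd_M[OF \<beta>1_bd[OF t] _ t]) simp
  show 5: "\<bar>- (\<beta> \<sigma> t * \<tau>1 t / \<tau> t)\<bar> \<le> M / \<tau> t" unfolding abs_minus_cancel by (rule bd_M[OF abs_div_le[OF b t] _ t]) simp
  then show "\<bar>- \<beta> \<sigma> t * \<tau>1 t / \<tau> t\<bar> \<le> M / \<tau> t" by simp
  show "\<bar>- (B1 \<sigma> t / \<tau> t)\<bar> \<le> M / \<tau> t"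
    unfolding abs_minus_cancel by (rule bd_M[OF abs_div_le[OF B1_bd[OF t] t] _ t]) simp
  have c: "\<bar>A1 \<sigma> t * \<tau>1 t\<bar> \<le> 6 * \<kappa>\<^sup>2 / \<tau> t"
    using abs_mult_le[OF A1_bd[OF t, of \<sigma>] \<tau>1_bd[OF t]] by (simp add: power2_eq_square mult.assoc)
  then show "\<bar>A1 \<sigma> t * \<tau>1 t\<bar> \<le> M / \<tau> t" by (rule bd_M[OF _ _ t]) simp
  have d: "\<bar>A \<sigma> t * \<tau>2\<bar> \<le> 6 * (2 * \<kappa>\<^sup>2 / \<tau> t)" by (intro abs_mult_le A_bd \<tau>2_bd t)
  have "\<bar>A1 \<sigma> t * \<tau>1 t + A \<sigma> t * \<tau>2\<bar> \<le> 18 * \<kappa>\<^sup>2 / \<tau> t"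
    using abs_triangle_ineq[of "A1 \<sigma> t * \<tau>1 t" "A \<sigma> t * \<tau>2"] c d by simp
  then show "\<bar>A1 \<sigma> t * \<tau>1 t + A \<sigma> t * \<tau>2\<bar> \<le> M / \<tau> t" by (rule bd_M[OF _ _ t]) simp
  have "\<bar>A \<sigma> t * \<tau>1 t * \<tau>1 t\<bar> \<le> 6 * \<kappa>\<^sup>2" using abs_mult_le[OF a \<tau>1_bd[OF t]] by (simp add: power2_eq_square)
  then show "\<bar>A \<sigma> t * \<tau>1 t * \<tau>1 t / \<tau> t\<bar> \<le> M / \<tau> t" by (rule bd_M[OF abs_div_le[OF _ t] _ t]) simp
  show "\<bar>B1 \<sigma> t * \<tau>1 t / \<tau> t\<bar> \<le> M / \<tau> t"
    by (rule bd_M[OF abs_div_le[OF abs_mult_le[OF B1_bd[OF t] \<tau>1_bd[OF t]] t] _ t]) simp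
  have e: "\<bar>\<beta>1 * \<tau>1 t\<bar> \<le> 1 / \<tau> t * \<kappa>" by (intro abs_mult_le \<beta>1_bd \<tau>1_bd t)
  have f: "\<bar>\<beta> \<sigma> t * \<tau>2\<bar> \<le> 1 / \<kappa> * (2 * \<kappa>\<^sup>2 / \<tau> t)" by (intro abs_mult_le \<beta>_bd \<tau>2_bd t)
  have "1 / \<kappa> * (2 * \<kappa>\<^sup>2 / \<tau> t) = 2 * \<kappa> / \<tau> t" using \<kappa> by (simp add: power2_eq_square)
  then have "\<bar>\<beta>1 * \<tau>1 t + \<beta> \<sigma> t * \<tau>2\<bar> \<le> 3 * \<kappa> / \<tau> t"
    using abs_triangle_ineq[of "\<beta>1 * \<tau>1 t" "\<beta> \<sigma> t * \<tau>2"] e f by simp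
  then show "\<bar>\<beta>1 * \<tau>1 t + \<beta> \<sigma> t * \<tau>2\<bar> \<le> M / \<tau> t" by (rule bd_M[OF _ _ t]) simp
  have "\<bar>\<beta> \<sigma> t * \<tau>1 t * \<tau>1 t\<bar> \<le> \<kappa>" using abs_mult_le[OF b \<tau>1_bd[OF t]] by simp
  then show "\<bar>\<beta> \<sigma> t * \<tau>1 t * \<tau>1 t / \<tau> t\<bar> \<le> M / \<tau> t" by (rule bd_M[OF abs_div_le[OF _ t] _ t]) simp
qed

end

section \<open>Regrouping into the differences of the data\<close>

context hermite begin

text \<open>The error of the trapezoidal rule for the normal derivative. It vanishes for boundary
  data of functions that are quadratic in t, up to which degree no third-order correction is
  present.\<close>

definition "D x = f0 True x - f0 False x - (f1 True x + f1 False x) * ((bp - bm) / 2)"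
definition "E x = f1 True x - f1 False x"
definition "G i x = g True i x - g False i x"

lemma Lloc_D: "Lloc p D"
proof -
  have "Lloc p (\<lambda>x. f0 True x - f0 False x - ((bp - bm) / 2) * (f1 True x + f1 False x))"
    by (intro Lloc_diff Lloc_cmult Lloc_add f0 f1 pp)
  then show ?thesis by (simp add: D_def[abs_def] mult.commute)
qed

lemma Lloc_E: "Lloc p E" unfolding E_def[abs_def] by (intro Lloc_diff f1 pp)
lemma Lloc_G: "i \<in> Basis \<Longrightarrow> Lloc p (G i)" unfolding G_def[abs_def] by (intro Lloc_diff g pp)

lemma A1_sign: "A1 False t = - A1 True t" and A2_sign: "A2 False t = - A2 True t"
  by (simp_all add: A1_def A2_def minus_divide_left)

text \<open>The two functions A add up to 1, so their derivatives are opposite and only the jump of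
  the gradient remains. This is necessary because the kernel here is \<phi>, of mean one.\<close>

lemma A1_group:
  assumes q: "q \<in> \<Omega>" and i: "i \<in> Basis"
  shows "(\<Sum>\<sigma>\<in>UNIV. T (A1 \<sigma>) \<phi> (g \<sigma> i) q) = T (A1 True) \<phi> (G i) q"
proof -
  have r: "\<tau> (snd q) > 0" using q L_tau(1) by (simp add: strip_iff)
  show ?thesis
    unfolding G_def[abs_def] wmol_def tmol_def mol_diff[OF g'[OF i] g'[OF i] \<phi>(1) r]
    by (simp add: UNIV_bool A1_sign algebra_simps)
qed

text \<open>With L the width, the second derivatives of the Hermite functions satisfy B'' =
  \<plusminus>1/L - (L/2) A'', where A belongs to the upper end. The common part joins the jump of
  f0 to form D, the part with opposite signs leaves E with the coefficient 1/L.\<close>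

lemma A2_group:
  assumes q: "q \<in> \<Omega>"
  shows "(\<Sum>\<sigma>\<in>UNIV. T (A2 \<sigma>) \<phi> (f0 \<sigma>) q + T (B2 \<sigma>) \<phi> (f1 \<sigma>) q) = T (A2 True) \<phi> D q + T (\<lambda>t. 1 / (bp - bm)) \<phi> E q"
proof -
  have r: "\<tau> (snd q) > 0" using q L_tau(1) by (simp add: strip_iff)
  let ?m = "\<lambda>f. mol \<phi> f (fst q, \<tau> (snd q))"
  have D: "?m D = ?m (f0 True) - ?m (f0 False) - ((bp - bm) / 2) * (?m (f1 True) + ?m (f1 False))"
  proof -
    obtain c where c: "(bp - bm) / 2 = c" by blast
    have "D = (\<lambda>x. (f0 True x - f0 False x) - c * (f1 True x + f1 False x))"
      by (simp add: D_def[abs_def] c mult.commute)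
    moreover have "Lloc 1 (\<lambda>x. f0 True x - f0 False x)" "Lloc 1 (\<lambda>x. f1 True x + f1 False x)" "Lloc 1 (\<lambda>x. c * (f1 True x + f1 False x))"
      by (intro Lloc_diff Lloc_add Lloc_cmult f0' f1'; simp)+
    ultimately show ?thesis
      unfolding c by (simp only: mol_diff[OF _ _ \<phi>(1) r] mol_add[OF _ _ \<phi>(1) r] mol_cmult f0' f1')
  qed
  have E: "?m E = ?m (f1 True) - ?m (f1 False)"
    unfolding E_def[abs_def] by (rule mol_diff[OF f1' f1' \<phi>(1) r])
  let ?t = "snd q"
  have L: "bp - bm \<noteq> 0" using b by simp
  \<comment> \<open>The identity between second Hermite derivatives, checked after writing
    everything in terms of the normalized height S and the width L.\<close>
  have B2: "B2 \<sigma> ?t = (if \<sigma> then 1 / (bp - bm) else - 1 / (bp - bm)) - A2 True ?t * ((bp - bm) / 2)" for \<sigma>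
  proof -
    obtain L S where LS: "L = bp - bm" "S = s ?t" "L \<noteq> 0" using L by simp
    have t1: "\<tau>1 ?t = \<kappa> * (1 - 2 * S)" unfolding LS taud_def s_def using L by (simp add: field_simps)
    show ?thesis
      unfolding B2_def A2_def \<beta>_def \<beta>1_def \<tau>2_def t1 LS(1,2)[symmetric]
      using LS(3) \<kappa> by (cases \<sigma>) (simp_all add: field_simps power2_eq_square)
  qed
  show ?thesis
    unfolding wmol_def tmol_def D E by (simp add: UNIV_bool A2_sign B2 algebra_simps)
qed

lemma Uxt_eq:
  assumes q: "q \<in> \<Omega>" and i: "i \<in> Basis"
  shows "Uxt i q = T (A1 True) \<phi> (G i) q + (\<Sum>\<sigma>\<in>UNIV. T (\<lambda>t. A \<sigma> t * \<tau>1 t / \<tau> t) (star \<phi>) (g \<sigma> i) q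
    + (T (\<lambda>t. - \<beta>1) (pd i \<phi>) (f1 \<sigma>) q + T (\<lambda>t. - \<beta> \<sigma> t * \<tau>1 t / \<tau> t) (star (pd i \<phi>)) (f1 \<sigma>) q))"
  unfolding Uxt_def A1_group[OF assms, symmetric] by (simp only: sum.distrib add.assoc)

lemma Utx_eq:
  assumes q: "q \<in> \<Omega>" and i: "i \<in> Basis"
  shows "Utx i q = T (A1 True) \<phi> (G i) q + (\<Sum>\<sigma>\<in>UNIV. (\<Sum>k\<in>Basis. T (\<lambda>t. - (A \<sigma> t * \<tau>1 t / \<tau> t)) (pd i (coord_mult k \<phi>)) (g \<sigma> k) q)
    + (T (\<lambda>t. - (B1 \<sigma> t / \<tau> t)) (pd i \<phi>) (f1 \<sigma>) q + T (\<lambda>t. - (\<beta> \<sigma> t * \<tau>1 t / \<tau> t)) (pd i (star \<phi>)) (f1 \<sigma>) q))"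
  unfolding Utx_def A1_group[OF assms, symmetric] by (simp only: sum.distrib add.assoc)

lemma Utt_eq:
  assumes q: "q \<in> \<Omega>"
  shows "Utt q = (T (A2 True) \<phi> D q + T (\<lambda>t. 1 / (bp - bm)) \<phi> E q)
    + (\<Sum>\<sigma>\<in>UNIV. (\<Sum>k\<in>Basis. T (\<lambda>t. A1 \<sigma> t * \<tau>1 t) (coord_mult k \<phi>) (g \<sigma> k) q)
     + (\<Sum>k\<in>Basis. T (\<lambda>t. A1 \<sigma> t * \<tau>1 t + A \<sigma> t * \<tau>2) (coord_mult k \<phi>) (g \<sigma> k) q + T (\<lambda>t. A \<sigma> t * \<tau>1 t * \<tau>1 t / \<tau> t) (star (coord_mult k \<phi>)) (g \<sigma> k) q)
     + (T (\<lambda>t. B1 \<sigma> t * \<tau>1 t / \<tau> t) (star \<phi>) (f1 \<sigma>) q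
     + (T (\<lambda>t. \<beta>1 * \<tau>1 t + \<beta> \<sigma> t * \<tau>2) (star \<phi>) (f1 \<sigma>) q + T (\<lambda>t. \<beta> \<sigma> t * \<tau>1 t * \<tau>1 t / \<tau> t) (star (star \<phi>)) (f1 \<sigma>) q)))"
  unfolding Utt_def A2_group[OF assms, symmetric] by (simp only: sum.distrib ac_simps)

end

subsection \<open>Bounds uniform in the data\<close>

definition energy :: "real \<Rightarrow> real \<Rightarrow> real \<Rightarrow> real \<Rightarrow> (bool \<Rightarrow> 'a::euclidean_space \<Rightarrow> real) \<Rightarrow> (bool \<Rightarrow> 'a \<Rightarrow> real) \<Rightarrow>
    (bool \<Rightarrow> 'a \<Rightarrow> 'a \<Rightarrow> real) \<Rightarrow> ennreal" where
  "energy p a bm bp f0 f1 g =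
     ennreal ((bp - bm) powr (1 - 2 * p)) * Lpp p UNIV (hermite.D bm bp f0 f1)
     + ennreal ((bp - bm) powr (1 - p)) * ((\<Sum>i\<in>Basis. Lpp p UNIV (hermite.G g i)) + Lpp p UNIV (hermite.E f1))
     + (\<Sum>\<sigma>\<in>UNIV. (\<Sum>i\<in>Basis. tilde_W_scalar a p (g \<sigma> i)) + tilde_W_scalar a p (f1 \<sigma>))"

text \<open>The constant has to be independent of the data, so the estimates are stated for families of functions
  indexed by the data.\<close>

definition dominated :: "real \<Rightarrow> real \<Rightarrow> real \<Rightarrow> ('a::euclidean_space \<Rightarrow> real) \<Rightarrow>
    (real \<Rightarrow> real \<Rightarrow> (bool \<Rightarrow> 'a \<Rightarrow> real) \<Rightarrow> (bool \<Rightarrow> 'a \<Rightarrow> real) \<Rightarrow> (bool \<Rightarrow> 'a \<Rightarrow> 'a \<Rightarrow> real) \<Rightarrow> 'a \<times> real \<Rightarrow> real) \<Rightarrow> bool" where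
  "dominated p a \<kappa> \<phi> F \<longleftrightarrow> (\<exists>C>0. \<forall>bm bp f0 f1 g. hermite p \<kappa> bm bp \<phi> f0 f1 g \<longrightarrow> \<kappa> * (bp - bm) \<le> a \<longrightarrow>
     continuous_on (strip bm bp) (F bm bp f0 f1 g) \<and>
     Lpp p (strip bm bp) (F bm bp f0 f1 g) \<le> ennreal C * energy p a bm bp f0 f1 g)"

lemma dominatedI:
  assumes "C > 0" "\<And>bm bp f0 f1 g. hermite p \<kappa> bm bp \<phi> f0 f1 g \<Longrightarrow> \<kappa> * (bp - bm) \<le> a \<Longrightarrow>
     continuous_on (strip bm bp) (F bm bp f0 f1 g) \<and>
     Lpp p (strip bm bp) (F bm bp f0 f1 g) \<le> ennreal C * energy p a bm bp f0 f1 g"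
  shows "dominated p a \<kappa> \<phi> F"
  unfolding dominated_def using assms by blast

lemma dominated_add:
  assumes F: "dominated p a \<kappa> \<phi> F" and G: "dominated p a \<kappa> \<phi> G" and p: "p \<ge> 1"
  shows "dominated p a \<kappa> \<phi> (\<lambda>bm bp f0 f1 g q. F bm bp f0 f1 g q + G bm bp f0 f1 g q)"
proof -
  obtain C1 where C1: "C1 > 0" "\<And>bm bp f0 f1 g. hermite p \<kappa> bm bp \<phi> f0 f1 g \<Longrightarrow> \<kappa> * (bp - bm) \<le> a \<Longrightarrow>
     continuous_on (strip bm bp) (F bm bp f0 f1 g) \<and>
     Lpp p (strip bm bp) (F bm bp f0 f1 g) \<le> ennreal C1 * energy p a bm bp f0 f1 g" using F unfolding dominated_def by blast
  obtain C2 where C2: "C2 > 0" "\<And>bm bp f0 f1 g. hermite p \<kappa> bm bp \<phi> f0 f1 g \<Longrightarrow> \<kappa> * (bp - bm) \<le> a \<Longrightarrow>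
     continuous_on (strip bm bp) (G bm bp f0 f1 g) \<and>
     Lpp p (strip bm bp) (G bm bp f0 f1 g) \<le> ennreal C2 * energy p a bm bp f0 f1 g" using G unfolding dominated_def by blast
  show ?thesis
  proof (rule dominatedI[of "2 powr p * (C1 + C2)"])
    show "2 powr p * (C1 + C2) > 0" using C1 C2 by simp
    fix bm bp f0 f1 g assume H: "hermite p \<kappa> bm bp \<phi> f0 f1 g" "\<kappa> * (bp - bm) \<le> a"
    note c1 = C1(2)[OF H] and c2 = C2(2)[OF H]
    have s: "(strip bm bp :: ('a \<times> real) set) \<in> sets borel" by (rule borel_open[OF strip_open])
    have "Lpp p (strip bm bp) (\<lambda>q. F bm bp f0 f1 g q + G bm bp f0 f1 g q) \<le>
      ennreal (2 powr p) * (Lpp p (strip bm bp) (F bm bp f0 f1 g) + Lpp p (strip bm bp) (G bm bp f0 f1 g))"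
      by (rule Lpp_add) (use p c1 c2 s in \<open>auto intro: borel_on_cont\<close>)
    also have "\<dots> \<le> ennreal (2 powr p) * (ennreal C1 * energy p a bm bp f0 f1 g + ennreal C2 * energy p a bm bp f0 f1 g)"
      using c1 c2 by (intro mult_left_mono add_mono) auto
    also have "\<dots> = ennreal (2 powr p * (C1 + C2)) * energy p a bm bp f0 f1 g"
      using C1 C2 by (simp add: ennreal_mult ennreal_plus distrib_right mult.assoc)
    finally show "continuous_on (strip bm bp) (\<lambda>q. F bm bp f0 f1 g q + G bm bp f0 f1 g q) \<and>
      Lpp p (strip bm bp) (\<lambda>q. F bm bp f0 f1 g q + G bm bp f0 f1 g q) \<le> ennreal (2 powr p * (C1 + C2)) * energy p a bm bp f0 f1 g"
      using c1 c2 by (auto intro: continuous_on_add)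
  qed
qed

lemma dominated_sum:
  assumes "\<And>i. i \<in> S \<Longrightarrow> dominated p a \<kappa> \<phi> (F i)" and p: "p \<ge> 1"
  shows "dominated p a \<kappa> \<phi> (\<lambda>bm bp f0 f1 g q. \<Sum>i\<in>S. F i bm bp f0 f1 g q)"
proof -
  have 0: "dominated p a \<kappa> \<phi> (\<lambda>bm bp f0 f1 g q. 0)"
    by (rule dominatedI[of 1]) (use p in \<open>auto simp: Lpp_def continuous_on_const\<close>)
  show ?thesis using assms(1)
  proof (induction S rule: infinite_finite_induct)
    case (insert i S)
    have "dominated p a \<kappa> \<phi> (\<lambda>bm bp f0 f1 g q. F i bm bp f0 f1 g q + (\<Sum>i\<in>S. F i bm bp f0 f1 g q))"
      by (rule dominated_add[OF _ _ p]) (use insert in auto)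
    then show ?case using insert by simp
  qed (use 0 in simp_all)
qed

lemma dominated_cong:
  assumes "dominated p a \<kappa> \<phi> F"
    "\<And>bm bp f0 f1 g q. hermite p \<kappa> bm bp \<phi> f0 f1 g \<Longrightarrow> q \<in> strip bm bp \<Longrightarrow> F bm bp f0 f1 g q = G bm bp f0 f1 g q"
  shows "dominated p a \<kappa> \<phi> G"
proof -
  obtain C where C: "C > 0" "\<And>bm bp f0 f1 g. hermite p \<kappa> bm bp \<phi> f0 f1 g \<Longrightarrow> \<kappa> * (bp - bm) \<le> a \<Longrightarrow>
     continuous_on (strip bm bp) (F bm bp f0 f1 g) \<and>
     Lpp p (strip bm bp) (F bm bp f0 f1 g) \<le> ennreal C * energy p a bm bp f0 f1 g" using assms(1) unfolding dominated_def by blast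
  show ?thesis
  proof (rule dominatedI[OF C(1)])
    fix bm bp f0 f1 g assume H: "hermite p \<kappa> bm bp \<phi> f0 f1 g" "\<kappa> * (bp - bm) \<le> a"
    have "continuous_on (strip bm bp) (G bm bp f0 f1 g)"
      by (rule continuous_on_eq[of _ "F bm bp f0 f1 g"]) (use C(2)[OF H] assms(2)[OF H(1)] in auto)
    moreover have "Lpp p (strip bm bp) (G bm bp f0 f1 g) = Lpp p (strip bm bp) (F bm bp f0 f1 g)"
      by (rule Lpp_cong) (simp add: assms(2)[OF H(1)])
    ultimately show "continuous_on (strip bm bp) (G bm bp f0 f1 g) \<and> Lpp p (strip bm bp) (G bm bp f0 f1 g) \<le> ennreal C * energy p a bm bp f0 f1 g"
      using C(2)[OF H] by simp
  qed
qed

lemma dominated_abs: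
  assumes "dominated p a \<kappa> \<phi> F" shows "dominated p a \<kappa> \<phi> (\<lambda>bm bp f0 f1 g q. \<bar>F bm bp f0 f1 g q\<bar>)"
proof -
  obtain C where C: "C > 0" "\<And>bm bp f0 f1 g. hermite p \<kappa> bm bp \<phi> f0 f1 g \<Longrightarrow> \<kappa> * (bp - bm) \<le> a \<Longrightarrow>
     continuous_on (strip bm bp) (F bm bp f0 f1 g) \<and>
     Lpp p (strip bm bp) (F bm bp f0 f1 g) \<le> ennreal C * energy p a bm bp f0 f1 g" using assms(1) unfolding dominated_def by blast
  show ?thesis
    by (rule dominatedI[OF C(1)]) (use C(2) in \<open>auto simp: Lpp_def intro!: continuous_on_rabs\<close>)
qed

text \<open>Singular terms: a coefficient of size M/\<tau> and a kernel of mean zero are charged to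
  the seminorm of one of the data, which h selects.\<close>

lemma dominated_sing:
  fixes \<Psi> \<phi> :: "'a::euclidean_space \<Rightarrow> real"
  assumes \<Psi>: "kern \<Psi>" "integral\<^sup>L lborel \<Psi> = 0" and p: "p \<ge> 1" and \<kappa>: "\<kappa> > 0"
    and c: "\<And>bm bp f0 f1 g. hermite p \<kappa> bm bp \<phi> f0 f1 g \<Longrightarrow> continuous_on {bm<..<bp} (c bm bp)"
      "\<And>bm bp f0 f1 g t. hermite p \<kappa> bm bp \<phi> f0 f1 g \<Longrightarrow> t \<in> {bm<..<bp} \<Longrightarrow> \<bar>c bm bp t\<bar> \<le> hermite.M \<kappa> / tau \<kappa> bm bp t"
    and h: "\<And>bm bp f0 f1 g. hermite p \<kappa> bm bp \<phi> f0 f1 g \<Longrightarrow> Lloc 1 (h f1 g)"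
      "\<And>bm bp f0 f1 g. tilde_W_scalar a p (h f1 g) \<le> energy p a bm bp f0 f1 g"
  shows "dominated p a \<kappa> \<phi> (\<lambda>bm bp f0 f1 g q. wmol \<kappa> bm bp (c bm bp) \<Psi> (h f1 g) q)"
proof -
  obtain C where C: "C > 0" "\<And>a bm bp g c. bm < bp \<Longrightarrow> \<kappa> * (bp - bm) \<le> a \<Longrightarrow> Lloc 1 g \<Longrightarrow>
    (\<And>t. t \<in> {bm<..<bp} \<Longrightarrow> \<bar>c t\<bar> \<le> hermite.M \<kappa> / tau \<kappa> bm bp t) \<Longrightarrow>
    Lpp p (strip bm bp) (\<lambda>q. c (snd q) * tmol \<kappa> bm bp \<Psi> g q) \<le> ennreal C * tilde_W_scalar a p g"
    using tmol_singular_Lpp[OF \<Psi> p \<kappa>] by blast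
  show ?thesis
  proof (rule dominatedI[OF C(1)])
    fix bm bp f0 f1 g assume H: "hermite p \<kappa> bm bp \<phi> f0 f1 g" and ka: "\<kappa> * (bp - bm) \<le> a"
    have b: "bm < bp" by (rule hermite.b[OF H])
    have "Lpp p (strip bm bp) (wmol \<kappa> bm bp (c bm bp) \<Psi> (h f1 g)) \<le> ennreal C * tilde_W_scalar a p (h f1 g)"
      unfolding wmol_def[abs_def] by (rule C(2)[OF b ka h(1)[OF H] c(2)[OF H]])
    also have "\<dots> \<le> ennreal C * energy p a bm bp f0 f1 g" by (intro mult_left_mono h) simp
    finally show "continuous_on (strip bm bp) (wmol \<kappa> bm bp (c bm bp) \<Psi> (h f1 g)) \<and>
      Lpp p (strip bm bp) (wmol \<kappa> bm bp (c bm bp) \<Psi> (h f1 g)) \<le> ennreal C * energy p a bm bp f0 f1 g"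
      using wmol_continuous[OF \<kappa> h(1)[OF H] \<Psi>(1) c(1)[OF H]] by simp
  qed
qed

lemma tilde_W_le_energy:
  shows "i \<in> Basis \<Longrightarrow> tilde_W_scalar a p (g \<sigma> i) \<le> energy p a bm bp f0 f1 g" "tilde_W_scalar a p (f1 \<sigma>) \<le> energy p a bm bp f0 f1 g"
proof -
  let ?S = "\<lambda>\<sigma>. (\<Sum>i\<in>Basis. tilde_W_scalar a p (g \<sigma> i)) + tilde_W_scalar a p (f1 \<sigma>)"
  have "?S \<sigma> \<le> (\<Sum>\<sigma>\<in>UNIV. ?S \<sigma>)" by (rule member_le_sum) auto
  also have "\<dots> \<le> energy p a bm bp f0 f1 g" unfolding energy_def by (rule add_increasing) auto
  finally have le: "?S \<sigma> \<le> energy p a bm bp f0 f1 g" .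
  show "tilde_W_scalar a p (f1 \<sigma>) \<le> energy p a bm bp f0 f1 g" by (rule order_trans[OF _ le]) (simp add: add_increasing)
  show "tilde_W_scalar a p (g \<sigma> i) \<le> energy p a bm bp f0 f1 g" if "i \<in> Basis"
  proof (rule order_trans[OF _ le])
    have "tilde_W_scalar a p (g \<sigma> i) \<le> (\<Sum>i\<in>Basis. tilde_W_scalar a p (g \<sigma> i))" by (rule member_le_sum) (use that in auto)
    then show "tilde_W_scalar a p (g \<sigma> i) \<le> ?S \<sigma>" by (simp add: add_increasing2)
  qed
qed

lemma dominated_sing_g:
  fixes \<Psi> \<phi> :: "'a::euclidean_space \<Rightarrow> real"
  assumes "kern \<Psi>" "integral\<^sup>L lborel \<Psi> = 0" "p \<ge> 1" "\<kappa> > 0" "i \<in> Basis"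
    "\<And>bm bp f0 f1 g. hermite p \<kappa> bm bp \<phi> f0 f1 g \<Longrightarrow> continuous_on {bm<..<bp} (c bm bp)"
    "\<And>bm bp f0 f1 g t. hermite p \<kappa> bm bp \<phi> f0 f1 g \<Longrightarrow> t \<in> {bm<..<bp} \<Longrightarrow> \<bar>c bm bp t\<bar> \<le> hermite.M \<kappa> / tau \<kappa> bm bp t"
  shows "dominated p a \<kappa> \<phi> (\<lambda>bm bp f0 f1 g q. wmol \<kappa> bm bp (c bm bp) \<Psi> (g \<sigma> i) q)"
  by (rule dominated_sing[where h="\<lambda>f1 g. g \<sigma> i"]) (use assms hermite.g' tilde_W_le_energy in auto)

lemma dominated_sing_f:
  fixes \<Psi> \<phi> :: "'a::euclidean_space \<Rightarrow> real"
  assumes "kern \<Psi>" "integral\<^sup>L lborel \<Psi> = 0" "p \<ge> 1" "\<kappa> > 0"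
    "\<And>bm bp f0 f1 g. hermite p \<kappa> bm bp \<phi> f0 f1 g \<Longrightarrow> continuous_on {bm<..<bp} (c bm bp)"
    "\<And>bm bp f0 f1 g t. hermite p \<kappa> bm bp \<phi> f0 f1 g \<Longrightarrow> t \<in> {bm<..<bp} \<Longrightarrow> \<bar>c bm bp t\<bar> \<le> hermite.M \<kappa> / tau \<kappa> bm bp t"
  shows "dominated p a \<kappa> \<phi> (\<lambda>bm bp f0 f1 g q. wmol \<kappa> bm bp (c bm bp) \<Psi> (f1 \<sigma>) q)"
  by (rule dominated_sing[where h="\<lambda>f1 g. f1 \<sigma>"]) (use assms hermite.f1' tilde_W_le_energy in auto)

text \<open>Terms with the kernel \<phi> itself. A coefficient of size L^(-n), L being the width,
  contributes L^(-n p), and integration across the strip another L; with n = 1 and n = 2 these are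
  the two powers of the width in the energy.\<close>

lemma dominated_bd:
  fixes \<phi> :: "'a::euclidean_space \<Rightarrow> real"
  assumes \<phi>: "kern \<phi>" and p: "p \<ge> 1" and \<kappa>: "\<kappa> > 0"
    and c: "\<And>bm bp f0 f1 g. hermite p \<kappa> bm bp \<phi> f0 f1 g \<Longrightarrow> continuous_on {bm<..<bp} (c bm bp)"
      "\<And>bm bp f0 f1 g t. hermite p \<kappa> bm bp \<phi> f0 f1 g \<Longrightarrow> t \<in> {bm<..<bp} \<Longrightarrow> \<bar>c bm bp t\<bar> \<le> 6 / (bp - bm) ^ n"
    and h: "\<And>bm bp f0 f1 g. hermite p \<kappa> bm bp \<phi> f0 f1 g \<Longrightarrow> Lloc 1 (h bm bp f0 f1 g)"
      "\<And>bm bp f0 f1 g. ennreal ((bp - bm) powr (1 - n * p)) * Lpp p UNIV (h bm bp f0 f1 g) \<le> energy p a bm bp f0 f1 g"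
  shows "dominated p a \<kappa> \<phi> (\<lambda>bm bp f0 f1 g q. wmol \<kappa> bm bp (c bm bp) \<phi> (h bm bp f0 f1 g) q)"
proof -
  obtain C where C: "C > 0" "\<And>\<kappa> bm bp c f M S S'. \<kappa> > 0 \<Longrightarrow> bm < bp \<Longrightarrow> Lloc 1 f \<Longrightarrow> continuous_on {bm<..<bp} c \<Longrightarrow>
    M \<ge> 0 \<Longrightarrow> (\<And>t. t \<in> {bm<..<bp} \<Longrightarrow> \<bar>c t\<bar> \<le> M) \<Longrightarrow> S \<in> sets borel \<Longrightarrow> S' \<in> sets borel \<Longrightarrow>
    (\<And>x y. x \<in> S \<Longrightarrow> norm y \<le> \<kappa> * (bp - bm) \<Longrightarrow> x + y \<in> S') \<Longrightarrow>
    Lpp p (S \<times> {bm<..<bp}) (wmol \<kappa> bm bp c \<phi> f) \<le> ennreal (M powr p * (C * (bp - bm))) * Lpp p S' f"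
    using wmol_Lpp[OF \<phi> p] by blast
  show ?thesis
  proof (rule dominatedI[of "6 powr p * C"])
    show "6 powr p * C > 0" using C by simp
    fix bm bp f0 f1 g assume H: "hermite p \<kappa> bm bp \<phi> f0 f1 g"
    have b: "bm < bp" by (rule hermite.b[OF H])
    define L where "L = bp - bm"
    have L: "L > 0" using b by (simp add: L_def)
    have "Lpp p (UNIV \<times> {bm<..<bp}) (wmol \<kappa> bm bp (c bm bp) \<phi> (h bm bp f0 f1 g))
      \<le> ennreal ((6 / L ^ n) powr p * (C * L)) * Lpp p UNIV (h bm bp f0 f1 g)"
      unfolding L_def by (rule C(2)[OF \<kappa> b h(1)[OF H] c(1)[OF H] _ c(2)[OF H]]) (use b in auto)
    also have "(6 / L ^ n) powr p * (C * L) = 6 powr p * C * L powr (1 - n * p)"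
    proof -
      have "(L ^ n) powr p = L powr (n * p)" using L by (simp add: powr_realpow[symmetric] powr_powr)
      moreover have "L powr (1 - n * p) = L / L powr (n * p)" using L by (simp add: powr_diff)
      ultimately show ?thesis using L by (simp add: powr_divide)
    qed
    also have "ennreal (6 powr p * C * L powr (1 - n * p)) * Lpp p UNIV (h bm bp f0 f1 g)
      = ennreal (6 powr p * C) * (ennreal (L powr (1 - n * p)) * Lpp p UNIV (h bm bp f0 f1 g))"
      using C(1) by (simp add: ennreal_mult mult.assoc)
    also have "\<dots> \<le> ennreal (6 powr p * C) * energy p a bm bp f0 f1 g"
      unfolding L_def by (intro mult_left_mono h) simp
    finally show "continuous_on (strip bm bp) (wmol \<kappa> bm bp (c bm bp) \<phi> (h bm bp f0 f1 g)) \<and>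
      Lpp p (strip bm bp) (wmol \<kappa> bm bp (c bm bp) \<phi> (h bm bp f0 f1 g)) \<le> ennreal (6 powr p * C) * energy p a bm bp f0 f1 g"
      using wmol_continuous[OF \<kappa> h(1)[OF H] \<phi> c(1)[OF H]] by (simp add: strip_def)
  qed
qed

lemma energy_ge:
  shows "ennreal ((bp - bm) powr (1 - 2 * p)) * Lpp p UNIV (hermite.D bm bp f0 f1) \<le> energy p a bm bp f0 f1 g"
    "i \<in> Basis \<Longrightarrow> ennreal ((bp - bm) powr (1 - p)) * Lpp p UNIV (hermite.G g i) \<le> energy p a bm bp f0 f1 g"
    "ennreal ((bp - bm) powr (1 - p)) * Lpp p UNIV (hermite.E f1) \<le> energy p a bm bp f0 f1 g"
proof -
  let ?e = "ennreal ((bp - bm) powr (1 - p))" and ?S = "(\<Sum>i\<in>Basis. Lpp p UNIV (hermite.G g i)) + Lpp p UNIV (hermite.E f1)"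
  show "ennreal ((bp - bm) powr (1 - 2 * p)) * Lpp p UNIV (hermite.D bm bp f0 f1) \<le> energy p a bm bp f0 f1 g"
    unfolding energy_def add.assoc by (rule add_increasing2) auto
  have le: "?e * ?S \<le> energy p a bm bp f0 f1 g"
    unfolding energy_def add.assoc by (rule add_increasing, simp, rule add_increasing2) auto
  show "?e * Lpp p UNIV (hermite.E f1) \<le> energy p a bm bp f0 f1 g"
    by (rule order_trans[OF mult_left_mono le]) (auto simp: add_increasing)
  show "?e * Lpp p UNIV (hermite.G g i) \<le> energy p a bm bp f0 f1 g" if i: "i \<in> Basis"
  proof (rule order_trans[OF mult_left_mono le])
    have "Lpp p UNIV (hermite.G g i) \<le> (\<Sum>i\<in>Basis. Lpp p UNIV (hermite.G g i))" by (rule member_le_sum) (use i in auto)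
    then show "Lpp p UNIV (hermite.G g i) \<le> ?S" by (simp add: add_increasing2)
  qed simp
qed

context
  fixes p a \<kappa> :: real and \<phi> :: "'a::euclidean_space \<Rightarrow> real"
  assumes p: "p \<ge> 1" and \<kappa>: "\<kappa> > 0" and \<phi>: "kern \<phi>" "\<And>y. \<phi> (- y) = \<phi> y"
begin

lemma dominated_G: assumes i: "i \<in> Basis" shows "dominated p a \<kappa> \<phi> (\<lambda>bm bp f0 f1 g q. wmol \<kappa> bm bp (hermite.A1 bm bp True) \<phi> (hermite.G g i) q)"
proof (rule dominated_bd[where n=1 and h="\<lambda>bm bp f0 f1 g. hermite.G g i", OF \<phi>(1) p \<kappa>])
  fix bm bp f0 f1 g assume H: "hermite p \<kappa> bm bp \<phi> f0 f1 g"
  show "continuous_on {bm<..<bp} (hermite.A1 bm bp True)" by (rule hermite.conts(2)[OF H])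
  show "\<bar>hermite.A1 bm bp True t\<bar> \<le> 6 / (bp - bm) ^ 1" if "t \<in> {bm<..<bp}" for t using hermite.A1_bd'[OF H that] by simp
  show "Lloc 1 (hermite.G g i)" by (rule Lloc_1[OF hermite.Lloc_G[OF H i] p])
qed (use energy_ge(2)[OF i] in simp)

lemma dominated_D: "dominated p a \<kappa> \<phi> (\<lambda>bm bp f0 f1 g q. wmol \<kappa> bm bp (hermite.A2 bm bp True) \<phi> (hermite.D bm bp f0 f1) q)"
proof (rule dominated_bd[where n=2 and h="\<lambda>bm bp f0 f1 g. hermite.D bm bp f0 f1", OF \<phi>(1) p \<kappa>])
  fix bm bp f0 f1 g assume H: "hermite p \<kappa> bm bp \<phi> f0 f1 g"
  show "continuous_on {bm<..<bp} (hermite.A2 bm bp True)" by (rule hermite.A2_cont[OF H])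
  show "\<bar>hermite.A2 bm bp True t\<bar> \<le> 6 / (bp - bm)\<^sup>2" if "t \<in> {bm<..<bp}" for t using hermite.A2_bd[OF H that] by simp
  show "Lloc 1 (hermite.D bm bp f0 f1)" by (rule Lloc_1[OF hermite.Lloc_D[OF H] p])
qed (use energy_ge(1) in simp)

lemma dominated_E: "dominated p a \<kappa> \<phi> (\<lambda>bm bp f0 f1 g q. wmol \<kappa> bm bp (\<lambda>t. 1 / (bp - bm)) \<phi> (hermite.E f1) q)"
proof (rule dominated_bd[where n=1 and h="\<lambda>bm bp f0 f1 g. hermite.E f1", OF \<phi>(1) p \<kappa>])
  fix bm bp f0 f1 g assume H: "hermite p \<kappa> bm bp \<phi> f0 f1 g"
  have b: "bm < bp" by (rule hermite.b[OF H])
  show "\<bar>1 / (bp - bm)\<bar> \<le> 6 / (bp - bm) ^ 1" using b by (simp add: divide_right_mono)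
  show "Lloc 1 (hermite.E f1)" by (rule Lloc_1[OF hermite.Lloc_E[OF H] p])
qed (use energy_ge(3) in \<open>simp_all add: continuous_on_const\<close>)

lemmas kernels_mean_zero = kern_pd kern_star kern_coord_mult \<phi> integral_kern_pd integral_star integral_coord_mult

lemma dominated_Uxx:
  assumes i: "i \<in> Basis" and j: "j \<in> Basis"
  shows "dominated p a \<kappa> \<phi> (\<lambda>bm bp f0 f1 g. hermite.Uxx \<kappa> bm bp \<phi> f1 g i j)"
proof (rule dominated_cong[OF _ hermite.Uxx_def[symmetric]])
  show "dominated p a \<kappa> \<phi> (\<lambda>bm bp f0 f1 g q. \<Sum>\<sigma>\<in>UNIV. wmol \<kappa> bm bp (\<lambda>t. - (hermite.A bm bp \<sigma> t / tau \<kappa> bm bp t)) (pd j \<phi>) (g \<sigma> i) q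
    + wmol \<kappa> bm bp (\<lambda>t. - (- hermite.\<beta> \<kappa> bm bp \<sigma> t / tau \<kappa> bm bp t)) (pd j (pd i \<phi>)) (f1 \<sigma>) q)"
    by (intro dominated_sum dominated_add p dominated_sing_g dominated_sing_f \<kappa> kernels_mean_zero i j; (rule hermite.coeff_bounds, assumption+ | intro hermite.coeff_continuous; assumption))
qed

text \<open>The regrouped form \<open>Uxt_eq\<close> is essential: in the definition each term with
  coefficient A1 and kernel \<phi> involves a gradient that need not be globally integrable.\<close>

lemma dominated_Uxt:
  assumes i: "i \<in> Basis"
  shows "dominated p a \<kappa> \<phi> (\<lambda>bm bp f0 f1 g. hermite.Uxt \<kappa> bm bp \<phi> f1 g i)"
proof (rule dominated_cong[OF _ hermite.Uxt_eq[OF _ _ i, symmetric]])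
  show "dominated p a \<kappa> \<phi> (\<lambda>bm bp f0 f1 g q. wmol \<kappa> bm bp (hermite.A1 bm bp True) \<phi> (hermite.G g i) q +
    (\<Sum>\<sigma>\<in>UNIV. wmol \<kappa> bm bp (\<lambda>t. hermite.A bm bp \<sigma> t * taud \<kappa> bm bp t / tau \<kappa> bm bp t) (star \<phi>) (g \<sigma> i) q
    + (wmol \<kappa> bm bp (\<lambda>t. - hermite.\<beta>1 \<kappa> bm bp) (pd i \<phi>) (f1 \<sigma>) q
    + wmol \<kappa> bm bp (\<lambda>t. - hermite.\<beta> \<kappa> bm bp \<sigma> t * taud \<kappa> bm bp t / tau \<kappa> bm bp t) (star (pd i \<phi>)) (f1 \<sigma>) q)))"
    by (intro dominated_G dominated_sum dominated_add p dominated_sing_g dominated_sing_f \<kappa> kernels_mean_zero i; (rule hermite.coeff_bounds, assumption+ | intro hermite.coeff_continuous; assumption))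
qed

lemma dominated_Utx:
  assumes i: "i \<in> Basis"
  shows "dominated p a \<kappa> \<phi> (\<lambda>bm bp f0 f1 g. hermite.Utx \<kappa> bm bp \<phi> f1 g i)"
proof (rule dominated_cong[OF _ hermite.Utx_eq[OF _ _ i, symmetric]])
  show "dominated p a \<kappa> \<phi> (\<lambda>bm bp f0 f1 g q. wmol \<kappa> bm bp (hermite.A1 bm bp True) \<phi> (hermite.G g i) q +
    (\<Sum>\<sigma>\<in>UNIV. (\<Sum>k\<in>Basis. wmol \<kappa> bm bp (\<lambda>t. - (hermite.A bm bp \<sigma> t * taud \<kappa> bm bp t / tau \<kappa> bm bp t)) (pd i (coord_mult k \<phi>)) (g \<sigma> k) q)
    + (wmol \<kappa> bm bp (\<lambda>t. - (hermite.B1 \<kappa> bm bp \<sigma> t / tau \<kappa> bm bp t)) (pd i \<phi>) (f1 \<sigma>) q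
    + wmol \<kappa> bm bp (\<lambda>t. - (hermite.\<beta> \<kappa> bm bp \<sigma> t * taud \<kappa> bm bp t / tau \<kappa> bm bp t)) (pd i (star \<phi>)) (f1 \<sigma>) q)))"
    by (intro dominated_G dominated_sum dominated_add p dominated_sing_g dominated_sing_f \<kappa> kernels_mean_zero i; (rule hermite.coeff_bounds, assumption+ | intro hermite.coeff_continuous; assumption | assumption))
qed

lemma dominated_Utt: "dominated p a \<kappa> \<phi> (\<lambda>bm bp f0 f1 g. hermite.Utt \<kappa> bm bp \<phi> f0 f1 g)"
proof (rule dominated_cong[OF _ hermite.Utt_eq[symmetric]])
  show "dominated p a \<kappa> \<phi> (\<lambda>bm bp f0 f1 g q. (wmol \<kappa> bm bp (hermite.A2 bm bp True) \<phi> (hermite.D bm bp f0 f1) q + wmol \<kappa> bm bp (\<lambda>t. 1 / (bp - bm)) \<phi> (hermite.E f1) q)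
    + (\<Sum>\<sigma>\<in>UNIV. (\<Sum>k\<in>Basis. wmol \<kappa> bm bp (\<lambda>t. hermite.A1 bm bp \<sigma> t * taud \<kappa> bm bp t) (coord_mult k \<phi>) (g \<sigma> k) q)
     + (\<Sum>k\<in>Basis. wmol \<kappa> bm bp (\<lambda>t. hermite.A1 bm bp \<sigma> t * taud \<kappa> bm bp t + hermite.A bm bp \<sigma> t * hermite.\<tau>2 \<kappa> bm bp) (coord_mult k \<phi>) (g \<sigma> k) q
        + wmol \<kappa> bm bp (\<lambda>t. hermite.A bm bp \<sigma> t * taud \<kappa> bm bp t * taud \<kappa> bm bp t / tau \<kappa> bm bp t) (star (coord_mult k \<phi>)) (g \<sigma> k) q)
     + (wmol \<kappa> bm bp (\<lambda>t. hermite.B1 \<kappa> bm bp \<sigma> t * taud \<kappa> bm bp t / tau \<kappa> bm bp t) (star \<phi>) (f1 \<sigma>) q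
     + (wmol \<kappa> bm bp (\<lambda>t. hermite.\<beta>1 \<kappa> bm bp * taud \<kappa> bm bp t + hermite.\<beta> \<kappa> bm bp \<sigma> t * hermite.\<tau>2 \<kappa> bm bp) (star \<phi>) (f1 \<sigma>) q
        + wmol \<kappa> bm bp (\<lambda>t. hermite.\<beta> \<kappa> bm bp \<sigma> t * taud \<kappa> bm bp t * taud \<kappa> bm bp t / tau \<kappa> bm bp t) (star (star \<phi>)) (f1 \<sigma>) q))))"
    by (intro dominated_D dominated_E dominated_sum dominated_add p dominated_sing_g dominated_sing_f \<kappa> kernels_mean_zero; (rule hermite.coeff_bounds, assumption+ | intro hermite.coeff_continuous; assumption | assumption))
qed

end

subsection \<open>Representatives and the extension operator\<close>

text \<open>The data are only Lebesgue measurable; Borel representatives make the compositions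
  \<open>f (x + r *\<^sub>R y)\<close> jointly measurable.\<close>

definition borel_rep :: "('a::euclidean_space \<Rightarrow> real) \<Rightarrow> 'a \<Rightarrow> real" where
  "borel_rep f = (SOME h. h \<in> borel_measurable borel \<and> (AE x in lborel. f x = h x))"

lemma borel_rep:
  assumes "f \<in> borel_measurable (lebesgue_on UNIV)"
  shows "borel_rep f \<in> borel_measurable borel" "AE x in lborel. f x = borel_rep f x"
proof -
  have "f \<in> borel_measurable lebesgue" using assms by (simp add: lebesgue_on_UNIV_eq)
  then have "\<exists>h. h \<in> borel_measurable borel \<and> (AE x in lborel. f x = h x)"
    using completion_ex_borel_measurable_real[of f lborel] by auto
  from someI_ex[OF this] show "borel_rep f \<in> borel_measurable borel" "AE x in lborel. f x = borel_rep f x"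
    unfolding borel_rep_def by auto
qed

lemma Lloc_borel_rep:
  assumes "in_Lp_loc p UNIV f" shows "Lloc p (borel_rep f)"
  unfolding Lloc_def
proof (intro conjI allI)
  have m: "f \<in> borel_measurable (lebesgue_on UNIV)" using assms by (simp add: in_Lp_loc_def)
  show "borel_rep f \<in> borel_measurable borel" by (rule borel_rep(1)[OF m])
  fix R
  have "Lpp p (ball 0 R) (borel_rep f) = Lpp p (ball 0 R) f"
    by (rule Lpp_cong_AE) (use borel_rep(2)[OF m] in \<open>eventually_elim, auto\<close>)
  also have "\<dots> \<le> Lpp p (cball 0 R) f" by (rule Lpp_subset) auto
  also have "\<dots> < \<infinity>"
    using assms unfolding in_Lp_loc_def nn_integral_lebesgue_eq_Lpp by auto
  finally show "Lpp p (ball 0 R) (borel_rep f) < \<infinity>" .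
qed

lemma mol_cong_AE:
  fixes f h :: "'a::euclidean_space \<Rightarrow> real"
  assumes "f \<in> borel_measurable borel" "h \<in> borel_measurable borel" "AE x in lborel. f x = h x" "kern \<Psi>" "r \<noteq> 0"
  shows "mol \<Psi> f (x, r) = mol \<Psi> h (x, r)"
  unfolding mol_def fst_conv snd_conv
proof (rule integral_cong_AE)
  have [measurable]: "f \<in> borel_measurable borel" "h \<in> borel_measurable borel" "\<Psi> \<in> borel_measurable borel"
    using assms kern_measurable by auto
  show "(\<lambda>y. f (x + r *\<^sub>R y) * \<Psi> y) \<in> borel_measurable lborel" "(\<lambda>y. h (x + r *\<^sub>R y) * \<Psi> y) \<in> borel_measurable lborel"
    by measurable
  show "AE y in lborel. f (x + r *\<^sub>R y) * \<Psi> y = h (x + r *\<^sub>R y) * \<Psi> y"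
    using AE_lborel_affine[OF assms(3,5), of x] by eventually_elim simp
qed

text \<open>k is a coordinate functional or the identity, a contraction in either case. For almost
  every x the value h x is correct, and by translation h (x + y) is correct for almost every y;
  hence passing to representatives does not disturb the double integral.\<close>

lemma tilde_W_scalar_le:
  fixes G :: "'a::euclidean_space \<Rightarrow> 'b::real_normed_vector" and h :: "'a \<Rightarrow> real"
  assumes h: "AE x in lborel. h x = k (G x)" and k: "\<And>u v. \<bar>k u - k v\<bar> \<le> norm (u - v)" and p: "p \<ge> 0"
  shows "tilde_W_scalar a p h \<le> tilde_W_pow a p G"
  unfolding tilde_W_scalar_def tilde_W_pow_def nn_integral_completion
proof (rule nn_integral_mono_AE, use h in eventually_elim)
  fix x assume x: "h x = k (G x)"
  show "(\<integral>\<^sup>+y\<in>ball 0 a. ennreal (\<bar>h (x + y) - h x\<bar> powr p / norm y powr (p + real DIM('a) - 1)) \<partial>lborel)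
    \<le> (\<integral>\<^sup>+y\<in>ball 0 a. ennreal (norm (G (x + y) - G x) powr p / norm y powr (p + real DIM('a) - 1)) \<partial>lborel)"
  proof (rule nn_integral_mono_AE, use AE_lborel_affine[OF h one_neq_zero, of x] in eventually_elim)
    fix y assume "h (x + 1 *\<^sub>R y) = k (G (x + 1 *\<^sub>R y))"
    then have "\<bar>h (x + y) - h x\<bar> powr p \<le> norm (G (x + y) - G x) powr p"
      using x k p by (intro powr_mono2) auto
    then show "ennreal (\<bar>h (x + y) - h x\<bar> powr p / norm y powr (p + real DIM('a) - 1)) * indicator (ball 0 a) y
      \<le> ennreal (norm (G (x + y) - G x) powr p / norm y powr (p + real DIM('a) - 1)) * indicator (ball 0 a) y"
      by (intro mult_right_mono ennreal_leI divide_right_mono) auto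
  qed
qed

lemma weak_grad_inner: "i \<in> Basis \<Longrightarrow> weak_grad U f x \<bullet> i = weak_partial U [i] f x"
  by (simp add: weak_grad_def inner_sum_left_Basis)

definition choose_data :: "'b \<Rightarrow> 'b \<Rightarrow> bool \<Rightarrow> 'b" where
  "choose_data m q \<sigma> = (if \<sigma> then q else m)"

definition choose_grad :: "(bool \<Rightarrow> 'a::euclidean_space \<Rightarrow> real) \<Rightarrow> bool \<Rightarrow> 'a \<Rightarrow> 'a \<Rightarrow> real" where
  "choose_grad f \<sigma> i = borel_rep (weak_partial UNIV [i] (f \<sigma>))"

text \<open>The interpolant \<open>hermite.u\<close> as an operator on the four data functions, each
  replaced by a Borel representative. It is total; its properties are claimed for admissible
  data.\<close>

definition extension :: "real \<Rightarrow> ('a::euclidean_space \<Rightarrow> real) \<Rightarrow> real \<Rightarrow> real \<Rightarrow> ('a \<Rightarrow> real) \<Rightarrow> ('a \<Rightarrow> real) \<Rightarrow> ('a \<Rightarrow> real) \<Rightarrow> ('a \<Rightarrow> real) \<Rightarrow>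
    'a \<times> real \<Rightarrow> real" where
  "extension \<kappa> \<phi> bm bp f0m f0p f1m f1p q = (\<Sum>\<sigma>\<in>UNIV. wmol \<kappa> bm bp (hermite.A bm bp \<sigma>) \<phi> (borel_rep (choose_data f0m f0p \<sigma>)) q
     + wmol \<kappa> bm bp (hermite.B \<kappa> bm bp \<sigma>) \<phi> (borel_rep (choose_data f1m f1p \<sigma>)) q)"

lemma W1p_loc_weak_partial:
  fixes f :: "'a::euclidean_space \<Rightarrow> real"
  assumes f: "in_W1p_loc p UNIV f" and i: "i \<in> Basis"
  shows "has_weak_partial UNIV [i] f (weak_partial UNIV [i] f)" "in_Lp_loc p UNIV (weak_partial UNIV [i] f)"
proof -
  obtain g where g: "in_Lp_loc p UNIV g" "has_weak_partial UNIV [i] f g" using f i unfolding in_W1p_loc_def by blast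
  show w: "has_weak_partial UNIV [i] f (weak_partial UNIV [i] f)" by (rule weak_partial_works[OF g(2)])
  have "AE x in lborel. x \<in> UNIV \<longrightarrow> g x = weak_partial UNIV [i] f x"
    by (rule has_weak_partial_unique[OF g(2) w]) simp
  moreover have "weak_partial UNIV [i] f \<in> borel_measurable (lebesgue_on UNIV)"
    using w by (simp add: has_weak_partial_def in_Lp_loc_def)
  ultimately show "in_Lp_loc p UNIV (weak_partial UNIV [i] f)" by (intro in_Lp_loc_AE[OF g(1)])
qed

lemma admissible_measurable:
  assumes "admissible_data a p bm bp f0m f0p f1m f1p"
  shows "choose_data f0m f0p \<sigma> \<in> borel_measurable (lebesgue_on UNIV)" "choose_data f1m f1p \<sigma> \<in> borel_measurable (lebesgue_on UNIV)"
  using assms by (auto simp: admissible_data_def in_W1p_loc_def in_Lp_loc_def choose_data_def)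

lemma admissible_hermite:
  fixes \<phi> :: "'a::euclidean_space \<Rightarrow> real"
  assumes d: "admissible_data a p bm bp f0m f0p f1m f1p" and p: "p \<ge> 1" and \<kappa>: "\<kappa> > 0" and b: "bm < bp"
    and \<phi>: "kern \<phi>" "\<And>y. \<phi> (- y) = \<phi> y" "integral\<^sup>L lborel \<phi> = 1"
  shows "hermite p \<kappa> bm bp \<phi> (\<lambda>\<sigma>. borel_rep (choose_data f0m f0p \<sigma>)) (\<lambda>\<sigma>. borel_rep (choose_data f1m f1p \<sigma>)) (choose_grad (choose_data f0m f0p))"
proof
  have W: "in_W1p_loc p UNIV (choose_data f0m f0p \<sigma>)" for \<sigma> using d by (auto simp: admissible_data_def choose_data_def)
  have Lp: "in_Lp_loc p UNIV (choose_data f0m f0p \<sigma>)" for \<sigma> using W by (simp add: in_W1p_loc_def)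
  show "Lloc p (borel_rep (choose_data f0m f0p \<sigma>))" for \<sigma> by (rule Lloc_borel_rep[OF Lp])
  show "Lloc p (borel_rep (choose_data f1m f1p \<sigma>))" for \<sigma> by (rule Lloc_borel_rep) (use d in \<open>auto simp: admissible_data_def choose_data_def\<close>)
  show "Lloc p (choose_grad (choose_data f0m f0p) \<sigma> i)" if "i \<in> Basis" for \<sigma> i
    unfolding choose_grad_def by (rule Lloc_borel_rep[OF W1p_loc_weak_partial(2)[OF W that]])
  show "grad_mol (borel_rep (choose_data f0m f0p \<sigma>)) (choose_grad (choose_data f0m f0p) \<sigma>)" for \<sigma>
    unfolding grad_mol_def
  proof (intro ballI allI impI)
    fix i :: 'a and \<Psi> :: "'a \<Rightarrow> real" and x :: 'a and r :: real assume i: "i \<in> Basis" and \<Psi>: "kern \<Psi>" and r: "r > 0"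
    note w = W1p_loc_weak_partial(1)[OF W i, of \<sigma>]
    have m: "choose_data f0m f0p \<sigma> \<in> borel_measurable (lebesgue_on UNIV)" "weak_partial UNIV [i] (choose_data f0m f0p \<sigma>) \<in> borel_measurable (lebesgue_on UNIV)"
      using w by (simp_all add: has_weak_partial_def in_Lp_loc_def)
    show "mol (pd i \<Psi>) (borel_rep (choose_data f0m f0p \<sigma>)) (x, r) = - r * mol \<Psi> (choose_grad (choose_data f0m f0p) \<sigma> i) (x, r)"
      unfolding choose_grad_def by (rule mol_pd_weak_partial[OF w i borel_rep[OF m(1)] borel_rep[OF m(2)] \<Psi> r])
  qed
qed (use p \<kappa> b \<phi> in auto)

text \<open>The choice of representatives is not linear, but the representative of a combination
  agrees almost everywhere with the combination of the representatives. Mollification with positive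
  radius ignores null sets, so linearity holds at every point of the strip.\<close>

lemma extension_linear:
  fixes \<phi> :: "'a::euclidean_space \<Rightarrow> real"
  assumes p: "p \<ge> 1" and \<kappa>: "\<kappa> > 0" and b: "bm < bp"
    and \<phi>: "kern \<phi>" "\<And>y. \<phi> (- y) = \<phi> y" "integral\<^sup>L lborel \<phi> = 1"
    and f: "admissible_data a p bm bp f0m f0p f1m f1p" and g: "admissible_data a p bm bp g0m g0p g1m g1p"
    and q: "q \<in> strip bm bp"
  shows "extension \<kappa> \<phi> bm bp (\<lambda>y. \<alpha> * f0m y + \<beta> * g0m y) (\<lambda>y. \<alpha> * f0p y + \<beta> * g0p y)
      (\<lambda>y. \<alpha> * f1m y + \<beta> * g1m y) (\<lambda>y. \<alpha> * f1p y + \<beta> * g1p y) q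
    = \<alpha> * extension \<kappa> \<phi> bm bp f0m f0p f1m f1p q + \<beta> * extension \<kappa> \<phi> bm bp g0m g0p g1m g1p q"
proof -
  note H = admissible_hermite[OF f p \<kappa> b \<phi>] and H' = admissible_hermite[OF g p \<kappa> b \<phi>]
  have r: "tau \<kappa> bm bp (snd q) > 0" using tau_pos[OF \<kappa>] q by (simp add: strip_iff)
  have lin: "tmol \<kappa> bm bp \<phi> (borel_rep (\<lambda>y. \<alpha> * u y + \<beta> * v y)) q = \<alpha> * tmol \<kappa> bm bp \<phi> (borel_rep u) q + \<beta> * tmol \<kappa> bm bp \<phi> (borel_rep v) q"
    if "u \<in> borel_measurable (lebesgue_on UNIV)" "v \<in> borel_measurable (lebesgue_on UNIV)" "Lloc 1 (borel_rep u)" "Lloc 1 (borel_rep v)" for u v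
  proof -
    have m: "(\<lambda>y. \<alpha> * u y + \<beta> * v y) \<in> borel_measurable (lebesgue_on UNIV)"
      using that by (intro borel_measurable_add borel_measurable_times) auto
    have ae: "AE x in lborel. borel_rep (\<lambda>y. \<alpha> * u y + \<beta> * v y) x = \<alpha> * borel_rep u x + \<beta> * borel_rep v x"
      using borel_rep(2)[OF m] borel_rep(2)[OF that(1)] borel_rep(2)[OF that(2)] by eventually_elim simp
    have L: "Lloc 1 (\<lambda>x. \<alpha> * borel_rep u x)" "Lloc 1 (\<lambda>x. \<beta> * borel_rep v x)" using that by (auto intro: Lloc_cmult)
    have "mol \<phi> (borel_rep (\<lambda>y. \<alpha> * u y + \<beta> * v y)) (fst q, tau \<kappa> bm bp (snd q)) = mol \<phi> (\<lambda>x. \<alpha> * borel_rep u x + \<beta> * borel_rep v x) (fst q, tau \<kappa> bm bp (snd q))"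
      by (rule mol_cong_AE[OF borel_rep(1)[OF m] _ ae \<phi>(1)]) (use L r in \<open>auto simp: Lloc_def\<close>)
    then show ?thesis by (simp add: tmol_def mol_add[OF L \<phi>(1) r] mol_cmult)
  qed
  have s: "choose_data (\<lambda>y. \<alpha> * u y + \<beta> * v y) (\<lambda>y. \<alpha> * u' y + \<beta> * v' y) \<sigma> = (\<lambda>y. \<alpha> * choose_data u u' \<sigma> y + \<beta> * choose_data v v' \<sigma> y)" for u v u' v' :: "'a \<Rightarrow> real" and \<sigma>
    by (simp add: choose_data_def)
  show ?thesis
    unfolding extension_def s wmol_def
    using lin[OF admissible_measurable(1)[OF f] admissible_measurable(1)[OF g] hermite.f0'[OF H] hermite.f0'[OF H']]
      lin[OF admissible_measurable(2)[OF f] admissible_measurable(2)[OF g] hermite.f1'[OF H] hermite.f1'[OF H']]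
    by (simp add: UNIV_bool algebra_simps)
qed


section \<open>The weak gradient and Hessian of the interpolant\<close>

context hermite begin

text \<open>The derivatives indexed by basis vectors of the product space; \<open>snd e = 0\<close>
  marks the tangential directions.\<close>

definition "V e = (if snd e = (0::real) then Ux (fst e) else Ut)"
definition "W e e' = (if snd e = (0::real) then if snd e' = (0::real) then Uxx (fst e) (fst e') else Uxt (fst e)
  else if snd e' = 0 then Utx (fst e') else Utt)"

lemma dV: "e \<in> Basis \<Longrightarrow> dir_deriv \<Omega> e u (V e)"
  using dU_x dU_t by (auto simp: Basis_prod_def V_def)

lemma dW: "e \<in> Basis \<Longrightarrow> e' \<in> Basis \<Longrightarrow> dir_deriv \<Omega> e' (V e) (W e e')"
  using dUx_x dUx_t dUt_x dUt_t by (auto simp: Basis_prod_def V_def W_def)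

lemma loc_Lp_V: "e \<in> Basis \<Longrightarrow> loc_Lp p bm bp (V e)"
  using loc_Lp_Ux loc_Lp_Ut by (auto simp: Basis_prod_def V_def)

lemma weak_u: "e \<in> Basis \<Longrightarrow> has_weak_partial \<Omega> [e] u (V e)"
  by (intro has_weak_partial_dir_deriv strip_open dV)

lemma weak_u2: "e \<in> Basis \<Longrightarrow> e' \<in> Basis \<Longrightarrow> has_weak_partial \<Omega> [e, e'] u (W e e')"
  by (intro has_weak_partial_Cons[OF weak_u] has_weak_partial_dir_deriv strip_open dW)

end

lemma dominated_W:
  fixes \<phi> :: "'a::euclidean_space \<Rightarrow> real"
  assumes p: "p \<ge> 1" and \<kappa>: "\<kappa> > 0" and \<phi>: "kern \<phi>" "\<And>y. \<phi> (- y) = \<phi> y"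
    and e: "e \<in> Basis" and e': "e' \<in> Basis"
  shows "dominated p a \<kappa> \<phi> (\<lambda>bm bp f0 f1 g. hermite.W \<kappa> bm bp \<phi> f0 f1 g e e')"
proof -
  consider i where "i \<in> Basis" "e = (i, 0)" | "e = (0, 1)" using e by (auto simp: Basis_prod_def)
  then obtain F where F: "dominated p a \<kappa> \<phi> F" "\<And>bm bp f0 f1 g. hermite p \<kappa> bm bp \<phi> f0 f1 g \<Longrightarrow> F bm bp f0 f1 g = hermite.W \<kappa> bm bp \<phi> f0 f1 g e e'"
  proof cases
    case (1 i)
    consider j where "j \<in> Basis" "e' = (j, 0)" | "e' = (0, 1)" using e' by (auto simp: Basis_prod_def)
    then show ?thesis
    proof cases
      case (1 j)
      with \<open>i \<in> Basis\<close> \<open>e = (i, 0)\<close> show ?thesis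
        by (intro that[OF dominated_Uxx[OF p \<kappa> \<phi>]]) (auto simp: hermite.W_def)
    next
      case 2
      with \<open>i \<in> Basis\<close> \<open>e = (i, 0)\<close> show ?thesis
        by (intro that[OF dominated_Uxt[OF p \<kappa> \<phi>]]) (auto simp: hermite.W_def)
    qed
  next
    case 2
    consider j where "j \<in> Basis" "e' = (j, 0)" | "e' = (0, 1)" using e' by (auto simp: Basis_prod_def)
    then show ?thesis
    proof cases
      case (1 j)
      with \<open>e = (0, 1)\<close> show ?thesis
        by (intro that[OF dominated_Utx[OF p \<kappa> \<phi>]]) (auto simp: hermite.W_def)
    next
      case 2
      with \<open>e = (0, 1)\<close> show ?thesis
        by (intro that[OF dominated_Utt[OF p \<kappa> \<phi>]]) (auto simp: hermite.W_def)
    qed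
  qed
  show ?thesis by (rule dominated_cong[OF F(1)]) (simp add: F(2))
qed

lemma sqrt_sum_squares_le:
  fixes w :: "'i \<Rightarrow> 'i \<Rightarrow> real"
  assumes "finite S" shows "sqrt (\<Sum>i\<in>S. \<Sum>j\<in>S. (w i j)\<^sup>2) \<le> (\<Sum>i\<in>S. \<Sum>j\<in>S. \<bar>w i j\<bar>)"
proof -
  have "sqrt (\<Sum>z\<in>S \<times> S. (case_prod w z)\<^sup>2) \<le> (\<Sum>z\<in>S \<times> S. \<bar>case_prod w z\<bar>)"
    using L2_set_le_sum_abs[of "case_prod w" "S \<times> S"] by (simp add: L2_set_def)
  then show ?thesis by (simp add: sum.cartesian_product split_def)
qed

section \<open>Comparison of the energies and assembly of the estimate\<close>

definition data_energy :: "real \<Rightarrow> real \<Rightarrow> real \<Rightarrow> real \<Rightarrow> ('a::euclidean_space \<Rightarrow> real) \<Rightarrow> ('a \<Rightarrow> real) \<Rightarrow> ('a \<Rightarrow> real) \<Rightarrow> ('a \<Rightarrow> real) \<Rightarrow> ennreal" where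
  "data_energy a p bm bp f0m f0p f1m f1p =
    ennreal ((bp - bm) powr (- 2 * p + 1)) * diff_energy0 p bm bp f0m f0p f1m f1p
    + ennreal ((bp - bm) powr (- p + 1)) * diff_energy1 p f0m f0p f1m f1p
    + tilde_W_pow a p (weak_grad UNIV f0m) + tilde_W_pow a p (weak_grad UNIV f0p)
    + tilde_W_pow a p f1m + tilde_W_pow a p f1p"

lemma data_energy_finite:
  assumes "admissible_data a p bm bp f0m f0p f1m f1p" shows "data_energy a p bm bp f0m f0p f1m f1p < \<infinity>"
  using assms by (simp add: admissible_data_def data_energy_def ennreal_mult_less_top)

text \<open>A component of a vector is bounded by its norm, so the sum over the tangential
  coordinates counts each gradient energy at most \<open>DIM('a)\<close> times. The remaining 1 in
  the factor accounts for the part of f1 in the same energy.\<close>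

lemma energy_le_data:
  fixes \<phi> :: "'a::euclidean_space \<Rightarrow> real"
  assumes d: "admissible_data a p bm bp f0m f0p f1m f1p" and p: "p \<ge> 1"
    and H: "hermite p \<kappa> bm bp \<phi> (\<lambda>\<sigma>. borel_rep (choose_data f0m f0p \<sigma>)) (\<lambda>\<sigma>. borel_rep (choose_data f1m f1p \<sigma>)) (choose_grad (choose_data f0m f0p))"
  shows "energy p a bm bp (\<lambda>\<sigma>. borel_rep (choose_data f0m f0p \<sigma>)) (\<lambda>\<sigma>. borel_rep (choose_data f1m f1p \<sigma>)) (choose_grad (choose_data f0m f0p))
    \<le> of_nat (DIM('a) + 1) * data_energy a p bm bp f0m f0p f1m f1p"
proof -
  let ?n = "of_nat (DIM('a) + 1) :: ennreal"
  have n1: "x \<le> ?n * x" for x :: ennreal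
    using mult_right_mono[of 1 ?n x] by simp
  have W: "in_W1p_loc p UNIV (choose_data f0m f0p \<sigma>)" for \<sigma> using d by (auto simp: admissible_data_def choose_data_def)
  note r0 = borel_rep(2)[OF admissible_measurable(1)[OF d]] and r1 = borel_rep(2)[OF admissible_measurable(2)[OF d]]
  have rg: "AE x in lborel. weak_grad UNIV (choose_data f0m f0p \<sigma>) x \<bullet> i = choose_grad (choose_data f0m f0p) \<sigma> i x" if i: "i \<in> Basis" for i \<sigma>
  proof -
    have "weak_partial UNIV [i] (choose_data f0m f0p \<sigma>) \<in> borel_measurable (lebesgue_on UNIV)"
      using W1p_loc_weak_partial(2)[OF W i] by (simp add: in_Lp_loc_def)
    from borel_rep(2)[OF this] show ?thesis unfolding choose_grad_def weak_grad_inner[OF i] .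
  qed
  have sT: "choose_data m q True = q" and sF: "choose_data m q False = m" for m q :: "'a \<Rightarrow> real" by (simp_all add: choose_data_def)
  have D: "Lpp p UNIV (hermite.D bm bp (\<lambda>\<sigma>. borel_rep (choose_data f0m f0p \<sigma>)) (\<lambda>\<sigma>. borel_rep (choose_data f1m f1p \<sigma>))) = diff_energy0 p bm bp f0m f0p f1m f1p"
    unfolding Lpp_def diff_energy0_def nn_integral_completion
    by (rule nn_integral_cong_AE, use r0[of True] r0[of False] r1[of True] r1[of False] in eventually_elim)
       (simp add: hermite.D_def[OF H] sT sF)
  have E: "Lpp p UNIV (hermite.E (\<lambda>\<sigma>. borel_rep (choose_data f1m f1p \<sigma>))) \<le> diff_energy1 p f0m f0p f1m f1p"
    unfolding Lpp_def diff_energy1_def nn_integral_completion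
    by (rule nn_integral_mono_AE, use r1[of True] r1[of False] in eventually_elim)
       (auto simp: hermite.E_def[OF H] sT sF intro!: ennreal_leI)
  have G: "Lpp p UNIV (hermite.G (choose_grad (choose_data f0m f0p)) i) \<le> diff_energy1 p f0m f0p f1m f1p" if i: "i \<in> Basis" for i
    unfolding Lpp_def diff_energy1_def nn_integral_completion
  proof (rule nn_integral_mono_AE, use rg[OF i, of True] rg[OF i, of False] in eventually_elim)
    fix x assume x: "weak_grad UNIV (choose_data f0m f0p True) x \<bullet> i = choose_grad (choose_data f0m f0p) True i x"
      "weak_grad UNIV (choose_data f0m f0p False) x \<bullet> i = choose_grad (choose_data f0m f0p) False i x"
    have "\<bar>choose_grad (choose_data f0m f0p) True i x - choose_grad (choose_data f0m f0p) False i x\<bar> = \<bar>(weak_grad UNIV f0p x - weak_grad UNIV f0m x) \<bullet> i\<bar>"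
      using x by (simp add: sT sF inner_diff_left)
    also have "\<dots> \<le> norm (weak_grad UNIV f0p x - weak_grad UNIV f0m x)" by (rule Basis_le_norm[OF i])
    finally have "\<bar>hermite.G (choose_grad (choose_data f0m f0p)) i x\<bar> powr p \<le> norm (weak_grad UNIV f0p x - weak_grad UNIV f0m x) powr p"
      unfolding hermite.G_def[OF H] using p by (intro powr_mono2) auto
    then show "ennreal (\<bar>hermite.G (choose_grad (choose_data f0m f0p)) i x\<bar> powr p) * indicator UNIV x
      \<le> ennreal (norm (weak_grad UNIV f0p x - weak_grad UNIV f0m x) powr p + \<bar>f1p x - f1m x\<bar> powr p)"
      by (auto intro!: ennreal_leI add_increasing2)
  qed
  have tg: "tilde_W_scalar a p (choose_grad (choose_data f0m f0p) \<sigma> i) \<le> tilde_W_pow a p (weak_grad UNIV (choose_data f0m f0p \<sigma>))" if i: "i \<in> Basis" for i \<sigma>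
  proof (rule tilde_W_scalar_le[where k="\<lambda>v. v \<bullet> i"])
    show "AE x in lborel. choose_grad (choose_data f0m f0p) \<sigma> i x = weak_grad UNIV (choose_data f0m f0p \<sigma>) x \<bullet> i" using rg[OF i, of \<sigma>] by eventually_elim simp
    show "\<bar>u \<bullet> i - v \<bullet> i\<bar> \<le> norm (u - v)" for u v :: 'a using Basis_le_norm[OF i, of "u - v"] by (simp add: inner_diff_left)
  qed (use p in simp)
  have t1: "tilde_W_scalar a p (borel_rep (choose_data f1m f1p \<sigma>)) \<le> tilde_W_pow a p (choose_data f1m f1p \<sigma>)" for \<sigma>
  proof (rule tilde_W_scalar_le[where k="\<lambda>v. v"])
    show "AE x in lborel. borel_rep (choose_data f1m f1p \<sigma>) x = choose_data f1m f1p \<sigma> x" using r1[of \<sigma>] by eventually_elim simp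
  qed (use p in auto)
  have sumG: "(\<Sum>i\<in>Basis. Lpp p UNIV (hermite.G (choose_grad (choose_data f0m f0p)) i)) + Lpp p UNIV (hermite.E (\<lambda>\<sigma>. borel_rep (choose_data f1m f1p \<sigma>)))
    \<le> ?n * diff_energy1 p f0m f0p f1m f1p"
  proof -
    have "(\<Sum>i\<in>Basis. Lpp p UNIV (hermite.G (choose_grad (choose_data f0m f0p)) i)) \<le> (\<Sum>i\<in>(Basis::'a set). diff_energy1 p f0m f0p f1m f1p)" by (rule sum_mono) (rule G)
    also have "\<dots> = of_nat DIM('a) * diff_energy1 p f0m f0p f1m f1p" by simp
    finally have "(\<Sum>i\<in>Basis. Lpp p UNIV (hermite.G (choose_grad (choose_data f0m f0p)) i)) + Lpp p UNIV (hermite.E (\<lambda>\<sigma>. borel_rep (choose_data f1m f1p \<sigma>)))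
      \<le> of_nat DIM('a) * diff_energy1 p f0m f0p f1m f1p + diff_energy1 p f0m f0p f1m f1p" using E by (rule add_mono)
    then show ?thesis by (simp add: distrib_right add.commute)
  qed
  have sumt: "(\<Sum>i\<in>Basis. tilde_W_scalar a p (choose_grad (choose_data f0m f0p) \<sigma> i)) + tilde_W_scalar a p (borel_rep (choose_data f1m f1p \<sigma>))
    \<le> ?n * (tilde_W_pow a p (weak_grad UNIV (choose_data f0m f0p \<sigma>)) + tilde_W_pow a p (choose_data f1m f1p \<sigma>))" for \<sigma>
  proof -
    have "(\<Sum>i\<in>Basis. tilde_W_scalar a p (choose_grad (choose_data f0m f0p) \<sigma> i)) \<le> (\<Sum>i\<in>(Basis::'a set). tilde_W_pow a p (weak_grad UNIV (choose_data f0m f0p \<sigma>)))"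
      by (rule sum_mono) (rule tg)
    also have "\<dots> = of_nat DIM('a) * tilde_W_pow a p (weak_grad UNIV (choose_data f0m f0p \<sigma>))" by simp
    also have "\<dots> \<le> ?n * tilde_W_pow a p (weak_grad UNIV (choose_data f0m f0p \<sigma>))" by (intro mult_right_mono) auto
    finally show ?thesis unfolding distrib_left by (rule add_mono) (rule order_trans[OF t1 n1])
  qed
  have "energy p a bm bp (\<lambda>\<sigma>. borel_rep (choose_data f0m f0p \<sigma>)) (\<lambda>\<sigma>. borel_rep (choose_data f1m f1p \<sigma>)) (choose_grad (choose_data f0m f0p))
    \<le> ennreal ((bp - bm) powr (1 - 2 * p)) * (?n * diff_energy0 p bm bp f0m f0p f1m f1p)
    + ennreal ((bp - bm) powr (1 - p)) * (?n * diff_energy1 p f0m f0p f1m f1p)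
    + (\<Sum>\<sigma>\<in>UNIV. ?n * (tilde_W_pow a p (weak_grad UNIV (choose_data f0m f0p \<sigma>)) + tilde_W_pow a p (choose_data f1m f1p \<sigma>)))"
    unfolding energy_def D by (intro add_mono mult_left_mono sum_mono sumG sumt n1) auto
  also have "\<dots> = ?n * data_energy a p bm bp f0m f0p f1m f1p"
    unfolding data_energy_def by (simp add: UNIV_bool sT sF distrib_left ac_simps del: of_nat_add)
  finally show ?thesis .
qed

text \<open>The constant is that of the sum of all |W e e'|, a majorant of the Hessian norm, times
  the factor from comparing componentwise with vectorial energies. It is fixed before strip and data
  are chosen.\<close>

lemma extension_operator:
  fixes \<phi> :: "'a::euclidean_space \<Rightarrow> real"
  assumes p: "p \<ge> 1" and \<kappa>: "\<kappa> > 0" and \<phi>: "kern \<phi>" "\<And>y. \<phi> (- y) = \<phi> y" "integral\<^sup>L lborel \<phi> = 1"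
  obtains C :: real where "C > 0" "\<And>bm bp f0m f0p f1m f1p. bm < bp \<Longrightarrow> \<kappa> * (bp - bm) \<le> a \<Longrightarrow>
    admissible_data a p bm bp f0m f0p f1m f1p \<Longrightarrow>
    (let \<Omega> = strip bm bp; u = extension \<kappa> \<phi> bm bp f0m f0p f1m f1p; dNu = weak_partial \<Omega> [(0, 1)] u in
      in_homog_W2p p \<Omega> u \<and> has_trace p bm bp bm u f0m \<and> has_trace p bm bp bp u f0p \<and>
      has_trace p bm bp bm dNu f1m \<and> has_trace p bm bp bp dNu f1p \<and>
      (\<integral>\<^sup>+x\<in>\<Omega>. ennreal (weak_hess_norm \<Omega> u x powr p) \<partial>lebesgue) \<le> ennreal C * data_energy a p bm bp f0m f0p f1m f1p)"
proof -
  have "dominated p a \<kappa> \<phi> (\<lambda>bm bp f0 f1 g q. \<Sum>e\<in>Basis. \<Sum>e'\<in>Basis. \<bar>hermite.W \<kappa> bm bp \<phi> f0 f1 g e e' q\<bar>)"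
    by (intro dominated_sum dominated_abs dominated_W p \<kappa> \<phi>)
  then obtain C where C: "C > 0" "\<And>bm bp f0 f1 g. hermite p \<kappa> bm bp \<phi> f0 f1 g \<Longrightarrow> \<kappa> * (bp - bm) \<le> a \<Longrightarrow>
     Lpp p (strip bm bp) (\<lambda>q. \<Sum>e\<in>Basis. \<Sum>e'\<in>Basis. \<bar>hermite.W \<kappa> bm bp \<phi> f0 f1 g e e' q\<bar>) \<le> ennreal C * energy p a bm bp f0 f1 g"
    unfolding dominated_def by blast
  show ?thesis
  proof (rule that[of "C * (DIM('a) + 1)"])
    show "C * (DIM('a) + 1) > 0" using C by simp
    fix bm bp :: real and f0m f0p f1m f1p :: "'a \<Rightarrow> real"
    assume b: "bm < bp" and ka: "\<kappa> * (bp - bm) \<le> a" and d: "admissible_data a p bm bp f0m f0p f1m f1p"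
    define F0 where "F0 = (\<lambda>\<sigma>. borel_rep (choose_data f0m f0p \<sigma>))"
    define F1 where "F1 = (\<lambda>\<sigma>. borel_rep (choose_data f1m f1p \<sigma>))"
    define g where "g = choose_grad (choose_data f0m f0p)"
    have H: "hermite p \<kappa> bm bp \<phi> F0 F1 g"
      unfolding F0_def F1_def g_def by (rule admissible_hermite[OF d p \<kappa> b \<phi>])
    interpret hermite p \<kappa> bm bp \<phi> F0 F1 g by (rule H)
    define v where "v = extension \<kappa> \<phi> bm bp f0m f0p f1m f1p"
    have v: "v = u"
    proof
      show "v q = u q" for q unfolding v_def extension_def u_def by (simp add: F0_def F1_def)
    qed
    define dv where "dv = weak_partial \<Omega> [(0, 1)] v"
    define h where "h q = (\<Sum>e\<in>Basis. \<Sum>e'\<in>Basis. \<bar>W e e' q\<bar>)" for q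
    define \<E> where "\<E> = data_energy a p bm bp f0m f0p f1m f1p"
    have "Lpp p \<Omega> h \<le> ennreal C * energy p a bm bp F0 F1 g" unfolding h_def by (rule C(2)[OF H ka])
    also have "\<dots> \<le> ennreal C * (of_nat (DIM('a) + 1) * \<E>)"
      unfolding F0_def F1_def g_def \<E>_def
      by (intro mult_left_mono energy_le_data[OF d p H[unfolded F0_def F1_def g_def]]) simp
    also have "\<dots> = ennreal (C * (DIM('a) + 1)) * \<E>"
    proof -
      have "ennreal (C * (DIM('a) + 1)) = ennreal C * ennreal (real (DIM('a) + 1))" using C(1) by (subst ennreal_mult[symmetric]) auto
      then show ?thesis by (simp only: ennreal_of_nat_eq_real_of_nat mult.assoc)
    qed
    finally have hE: "Lpp p \<Omega> h \<le> ennreal (C * (DIM('a) + 1)) * \<E>" .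
    also have "\<dots> < \<infinity>" using data_energy_finite[OF d] by (simp add: \<E>_def ennreal_mult_less_top)
    finally have hfin: "Lpp p \<Omega> h < \<infinity>" .
    have Wh: "\<bar>W e e' q\<bar> \<le> h q" if "e \<in> Basis" "e' \<in> Basis" for e e' q
    proof -
      have "\<bar>W e e' q\<bar> \<le> (\<Sum>e'\<in>Basis. \<bar>W e e' q\<bar>)" by (rule member_le_sum) (use that in auto)
      also have "\<dots> \<le> h q" unfolding h_def by (rule member_le_sum[where f="\<lambda>e. \<Sum>e'\<in>Basis. \<bar>W e e' q\<bar>"]) (use that in \<open>auto intro: sum_nonneg\<close>)
      finally show ?thesis .
    qed
    have Wfin: "Lpp p \<Omega> (W e e') < \<infinity>" if "e \<in> Basis" "e' \<in> Basis" for e e'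
      by (rule le_less_trans[OF Lpp_mono hfin]) (use p order_trans[OF Wh[OF that] abs_ge_self] in simp_all)
    have Wc: "continuous_on \<Omega> (W e e')" if "e \<in> Basis" "e' \<in> Basis" for e e'
      using dW[OF that] by (simp add: dir_deriv_def)
    have e01: "((0, 1) :: 'a \<times> real) \<in> Basis" by (simp add: Basis_prod_def)
    have V01: "V (0, 1) = Ut" by (simp add: V_def)
    have uc: "continuous_on \<Omega> u" using loc_Lp_u by (simp add: loc_Lp_def)
    have um: "u \<in> borel_measurable (lebesgue_on \<Omega>)"
      by (rule continuous_imp_measurable_on_sets_lebesgue[OF uc]) (simp add: strip_open lebesgue_openin)
    have hw: "in_homog_W2p p \<Omega> v"
      unfolding in_homog_W2p_def v
      using in_Lp_loc_1_continuous[OF strip_open uc] weak_u2 in_Lp_continuous[OF strip_open Wc Wfin] by blast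
    have dvm: "dv \<in> borel_measurable (lebesgue_on \<Omega>)"
      using weak_partial_works[OF weak_u[OF e01]] by (simp add: dv_def v has_weak_partial_def in_Lp_loc_def)
    \<comment> \<open>The normal derivative in the conclusion is an arbitrary representative; it is
      identified with the continuous \<open>Ut\<close> by uniqueness.\<close>
    have dvae: "AE q in lborel. q \<in> \<Omega> \<longrightarrow> Ut q = dv q"
      using weak_partial_AE_eq[OF weak_u[OF e01] strip_open] unfolding dv_def v V01 by eventually_elim simp
    have Lp: "in_Lp_loc p UNIV (choose_data f0m f0p \<sigma>)" "in_Lp_loc p UNIV (choose_data f1m f1p \<sigma>)" for \<sigma>
      using d by (auto simp: admissible_data_def choose_data_def in_W1p_loc_def)
    have ae: "AE x in lborel. choose_data f0m f0p \<sigma> x = F0 \<sigma> x" "AE x in lborel. choose_data f1m f1p \<sigma> x = F1 \<sigma> x" for \<sigma>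
      unfolding F0_def F1_def by (intro borel_rep admissible_measurable[OF d])+
    have sub: "ball (0::'a) R \<times> {bm<..<bp} \<subseteq> \<Omega>" for R by (auto simp: strip_iff)
    have tru: "has_trace p bm bp t v (choose_data f0m f0p (t = bp))" if t: "t \<in> {bm, bp}" for t
    proof (rule has_traceI[OF p b t, of u V])
      show "dir_deriv \<Omega> e u (V e)" if "e \<in> Basis" for e by (rule dV[OF that])
      show "Lp_tends p R (at t within {bm<..<bp}) u (F0 (t = bp))" for R using u_trace[OF t] by (simp add: Lp_trace_def)
    qed (use loc_Lp_u loc_Lp_V Lp ae um v in \<open>auto simp: loc_Lp_def\<close>)
    \<comment> \<open>The derivatives of \<open>Ut\<close> are entries of the Hessian, so their
      integrability on cylinders comes from the global estimate.\<close>
    have trd: "has_trace p bm bp t dv (choose_data f1m f1p (t = bp))" if t: "t \<in> {bm, bp}" for t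
    proof (rule has_traceI[OF p b t, of Ut "W (0, 1)"])
      show "dir_deriv \<Omega> e Ut (W (0, 1) e)" if "e \<in> Basis" for e using dW[OF e01 that] unfolding V01 .
      show "Lpp p (ball 0 R \<times> {bm<..<bp}) (W (0, 1) e) < \<infinity>" if "e \<in> Basis" for e R
        by (rule le_less_trans[OF Lpp_subset[OF sub] Wfin[OF e01 that]])
      show "Lp_tends p R (at t within {bm<..<bp}) Ut (F1 (t = bp))" for R using Ut_trace[OF t] by (simp add: Lp_trace_def)
    qed (use loc_Lp_Ut Lp ae dvm dvae in \<open>auto simp: loc_Lp_def\<close>)
    have "(\<integral>\<^sup>+x\<in>\<Omega>. ennreal (weak_hess_norm \<Omega> v x powr p) \<partial>lebesgue) \<le> Lpp p \<Omega> h"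
    proof -
      have "AE q in lborel. \<forall>e\<in>Basis. \<forall>e'\<in>Basis. q \<in> \<Omega> \<longrightarrow> weak_partial \<Omega> [e, e'] u q = W e e' q"
        by (intro AE_ball_countable[THEN iffD2] countable_finite finite_Basis ballI weak_partial_AE_eq[OF weak_u2 strip_open])
      then have "AE q in lborel. ennreal (weak_hess_norm \<Omega> v q powr p) * indicator \<Omega> q \<le> ennreal (\<bar>h q\<bar> powr p) * indicator \<Omega> q"
      proof eventually_elim
        fix q assume q: "\<forall>e\<in>Basis. \<forall>e'\<in>Basis. q \<in> \<Omega> \<longrightarrow> weak_partial \<Omega> [e, e'] u q = W e e' q"
        have "weak_hess_norm \<Omega> v q powr p \<le> \<bar>h q\<bar> powr p" if "q \<in> \<Omega>"
        proof (rule powr_mono2)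
          have "weak_hess_norm \<Omega> v q = sqrt (\<Sum>e\<in>Basis. \<Sum>e'\<in>Basis. (W e e' q)\<^sup>2)"
            unfolding weak_hess_norm_def v using q that by simp
          also have "\<dots> \<le> h q" unfolding h_def by (rule sqrt_sum_squares_le) simp
          finally show "weak_hess_norm \<Omega> v q \<le> \<bar>h q\<bar>" by simp
          show "0 \<le> weak_hess_norm \<Omega> v q" unfolding weak_hess_norm_def by (intro real_sqrt_ge_zero sum_nonneg) simp
        qed (use p in simp)
        then show "ennreal (weak_hess_norm \<Omega> v q powr p) * indicator \<Omega> q \<le> ennreal (\<bar>h q\<bar> powr p) * indicator \<Omega> q"
          by (auto simp: indicator_def intro!: ennreal_leI)
      qed
      then show ?thesis unfolding nn_integral_completion Lpp_def by (rule nn_integral_mono_AE)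
    qed
    then have "(\<integral>\<^sup>+x\<in>\<Omega>. ennreal (weak_hess_norm \<Omega> v x powr p) \<partial>lebesgue) \<le> ennreal (C * (DIM('a) + 1)) * \<E>"
      using hE by (rule order_trans)
    then show "let \<Omega> = strip bm bp; u = extension \<kappa> \<phi> bm bp f0m f0p f1m f1p; dNu = weak_partial \<Omega> [(0, 1)] u in
      in_homog_W2p p \<Omega> u \<and> has_trace p bm bp bm u f0m \<and> has_trace p bm bp bp u f0p \<and>
      has_trace p bm bp bm dNu f1m \<and> has_trace p bm bp bp dNu f1p \<and>
      (\<integral>\<^sup>+x\<in>\<Omega>. ennreal (weak_hess_norm \<Omega> u x powr p) \<partial>lebesgue) \<le> ennreal (C * (DIM('a) + 1)) * data_energy a p bm bp f0m f0p f1m f1p"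
      unfolding Let_def v_def[symmetric] dv_def[symmetric] \<E>_def[symmetric]
      using hw tru[of bm] tru[of bp] trd[of bm] trd[of bp] b by (simp add: choose_data_def)
  qed
qed

theorem theorem1p9:
  fixes a p K :: real
  assumes "0 < a" and "1 < p"
  shows "\<exists>c>0. \<forall>bm bp. bm < bp \<and> bp - bm \<le> K \<longrightarrow>
    (\<exists>T :: (real^'n \<Rightarrow> real) \<Rightarrow> (real^'n \<Rightarrow> real) \<Rightarrow> (real^'n \<Rightarrow> real) \<Rightarrow> (real^'n \<Rightarrow> real) \<Rightarrow>
           (real^'n) \<times> real \<Rightarrow> real.
      (\<forall>f0m f0p f1m f1p. admissible_data a p bm bp f0m f0p f1m f1p \<longrightarrow>
        (let \<Omega> = strip bm bp;
             u = T f0m f0p f1m f1p;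
             dNu = weak_partial \<Omega> [(0, 1)] u
         in in_homog_W2p p \<Omega> u \<and>
            has_trace p bm bp bm u f0m \<and> has_trace p bm bp bp u f0p \<and>
            has_trace p bm bp bm dNu f1m \<and> has_trace p bm bp bp dNu f1p \<and>
            (\<integral>\<^sup>+x\<in>\<Omega>. ennreal (weak_hess_norm \<Omega> u x powr p) \<partial>lebesgue)
              \<le> ennreal (c * (bp - bm) powr (- 2 * p + 1)) * diff_energy0 p bm bp f0m f0p f1m f1p
                + ennreal (c * (bp - bm) powr (- p + 1)) * diff_energy1 p f0m f0p f1m f1p
                + ennreal c * tilde_W_pow a p (weak_grad UNIV f0m)
                + ennreal c * tilde_W_pow a p (weak_grad UNIV f0p)
                + ennreal c * tilde_W_pow a p f1m
                + ennreal c * tilde_W_pow a p f1p)) \<and>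
      (\<forall>f0m f0p f1m f1p g0m g0p g1m g1p \<alpha> \<beta>.
        admissible_data a p bm bp f0m f0p f1m f1p \<and> admissible_data a p bm bp g0m g0p g1m g1p \<longrightarrow>
        (AE x in lebesgue_on (strip bm bp).
          T (\<lambda>y. \<alpha> * f0m y + \<beta> * g0m y) (\<lambda>y. \<alpha> * f0p y + \<beta> * g0p y)
            (\<lambda>y. \<alpha> * f1m y + \<beta> * g1m y) (\<lambda>y. \<alpha> * f1p y + \<beta> * g1p y) x
          = \<alpha> * T f0m f0p f1m f1p x + \<beta> * T g0m g0p g1m g1p x)))"
proof (cases "K > 0")
  \<comment> \<open>No strip has width at most K when K is not positive, so any c will do.\<close>
  case False
  then have "\<not> (bm < bp \<and> bp - bm \<le> K)" for bm bp :: real by auto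
  then show ?thesis by (intro exI[of _ 1]) auto
next
  case True
  \<comment> \<open>For every width up to K this gives \<tau> < \<kappa> (b^+ - b^-) \<le> a, so the
    averages only use translations seen by the seminorm. Through \<kappa> the constant depends on a
    and K, otherwise on p and the dimension.\<close>
  define \<kappa> where "\<kappa> = a / K"
  have \<kappa>: "\<kappa> > 0" using True assms by (simp add: \<kappa>_def)
  have p: "p \<ge> 1" using assms by simp
  obtain \<phi> :: "real^'n \<Rightarrow> real" where \<phi>: "kern \<phi>" "\<And>y. \<phi> (- y) = \<phi> y" "integral\<^sup>L lborel \<phi> = 1"
    using exists_bump by blast
  obtain c where c: "c > 0" "\<And>bm bp f0m f0p f1m f1p. bm < bp \<Longrightarrow> \<kappa> * (bp - bm) \<le> a \<Longrightarrow>
    admissible_data a p bm bp f0m f0p f1m f1p \<Longrightarrow>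
    (let \<Omega> = strip bm bp; u = extension \<kappa> \<phi> bm bp f0m f0p f1m f1p; dNu = weak_partial \<Omega> [(0, 1)] u in
      in_homog_W2p p \<Omega> u \<and> has_trace p bm bp bm u f0m \<and> has_trace p bm bp bp u f0p \<and>
      has_trace p bm bp bm dNu f1m \<and> has_trace p bm bp bp dNu f1p \<and>
      (\<integral>\<^sup>+x\<in>\<Omega>. ennreal (weak_hess_norm \<Omega> u x powr p) \<partial>lebesgue) \<le> ennreal c * data_energy a p bm bp f0m f0p f1m f1p)"
    using extension_operator[OF p \<kappa> \<phi>, of a] by blast
  have ka: "\<kappa> * (bp - bm) \<le> a" if "bp - bm \<le> K" for bm bp
    using mult_left_mono[OF that, of \<kappa>] \<kappa> True by (simp add: \<kappa>_def)
  have e: "ennreal c * data_energy a p bm bp f0m f0p f1m f1p =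
      ennreal (c * (bp - bm) powr (- 2 * p + 1)) * diff_energy0 p bm bp f0m f0p f1m f1p
      + ennreal (c * (bp - bm) powr (- p + 1)) * diff_energy1 p f0m f0p f1m f1p
      + ennreal c * tilde_W_pow a p (weak_grad UNIV f0m) + ennreal c * tilde_W_pow a p (weak_grad UNIV f0p)
      + ennreal c * tilde_W_pow a p f1m + ennreal c * tilde_W_pow a p f1p" for bm bp and f0m f0p f1m f1p :: "real^'n \<Rightarrow> real"
    using c(1) by (simp add: data_energy_def distrib_left ennreal_mult mult.assoc)
  show ?thesis
  proof (intro exI[of _ c] conjI c(1) allI impI, elim conjE)
    fix bm bp :: real assume b: "bm < bp" "bp - bm \<le> K"
    have sm: "space (lebesgue_on (strip bm bp :: ((real^'n) \<times> real) set)) = strip bm bp" by simp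
    show "\<exists>T :: (real^'n \<Rightarrow> real) \<Rightarrow> (real^'n \<Rightarrow> real) \<Rightarrow> (real^'n \<Rightarrow> real) \<Rightarrow> (real^'n \<Rightarrow> real) \<Rightarrow>
           (real^'n) \<times> real \<Rightarrow> real.
      (\<forall>f0m f0p f1m f1p. admissible_data a p bm bp f0m f0p f1m f1p \<longrightarrow>
        (let \<Omega> = strip bm bp;
             u = T f0m f0p f1m f1p;
             dNu = weak_partial \<Omega> [(0, 1)] u
         in in_homog_W2p p \<Omega> u \<and>
            has_trace p bm bp bm u f0m \<and> has_trace p bm bp bp u f0p \<and>
            has_trace p bm bp bm dNu f1m \<and> has_trace p bm bp bp dNu f1p \<and>
            (\<integral>\<^sup>+x\<in>\<Omega>. ennreal (weak_hess_norm \<Omega> u x powr p) \<partial>lebesgue)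
              \<le> ennreal (c * (bp - bm) powr (- 2 * p + 1)) * diff_energy0 p bm bp f0m f0p f1m f1p
                + ennreal (c * (bp - bm) powr (- p + 1)) * diff_energy1 p f0m f0p f1m f1p
                + ennreal c * tilde_W_pow a p (weak_grad UNIV f0m)
                + ennreal c * tilde_W_pow a p (weak_grad UNIV f0p)
                + ennreal c * tilde_W_pow a p f1m
                + ennreal c * tilde_W_pow a p f1p)) \<and>
      (\<forall>f0m f0p f1m f1p g0m g0p g1m g1p \<alpha> \<beta>.
        admissible_data a p bm bp f0m f0p f1m f1p \<and> admissible_data a p bm bp g0m g0p g1m g1p \<longrightarrow>
        (AE x in lebesgue_on (strip bm bp).
          T (\<lambda>y. \<alpha> * f0m y + \<beta> * g0m y) (\<lambda>y. \<alpha> * f0p y + \<beta> * g0p y)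
            (\<lambda>y. \<alpha> * f1m y + \<beta> * g1m y) (\<lambda>y. \<alpha> * f1p y + \<beta> * g1p y) x
          = \<alpha> * T f0m f0p f1m f1p x + \<beta> * T g0m g0p g1m g1p x))"
      unfolding e[symmetric]
    proof (intro exI[of _ "extension \<kappa> \<phi> bm bp"] conjI allI impI, goal_cases)
      case (1 f0m f0p f1m f1p)
      then show ?case by (rule c(2)[OF b(1) ka[OF b(2)]])
    next
      case (2 f0m f0p f1m f1p g0m g0p g1m g1p \<alpha> \<beta>)
      then show ?case
        using extension_linear[OF p \<kappa> b(1) \<phi>, of a f0m f0p f1m f1p g0m g0p g1m g1p _ \<alpha> \<beta>]
        by (intro AE_I2) (simp add: sm)
    qed
  qed
qed

end
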